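(* Let $V=(M_\psi\otimes K^* )\mathscr V(M_\psi\otimes K)$ with $\nu_0>3$, $0\le\mathscr V\in\mathcal B(\ell^2(\mathbb Z_h,\mathcal G))$ and $K\in\mathfrak S_2(\mathcal G)$. Then for all non-degenerate thresholds $\mu_s$ and $\frac4{h^2}+\mu_s$ in $\mathscr E_Q$, $s\in I_Q$, $$\mp\xi(\lambda;H^\pm,H_Q)\sim-\frac1\pi\mathrm{Tr}\arctan(\omega_s(\lambda)),\qquad\lambda\searrow\mu_s,$$ and $$\mp\xi(\lambda;H^\pm,H_Q)\sim-\frac1\pi\mathrm{Tr}\arctan(-\omega_{4,s}(\lambda)),\qquad\lambda\nearrow\tfrac4{h^2}+\mu_s.$$
   Context: Let $h>0$, $\mathbb Z_h=\{hn:n\in\mathbb Z\}$, and let $\mathcal G$ be a separable complex Hilbert space. $\ell^2(\mathbb Z_h)=\ell^2(\mathbb Z_h,\mathbb C)$ has scalar product $\langle\varphi,\phi\rangle=\sum_{n\in\mathbb Z}\overline{\varphi(hn)}\phi(hn)$, and $\ell^2(\mathbb Z_h,\mathcal G)$ is identified with $\ell^2(\mathbb Z_h)\otimes\mathcal G$. On $\ell^2(\mathbb Z_h)$, $(-\Delta_h\phi)(hn)=h^{-2}\big(2\phi(hn)-\phi(h(n+1))-\phi(h(n-1))\big)$, whose spectrum is $[0,4/h^2]$. $Q$ is a self-adjoint operator on $\mathcal G$ such that either $Q=0$, or $Q\ne0$ and $\mathcal G=\bigoplus_{s=1}^d\mathrm{Ker}(Q-\mu_s)$ with $d<+\infty$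 and $\mu_1,\dots,\mu_d$ the distinct (real) eigenvalues of $Q$. If $Q=0$ put $I_Q=\{0\}$, $\mu_0=0$, $\pi_0=I_{\mathcal G}$; if $Q\neq0$ put $I_Q=\{1,\dots,d\}$ and let $\pi_s$ be the orthogonal projection onto $\mathrm{Ker}(Q-\mu_s)$. $H_Q=-\Delta_h\otimes I_{\mathcal G}+I_{\ell^2(\mathbb Z_h)}\otimes Q$; the threshold set is $\mathscr E_Q=\{\mu_s,\mu_s+4/h^2\}_{s\in I_Q}$. If $Q\ne0$, $\mu_s$ (resp. $\frac4{h^2}+\mu_s$) is non-degenerate if $\mu_s\ne\frac4{h^2}+\mu_{s'}$ (resp. $\frac4{h^2}+\mu_s\neq\mu_{s'}$) for all $s'\ne s$; if $Q=0$ both thresholds $0,4/h^2$ count as non-degenerate. $\mathfrak S_p$ denotes the Schatten class. $\langle n\rangle=(1+n^2)^{1/2}$, $\psi(hn)=\langle n\rangle^{-\nu_0/2}$, $M_\psi$ is multiplication by $\psi$ on $\ell^2(\mathbb Z_h)$. $H^\pm=H_Q\pm V$. Spectral shift function: put $\mathscr M=\mathscr V^{1/2}(M_\psi\otimes K)\in\mathfrak S_2$ (so $V=\mathscr M^*\mathscr M$) and $T(z)=\mathscr M(H_Q-z)^{-1}\mathscr M^*$. For each $\lambda\in\mathbb R\setminus\mathscr E_Q$ the limit $T(\lambda+i0)=\lim_{\varepsilon\searrow0}T(\lambda+i\varepsilon)$ exists in $\mathfrak S_2$; $A(\lambda+i0)$ and $B(\lambda+i0)$ are its real and imaginary (self-adjoint)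 parts, $0\le B(\lambda+i0)\in\mathfrak S_1$. For compact self-adjoint $S$ and $r>0$, $\mathscr N_\pm(r,S)=\mathrm{Rank}\,\mathbf 1_{(r,\infty)}(\pm S)$. The SSF is identified with its representative $\xi(\lambda;H^\pm,H_Q)=\pm\frac1\pi\int_{\mathbb R}\mathscr N_\mp(1,A(\lambda+i0)+tB(\lambda+i0))\frac{dt}{1+t^2}$, $\lambda\in\mathbb R\setminus\mathscr E_Q$. Effective operators: $\langle\psi|:\ell^2(\mathbb Z_h)\to\mathbb C$, $\phi\mapsto\langle\psi,\phi\rangle$; $(J\varphi)(hn)=(-1)^n\varphi(hn)$; $P_s=\langle\psi|\otimes\pi_s:\ell^2(\mathbb Z_h)\otimes\mathcal G\to\mathbb C\otimes\mathcal G$; $\mathbf V=(I\otimes K^* )\mathscr V(I\otimes K)$; $\mathbf V_J=(J\otimes I_{\mathcal G})^*\mathbf V(J\otimes I_{\mathcal G})$; $$\omega_s(\lambda)=\frac h2\frac{P_s\mathbf VP_s^*}{\sqrt{|\lambda-\mu_s|}},\qquad \omega_{4,s}(\lambda)=-\frac h2\frac{P_s\mathbf V_JP_s^*}{\sqrt{|4/h^2+\mu_s-\lambda|}}.$$ Notation $\sim$: for real functionals $F_1(V,\lambda),F_2(V,\lambda)$, $F_1(V,\lambda)\sim F_2(V,\lambda)$ as $\lambda\to\lambda_0$ means that for every $\varepsilon\in(0,1)$, $$F_2((1-\varepsilon)^{-1}V,\lambda)+\mathcal O_\varepsilon(1)\le F_1(V,\lambda)\le F_2((1+\varepsilon)^{-1}V,\lambda)+\mathcal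 O_\varepsilon(1),\quad\lambda\to\lambda_0,$$ where $F(cV,\lambda)$ is $F$ with $\mathscr V$ replaced by $c\mathscr V$ ($\nu_0$, $K$ fixed). *)

theory Defs
  imports "HOL-Analysis.Analysis" "HOL-Library.Landau_Symbols"
begin

section \<open>Complex Hilbert spaces\<close>

text \<open>
  The scalar product \<open>cinner\<close> is conjugate-linear in its first argument.  The underlying real
  structure (norm, topology, real scalar product) is that of \<^class>\<open>real_inner\<close>.
\<close>

class complex_inner = real_inner +
  fixes scaleC :: "complex \<Rightarrow> 'a \<Rightarrow> 'a"  (infixr \<open>*\<^sub>C\<close> 75)
    and cinner :: "'a \<Rightarrow> 'a \<Rightarrow> complex"
  assumes scaleC_add_right: "c *\<^sub>C (x + y) = c *\<^sub>C x + c *\<^sub>C y"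
    and scaleC_add_left: "(b + c) *\<^sub>C x = b *\<^sub>C x + c *\<^sub>C x"
    and scaleC_scaleC: "b *\<^sub>C c *\<^sub>C x = (b * c) *\<^sub>C x"
    and scaleC_of_real: "complex_of_real r *\<^sub>C x = r *\<^sub>R x"
    and cinner_commute: "cinner x y = cnj (cinner y x)"
    and cinner_add_right: "cinner x (y + z) = cinner x y + cinner x z"
    and cinner_scaleC_right: "cinner x (c *\<^sub>C y) = c * cinner x y"
    and Re_cinner: "Re (cinner x y) = inner x y"

class chilbert_space = complex_inner + complete_space

lemma scaleC_one: "1 *\<^sub>C x = (x :: 'a::complex_inner)"
  using scaleC_of_real[of 1 x] by simp

global_interpretation complex_vector: vector_space "scaleC :: complex \<Rightarrow> 'a \<Rightarrow> 'a::complex_inner"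
  by standard (simp_all add: scaleC_add_right scaleC_add_left scaleC_scaleC scaleC_one)

lemma cinner_add_left: "cinner (x + y) (z :: 'a::complex_inner) = cinner x z + cinner y z"
  by (metis cinner_add_right cinner_commute complex_cnj_add)

lemma cinner_scaleC_left: "cinner (c *\<^sub>C x) (y :: 'a::complex_inner) = cnj c * cinner x y"
  by (metis cinner_scaleC_right cinner_commute complex_cnj_mult)

lemma cinner_self: "cinner x (x :: 'a::complex_inner) = of_real ((norm x)\<^sup>2)"
proof (rule complex_eqI)
  have "Im (cinner x x) = - Im (cinner x x)"
    by (metis cinner_commute cnj.simps(2))
  then show "Im (cinner x x) = Im (complex_of_real ((norm x)\<^sup>2))" by simp
qed (simp add: Re_cinner power2_norm_eq_inner)

lemma norm_scaleC: "norm (c *\<^sub>C (x :: 'a::complex_inner)) = cmod c * norm x"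
proof -
  have "complex_of_real ((norm (c *\<^sub>C x))\<^sup>2) = cnj c * c * of_real ((norm x)\<^sup>2)"
    by (simp only: cinner_self[symmetric] cinner_scaleC_left cinner_scaleC_right mult_ac)
  also have "\<dots> = of_real ((cmod c * norm x)\<^sup>2)"
    by (simp only: power_mult_distrib of_real_mult complex_norm_square mult_ac)
  finally have "(norm (c *\<^sub>C x))\<^sup>2 = (cmod c * norm x)\<^sup>2"
    using of_real_eq_iff by blast
  then show ?thesis by (simp add: power2_eq_iff_nonneg)
qed

lemma cmod_cinner_le: "cmod (cinner x (y :: 'a::complex_inner)) \<le> norm x * norm y"
proof (cases "cinner x y = 0")
  case False
  define c where "c = cinner x y / cmod (cinner x y)"
  have c: "cmod c = 1" using False by (simp add: c_def norm_divide)
  have "cinner (c *\<^sub>C x) y = of_real (cmod (cinner x y))"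
    using False
    by (simp add: cinner_scaleC_left c_def mult.commute flip: complex_norm_square)
       (simp add: complex_norm_square[symmetric] power2_eq_square)
  then have "cmod (cinner x y) = inner (c *\<^sub>C x) y"
    by (metis Re_cinner Re_complex_of_real)
  also have "\<dots> \<le> norm (c *\<^sub>C x) * norm y" by (rule norm_cauchy_schwarz)
  finally show ?thesis by (simp add: norm_scaleC c)
qed simp

instantiation complex :: chilbert_space
begin

definition scaleC_complex :: "complex \<Rightarrow> complex \<Rightarrow> complex" where
  "scaleC_complex c x = c * x"

definition cinner_complex :: "complex \<Rightarrow> complex \<Rightarrow> complex" where
  "cinner_complex x y = cnj x * y"

instance
  by standard (simp_all add: scaleC_complex_def cinner_complex_def algebra_simps inner_complex_def
      scaleR_conv_of_real)

end


section \<open>The Hilbert space of square-summable sequences on the lattice\<close>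

text \<open>
  \<open>'g lat\<close> is \<open>\<ell>\<^sup>2(\<int>\<^sub>h, \<G>)\<close>, and \<open>complex lat\<close> is \<open>\<ell>\<^sup>2(\<int>\<^sub>h)\<close>.  The lattice point \<open>h n\<close> is represented by
  the integer \<open>n\<close>: the scalar product carries no weight depending on \<open>h\<close>.
\<close>

typedef (overloaded) 'g lat =
  "{f :: int \<Rightarrow> 'g::complex_inner. (\<lambda>n. (norm (f n))\<^sup>2) summable_on UNIV}"
  morphisms lat_fun Abs_lat
  by (rule exI[of _ "\<lambda>_. 0"]) simp

setup_lifting type_definition_lat

lemma lat_summable: "(\<lambda>n. (norm (lat_fun f n))\<^sup>2) summable_on UNIV"
  using lat_fun[of f] by simp

lemma lat_sum_bound: "(norm (x + y :: 'a::real_inner))\<^sup>2 \<le> 2 * (norm x)\<^sup>2 + 2 * (norm y)\<^sup>2"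
proof -
  have "0 \<le> (norm (x - y))\<^sup>2" by simp
  then show ?thesis
    by (simp add: power2_norm_eq_inner inner_add_left inner_add_right inner_diff_left
        inner_diff_right)
qed

lemma lat_add_summable:
  fixes f g :: "int \<Rightarrow> 'a::complex_inner"
  assumes "(\<lambda>n. (norm (f n))\<^sup>2) summable_on UNIV" "(\<lambda>n. (norm (g n))\<^sup>2) summable_on UNIV"
  shows "(\<lambda>n. (norm (f n + g n))\<^sup>2) summable_on UNIV"
  by (rule summable_on_comparison_test[where f = "\<lambda>n. 2 * (norm (f n))\<^sup>2 + 2 * (norm (g n))\<^sup>2"])
     (auto intro!: lat_sum_bound summable_on_add summable_on_cmult_right assms)

lemma lat_scaleC_summable:
  fixes f :: "int \<Rightarrow> 'a::complex_inner"
  assumes "(\<lambda>n. (norm (f n))\<^sup>2) summable_on UNIV"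
  shows "(\<lambda>n. (norm (c *\<^sub>C f n))\<^sup>2) summable_on UNIV"
  by (auto simp: norm_scaleC power_mult_distrib intro: summable_on_cmult_right assms)

lemma lat_cinner_summable:
  "(\<lambda>n. cinner (lat_fun f n) (lat_fun g n)) summable_on UNIV"
proof -
  have "cmod (cinner x y) \<le> (norm x)\<^sup>2 + (norm y)\<^sup>2" for x y :: 'a
  proof -
    have "0 \<le> (norm x - norm y)\<^sup>2" "0 \<le> norm x * norm y" by simp_all
    then have "norm x * norm y \<le> (norm x)\<^sup>2 + (norm y)\<^sup>2"
      unfolding power2_diff by linarith
    then show ?thesis using cmod_cinner_le[of x y] by linarith
  qed
  then have "(\<lambda>n. norm (cinner (lat_fun f n) (lat_fun g n))) summable_on UNIV"
    by (rule Infinite_Sum.abs_summable_on_comparison_test'[OF summable_on_add[OF lat_summable[of f] lat_summable[of g]]])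
  then show ?thesis by (rule abs_summable_summable)
qed

instantiation lat :: (complex_inner) complex_inner
begin

lift_definition zero_lat :: "'a lat" is "\<lambda>_. 0" by simp
lift_definition plus_lat :: "'a lat \<Rightarrow> 'a lat \<Rightarrow> 'a lat" is "\<lambda>f g n. f n + g n"
  by (rule lat_add_summable)
lift_definition uminus_lat :: "'a lat \<Rightarrow> 'a lat" is "\<lambda>f n. - f n" by simp
lift_definition minus_lat :: "'a lat \<Rightarrow> 'a lat \<Rightarrow> 'a lat" is "\<lambda>f g n. f n - g n"
  using lat_add_summable[where g = "\<lambda>n. - g n" for g] by fastforce
lift_definition scaleC_lat :: "complex \<Rightarrow> 'a lat \<Rightarrow> 'a lat" is "\<lambda>c f n. c *\<^sub>C f n"
  by (rule lat_scaleC_summable)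
lift_definition scaleR_lat :: "real \<Rightarrow> 'a lat \<Rightarrow> 'a lat" is "\<lambda>r f n. r *\<^sub>R f n"
  using lat_scaleC_summable by (simp only: scaleC_of_real[symmetric])

definition cinner_lat :: "'a lat \<Rightarrow> 'a lat \<Rightarrow> complex" where
  "cinner_lat f g = (\<Sum>\<^sub>\<infinity>n. cinner (lat_fun f n) (lat_fun g n))"
definition inner_lat :: "'a lat \<Rightarrow> 'a lat \<Rightarrow> real" where
  "inner_lat f g = Re (cinner f g)"
definition norm_lat :: "'a lat \<Rightarrow> real" where
  "norm_lat f = sqrt (inner f f)"
definition dist_lat :: "'a lat \<Rightarrow> 'a lat \<Rightarrow> real" where
  "dist_lat f g = norm (f - g)"
definition sgn_lat :: "'a lat \<Rightarrow> 'a lat" where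
  "sgn_lat f = inverse (norm f) *\<^sub>R f"
definition uniformity_lat :: "('a lat \<times> 'a lat) filter" where
  "uniformity_lat = (INF e\<in>{0 <..}. principal {(x, y). dist x y < e})"
definition open_lat :: "'a lat set \<Rightarrow> bool" where
  "open_lat U = (\<forall>x\<in>U. eventually (\<lambda>(x', y). x' = x \<longrightarrow> y \<in> U) uniformity)"

lemma inner_lat_self: "inner (f :: 'a lat) f = (\<Sum>\<^sub>\<infinity>n. (norm (lat_fun f n))\<^sup>2)"
proof -
  have "inner f f = (\<Sum>\<^sub>\<infinity>n. Re (cinner (lat_fun f n) (lat_fun f n)))"
    unfolding inner_lat_def cinner_lat_def
    by (rule infsum_Re[symmetric]) (rule lat_cinner_summable)
  then show ?thesis by (simp add: cinner_self)
qed

instance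
proof
  fix f g k :: "'a lat" and b c :: complex and r s :: real
  show "f + g + k = f + (g + k)" "f + g = g + f" "0 + f = f" "- f + f = 0" "f - g = f + - g"
    by (transfer; simp add: algebra_simps)+
  show "r *\<^sub>R (f + g) = r *\<^sub>R f + r *\<^sub>R g" "(r + s) *\<^sub>R f = r *\<^sub>R f + s *\<^sub>R f"
    "r *\<^sub>R s *\<^sub>R f = (r * s) *\<^sub>R f" "1 *\<^sub>R f = f"
    by (transfer; simp add: algebra_simps)+
  show sc: "c *\<^sub>C (f + g) = c *\<^sub>C f + c *\<^sub>C g" "(b + c) *\<^sub>C f = b *\<^sub>C f + c *\<^sub>C f"
    "b *\<^sub>C c *\<^sub>C f = (b * c) *\<^sub>C f"
    by (transfer; simp add: scaleC_add_right scaleC_add_left scaleC_scaleC)+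
  show cr: "complex_of_real r *\<^sub>C f = r *\<^sub>R f" for f :: "'a lat" and r
    by transfer (simp add: scaleC_of_real)
  show cc: "cinner f g = cnj (cinner g f)" for f g :: "'a lat"
    unfolding cinner_lat_def by (subst cinner_commute) simp
  show ca: "cinner f (g + k) = cinner f g + cinner f k" for f g k :: "'a lat"
    unfolding cinner_lat_def plus_lat.rep_eq cinner_add_right
    by (rule infsum_add) (rule lat_cinner_summable)+
  show cs: "cinner f (c *\<^sub>C g) = c * cinner f g" for f g :: "'a lat" and c
    unfolding cinner_lat_def scaleC_lat.rep_eq cinner_scaleC_right
    by (rule infsum_cmult_right')
  show "Re (cinner f g) = inner f g" by (simp add: inner_lat_def)
  show ic: "inner f g = inner g f" for f g :: "'a lat"
    unfolding inner_lat_def by (subst cc) simp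
  have "inner k (f + g) = inner k f + inner k g"
    unfolding inner_lat_def ca by simp
  then show "inner (f + g) k = inner f k + inner g k" by (simp only: ic[of _ k])
  have "inner g (r *\<^sub>R f) = r * inner g f"
    unfolding inner_lat_def cr[symmetric] cs by simp
  then show "inner (r *\<^sub>R f) g = r * inner f g" by (simp only: ic[of _ g])
  show "0 \<le> inner f f" unfolding inner_lat_self by (rule infsum_nonneg) simp
  show "inner f f = 0 \<longleftrightarrow> f = 0"
  proof
    assume z: "inner f f = 0"
    have "(norm (lat_fun f n))\<^sup>2 = 0" for n
      by (rule nonneg_infsum_le_0D[where A = UNIV and f = "\<lambda>n. (norm (lat_fun f n))\<^sup>2"])
         (use z in \<open>auto simp: inner_lat_self intro: lat_summable\<close>)
    then have "lat_fun f = (\<lambda>_. 0)" by auto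
    then show "f = 0" by (metis lat_fun_inverse zero_lat.abs_eq)
  qed (simp add: inner_lat_self zero_lat.rep_eq)
qed (simp_all add: norm_lat_def dist_lat_def sgn_lat_def uniformity_lat_def open_lat_def)

end

lemma norm_lat_sq: "(norm f)\<^sup>2 = (\<Sum>\<^sub>\<infinity>n. (norm (lat_fun f n))\<^sup>2)"
  by (simp add: power2_norm_eq_inner inner_lat_self)

lemma sum_le_norm_lat_sq: "finite F \<Longrightarrow> (\<Sum>n\<in>F. (norm (lat_fun f n))\<^sup>2) \<le> (norm f)\<^sup>2"
  unfolding norm_lat_sq by (rule finite_sum_le_infsum) (auto intro: lat_summable)

lemma norm_lat_coord: "norm (lat_fun f n) \<le> norm f"
  using sum_le_norm_lat_sq[of "{n}" f] by (simp add: power2_le_iff_abs_le)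

instance lat :: (chilbert_space) chilbert_space
proof
  fix X :: "nat \<Rightarrow> 'a lat"
  assume X: "Cauchy X"
  have "Cauchy (\<lambda>m. lat_fun (X m) n)" for n
  proof (rule metric_CauchyI)
    fix e :: real assume "0 < e"
    then obtain M where "\<forall>i\<ge>M. \<forall>j\<ge>M. dist (X i) (X j) < e"
      using X unfolding Cauchy_def by blast
    moreover have "dist (lat_fun (X i) n) (lat_fun (X j) n) \<le> dist (X i) (X j)" for i j
      using norm_lat_coord[of "X i - X j" n] by (simp add: dist_norm minus_lat.rep_eq)
    ultimately show "\<exists>M. \<forall>i\<ge>M. \<forall>j\<ge>M. dist (lat_fun (X i) n) (lat_fun (X j) n) < e"
      using order_le_less_trans by blast
  qed
  then have "\<exists>l. (\<lambda>m. lat_fun (X m) n) \<longlonglongrightarrow> l" for n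
    using Cauchy_convergent unfolding convergent_def by blast
  then obtain f where "\<forall>n. (\<lambda>m. lat_fun (X m) n) \<longlonglongrightarrow> f n"
    using choice[of "\<lambda>n l. (\<lambda>m. lat_fun (X m) n) \<longlonglongrightarrow> l"] by blast
  then have f: "(\<lambda>m. lat_fun (X m) n) \<longlonglongrightarrow> f n" for n
    by blast
  have est: "(\<Sum>n\<in>F. (norm (lat_fun (X i) n - f n))\<^sup>2) \<le> e\<^sup>2"
    if "finite F" "\<forall>j\<ge>M. norm (X i - X j) < e" for F M i e
  proof (rule tendsto_upperbound)
    show "(\<lambda>j. \<Sum>n\<in>F. (norm (lat_fun (X i) n - lat_fun (X j) n))\<^sup>2)
        \<longlonglongrightarrow> (\<Sum>n\<in>F. (norm (lat_fun (X i) n - f n))\<^sup>2)"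
      by (intro tendsto_intros f)
    have "(\<Sum>n\<in>F. (norm (lat_fun (X i) n - lat_fun (X j) n))\<^sup>2) \<le> e\<^sup>2" if "j \<ge> M" for j
    proof -
      have "(\<Sum>n\<in>F. (norm (lat_fun (X i) n - lat_fun (X j) n))\<^sup>2) \<le> (norm (X i - X j))\<^sup>2"
        using sum_le_norm_lat_sq[OF \<open>finite F\<close>, of "X i - X j"] by (simp add: minus_lat.rep_eq)
      also have "\<dots> \<le> e\<^sup>2"
        using \<open>\<forall>j\<ge>M. norm (X i - X j) < e\<close> that by (intro power_mono) auto
      finally show ?thesis .
    qed
    then show "\<forall>\<^sub>F j in sequentially. (\<Sum>n\<in>F. (norm (lat_fun (X i) n - lat_fun (X j) n))\<^sup>2) \<le> e\<^sup>2"
      unfolding eventually_sequentially by blast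
  qed simp
  have summ: "(\<lambda>n. (norm (lat_fun (X i) n - f n))\<^sup>2) summable_on UNIV"
    if "\<forall>j\<ge>M. norm (X i - X j) < e" for M i e
    by (rule nonneg_bdd_above_summable_on) (auto intro!: bdd_aboveI2[of _ _ "e\<^sup>2"] est[OF _ that])
  obtain M0 where "\<forall>i\<ge>M0. \<forall>j\<ge>M0. dist (X i) (X j) < 1"
    using X unfolding Cauchy_def by (meson zero_less_one)
  then have "\<forall>j\<ge>M0. norm (X M0 - X j) < 1" by (simp add: dist_norm)
  from summ[OF this]
  have "(\<lambda>n. (norm (lat_fun (X M0) n + - (lat_fun (X M0) n - f n)))\<^sup>2) summable_on UNIV"
    by (intro lat_add_summable lat_summable) (simp only: norm_minus_cancel)
  then have fs: "(\<lambda>n. (norm (f n))\<^sup>2) summable_on UNIV" by simp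
  define L where "L = Abs_lat f"
  have L: "lat_fun L = f" unfolding L_def using fs by (simp add: Abs_lat_inverse)
  have "X \<longlonglongrightarrow> L"
  proof (rule metric_LIMSEQ_I)
    fix r :: real assume r: "0 < r"
    then obtain M where M: "\<forall>i\<ge>M. \<forall>j\<ge>M. dist (X i) (X j) < r / 2"
      using X unfolding Cauchy_def by (meson half_gt_zero)
    show "\<exists>M. \<forall>i\<ge>M. dist (X i) L < r"
    proof (intro exI allI impI)
      fix i assume "i \<ge> M"
      then have i: "\<forall>j\<ge>M. norm (X i - X j) < r / 2" using M by (simp add: dist_norm)
      have "(norm (X i - L))\<^sup>2 \<le> (r / 2)\<^sup>2"
        unfolding norm_lat_sq minus_lat.rep_eq L
        by (rule infsum_le_finite_sums) (auto intro: summ[OF i] est[OF _ i])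
      then have "norm (X i - L) \<le> r / 2"
        using r by (simp add: power2_le_iff_abs_le)
      then show "dist (X i) L < r" using r by (simp add: dist_norm)
    qed
  qed
  then show "convergent X" by (rule convergentI)
qed


section \<open>Bounded operators\<close>

definition bounded_clinear :: "('a::complex_inner \<Rightarrow> 'b::complex_inner) \<Rightarrow> bool" where
  "bounded_clinear A \<longleftrightarrow> bounded_linear A \<and> (\<forall>c x. A (c *\<^sub>C x) = c *\<^sub>C A x)"

definition cadj :: "('a::complex_inner \<Rightarrow> 'b::complex_inner) \<Rightarrow> 'b \<Rightarrow> 'a" where
  "cadj A = (THE B. \<forall>x y. cinner (A x) y = cinner x (B y))"

definition self_adjoint :: "('a::complex_inner \<Rightarrow> 'a) \<Rightarrow> bool" where
  "self_adjoint A \<longleftrightarrow> bounded_clinear A \<and> (\<forall>x y. cinner (A x) y = cinner x (A y))"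

definition nonneg_op :: "('a::complex_inner \<Rightarrow> 'a) \<Rightarrow> bool" where
  "nonneg_op A \<longleftrightarrow> bounded_clinear A \<and> (\<forall>x. cinner x (A x) \<in> \<real> \<and> 0 \<le> Re (cinner x (A x)))"

definition op_sqrt :: "('a::complex_inner \<Rightarrow> 'a) \<Rightarrow> 'a \<Rightarrow> 'a" where
  "op_sqrt A = (THE B. nonneg_op B \<and> B \<circ> B = A)"

definition re_part :: "('a::complex_inner \<Rightarrow> 'a) \<Rightarrow> 'a \<Rightarrow> 'a" where
  "re_part A x = (1 / 2) *\<^sub>C (A x + cadj A x)"

definition im_part :: "('a::complex_inner \<Rightarrow> 'a) \<Rightarrow> 'a \<Rightarrow> 'a" where
  "im_part A x = (1 / (2 * \<i>)) *\<^sub>C (A x - cadj A x)"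

definition eigenspace :: "('a::complex_inner \<Rightarrow> 'a) \<Rightarrow> real \<Rightarrow> 'a set" where
  "eigenspace A l = {x. A x = l *\<^sub>R x}"

definition orth_proj :: "'a::complex_inner set \<Rightarrow> 'a \<Rightarrow> 'a" where
  "orth_proj S x = (THE p. p \<in> S \<and> (\<forall>y\<in>S. cinner y (x - p) = 0))"

definition op_rank :: "('a::complex_inner \<Rightarrow> 'b::complex_inner) \<Rightarrow> nat" where
  "op_rank A = complex_vector.dim (range A)"

definition compact_op :: "('a::complex_inner \<Rightarrow> 'b::complex_inner) \<Rightarrow> bool" where
  "compact_op A \<longleftrightarrow> bounded_clinear A \<and> compact (closure (A ` cball 0 1))"

text \<open>
  Functional calculus \<open>f(S) = \<Sum>\<^sub>l f(l) \<Pi>\<^sub>l\<close> for a compact self-adjoint operator \<open>S\<close>, where \<open>\<Pi>\<^sub>l\<close> is the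
  orthogonal projection onto \<open>Ker (S - l)\<close>.  The sum over all reals converges strongly and
  unconditionally for \<open>f\<close> bounded on the spectrum, since \<open>\<Pi>\<^sub>l = 0\<close> unless \<open>l\<close> is an eigenvalue.
\<close>

definition fun_calc :: "(real \<Rightarrow> real) \<Rightarrow> ('a::complex_inner \<Rightarrow> 'a) \<Rightarrow> 'a \<Rightarrow> 'a" where
  "fun_calc f S x = (\<Sum>\<^sub>\<infinity>l. f l *\<^sub>R orth_proj (eigenspace S l) x)"

definition orthonormal_basis :: "'a::complex_inner set \<Rightarrow> bool" where
  "orthonormal_basis B \<longleftrightarrow> (\<forall>x\<in>B. \<forall>y\<in>B. cinner x y = (if x = y then 1 else 0)) \<and>
     closure (complex_vector.span B) = UNIV"

definition the_basis :: "'a::complex_inner set" where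
  "the_basis = (SOME B. orthonormal_basis B)"

definition op_trace :: "('a::complex_inner \<Rightarrow> 'a) \<Rightarrow> complex" where
  "op_trace A = (\<Sum>\<^sub>\<infinity>e\<in>the_basis. cinner e (A e))"

text \<open>\<open>abs_powr A p\<close> is \<open>|A|\<^sup>p = (A\<^sup>* A)\<^sup>p\<^sup>/\<^sup>2\<close>.\<close>

definition abs_powr :: "('a::complex_inner \<Rightarrow> 'b::complex_inner) \<Rightarrow> real \<Rightarrow> 'a \<Rightarrow> 'a" where
  "abs_powr A p = fun_calc (\<lambda>t. t powr (p / 2)) (cadj A \<circ> A)"

definition schatten :: "real \<Rightarrow> ('a::complex_inner \<Rightarrow> 'b::complex_inner) set" where
  "schatten p = {A. compact_op A \<and> (\<lambda>e. cinner e (abs_powr A p e)) summable_on the_basis}"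

definition schatten_norm :: "real \<Rightarrow> ('a::complex_inner \<Rightarrow> 'b::complex_inner) \<Rightarrow> real" where
  "schatten_norm p A = Re (op_trace (abs_powr A p)) powr (1 / p)"

text \<open>
  Convergence in \<open>\<SS>\<^sub>p\<close>.  Membership is required explicitly because \<^const>\<open>schatten_norm\<close> has no
  meaning outside \<^const>\<open>schatten\<close>.
\<close>

definition schatten_tendsto ::
  "real \<Rightarrow> ('i \<Rightarrow> 'a::complex_inner \<Rightarrow> 'b::complex_inner) \<Rightarrow> ('a \<Rightarrow> 'b) \<Rightarrow> 'i filter \<Rightarrow> bool" where
  "schatten_tendsto p T T0 F \<longleftrightarrow> T0 \<in> schatten p \<and> (\<forall>\<^sub>F i in F. T i \<in> schatten p) \<and>
     ((\<lambda>i. schatten_norm p (\<lambda>x. T i x - T0 x)) \<longlongrightarrow> 0) F"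

text \<open>
  \<open>tensor_op \<tau> \<tau>' A B\<close> is \<open>A \<otimes> B\<close>, where \<open>\<tau>\<close> and \<open>\<tau>'\<close> are the maps \<open>(x, y) \<mapsto> x \<otimes> y\<close> into the domain
  and into the codomain.
\<close>

definition tensor_op ::
  "('a \<Rightarrow> 'b \<Rightarrow> 'c::complex_inner) \<Rightarrow> ('a' \<Rightarrow> 'b' \<Rightarrow> 'c'::complex_inner) \<Rightarrow>
   ('a \<Rightarrow> 'a') \<Rightarrow> ('b \<Rightarrow> 'b') \<Rightarrow> 'c \<Rightarrow> 'c'" where
  "tensor_op \<tau> \<tau>' A B =
     (THE C. bounded_clinear C \<and> (\<forall>x y. C (\<tau> x y) = \<tau>' (A x) (B y)))"


section \<open>The unperturbed operator\<close>

text \<open>\<open>\<ell>\<^sup>2(\<int>\<^sub>h, \<G>) = \<ell>\<^sup>2(\<int>\<^sub>h) \<otimes> \<G>\<close> via \<open>(\<phi> \<otimes> g)(h n) = \<phi>(h n) g\<close>.\<close>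

definition lat_tensor :: "complex lat \<Rightarrow> 'g::complex_inner \<Rightarrow> 'g lat"  (infixr \<open>\<otimes>\<^sub>l\<close> 70) where
  "\<phi> \<otimes>\<^sub>l g = Abs_lat (\<lambda>n. lat_fun \<phi> n *\<^sub>C g)"

definition lat_op_tensor ::
  "(complex lat \<Rightarrow> complex lat) \<Rightarrow> ('g::complex_inner \<Rightarrow> 'g) \<Rightarrow> 'g lat \<Rightarrow> 'g lat"
  (infixr \<open>\<otimes>\<^sub>o\<close> 70) where
  "A \<otimes>\<^sub>o B = tensor_op lat_tensor lat_tensor A B"

definition neg_laplacian :: "real \<Rightarrow> complex lat \<Rightarrow> complex lat" where
  "neg_laplacian h \<phi> = Abs_lat (\<lambda>n. of_real (1 / h\<^sup>2) *
     (2 * lat_fun \<phi> n - lat_fun \<phi> (n + 1) - lat_fun \<phi> (n - 1)))"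

definition H_free :: "real \<Rightarrow> ('g::complex_inner \<Rightarrow> 'g) \<Rightarrow> 'g lat \<Rightarrow> 'g lat" where
  "H_free h Q f = (neg_laplacian h \<otimes>\<^sub>o id) f + (id \<otimes>\<^sub>o Q) f"

text \<open>
  \<open>eigen_decomp Q d \<mu>\<close>: either \<open>Q = 0\<close>, and then \<open>\<mu>\<^sub>0 = 0\<close>; or \<open>Q \<noteq> 0\<close>, \<open>\<mu>\<^sub>1, \<dots>, \<mu>\<^sub>d\<close> are the distinct
  eigenvalues of \<open>Q\<close>, and \<open>\<G>\<close> is the orthogonal sum of the eigenspaces.  As there are finitely many
  of these, such a \<open>Q\<close> is everywhere defined and bounded.
\<close>

definition eigen_decomp :: "('g::complex_inner \<Rightarrow> 'g) \<Rightarrow> nat \<Rightarrow> (nat \<Rightarrow> real) \<Rightarrow> bool" where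
  "eigen_decomp Q d \<mu> \<longleftrightarrow> self_adjoint Q \<and>
     (if Q = (\<lambda>_. 0) then \<mu> 0 = 0
      else inj_on \<mu> {1..d} \<and> (\<forall>s\<in>{1..d}. eigenspace Q (\<mu> s) \<noteq> {0}) \<and>
        (\<forall>s\<in>{1..d}. \<forall>t\<in>{1..d}. s \<noteq> t \<longrightarrow>
           (\<forall>x\<in>eigenspace Q (\<mu> s). \<forall>y\<in>eigenspace Q (\<mu> t). cinner x y = 0)) \<and>
        (\<forall>x. \<exists>y. (\<forall>s\<in>{1..d}. y s \<in> eigenspace Q (\<mu> s)) \<and> x = (\<Sum>s\<in>{1..d}. y s)))"

definition index_set :: "('g::complex_inner \<Rightarrow> 'g) \<Rightarrow> nat \<Rightarrow> nat set" where
  "index_set Q d = (if Q = (\<lambda>_. 0) then {0} else {1..d})"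

definition eigen_proj :: "('g::complex_inner \<Rightarrow> 'g) \<Rightarrow> (nat \<Rightarrow> real) \<Rightarrow> nat \<Rightarrow> 'g \<Rightarrow> 'g" where
  "eigen_proj Q \<mu> s = (if Q = (\<lambda>_. 0) then id else orth_proj (eigenspace Q (\<mu> s)))"

definition nondegenerate_lower ::
  "real \<Rightarrow> ('g::complex_inner \<Rightarrow> 'g) \<Rightarrow> nat \<Rightarrow> (nat \<Rightarrow> real) \<Rightarrow> nat \<Rightarrow> bool" where
  "nondegenerate_lower h Q d \<mu> s \<longleftrightarrow>
     Q = (\<lambda>_. 0) \<or> (\<forall>t\<in>index_set Q d. t \<noteq> s \<longrightarrow> \<mu> s \<noteq> 4 / h\<^sup>2 + \<mu> t)"

definition nondegenerate_upper ::
  "real \<Rightarrow> ('g::complex_inner \<Rightarrow> 'g) \<Rightarrow> nat \<Rightarrow> (nat \<Rightarrow> real) \<Rightarrow> nat \<Rightarrow> bool" where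
  "nondegenerate_upper h Q d \<mu> s \<longleftrightarrow>
     Q = (\<lambda>_. 0) \<or> (\<forall>t\<in>index_set Q d. t \<noteq> s \<longrightarrow> 4 / h\<^sup>2 + \<mu> s \<noteq> \<mu> t)"


section \<open>The perturbation and the spectral shift function\<close>

text \<open>\<open>weight \<nu>\<^sub>0 n\<close> is \<open>\<psi>(h n)\<close>.\<close>

definition weight :: "real \<Rightarrow> int \<Rightarrow> complex" where
  "weight \<nu> n = of_real (sqrt (1 + (of_int n)\<^sup>2) powr (- \<nu> / 2))"

definition mult_op :: "(int \<Rightarrow> complex) \<Rightarrow> complex lat \<Rightarrow> complex lat" where
  "mult_op m \<phi> = Abs_lat (\<lambda>n. m n * lat_fun \<phi> n)"

definition V_op ::
  "real \<Rightarrow> ('g::complex_inner \<Rightarrow> 'g) \<Rightarrow> ('g lat \<Rightarrow> 'g lat) \<Rightarrow> 'g lat \<Rightarrow> 'g lat" where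
  "V_op \<nu> K \<V> = (mult_op (weight \<nu>) \<otimes>\<^sub>o cadj K) \<circ> \<V> \<circ> (mult_op (weight \<nu>) \<otimes>\<^sub>o K)"

text \<open>\<open>H_pert \<sigma>\<close> for \<open>\<sigma> = \<plusminus>1\<close> is \<open>H\<^sup>\<plusminus> = H\<^sub>Q \<plusminus> V\<close>.\<close>

definition H_pert ::
  "real \<Rightarrow> real \<Rightarrow> real \<Rightarrow> ('g::complex_inner \<Rightarrow> 'g) \<Rightarrow> ('g \<Rightarrow> 'g) \<Rightarrow> ('g lat \<Rightarrow> 'g lat) \<Rightarrow>
   'g lat \<Rightarrow> 'g lat" where
  "H_pert \<sigma> h \<nu> Q K \<V> f = H_free h Q f + \<sigma> *\<^sub>R V_op \<nu> K \<V> f"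

text \<open>The operator \<open>\<M> = \<V>\<^sup>1\<^sup>/\<^sup>2 (M\<^sub>\<psi> \<otimes> K)\<close>, so that \<open>V = \<M>\<^sup>* \<M>\<close>.\<close>

definition factor_op ::
  "real \<Rightarrow> ('g::complex_inner \<Rightarrow> 'g) \<Rightarrow> ('g lat \<Rightarrow> 'g lat) \<Rightarrow> 'g lat \<Rightarrow> 'g lat" where
  "factor_op \<nu> K \<V> = op_sqrt \<V> \<circ> (mult_op (weight \<nu>) \<otimes>\<^sub>o K)"

definition sandwiched_resolvent ::
  "('a::complex_inner \<Rightarrow> 'a) \<Rightarrow> ('a \<Rightarrow> 'b::complex_inner) \<Rightarrow> complex \<Rightarrow> 'b \<Rightarrow> 'b" where
  "sandwiched_resolvent H M z = M \<circ> inv (\<lambda>x. H x - z *\<^sub>C x) \<circ> cadj M"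

definition boundary_resolvent ::
  "('a::complex_inner \<Rightarrow> 'a) \<Rightarrow> ('a \<Rightarrow> 'b::complex_inner) \<Rightarrow> real \<Rightarrow> 'b \<Rightarrow> 'b" where
  "boundary_resolvent H M lam =
     (THE T. schatten_tendsto 2 (\<lambda>\<epsilon>. sandwiched_resolvent H M (Complex lam \<epsilon>)) T (at_right 0))"

text \<open>For \<open>\<sigma> = \<plusminus>1\<close>, \<open>counting \<sigma> r S\<close> is \<open>\<N>\<^sub>\<plusminus>(r, S)\<close>.\<close>

definition counting :: "real \<Rightarrow> real \<Rightarrow> ('a::complex_inner \<Rightarrow> 'a) \<Rightarrow> nat" where
  "counting \<sigma> r S = op_rank (fun_calc (indicator {r<..}) (\<lambda>x. \<sigma> *\<^sub>R S x))"

definition pushnitski_formula ::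
  "real \<Rightarrow> ('a::complex_inner \<Rightarrow> 'a) \<Rightarrow> ('a \<Rightarrow> 'b::complex_inner) \<Rightarrow> real \<Rightarrow> real" where
  "pushnitski_formula \<sigma> H M lam = \<sigma> * (1 / pi) * (LINT t|lborel.
     real (counting (- \<sigma>) 1 (\<lambda>x. re_part (boundary_resolvent H M lam) x +
                                 t *\<^sub>R im_part (boundary_resolvent H M lam) x)) / (1 + t\<^sup>2))"

text \<open>
  The representative of \<open>\<xi>(lam; H\<^sub>1, H\<^sub>0)\<close> for \<open>H\<^sub>1 = H\<^sub>0 \<plusminus> M\<^sup>* M\<close>, outside the thresholds.  Both signs apply
  only when \<open>M = 0\<close>, and then both values are \<open>0\<close>.
\<close>

definition ssf ::
  "('a::complex_inner \<Rightarrow> 'a) \<Rightarrow> ('a \<Rightarrow> 'a) \<Rightarrow> ('a \<Rightarrow> 'b::complex_inner) \<Rightarrow> real \<Rightarrow> real" where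
  "ssf H1 H0 M lam = (THE x. \<exists>\<sigma>\<in>{1, -1}.
     H1 = (\<lambda>f. H0 f + \<sigma> *\<^sub>R cadj M (M f)) \<and> x = pushnitski_formula \<sigma> H0 M lam)"


section \<open>Effective operators\<close>

text \<open>\<open>P\<^sub>s = \<langle>\<psi>| \<otimes> \<pi>\<^sub>s\<close>, with \<open>\<complex> \<otimes> \<G>\<close> identified with \<open>\<G>\<close> via \<open>c \<otimes> g = c g\<close>.\<close>

definition P_op ::
  "real \<Rightarrow> ('g::complex_inner \<Rightarrow> 'g) \<Rightarrow> (nat \<Rightarrow> real) \<Rightarrow> nat \<Rightarrow> 'g lat \<Rightarrow> 'g" where
  "P_op \<nu> Q \<mu> s =
     tensor_op lat_tensor scaleC (cinner (Abs_lat (weight \<nu>))) (eigen_proj Q \<mu> s)"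

definition V_bold ::
  "('g::complex_inner \<Rightarrow> 'g) \<Rightarrow> ('g lat \<Rightarrow> 'g lat) \<Rightarrow> 'g lat \<Rightarrow> 'g lat" where
  "V_bold K \<V> = (id \<otimes>\<^sub>o cadj K) \<circ> \<V> \<circ> (id \<otimes>\<^sub>o K)"

definition J_op :: "complex lat \<Rightarrow> complex lat" where
  "J_op = mult_op (\<lambda>n. (-1) powi n)"

definition V_bold_J ::
  "('g::complex_inner \<Rightarrow> 'g) \<Rightarrow> ('g lat \<Rightarrow> 'g lat) \<Rightarrow> 'g lat \<Rightarrow> 'g lat" where
  "V_bold_J K \<V> = cadj (J_op \<otimes>\<^sub>o id) \<circ> V_bold K \<V> \<circ> (J_op \<otimes>\<^sub>o id)"

definition omega_lower ::
  "real \<Rightarrow> real \<Rightarrow> ('g::complex_inner \<Rightarrow> 'g) \<Rightarrow> (nat \<Rightarrow> real) \<Rightarrow> nat \<Rightarrow> ('g \<Rightarrow> 'g) \<Rightarrow>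
   ('g lat \<Rightarrow> 'g lat) \<Rightarrow> real \<Rightarrow> 'g \<Rightarrow> 'g" where
  "omega_lower h \<nu> Q \<mu> s K \<V> lam x = (h / 2 / sqrt \<bar>lam - \<mu> s\<bar>) *\<^sub>R
     (P_op \<nu> Q \<mu> s \<circ> V_bold K \<V> \<circ> cadj (P_op \<nu> Q \<mu> s)) x"

definition omega_upper ::
  "real \<Rightarrow> real \<Rightarrow> ('g::complex_inner \<Rightarrow> 'g) \<Rightarrow> (nat \<Rightarrow> real) \<Rightarrow> nat \<Rightarrow> ('g \<Rightarrow> 'g) \<Rightarrow>
   ('g lat \<Rightarrow> 'g lat) \<Rightarrow> real \<Rightarrow> 'g \<Rightarrow> 'g" where
  "omega_upper h \<nu> Q \<mu> s K \<V> lam x = (- (h / 2 / sqrt \<bar>4 / h\<^sup>2 + \<mu> s - lam\<bar>)) *\<^sub>R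
     (P_op \<nu> Q \<mu> s \<circ> V_bold_J K \<V> \<circ> cadj (P_op \<nu> Q \<mu> s)) x"

definition tr_arctan :: "('g::complex_inner \<Rightarrow> 'g) \<Rightarrow> real" where
  "tr_arctan A = Re (op_trace (fun_calc arctan A))"

text \<open>
  \<open>F\<^sub>1(V, lam) \<sim> F\<^sub>2(V, lam)\<close> along the filter \<open>L\<close>.  A functional of \<open>V\<close> is represented as a function of
  \<open>\<V>\<close>, with \<open>\<nu>\<^sub>0\<close> and \<open>K\<close> fixed.
\<close>

definition sim_along ::
  "(('a::complex_inner \<Rightarrow> 'a) \<Rightarrow> real \<Rightarrow> real) \<Rightarrow> (('a \<Rightarrow> 'a) \<Rightarrow> real \<Rightarrow> real) \<Rightarrow> ('a \<Rightarrow> 'a) \<Rightarrow>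
   real filter \<Rightarrow> bool" where
  "sim_along F1 F2 \<V> L \<longleftrightarrow>
     (\<forall>\<epsilon>\<in>{0<..<1}. \<exists>R1\<in>O[L](\<lambda>_. 1). \<exists>R2\<in>O[L](\<lambda>_. 1). \<forall>\<^sub>F lam in L.
        F2 (\<lambda>x. (1 / (1 - \<epsilon>)) *\<^sub>R \<V> x) lam + R1 lam \<le> F1 \<V> lam \<and>
        F1 \<V> lam \<le> F2 (\<lambda>x. (1 / (1 + \<epsilon>)) *\<^sub>R \<V> x) lam + R2 lam)"

end

theory Submission
  imports Defs
begin

text \<open>Sandwiched between \<open>\<M>\<close> and \<open>\<M>\<^sup>*\<close>, the resolvent \<open>inverse (H\<^sub>Q - z)\<close> is in each channel \<open>\<mu>\<^sub>t\<close> an operator with kernel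
  \<open>\<psi>(n) h\<^sup>2 r ^ \<bar>n - m\<bar> \<psi>(m) / (1 - r\<^sup>2)\<close>, where \<open>r\<close> is the root of \<open>r\<^sup>2 - 2 w r + 1 = 0\<close> in the unit disc and
  \<open>w = 1 - h\<^sup>2 (z - \<mu>\<^sub>t) / 2\<close>. On the real axis \<open>r\<close> has modulus one in the open channels \<open>\<bar>w\<bar> < 1\<close>, and a threshold is
  a point with \<open>w = \<plusminus>1\<close>. Near a non-degenerate threshold of the channel \<open>s\<close> only this channel is singular. There the real part
  \<open>A\<close> of the kernel has the size of \<open>\<bar>n - m\<bar>\<close>, so it is bounded in Hilbert-Schmidt norm because \<open>\<nu>\<^sub>0 > 3\<close>, while the
  imaginary part \<open>B\<close> is \<open>\<kappa> L L\<^sup>*\<close> up to a relative error \<open>\<epsilon>\<close> and a remainder of bounded trace, with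
  \<open>\<kappa> = h / (2 sqrt \<bar>\<lambda> - \<lambda>\<^sub>0\<bar>)\<close> and \<open>\<kappa> L\<^sup>* L\<close> the effective operator \<open>\<omega>\<close>.
  The number of eigenvalues above \<open>r\<close> is the least codimension of a subspace on which the quadratic form is at most \<open>r\<close>;
  hence Weyl's inequalities remove \<open>A\<close> and the remainder at the cost of \<open>O(1)\<close> after integration against
  \<open>dt / (1 + t\<^sup>2)\<close>, replace \<open>L L\<^sup>*\<close> by \<open>L\<^sup>* L\<close>, and the layer-cake formula turns what is left into \<open>Tr arctan \<omega>\<close>.\<close>

section \<open>Sesquilinear algebra and adjoints\<close>

text \<open>The average over \<open>t\<close> dictates what may be discarded. Eigenvalues of
  \<open>A\<close> above a fixed level are bounded in number uniformly in \<open>t\<close>, so a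
  Hilbert-Schmidt bound costs a constant times the total mass of the Cauchy kernel. A term
  multiplied by \<open>t\<close> has no such uniform count and needs a trace bound: the averaged
  counting function of \<open>t D\<close> at level 1 is Tr arctan \<open>D\<close>, which is at most
  Tr \<open>D\<close>. Hence everything is arranged as inequalities between quadratic forms with a
  relative error and a nonnegative remainder of bounded trace; the relative error is what the
  rescaling of V in \<open>sim_along\<close> tolerates. A second obstacle is that adjoint, tensor
  product, square root, boundary resolvent and the shift function are definite descriptions, and the
  resolvent is a plain inverse function. Each is usable only after existence and uniqueness, so each
  is traded for something explicit: square roots for an iteration, tensor products for pointwise
  formulas, the resolvent for convolution with a Green function, traces for sums over orthonormal
  eigenvectors.\<close>

instance chilbert_space \<subseteq> banach ..

global_interpretation cinner: bounded_bilinear "cinner :: 'a::complex_inner \<Rightarrow> 'a \<Rightarrow> complex"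
proof
  fix a a' b b' :: 'a and r :: real
  show "cinner (a + a') b = cinner a b + cinner a' b" by (rule cinner_add_left)
  show "cinner a (b + b') = cinner a b + cinner a b'" by (rule cinner_add_right)
  show "cinner (r *\<^sub>R a) b = r *\<^sub>R cinner a b"
    by (simp add: cinner_scaleC_left scaleR_conv_of_real flip: scaleC_of_real)
  show "cinner a (r *\<^sub>R b) = r *\<^sub>R cinner a b"
    by (simp add: cinner_scaleC_right scaleR_conv_of_real flip: scaleC_of_real)
  show "\<exists>K. \<forall>a b :: 'a. norm (cinner a b) \<le> norm a * norm b * K"
    by (rule exI[of _ 1]) (simp add: cmod_cinner_le)
qed

global_interpretation scaleC: bounded_bilinear "scaleC :: complex \<Rightarrow> 'a::complex_inner \<Rightarrow> 'a"
proof
  fix a a' :: complex and b b' :: 'a and r :: real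
  show "(a + a') *\<^sub>C b = a *\<^sub>C b + a' *\<^sub>C b" by (rule scaleC_add_left)
  show "a *\<^sub>C (b + b') = a *\<^sub>C b + a *\<^sub>C b'" by (rule scaleC_add_right)
  show "(r *\<^sub>R a) *\<^sub>C b = r *\<^sub>R a *\<^sub>C b"
    by (simp add: scaleC_scaleC scaleR_conv_of_real flip: scaleC_of_real)
  show "a *\<^sub>C (r *\<^sub>R b) = r *\<^sub>R a *\<^sub>C b"
    by (simp add: scaleC_scaleC mult.commute flip: scaleC_of_real)
  show "\<exists>K. \<forall>a (b :: 'a). norm (a *\<^sub>C b) \<le> norm a * norm b * K"
    by (rule exI[of _ 1]) (simp add: norm_scaleC)
qed

section \<open>Elementary calculus of complex-linear maps\<close>

lemma cinner_eqI:
  assumes "\<And>x. cinner x y = cinner x (z :: 'a::complex_inner)"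
  shows "y = z"
proof -
  have "cinner (y - z) (y - z) = 0" using assms[of "y - z"] by (simp add: cinner.diff_right)
  then show ?thesis by (simp add: cinner_self)
qed

lemma norm_sq_cinner: "(norm (x :: 'a::complex_inner))\<^sup>2 = Re (cinner x x)"
  by (simp add: cinner_self)

lemma bounded_clinearI:
  assumes "\<And>x y. A (x + y) = A x + A y" "\<And>c x. A (c *\<^sub>C x) = c *\<^sub>C A x"
    "\<And>x. norm (A x) \<le> norm x * K"
  shows "bounded_clinear A"
  unfolding bounded_clinear_def
proof safe
  show "bounded_linear A"
    by (rule bounded_linear_intro[of _ K]) (use assms in \<open>auto simp flip: scaleC_of_real\<close>)
qed (use assms in auto)

lemma
  assumes "bounded_clinear A"
  shows bounded_clinear_linear: "bounded_linear A"
    and bounded_clinear_add: "A (x + y) = A x + A y"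
    and bounded_clinear_diff: "A (x - y) = A x - A y"
    and bounded_clinear_scaleC: "A (c *\<^sub>C x) = c *\<^sub>C A x"
    and bounded_clinear_scaleR: "A (r *\<^sub>R x) = r *\<^sub>R A x"
    and bounded_clinear_zero: "A 0 = 0"
    and bounded_clinear_sum: "A (sum f I) = (\<Sum>i\<in>I. A (f i))"
proof -
  show *: "bounded_linear A" using assms by (simp add: bounded_clinear_def)
  interpret bounded_linear A by fact
  show "A (x + y) = A x + A y" "A (x - y) = A x - A y" "A (r *\<^sub>R x) = r *\<^sub>R A x" "A 0 = 0"
    "A (sum f I) = (\<Sum>i\<in>I. A (f i))"
    by (simp_all add: add diff scaleR sum)
  show "A (c *\<^sub>C x) = c *\<^sub>C A x" using assms by (simp add: bounded_clinear_def)
qed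

lemma bounded_clinear_id: "bounded_clinear (\<lambda>x. x)"
  and bounded_clinear_0: "bounded_clinear (\<lambda>x. 0)"
  by (simp_all add: bounded_clinear_def bounded_linear_ident bounded_linear_zero)

lemma bounded_clinear_compose:
  "bounded_clinear A \<Longrightarrow> bounded_clinear B \<Longrightarrow> bounded_clinear (\<lambda>x. A (B x))"
  by (simp add: bounded_clinear_def bounded_linear_compose)

lemma bounded_clinear_plus:
  "bounded_clinear A \<Longrightarrow> bounded_clinear B \<Longrightarrow> bounded_clinear (\<lambda>x. A x + B x)"
  by (simp add: bounded_clinear_def bounded_linear_add scaleC_add_right)

lemma bounded_clinear_minus:
  "bounded_clinear A \<Longrightarrow> bounded_clinear B \<Longrightarrow> bounded_clinear (\<lambda>x. A x - B x)"
  by (simp add: bounded_clinear_def bounded_linear_sub scaleC.diff_right)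

lemma bounded_clinear_scaleC_left:
  assumes "bounded_clinear A"
  shows "bounded_clinear (\<lambda>x. c *\<^sub>C A x)"
  unfolding bounded_clinear_def using assms
  by (simp add: bounded_linear_compose[OF scaleC.bounded_linear_right] bounded_clinear_linear
      bounded_clinear_scaleC scaleC_scaleC mult.commute)

lemma bounded_clinear_scaleR_left:
  "bounded_clinear A \<Longrightarrow> bounded_clinear (\<lambda>x. r *\<^sub>R A x)"
  using bounded_clinear_scaleC_left[of A "of_real r"] by (simp add: scaleC_of_real)

lemma bounded_clinear_sums:
  "(\<And>i. i \<in> I \<Longrightarrow> bounded_clinear (A i)) \<Longrightarrow> bounded_clinear (\<lambda>x. \<Sum>i\<in>I. A i x)"
  by (simp add: bounded_clinear_def bounded_linear_sum scaleC.sum_right)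

lemma bounded_clinear_bound:
  assumes "bounded_clinear A"
  obtains k where "k > 0" "\<And>x. norm (A x) \<le> k * norm x"
  using bounded_linear.pos_bounded[OF bounded_clinear_linear[OF assms]] by (auto simp: mult.commute)

text \<open>A relation rather than the function \<open>cadj\<close>: adjoint pairs are composed and
  reversed directly, and the definite description is evaluated only in
  \<open>adj_cadj\<close>.\<close>

definition adj :: "('a::complex_inner \<Rightarrow> 'b::complex_inner) \<Rightarrow> ('b \<Rightarrow> 'a) \<Rightarrow> bool" where
  "adj A B \<longleftrightarrow> (\<forall>x y. cinner (A x) y = cinner x (B y))"

lemma adjD: "adj A B \<Longrightarrow> cinner (A x) y = cinner x (B y)"
  by (simp add: adj_def)

lemma adj_sym: "adj A B \<Longrightarrow> adj B A"
  unfolding adj_def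
proof (intro allI)
  fix x y assume "\<forall>x y. cinner (A x) y = cinner x (B y)"
  then have "cnj (cinner (A y) x) = cnj (cinner y (B x))" by simp
  then show "cinner (B x) y = cinner x (A y)" by (simp flip: cinner_commute)
qed

lemma adj_cadj:
  assumes "adj A B"
  shows "cadj A = B"
proof -
  have "(THE C. \<forall>x y. cinner (A x) y = cinner x (C y)) = B"
  proof (rule the_equality)
    show "\<forall>x y. cinner (A x) y = cinner x (B y)" using assms unfolding adj_def .
  next
    fix C assume a: "\<forall>x y. cinner (A x) y = cinner x (C y)"
    show "C = B"
    proof (rule ext, rule cinner_eqI)
      fix y x
      have "cinner x (C y) = cinner (A x) y" by (rule a[rule_format, symmetric])
      also have "\<dots> = cinner x (B y)" by (rule adjD[OF assms])
      finally show "cinner x (C y) = cinner x (B y)" .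
    qed
  qed
  then show ?thesis unfolding cadj_def .
qed

lemma adj_compose: "adj A A' \<Longrightarrow> adj B B' \<Longrightarrow> adj (\<lambda>x. A (B x)) (\<lambda>x. B' (A' x))"
  by (simp add: adj_def)

text \<open>The squared norm of \<open>B x\<close> equals the scalar product of
  \<open>A (B x)\<close> with \<open>x\<close>, hence is at most \<open>k\<close> times the norms of
  \<open>B x\<close> and \<open>x\<close>; one factor cancels.\<close>

lemma adj_bounded:
  assumes "bounded_clinear A" "adj A B"
  shows "bounded_clinear B"
proof -
  obtain k where k: "k > 0" "\<And>x. norm (A x) \<le> k * norm x"
    using bounded_clinear_bound[OF assms(1)] by metis
  have B: "cinner x (B y) = cinner (A x) y" for x y using assms(2) by (simp add: adj_def)
  show ?thesis
  proof (rule bounded_clinearI[where K = k])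
    show "B (x + y) = B x + B y" for x y
      by (rule cinner_eqI) (simp add: B cinner_add_right)
    show "B (c *\<^sub>C x) = c *\<^sub>C B x" for c x
      by (rule cinner_eqI) (simp add: B cinner_scaleC_right)
    fix x
    have "(norm (B x))\<^sup>2 = cmod (cinner (A (B x)) x)" by (simp add: B[symmetric] cinner_self norm_power)
    also have "\<dots> \<le> norm (A (B x)) * norm x" by (rule cmod_cinner_le)
    also have "\<dots> \<le> k * norm (B x) * norm x" by (simp add: k mult_right_mono)
    finally have *: "norm (B x) * norm (B x) \<le> norm (B x) * (norm x * k)"
      by (simp add: power2_eq_square mult_ac)
    show "norm (B x) \<le> norm x * k"
      using * k by (cases "B x = 0") (simp_all add: mult_le_cancel_left)
  qed
qed

text \<open>The representing vector is the minimizer of \<open>\<parallel>x\<parallel>\<^sup>2 - 2 f x\<close>, whose minimizing sequences are Cauchy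
  by the parallelogram law.\<close>

lemma riesz_real:
  fixes f :: "'a::{real_inner,complete_space} \<Rightarrow> real"
  assumes "bounded_linear f"
  obtains y where "\<And>x. f x = inner y x"
proof -
  interpret f: bounded_linear f by fact
  obtain K where K: "\<And>x. norm (f x) \<le> norm x * K" "K > 0" using f.pos_bounded by blast
  define J where "J x = (norm x)\<^sup>2 - 2 * f x" for x
  have lower: "- (K\<^sup>2) \<le> J x" for x
  proof -
    have "f x \<le> norm x * K" using K(1)[of x] by simp
    moreover have "0 \<le> (norm x - K)\<^sup>2" by simp
    ultimately show ?thesis unfolding J_def power2_diff by linarith
  qed
  define m where "m = Inf (range J)"
  have bdd: "bdd_below (range J)" using lower by (auto intro!: bdd_belowI)
  have m: "m \<le> J x" for x unfolding m_def by (rule cInf_lower) (auto intro: bdd)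
  have "\<exists>x. J x < m + 1 / (real n + 1)" for n
    using cInf_lessD[of "range J" "m + 1 / (real n + 1)"] by (auto simp: m_def)
  then obtain X where X: "\<And>n. J (X n) < m + 1 / (real n + 1)" by metis
  have par: "(norm (x - y))\<^sup>2 \<le> 2 * (J x - m) + 2 * (J y - m)" for x y
  proof -
    have "(norm (x - y))\<^sup>2 = 2 * J x + 2 * J y - 4 * J ((1/2) *\<^sub>R (x + y))"
      by (simp add: J_def f.scaleR f.add power2_norm_eq_inner inner_simps inner_commute algebra_simps)
    then show ?thesis using m[of "(1/2) *\<^sub>R (x + y)"] by argo
  qed
  have "Cauchy X"
  proof (rule metric_CauchyI)
    fix e :: real assume e: "e > 0"
    obtain N where N: "4 / e\<^sup>2 < real N" using reals_Archimedean2 by blast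
    show "\<exists>M. \<forall>i\<ge>M. \<forall>j\<ge>M. dist (X i) (X j) < e"
    proof (intro exI allI impI)
      fix i j assume ij: "i \<ge> N" "j \<ge> N"
      have *: "J (X i) - m < e\<^sup>2 / 4" if "i \<ge> N" for i
      proof -
        have "4 / e\<^sup>2 < real i + 1" using N that by linarith
        then have "1 / (real i + 1) < e\<^sup>2 / 4" using e by (simp add: field_simps)
        from order.strict_trans[OF X[of i] add_strict_left_mono[OF this]]
        show ?thesis by simp
      qed
      have "(norm (X i - X j))\<^sup>2 \<le> 2 * (J (X i) - m) + 2 * (J (X j) - m)" by (rule par)
      also have "\<dots> < 2 * (e\<^sup>2 / 4) + 2 * (e\<^sup>2 / 4)"
        using *[OF ij(1)] *[OF ij(2)] by (intro add_strict_mono) auto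
      finally have "(norm (X i - X j))\<^sup>2 < e\<^sup>2" by simp
      then show "dist (X i) (X j) < e"
        using e power2_less_imp_less[of "norm (X i - X j)" e] by (simp add: dist_norm)
    qed
  qed
  then obtain y where y: "X \<longlonglongrightarrow> y" using Cauchy_convergent unfolding convergent_def by blast
  have "(\<lambda>n. J (X n)) \<longlonglongrightarrow> J y" unfolding J_def by (intro tendsto_intros f.tendsto y)
  moreover have "(\<lambda>n. m + 1 / (real n + 1)) \<longlonglongrightarrow> m"
    using tendsto_add[OF tendsto_const[of m] LIMSEQ_inverse_real_of_nat] by (simp add: inverse_eq_divide add.commute)
  ultimately have Jy: "J y \<le> m"
    by (rule LIMSEQ_le) (use X less_imp_le in blast)
  have "f v = inner y v" for v
  proof -
    define a b where "a = (norm v)\<^sup>2" and "b = 2 * (inner y v - f v)"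
    have q: "0 \<le> t\<^sup>2 * a + t * b" for t
    proof -
      have "J (y + t *\<^sub>R v) = J y + (t\<^sup>2 * a + t * b)"
        by (simp add: J_def a_def b_def f.scaleR f.add power2_norm_eq_inner inner_simps inner_commute
            power2_eq_square[of t] algebra_simps)
      then show ?thesis using Jy m[of "y + t *\<^sub>R v"] by linarith
    qed
    have "b = 0"
    proof (rule ccontr)
      assume "b \<noteq> 0"
      have a0: "0 \<le> a" by (simp add: a_def)
      \<comment> \<open>The choice \<open>t = - b * s\<close> turns the quadratic
        \<open>t\<^sup>2 * a + t * b\<close> into \<open>- (b * s)\<^sup>2\<close>; the 1 in the
        denominator covers \<open>a = 0\<close>.\<close>
      define s where "s = 1 / (a + 1)"
      have s: "s > 0" "s * a = 1 - s" using a0 by (simp_all add: s_def field_simps)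
      have "0 \<le> (- b * s)\<^sup>2 * a + (- b * s) * b" by (rule q)
      also have "\<dots> = b * b * s * (s * a - 1)" by (simp add: power2_eq_square algebra_simps)
      also have "\<dots> = - (b * s)\<^sup>2" unfolding s by (simp add: power2_eq_square)
      finally show False using \<open>b \<noteq> 0\<close> s(1) by simp
    qed
    then show ?thesis by (simp add: b_def)
  qed
  then show ?thesis by (rule that)
qed

text \<open>The real functional \<open>inner y (A x)\<close> is represented by
  \<open>riesz_real\<close>. Its values at \<open>\<i> *\<^sub>C x\<close> give the imaginary part,
  so the same vector represents the complex functional.\<close>

lemma adj_exists:
  fixes A :: "'a::chilbert_space \<Rightarrow> 'b::complex_inner"
  assumes "bounded_clinear A"
  obtains B where "adj A B"
proof -
  have "\<exists>z. \<forall>x. cinner (A x) y = cinner x z" for y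
  proof -
    have bl: "bounded_linear (\<lambda>x. inner y (A x))"
      by (rule bounded_linear_compose[OF bounded_linear_inner_right bounded_clinear_linear[OF assms]])
    obtain z where z: "\<And>x. inner y (A x) = inner z x" by (rule riesz_real[OF bl]) blast
    have "cinner y (A x) = cinner z x" for x
    proof (rule complex_eqI)
      show "Re (cinner y (A x)) = Re (cinner z x)" by (simp add: Re_cinner z)
      have "Re (cinner y (A (\<i> *\<^sub>C x))) = Re (cinner z (\<i> *\<^sub>C x))" by (simp add: Re_cinner z)
      then show "Im (cinner y (A x)) = Im (cinner z x)"
        by (simp add: bounded_clinear_scaleC[OF assms] cinner_scaleC_right)
    qed
    then show ?thesis by (metis cinner_commute)
  qed
  then obtain B where "\<And>x y. cinner (A x) y = cinner x (B y)" by metis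
  then show ?thesis by (intro that[of B]) (simp add: adj_def)
qed

section \<open>Orthonormal sets\<close>

definition onset :: "'a::complex_inner set \<Rightarrow> bool" where
  "onset F \<longleftrightarrow> (\<forall>x\<in>F. \<forall>y\<in>F. cinner x y = (if x = y then 1 else 0))"

lemma onset_subset: "onset F \<Longrightarrow> G \<subseteq> F \<Longrightarrow> onset G"
  unfolding onset_def by (meson subsetD)

lemma onset_norm: "onset F \<Longrightarrow> x \<in> F \<Longrightarrow> norm x = 1"
proof -
  assume "onset F" "x \<in> F"
  then have "complex_of_real ((norm x)\<^sup>2) = 1" using cinner_self[of x] by (simp add: onset_def)
  then have "(norm x)\<^sup>2 = 1" by (simp only: of_real_eq_1_iff)
  then show "norm x = 1" by (simp add: abs_square_eq_1)
qed

lemma onset_cinner_sum: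
  assumes "onset F" "finite F" "e \<in> F"
  shows "cinner e (\<Sum>f\<in>F. c f *\<^sub>C f) = c e"
proof -
  have "cinner e (\<Sum>f\<in>F. c f *\<^sub>C f) = (\<Sum>f\<in>F. if f = e then c e else 0)"
    unfolding cinner.sum_right cinner_scaleC_right using assms
    by (intro sum.cong) (auto simp: onset_def)
  then show ?thesis using assms by simp
qed

lemma onset_cinner_sum_sum:
  assumes "onset F" "finite F"
  shows "cinner (\<Sum>f\<in>F. c f *\<^sub>C f) (\<Sum>f\<in>F. b f *\<^sub>C f) = (\<Sum>f\<in>F. cnj (c f) * b f)"
  unfolding cinner.sum_left cinner_scaleC_left
  by (intro sum.cong refl) (simp add: onset_cinner_sum assms)

lemma onset_norm_sum:
  assumes "onset F" "finite F"
  shows "(norm (\<Sum>f\<in>F. c f *\<^sub>C f))\<^sup>2 = (\<Sum>f\<in>F. (cmod (c f))\<^sup>2)"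
  by (subst norm_sq_cinner, subst onset_cinner_sum_sum[OF assms])
     (simp only: cmod_power2 Re_sum, simp add: power2_eq_square)

lemma onset_pythagoras:
  assumes "onset F" "finite F"
  shows "(norm (x - (\<Sum>f\<in>F. cinner f x *\<^sub>C f)))\<^sup>2 = (norm x)\<^sup>2 - (\<Sum>f\<in>F. (cmod (cinner f x))\<^sup>2)"
proof -
  define p where "p = (\<Sum>f\<in>F. cinner f x *\<^sub>C f)"
  have 1: "cinner p x = (\<Sum>f\<in>F. cnj (cinner f x) * cinner f x)"
    by (simp add: p_def cinner.sum_left cinner_scaleC_left)
  also have "\<dots> = cinner p p" by (simp add: p_def onset_cinner_sum_sum assms)
  finally have px: "cinner p x = cinner p p" .
  then have xp: "cinner x p = cinner p p" by (metis cinner_commute)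
  have "cinner (x - p) (x - p) = cinner x x - cinner p p"
    by (simp add: cinner.diff_left cinner.diff_right px xp)
  then have "(norm (x - p))\<^sup>2 = (norm x)\<^sup>2 - (norm p)\<^sup>2" by (simp add: norm_sq_cinner)
  then show ?thesis by (simp add: p_def onset_norm_sum assms)
qed

lemma onset_bessel:
  assumes "onset F" "finite F"
  shows "(\<Sum>f\<in>F. (cmod (cinner f x))\<^sup>2) \<le> (norm x)\<^sup>2"
  using onset_pythagoras[OF assms, of x] zero_le_power2[of "norm (x - (\<Sum>f\<in>F. cinner f x *\<^sub>C f))"]
  by linarith

lemma onset_bessel_summable:
  assumes "onset E"
  shows "(\<lambda>f. (cmod (cinner f x))\<^sup>2) summable_on E"
  by (rule nonneg_bdd_above_summable_on)
     (auto intro!: bdd_aboveI2[of _ _ "(norm x)\<^sup>2"] onset_bessel onset_subset[OF assms])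

text \<open>By Pythagoras, partial sums over nested finite sets differ in squared norm by the
  difference of the scalar partial sums. The Cauchy criterion for the scalar net thus passes to the
  vectors, whatever the size of \<open>E\<close>.\<close>

lemma onset_summable:
  fixes E :: "'a::chilbert_space set"
  assumes "onset E" "(\<lambda>e. (cmod (c e))\<^sup>2) summable_on E"
  shows "(\<lambda>e. c e *\<^sub>C e) summable_on E"
proof -
  let ?f = "\<lambda>e. c e *\<^sub>C e" and ?g = "\<lambda>e. (cmod (c e))\<^sup>2"
  from assms(2) obtain L where lim: "(sum ?g \<longlongrightarrow> L) (finite_subsets_at_top E)"
    unfolding has_sum_def summable_on_def by blast
  have "\<exists>P. eventually P (finite_subsets_at_top E) \<and>
            (\<forall>F F'. P F \<and> P F' \<longrightarrow> dist (sum ?f F) (sum ?f F') < e)" if "e > 0" for e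
  proof -
    have "\<forall>\<^sub>F F in finite_subsets_at_top E. dist (sum ?g F) L < e\<^sup>2 / 8"
      using \<open>e > 0\<close> by (intro tendstoD[OF lim]) simp
    then obtain F0 where F0: "finite F0" "F0 \<subseteq> E"
      "\<forall>F. finite F \<and> F0 \<subseteq> F \<and> F \<subseteq> E \<longrightarrow> dist (sum ?g F) L < e\<^sup>2 / 8"
      unfolding eventually_finite_subsets_at_top by (elim exE conjE)
    have close: "dist (sum ?f F) (sum ?f F0) < e / 2" if F: "finite F" "F0 \<subseteq> F" "F \<subseteq> E" for F
    proof -
      have "(dist (sum ?f F) (sum ?f F0))\<^sup>2 = (norm (sum ?f (F - F0)))\<^sup>2"
        using F by (simp add: dist_norm sum_diff)
      also have "\<dots> = sum ?g (F - F0)"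
        using F by (intro onset_norm_sum onset_subset[OF assms(1)]) auto
      also have "\<dots> = sum ?g F - sum ?g F0" using F by (simp add: sum_diff)
      also have "\<dots> < e\<^sup>2 / 8 + e\<^sup>2 / 8"
      proof -
        have "\<bar>sum ?g F - L\<bar> < e\<^sup>2 / 8" "\<bar>sum ?g F0 - L\<bar> < e\<^sup>2 / 8"
          using F0 F by (simp_all add: dist_real_def)
        then show ?thesis unfolding abs_less_iff by argo
      qed
      also have "\<dots> = (e / 2)\<^sup>2" by (simp add: power_divide)
      finally show ?thesis by (rule power2_less_imp_less) (use \<open>e > 0\<close> in simp)
    qed
    show ?thesis
    proof (intro exI[of _ "\<lambda>F. finite F \<and> F0 \<subseteq> F \<and> F \<subseteq> E"] conjI allI impI)
      show "\<forall>\<^sub>F F in finite_subsets_at_top E. finite F \<and> F0 \<subseteq> F \<and> F \<subseteq> E"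
        unfolding eventually_finite_subsets_at_top using F0 by blast
      fix F F' assume "(finite F \<and> F0 \<subseteq> F \<and> F \<subseteq> E) \<and> (finite F' \<and> F0 \<subseteq> F' \<and> F' \<subseteq> E)"
      then show "dist (sum ?f F) (sum ?f F') < e"
        using close[of F] close[of F'] dist_triangle2[of "sum ?f F" "sum ?f F'" "sum ?f F0"]
        by linarith
    qed
  qed
  then have "cauchy_filter (filtermap (sum ?f) (finite_subsets_at_top E))"
    by (simp add: cauchy_filter_metric_filtermap)
  moreover have "complete (UNIV::'a set)" by (rule complete_UNIV_cuspace)
  ultimately obtain L' where "(sum ?f \<longlongrightarrow> L') (finite_subsets_at_top E)"
    using complete_uniform[where S=UNIV] by (force simp add: filterlim_def)
  then show ?thesis using summable_on_def has_sum_def by blast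
qed

lemma onset_expand_residual:
  fixes E :: "'a::chilbert_space set"
  assumes "onset E" "e \<in> E"
  shows "cinner e (x - (\<Sum>\<^sub>\<infinity>f\<in>E. cinner f x *\<^sub>C f)) = 0"
proof -
  have s: "(\<lambda>f. cinner f x *\<^sub>C f) summable_on E"
    by (intro onset_summable onset_bessel_summable assms)
  have "cinner e (\<Sum>\<^sub>\<infinity>f\<in>E. cinner f x *\<^sub>C f) = (\<Sum>\<^sub>\<infinity>f\<in>E. cinner e (cinner f x *\<^sub>C f))"
    by (rule infsumI[symmetric, OF has_sum_bounded_linear[OF cinner.bounded_linear_right has_sum_infsum[OF s]]])
  also have "\<dots> = (\<Sum>\<^sub>\<infinity>f\<in>{e}. cinner e (cinner f x *\<^sub>C f))"
    using assms by (intro infsum_cong_neutral) (auto simp: cinner_scaleC_right onset_def)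
  also have "\<dots> = cinner e x"
    using assms by (auto simp: cinner_scaleC_right onset_def)
  finally show ?thesis by (simp add: cinner.diff_right)
qed

text \<open>The residual of the expansion is orthogonal to \<open>B\<close>, hence to the span of
  \<open>B\<close> and to its closure, which contains the residual itself.\<close>

lemma orthonormal_basis_expand:
  fixes B :: "'a::chilbert_space set"
  assumes "orthonormal_basis B"
  shows "((\<lambda>e. cinner e x *\<^sub>C e) has_sum x) B"
proof -
  have on: "onset B" using assms by (simp add: orthonormal_basis_def onset_def)
  define y where "y = x - (\<Sum>\<^sub>\<infinity>f\<in>B. cinner f x *\<^sub>C f)"
  have "complex_vector.span B \<subseteq> {z. cinner y z = 0}"
  proof
    fix z assume "z \<in> complex_vector.span B"
    then show "z \<in> {z. cinner y z = 0}"
    proof (induction rule: complex_vector.span_induct_alt)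
      case base then show ?case by (simp add: cinner.zero_right)
    next
      case (step c u v)
      have "cinner u y = 0" unfolding y_def by (rule onset_expand_residual[OF on step(1)])
      then have "cinner y u = 0" by (metis cinner_commute complex_cnj_zero)
      then show ?case using step by (simp add: cinner_add_right cinner_scaleC_right)
    qed
  qed
  moreover have "closed {z. cinner y z = 0}"
    by (intro closed_Collect_eq continuous_intros linear_continuous_on cinner.bounded_linear_right)
  ultimately have "closure (complex_vector.span B) \<subseteq> {z. cinner y z = 0}"
    by (rule closure_minimal)
  then have "cinner y y = 0" using assms by (auto simp: orthonormal_basis_def)
  then have "x = (\<Sum>\<^sub>\<infinity>f\<in>B. cinner f x *\<^sub>C f)" by (simp add: cinner_self y_def)
  moreover have "(\<lambda>f. cinner f x *\<^sub>C f) summable_on B"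
    by (intro onset_summable onset_bessel_summable on)
  ultimately show ?thesis using has_sum_infsum by fastforce
qed

lemma orthonormal_basis_parseval:
  fixes B :: "'a::chilbert_space set"
  assumes "orthonormal_basis B"
  shows "((\<lambda>e. (cmod (cinner e x))\<^sup>2) has_sum (norm x)\<^sup>2) B"
proof -
  have "((\<lambda>e. cinner x (cinner e x *\<^sub>C e)) has_sum cinner x x) B"
    by (rule has_sum_bounded_linear[OF cinner.bounded_linear_right orthonormal_basis_expand[OF assms]])
  then have "((\<lambda>e. Re (cinner x (cinner e x *\<^sub>C e))) has_sum Re (cinner x x)) B" by (rule has_sum_Re)
  moreover have "Re (cinner x (cinner e x *\<^sub>C e)) = (cmod (cinner e x))\<^sup>2" for e
    by (simp add: cinner_scaleC_right cinner_commute[of x e] flip: complex_norm_square)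
  ultimately show ?thesis by (simp add: norm_sq_cinner)
qed

lemma onset_insert_unit:
  assumes "onset E" "\<And>e. e \<in> E \<Longrightarrow> cinner e y = 0" "y \<noteq> 0"
  shows "onset (insert ((1 / norm y) *\<^sub>R y) E)"
proof -
  let ?u = "(1 / norm y) *\<^sub>R y"
  have "cinner ?u ?u = 1"
    using assms(3) by (simp add: cinner_self)
  moreover have "cinner e ?u = 0" "cinner ?u e = 0" if "e \<in> E" for e
    using assms(2)[OF that] cinner_commute[of y e] by (simp_all add: cinner.scaleR_right cinner.scaleR_left)
  ultimately show ?thesis using assms(1) by (auto simp: onset_def)
qed

text \<open>Zorn's lemma with a parameter: \<open>P\<close> constantly true yields an orthonormal
  basis, \<open>P\<close> saying "eigenvector for a nonzero eigenvalue" yields a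
  diagonalization.\<close>

lemma maximal_onset:
  fixes P :: "'a::complex_inner \<Rightarrow> bool"
  obtains E where "onset E" "\<And>e. e \<in> E \<Longrightarrow> P e"
    "\<And>E'. onset E' \<Longrightarrow> (\<And>e. e \<in> E' \<Longrightarrow> P e) \<Longrightarrow> E \<subseteq> E' \<Longrightarrow> E' = E"
proof -
  let ?A = "{E :: 'a set. onset E \<and> (\<forall>e\<in>E. P e)}"
  have "\<exists>M\<in>?A. \<forall>X\<in>?A. M \<subseteq> X \<longrightarrow> X = M"
  proof (rule subset_Zorn_nonempty)
    show "?A \<noteq> {}" by (auto simp: onset_def intro!: exI[of _ "{}"])
    fix C assume C: "C \<noteq> {}" "subset.chain ?A C"
    have "cinner x y = (if x = y then 1 else 0)" if xy: "x \<in> \<Union>C" "y \<in> \<Union>C" for x y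
    proof -
      obtain X Y where XY: "X \<in> C" "Y \<in> C" "x \<in> X" "y \<in> Y" using xy by blast
      then have "X \<subseteq> Y \<or> Y \<subseteq> X" using C(2) unfolding subset.chain_def by blast
      moreover have "onset X" "onset Y" using XY C(2) unfolding subset.chain_def by blast+
      ultimately show ?thesis using XY unfolding onset_def by blast
    qed
    then have "onset (\<Union>C)" unfolding onset_def by (intro ballI)
    moreover have "C \<subseteq> ?A" using C(2) by (simp add: subset.chain_def)
    then have "\<forall>e\<in>\<Union>C. P e" by blast
    ultimately show "\<Union>C \<in> ?A" by simp
  qed
  then obtain E where "E \<in> ?A" "\<forall>X\<in>?A. E \<subseteq> X \<longrightarrow> X = E" by (elim bexE)
  then show ?thesis by (intro that[of E]) auto
qed

lemma orthonormal_basis_the_basis: "orthonormal_basis (the_basis :: 'a::chilbert_space set)"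
proof -
  obtain B :: "'a set" where B: "onset B" "\<And>E'. onset E' \<Longrightarrow> B \<subseteq> E' \<Longrightarrow> E' = B"
    by (rule maximal_onset[of "\<lambda>_. True"]) auto
  have "x \<in> closure (complex_vector.span B)" for x
  proof -
    define y where "y = x - (\<Sum>\<^sub>\<infinity>f\<in>B. cinner f x *\<^sub>C f)"
    have orth: "cinner e y = 0" if "e \<in> B" for e
      unfolding y_def by (rule onset_expand_residual[OF B(1) that])
    have "y = 0"
    proof (rule ccontr)
      assume y: "y \<noteq> 0"
      have "(1 / norm y) *\<^sub>R y \<in> B" using B(2)[OF onset_insert_unit[OF B(1) orth y]] by auto
      from orth[OF this] y show False by (simp add: cinner.scaleR_left cinner_self)
    qed
    moreover have "((\<lambda>f. cinner f x *\<^sub>C f) has_sum (\<Sum>\<^sub>\<infinity>f\<in>B. cinner f x *\<^sub>C f)) B"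
      by (intro has_sum_infsum onset_summable onset_bessel_summable B)
    ultimately have "(sum (\<lambda>f. cinner f x *\<^sub>C f) \<longlongrightarrow> x) (finite_subsets_at_top B)"
      by (simp add: y_def has_sum_def)
    moreover have "\<forall>\<^sub>F F in finite_subsets_at_top B.
        (\<Sum>f\<in>F. cinner f x *\<^sub>C f) \<in> closure (complex_vector.span B)"
      by (rule eventually_finite_subsets_at_top_weakI)
         (intro subsetD[OF closure_subset] complex_vector.span_sum complex_vector.span_scale
           complex_vector.span_base, auto)
    ultimately show ?thesis
      by (intro Lim_in_closed_set[of "closure (complex_vector.span B)"]) auto
  qed
  then have "orthonormal_basis B" using B(1) by (auto simp: orthonormal_basis_def onset_def)
  then show ?thesis unfolding the_basis_def by (rule someI)
qed

section \<open>Compact self-adjoint operators\<close>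

text \<open>Gaussian elimination: an equation with a nonzero coefficient at \<open>v\<close> is used
  to remove the unknown \<open>v\<close>. The lemma later supplies a nonzero vector in a span of
  eigenvectors that satisfies a smaller number of orthogonality conditions.\<close>

lemma homogeneous_system_nontrivial:
  fixes a :: "'b \<Rightarrow> 'c \<Rightarrow> complex"
  assumes "finite Y" "finite W" "card Y < card W"
  obtains c where "\<exists>w\<in>W. c w \<noteq> 0" "\<forall>y\<in>Y. (\<Sum>w\<in>W. a y w * c w) = 0"
proof -
  have "\<exists>c. (\<exists>w\<in>W. c w \<noteq> 0) \<and> (\<forall>y\<in>Y. (\<Sum>w\<in>W. a y w * c w) = 0)"
    using assms
  proof (induction Y arbitrary: W a rule: finite_induct)
    case empty
    then have "W \<noteq> {}" by auto
    then show ?case by (auto intro!: exI[of _ "\<lambda>_. 1"])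
  next
    case (insert y Y)
    show ?case
    proof (cases "\<forall>w\<in>W. a y w = 0")
      case True
      obtain c where "\<exists>w\<in>W. c w \<noteq> 0" "\<forall>y\<in>Y. (\<Sum>w\<in>W. a y w * c w) = 0"
        using insert.IH[of W a] insert.prems insert.hyps by auto
      then show ?thesis using True by (intro exI[of _ c]) auto
    next
      case False
      then obtain v where v: "v \<in> W" "a y v \<noteq> 0" by blast
      define a' where "a' z w = a z w - a z v * (a y w / a y v)" for z w
      have "card Y < card (W - {v})" using insert.prems insert.hyps v by simp
      then obtain c where c: "\<exists>w\<in>W - {v}. c w \<noteq> 0" "\<forall>z\<in>Y. (\<Sum>w\<in>W - {v}. a' z w * c w) = 0"
        using insert.IH[of "W - {v}" a'] insert.prems by auto
      define S where "S = (\<Sum>w\<in>W - {v}. a y w * c w)"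
      define c' where "c' = c(v := - S / a y v)"
      have split: "(\<Sum>w\<in>W. a z w * c' w) = a z v * (- S / a y v) + (\<Sum>w\<in>W - {v}. a z w * c w)" for z
      proof -
        have "(\<Sum>w\<in>W. a z w * c' w) = a z v * c' v + (\<Sum>w\<in>W - {v}. a z w * c' w)"
          using insert.prems v by (simp add: sum.remove)
        moreover have "(\<Sum>w\<in>W - {v}. a z w * c' w) = (\<Sum>w\<in>W - {v}. a z w * c w)"
          by (intro sum.cong) (auto simp: c'_def)
        ultimately show ?thesis by (simp add: c'_def)
      qed
      have "(\<Sum>w\<in>W. a z w * c' w) = 0" if "z \<in> insert y Y" for z
      proof (cases "z = y")
        case True
        then show ?thesis using v by (simp add: split S_def)
      next
        case False
        then have "(\<Sum>w\<in>W - {v}. a' z w * c w) = 0" using c that by blast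
        moreover have "(\<Sum>w\<in>W - {v}. a' z w * c w) = (\<Sum>w\<in>W - {v}. a z w * c w) - a z v * (S / a y v)"
          unfolding a'_def S_def
          by (simp add: algebra_simps sum_subtractf sum_distrib_left sum_divide_distrib)
        ultimately show ?thesis unfolding split by simp
      qed
      moreover have "\<exists>w\<in>W. c' w \<noteq> 0" using c(1) by (auto simp: c'_def)
      ultimately show ?thesis by blast
    qed
  qed
  then show ?thesis using that by (elim exE conjE)
qed

definition csa :: "('a::complex_inner \<Rightarrow> 'a) \<Rightarrow> bool" where
  "csa S \<longleftrightarrow> compact_op S \<and> self_adjoint S"

lemma csaD:
  assumes "csa S"
  shows "compact_op S" "self_adjoint S" "bounded_clinear S" "cinner (S x) y = cinner x (S y)"
  using assms by (auto simp: csa_def self_adjoint_def)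

lemma compact_op_subsequence:
  assumes "compact_op A" "\<And>n. norm (X n) \<le> 1"
  obtains l r where "strict_mono (r :: nat \<Rightarrow> nat)" "(\<lambda>n. A (X (r n))) \<longlonglongrightarrow> l"
proof -
  have "compact (closure (A ` cball 0 1))" using assms(1) by (simp add: compact_op_def)
  then have "seq_compact (closure (A ` cball 0 1))" by (rule compact_imp_seq_compact)
  moreover have "\<forall>n. A (X n) \<in> closure (A ` cball 0 1)"
    using assms(2) by (auto intro!: subsetD[OF closure_subset])
  ultimately obtain l r where "strict_mono (r :: nat \<Rightarrow> nat)" "((\<lambda>n. A (X n)) \<circ> r) \<longlonglongrightarrow> l"
    by (rule seq_compactE) blast
  then show ?thesis by (intro that) (simp_all add: o_def)
qed

text \<open>A maximizing sequence for \<open>\<parallel>S x\<parallel>\<close> produces an eigenvector \<open>y\<close> of \<open>S\<^sup>2\<close> for \<open>m\<^sup>2\<close>; then one of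
  \<open>y\<close> and \<open>S y + m y\<close> is an eigenvector of \<open>S\<close>.\<close>

lemma csa_eigenvector:
  assumes S: "csa S" and inv: "\<And>x e. e \<in> E \<Longrightarrow> (\<And>e. e \<in> E \<Longrightarrow> cinner e x = 0) \<Longrightarrow> cinner e (S x) = 0"
    and x0: "\<And>e. e \<in> E \<Longrightarrow> cinner e x0 = 0" "S x0 \<noteq> 0"
  obtains e l where "\<forall>f\<in>E. cinner f e = 0" "e \<noteq> 0" "l \<noteq> 0" "S e = l *\<^sub>R e"
proof -
  note lin = csaD(3)[OF S] and sym = csaD(4)[OF S]
  note bl = bounded_clinear_linear[OF lin]
  define F where "F = {x. \<forall>e\<in>E. cinner e x = 0}"
  have SF: "S x \<in> F" if "x \<in> F" for x using that inv by (auto simp: F_def)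
  have scF: "r *\<^sub>R x \<in> F" if "x \<in> F" for r x using that by (auto simp: F_def cinner.scaleR_right)
  have addF: "x + y \<in> F" if "x \<in> F" "y \<in> F" for x y using that by (auto simp: F_def cinner_add_right)
  have closedF: "closed F"
    unfolding F_def Collect_ball_eq
    by (intro closed_INT ballI closed_Collect_eq continuous_intros linear_continuous_on cinner.bounded_linear_right)
  obtain k where k: "k > 0" "\<And>x. norm (S x) \<le> k * norm x" using bounded_clinear_bound[OF lin] by metis
  define N where "N = (\<lambda>x. norm (S x)) ` (F \<inter> cball 0 1)"
  define m where "m = Sup N"
  have bdd: "bdd_above N"
  proof (rule bdd_aboveI)
    fix t assume "t \<in> N"
    then obtain x where "norm x \<le> 1" "t = norm (S x)" by (auto simp: N_def)
    then show "t \<le> k" using k(2)[of x] k(1) mult_left_mono[of "norm x" 1 k] by linarith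
  qed
  have "0 \<in> F \<inter> cball 0 1" by (simp add: F_def cinner.zero_right)
  then have ne: "N \<noteq> {}" unfolding N_def by blast
  have m1: "norm (S x) \<le> m" if "x \<in> F" "norm x \<le> 1" for x
    unfolding m_def using that by (intro cSup_upper bdd) (auto simp: N_def)
  have m: "norm (S x) \<le> m * norm x" if "x \<in> F" for x
  proof (cases "x = 0")
    case False
    then have "norm (S ((1 / norm x) *\<^sub>R x)) \<le> m" using that by (intro m1 scF) auto
    then show ?thesis using False by (simp add: bounded_clinear_scaleR[OF lin] field_simps)
  qed (simp add: bounded_clinear_zero[OF lin])
  have x0F: "x0 \<in> F" using x0 by (auto simp: F_def)
  have m0: "m > 0"
  proof (rule ccontr)
    assume "\<not> m > 0"
    then have "m * norm x0 \<le> 0" by (simp add: mult_nonpos_nonneg)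
    then show False using m[OF x0F] x0(2) by (metis norm_le_zero_iff order_trans)
  qed
  have "\<exists>x. x \<in> F \<and> norm x \<le> 1 \<and> m - 1 / (real n + 1) < norm (S x)" for n
  proof -
    have "m - 1 / (real n + 1) < Sup N" by (simp add: m_def)
    then obtain t where "t \<in> N" "m - 1 / (real n + 1) < t" using less_cSup_iff[OF ne bdd] by auto
    then show ?thesis by (auto simp: N_def)
  qed
  then obtain X where X: "\<And>n. X n \<in> F" "\<And>n. norm (X n) \<le> 1" "\<And>n. m - 1 / (real n + 1) < norm (S (X n))"
    by metis
  have lim1: "(\<lambda>n. norm (S (X n))) \<longlonglongrightarrow> m"
  proof (rule tendsto_sandwich[where f = "\<lambda>n. m - 1 / (real n + 1)" and h = "\<lambda>_. m"])
    show "(\<lambda>n. m - 1 / (real n + 1)) \<longlonglongrightarrow> m"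
      using tendsto_diff[OF tendsto_const[of m] LIMSEQ_inverse_real_of_nat]
      by (simp add: inverse_eq_divide add.commute)
  qed (use X m1 in \<open>auto intro!: always_eventually less_imp_le\<close>)
  \<comment> \<open>Expanding the square and using that the form of \<open>S\<^sup>2\<close> at
    \<open>x\<close> is the squared norm of \<open>S x\<close> shows that \<open>x\<close> is almost
    an eigenvector of the square once the norm of \<open>S x\<close> is close to
    \<open>m\<close>.\<close>
  have key: "(norm (S (S x) - m\<^sup>2 *\<^sub>R x))\<^sup>2 \<le> m\<^sup>2 * (m\<^sup>2 - (norm (S x))\<^sup>2)" if x: "x \<in> F" "norm x \<le> 1" for x
  proof -
    have "cinner (S (S x)) x = cinner (S x) (S x)" by (rule sym)
    then have i: "inner (S (S x)) x = (norm (S x))\<^sup>2" by (simp add: norm_sq_cinner flip: Re_cinner)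
    have sq: "(norm (a - b))\<^sup>2 = (norm a)\<^sup>2 - 2 * inner a b + (norm b)\<^sup>2" for a b :: 'a
      by (simp add: power2_norm_eq_inner inner_diff_left inner_diff_right inner_commute)
    have "(norm (S (S x) - m\<^sup>2 *\<^sub>R x))\<^sup>2
        = (norm (S (S x)))\<^sup>2 - 2 * m\<^sup>2 * inner (S (S x)) x + (m\<^sup>2 * norm x)\<^sup>2"
      by (simp only: sq inner_scaleR_right norm_scaleR) simp
    also have "\<dots> \<le> (m * norm (S x))\<^sup>2 - 2 * m\<^sup>2 * (norm (S x))\<^sup>2 + (m\<^sup>2 * 1)\<^sup>2"
      unfolding i using m[OF SF[OF x(1)]] m0 x(2)
      by (intro add_mono diff_mono power_mono mult_left_mono) auto
    finally show ?thesis by (simp add: power2_eq_square algebra_simps)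
  qed
  obtain y r where r: "strict_mono (r :: nat \<Rightarrow> nat)" and y: "(\<lambda>n. S (X (r n))) \<longlonglongrightarrow> y"
    by (rule compact_op_subsequence[OF csaD(1)[OF S] X(2)])
  have lim2: "(\<lambda>n. norm (S (X (r n)))) \<longlonglongrightarrow> m"
    using LIMSEQ_subseq_LIMSEQ[OF lim1 r] by (simp add: o_def)
  \<comment> \<open>The limit provided by compactness has norm \<open>m > 0\<close>, so
    \<open>y\<close> is nonzero.\<close>
  have ny: "norm y = m" by (rule LIMSEQ_unique[OF tendsto_norm[OF y] lim2])
  have "(\<lambda>n. (norm (S (S (X (r n))) - m\<^sup>2 *\<^sub>R X (r n)))\<^sup>2) \<longlonglongrightarrow> 0"
  proof (rule tendsto_sandwich[where f = "\<lambda>_. 0"])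
    have "(\<lambda>n. m\<^sup>2 * (m\<^sup>2 - (norm (S (X (r n))))\<^sup>2)) \<longlonglongrightarrow> m\<^sup>2 * (m\<^sup>2 - m\<^sup>2)"
      by (intro tendsto_intros lim2)
    then show "(\<lambda>n. m\<^sup>2 * (m\<^sup>2 - (norm (S (X (r n))))\<^sup>2)) \<longlonglongrightarrow> 0" by simp
  qed (use X key in \<open>auto intro!: always_eventually\<close>)
  then have "(\<lambda>n. sqrt ((norm (S (S (X (r n))) - m\<^sup>2 *\<^sub>R X (r n)))\<^sup>2)) \<longlonglongrightarrow> sqrt 0"
    by (rule tendsto_real_sqrt)
  then have "(\<lambda>n. S (S (X (r n))) - m\<^sup>2 *\<^sub>R X (r n)) \<longlonglongrightarrow> 0"
    by (simp add: tendsto_norm_zero_iff)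
  from tendsto_diff[OF bounded_linear.tendsto[OF bl y] this]
  have "(\<lambda>n. m\<^sup>2 *\<^sub>R X (r n)) \<longlonglongrightarrow> S y" by simp
  from bounded_linear.tendsto[OF bl this] have "(\<lambda>n. m\<^sup>2 *\<^sub>R S (X (r n))) \<longlonglongrightarrow> S (S y)"
    by (simp add: bounded_clinear_scaleR[OF lin])
  then have SSy: "S (S y) = m\<^sup>2 *\<^sub>R y"
    by (rule LIMSEQ_unique) (intro tendsto_intros y)
  have yF: "y \<in> F" by (rule closed_sequentially[OF closedF _ y]) (simp add: SF X)
  show ?thesis
  proof (cases "S y + m *\<^sub>R y = 0")
    case True
    then have "S y = (- m) *\<^sub>R y" by (simp add: eq_neg_iff_add_eq_0)
    then show ?thesis using that[of y "- m"] yF ny m0 by (auto simp: F_def)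
  next
    case False
    have "S (S y + m *\<^sub>R y) = m *\<^sub>R (S y + m *\<^sub>R y)"
      by (simp add: bounded_clinear_add[OF lin] bounded_clinear_scaleR[OF lin] SSy power2_eq_square
          scaleR_add_right)
    then show ?thesis using that[OF _ False, of m] addF[OF SF[OF yF] scF[OF yF]] m0 by (auto simp: F_def)
  qed
qed

text \<open>\<open>E\<close> is an orthonormal basis of the closure of the range of \<open>S\<close>; the null space of \<open>S\<close> is left out.\<close>

definition diag :: "('a::complex_inner \<Rightarrow> 'a) \<Rightarrow> 'a set \<Rightarrow> ('a \<Rightarrow> real) \<Rightarrow> bool" where
  "diag S E s \<longleftrightarrow> onset E \<and> (\<forall>e\<in>E. S e = s e *\<^sub>R e \<and> s e \<noteq> 0) \<and>
     (\<forall>r>0. finite {e\<in>E. r \<le> \<bar>s e\<bar>}) \<and> (\<forall>x. (\<forall>e\<in>E. cinner e x = 0) \<longrightarrow> S x = 0)"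

lemma diagD:
  assumes "diag S E s"
  shows "onset E" "e \<in> E \<Longrightarrow> S e = s e *\<^sub>R e" "e \<in> E \<Longrightarrow> s e \<noteq> 0"
    "r > 0 \<Longrightarrow> finite {e\<in>E. r \<le> \<bar>s e\<bar>}" "(\<And>e. e \<in> E \<Longrightarrow> cinner e x = 0) \<Longrightarrow> S x = 0"
  using assms by (auto simp: diag_def)

text \<open>A maximal orthonormal set of eigenvectors for nonzero eigenvalues. Two of its members
  with one eigenvalue of size at least \<open>r\<close> have images at distance at least
  \<open>r\<close>, so compactness leaves finitely many; if \<open>S\<close> were nonzero on the
  complement, \<open>csa_eigenvector\<close> would enlarge the set.\<close>

lemma diag_exists:
  assumes S: "csa S"
  obtains E s where "diag S E s"
proof -
  note lin = csaD(3)[OF S] and sym = csaD(4)[OF S]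
  define P where "P e \<longleftrightarrow> (\<exists>l. l \<noteq> 0 \<and> S e = l *\<^sub>R e)" for e
  obtain E where E: "onset E" "\<And>e. e \<in> E \<Longrightarrow> P e"
    "\<And>E'. onset E' \<Longrightarrow> (\<And>e. e \<in> E' \<Longrightarrow> P e) \<Longrightarrow> E \<subseteq> E' \<Longrightarrow> E' = E"
    by (rule maximal_onset[of P]) (assumption | blast)+
  obtain s where s: "\<And>e. e \<in> E \<Longrightarrow> s e \<noteq> 0 \<and> S e = s e *\<^sub>R e"
    using E(2) unfolding P_def by metis
  have fin: "finite {e\<in>E. r \<le> \<bar>s e\<bar>}" if r: "r > 0" for r
  proof (rule ccontr)
    assume inf: "infinite {e\<in>E. r \<le> \<bar>s e\<bar>}"
    obtain f :: "nat \<Rightarrow> 'a" where f: "inj f" "range f \<subseteq> {e\<in>E. r \<le> \<bar>s e\<bar>}"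
      using infinite_countable_subset[OF inf] by blast
    have fE: "f n \<in> E" "r \<le> \<bar>s (f n)\<bar>" for n using f(2) by auto
    have f1: "norm (f n) \<le> 1" for n using onset_norm[OF E(1) fE(1)] by simp
    obtain l q where q: "strict_mono (q :: nat \<Rightarrow> nat)" "(\<lambda>n. S (f (q n))) \<longlonglongrightarrow> l"
      by (rule compact_op_subsequence[OF csaD(1)[OF S] f1])
    then have "Cauchy (\<lambda>n. S (f (q n)))" using LIMSEQ_imp_Cauchy by blast
    then obtain M where M: "\<forall>i\<ge>M. \<forall>j\<ge>M. dist (S (f (q i))) (S (f (q j))) < r"
      using r unfolding Cauchy_def by blast
    define u v where "u = f (q M)" and "v = f (q (Suc M))"
    have uv: "u \<in> E" "v \<in> E" "u \<noteq> v" "r \<le> \<bar>s u\<bar>"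
      using fE f(1) q(1) by (auto simp: u_def v_def inj_eq strict_mono_eq)
    have "cinner u (S u - S v) = s u"
      using uv E(1) s by (simp add: cinner.diff_right cinner.scaleR_right onset_def scaleR_conv_of_real)
    then have "\<bar>s u\<bar> \<le> norm u * norm (S u - S v)" using cmod_cinner_le[of u "S u - S v"] by simp
    then have "r \<le> norm (S u - S v)" using uv onset_norm[OF E(1) uv(1)] by simp
    moreover have "norm (S u - S v) < r" using M by (simp add: u_def v_def dist_norm)
    ultimately show False by simp
  qed
  have zero: "S x = 0" if x: "\<And>e. e \<in> E \<Longrightarrow> cinner e x = 0" for x
  proof (rule ccontr)
    assume nz: "S x \<noteq> 0"
    have inv: "cinner e (S z) = 0" if "e \<in> E" "\<And>e. e \<in> E \<Longrightarrow> cinner e z = 0" for z e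
      using that s[of e] by (simp add: sym[symmetric] cinner.scaleR_left)
    obtain e l where e: "\<forall>f\<in>E. cinner f e = 0" "e \<noteq> 0" "l \<noteq> 0" "S e = l *\<^sub>R e"
      by (rule csa_eigenvector[OF S inv x nz])
    let ?u = "(1 / norm e) *\<^sub>R e"
    have "S ?u = l *\<^sub>R ?u" by (simp add: bounded_clinear_scaleR[OF lin] e)
    then have "P ?u" unfolding P_def using e(3) by blast
    then have "insert ?u E = E"
      using E(2) by (intro E(3) onset_insert_unit[OF E(1) bspec[OF e(1)] e(2)]) auto
    then have "cinner ?u e = 0" using e(1) by blast
    then show False using e(2) by (simp add: cinner.scaleR_left cinner_self)
  qed
  show ?thesis by (rule that[of E s]) (use E(1) s fin zero in \<open>auto simp: diag_def\<close>)
qed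

lemma diag_bound:
  assumes "csa S" "diag S E s"
  obtains k where "\<And>e. e \<in> E \<Longrightarrow> \<bar>s e\<bar> \<le> k"
proof -
  obtain k where k: "k > 0" "\<And>x. norm (S x) \<le> k * norm x"
    using bounded_clinear_bound[OF csaD(3)[OF assms(1)]] by metis
  have "\<bar>s e\<bar> \<le> k" if "e \<in> E" for e
    using k(2)[of e] diagD(2)[OF assms(2) that] onset_norm[OF diagD(1)[OF assms(2)] that] by simp
  then show ?thesis by (rule that)
qed

lemma diag_has_sum:
  fixes S :: "'a::chilbert_space \<Rightarrow> 'a"
  assumes S: "csa S" and D: "diag S E s"
  shows "((\<lambda>e. s e *\<^sub>R cinner e x *\<^sub>C e) has_sum S x) E"
proof -
  note lin = csaD(3)[OF S]
  define p where "p = (\<Sum>\<^sub>\<infinity>e\<in>E. cinner e x *\<^sub>C e)"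
  have "((\<lambda>e. cinner e x *\<^sub>C e) has_sum p) E"
    unfolding p_def by (intro has_sum_infsum onset_summable onset_bessel_summable diagD(1)[OF D])
  from has_sum_bounded_linear[OF bounded_clinear_linear[OF lin] this]
  have "((\<lambda>e. S (cinner e x *\<^sub>C e)) has_sum S p) E" .
  moreover have "S (x - p) = 0"
    by (rule diagD(5)[OF D]) (simp add: p_def onset_expand_residual diagD(1)[OF D])
  then have "S p = S x" by (simp add: bounded_clinear_diff[OF lin])
  moreover have "S (cinner e x *\<^sub>C e) = s e *\<^sub>R cinner e x *\<^sub>C e" if "e \<in> E" for e
    using diagD(2)[OF D that] by (simp add: bounded_clinear_scaleC[OF lin] scaleC.scaleR_right)
  ultimately show ?thesis using has_sum_cong by force
qed

lemma cinner_rank_one: "cinner x (r *\<^sub>R cinner e x *\<^sub>C e) = of_real (r * (cmod (cinner e x))\<^sup>2)"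
proof -
  have "cinner x (r *\<^sub>R cinner e x *\<^sub>C e) = of_real r * (cinner e x * cnj (cinner e x))"
    by (simp add: cinner.scaleR_right cinner_scaleC_right scaleR_conv_of_real cinner_commute[of x e])
  then show ?thesis by (simp flip: complex_norm_square)
qed

lemma diag_form_has_sum:
  fixes S :: "'a::chilbert_space \<Rightarrow> 'a"
  assumes S: "csa S" and D: "diag S E s"
  shows "((\<lambda>e. s e * (cmod (cinner e x))\<^sup>2) has_sum inner x (S x)) E"
proof -
  have "((\<lambda>e. inner x (s e *\<^sub>R cinner e x *\<^sub>C e)) has_sum inner x (S x)) E"
    by (rule has_sum_bounded_linear[OF bounded_linear_inner_right diag_has_sum[OF assms]])
  moreover have "inner x (s e *\<^sub>R cinner e x *\<^sub>C e) = s e * (cmod (cinner e x))\<^sup>2" for e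
    by (simp only: Re_cinner[symmetric] cinner_rank_one Re_complex_of_real)
  ultimately show ?thesis by (simp only:)
qed

text \<open>An eigenvector for \<open>l \<noteq> 0\<close> has no component along members of
  \<open>E\<close> with another eigenvalue. What is left after removing its components is
  annihilated by \<open>S\<close> and scaled by \<open>l\<close>, hence zero.\<close>

lemma diag_orth_proj:
  assumes S: "csa S" and D: "diag S E s" and l: "l \<noteq> 0"
  shows "orth_proj (eigenspace S l) x = (\<Sum>e | e \<in> E \<and> s e = l. cinner e x *\<^sub>C e)"
    and "finite {e \<in> E. s e = l}"
proof -
  note lin = csaD(3)[OF S] and sym = csaD(4)[OF S]
  let ?L = "{e \<in> E. s e = l}"
  show fin: "finite ?L" by (rule finite_subset[OF _ diagD(4)[OF D, of "\<bar>l\<bar>"]]) (use l in auto)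
  have on: "onset ?L" by (rule onset_subset[OF diagD(1)[OF D]]) auto
  define p where "p = (\<Sum>e\<in>?L. cinner e x *\<^sub>C e)"
  have sub: "(\<Sum>e\<in>?L. c e *\<^sub>C e) \<in> eigenspace S l" for c
    using diagD(2)[OF D]
    by (auto simp: eigenspace_def bounded_clinear_sum[OF lin] bounded_clinear_scaleC[OF lin]
        scaleR_sum_right scaleC.scaleR_right intro!: sum.cong)
  have rep: "y = (\<Sum>e\<in>?L. cinner e y *\<^sub>C e)" if y: "y \<in> eigenspace S l" for y
  proof -
    define z where "z = y - (\<Sum>e\<in>?L. cinner e y *\<^sub>C e)"
    have z: "S z = l *\<^sub>R z"
      using y sub[of "\<lambda>e. cinner e y"]
      by (simp add: z_def bounded_clinear_diff[OF lin] eigenspace_def scaleR_diff_right)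
    have "cinner e z = 0" if "e \<in> E" for e
    proof (cases "s e = l")
      case True
      then show ?thesis using that by (simp add: z_def cinner.diff_right onset_cinner_sum[OF on fin])
    next
      case False
      have "cinner (S e) z = cinner e (S z)" by (rule sym)
      then have "of_real (s e) * cinner e z = of_real l * cinner e z"
        using diagD(2)[OF D that] by (simp add: z cinner.scaleR_left cinner.scaleR_right scaleR_conv_of_real)
      then show ?thesis using False by simp
    qed
    then have "S z = 0" by (rule diagD(5)[OF D])
    then show ?thesis using z l by (simp add: z_def)
  qed
  show "orth_proj (eigenspace S l) x = p"
    unfolding orth_proj_def
  proof (rule the_equality)
    have "cinner y (x - p) = 0" if "y \<in> eigenspace S l" for y
      by (subst rep[OF that])
         (simp add: cinner.sum_left cinner_scaleC_left cinner.diff_right p_def onset_cinner_sum[OF on fin])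
    then show "p \<in> eigenspace S l \<and> (\<forall>y\<in>eigenspace S l. cinner y (x - p) = 0)"
      using sub by (simp add: p_def)
  next
    fix q assume q: "q \<in> eigenspace S l \<and> (\<forall>y\<in>eigenspace S l. cinner y (x - q) = 0)"
    have "q = (\<Sum>e\<in>?L. cinner e q *\<^sub>C e)" using q rep by blast
    also have "\<dots> = p" unfolding p_def
    proof (intro sum.cong refl)
      fix e assume "e \<in> ?L"
      then have "e \<in> eigenspace S l" using diagD(2)[OF D] by (auto simp: eigenspace_def)
      then have "cinner e (x - q) = 0" using q by blast
      then show "cinner e q *\<^sub>C e = cinner e x *\<^sub>C e" by (simp add: cinner.diff_right)
    qed
    finally show "q = p" .
  qed
qed

text \<open>Grouping \<open>E\<close> by eigenvalues turns the sum over eigenvectors into the sum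
  over all reals of \<open>fun_calc\<close>. The condition \<open>f 0 = 0\<close> silences the term
  of the null space, which \<open>E\<close> does not see.\<close>

lemma fun_calc_has_sum:
  fixes S :: "'a::chilbert_space \<Rightarrow> 'a"
  assumes S: "csa S" and D: "diag S E s" and f: "f 0 = 0" "\<And>e. e \<in> E \<Longrightarrow> \<bar>f (s e)\<bar> \<le> k"
  shows "((\<lambda>e. f (s e) *\<^sub>R cinner e x *\<^sub>C e) has_sum fun_calc f S x) E"
proof -
  let ?g = "\<lambda>e. f (s e) *\<^sub>R cinner e x *\<^sub>C e"
  have "(\<lambda>e. (cmod (of_real (f (s e)) * cinner e x))\<^sup>2) summable_on E"
  proof (rule summable_on_comparison_test)
    show "(\<lambda>e. k\<^sup>2 * (cmod (cinner e x))\<^sup>2) summable_on E"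
      by (intro summable_on_cmult_right onset_bessel_summable diagD(1)[OF D])
    fix e assume "e \<in> E"
    then have "\<bar>f (s e)\<bar>\<^sup>2 \<le> k\<^sup>2" by (intro power_mono f) auto
    then show "(cmod (of_real (f (s e)) * cinner e x))\<^sup>2 \<le> k\<^sup>2 * (cmod (cinner e x))\<^sup>2"
      by (simp add: norm_mult power_mult_distrib mult_right_mono)
  qed auto
  then have "(\<lambda>e. (of_real (f (s e)) * cinner e x) *\<^sub>C e) summable_on E"
    by (rule onset_summable[OF diagD(1)[OF D]])
  then have sum: "?g summable_on E" by (simp only: scaleC_scaleC[symmetric] scaleC_of_real)
  define B where "B = (\<lambda>l. {e \<in> E. s e = l})"
  define a where "a = infsum ?g E"
  have "(?g has_sum a) E" using sum by (simp add: a_def)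
  moreover have "E = snd ` Sigma UNIV B" by (force simp: B_def)
  moreover have inj: "inj_on snd (Sigma UNIV B)" by (auto simp: inj_on_def B_def)
  ultimately have "((?g \<circ> snd) has_sum a) (Sigma UNIV B)"
    by (simp add: has_sum_reindex)
  moreover have "((\<lambda>e. (?g \<circ> snd) (l, e)) has_sum (f l *\<^sub>R orth_proj (eigenspace S l) x)) (B l)" for l
  proof (cases "l = 0")
    case True
    then have "B l = {}" using diagD(3)[OF D] by (auto simp: B_def)
    then show ?thesis using True f(1) by simp
  next
    case False
    then show ?thesis
      using diag_orth_proj[OF S D False]
      by (intro has_sum_finiteI) (auto simp: B_def scaleR_sum_right intro!: sum.cong)
  qed
  ultimately have "((\<lambda>l. f l *\<^sub>R orth_proj (eigenspace S l) x) has_sum a) UNIV"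
    by (rule has_sum_SigmaD)
  then have "fun_calc f S x = a" unfolding fun_calc_def by (rule infsumI)
  then show ?thesis using sum by (simp add: a_def)
qed

section \<open>The counting function\<close>

text \<open>The finite set \<open>Y\<close> stands for the subspace orthogonal to it. Counting
  elements of \<open>Y\<close> instead of dimensions makes codimensions subadditive under unions and
  nonincreasing under images.\<close>

definition le_off :: "('a::complex_inner \<Rightarrow> 'a) \<Rightarrow> real \<Rightarrow> 'a set \<Rightarrow> bool" where
  "le_off S r Y \<longleftrightarrow> finite Y \<and> (\<forall>x. (\<forall>y\<in>Y. cinner y x = 0) \<longrightarrow> inner x (S x) \<le> r * (norm x)\<^sup>2)"

lemma onset_independent:
  assumes "onset F" "finite F"
  shows "complex_vector.independent F"
proof
  assume "complex_vector.dependent F"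
  then obtain u where u: "\<exists>v\<in>F. u v \<noteq> 0" "(\<Sum>v\<in>F. u v *\<^sub>C v) = 0"
    using complex_vector.dependent_finite[OF assms(2)] by auto
  then show False using onset_cinner_sum[OF assms, of _ u] by (auto simp: cinner.zero_right)
qed

lemma diag_finite_above: "diag S E s \<Longrightarrow> r > 0 \<Longrightarrow> finite {e \<in> E. s e > r}"
  by (rule finite_subset[OF _ diagD(4)[of S E s r]]) auto

lemma counting_diag:
  fixes S :: "'a::chilbert_space \<Rightarrow> 'a"
  assumes S: "csa S" and D: "diag S E s" and r: "r > 0"
  shows "counting 1 r S = card {e \<in> E. s e > r}"
proof -
  let ?L = "{e \<in> E. s e > r}" and ?f = "indicator {r<..} :: real \<Rightarrow> real"
  note fin = diag_finite_above[OF D r]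
  have on: "onset ?L" by (rule onset_subset[OF diagD(1)[OF D]]) auto
  have fc: "fun_calc ?f S x = (\<Sum>e\<in>?L. cinner e x *\<^sub>C e)" for x
  proof -
    have "((\<lambda>e. ?f (s e) *\<^sub>R cinner e x *\<^sub>C e) has_sum fun_calc ?f S x) E"
      by (rule fun_calc_has_sum[OF S D, of _ 1]) (use r in \<open>auto simp: indicator_def\<close>)
    then have "((\<lambda>e. cinner e x *\<^sub>C e) has_sum fun_calc ?f S x) ?L"
      by (rule has_sum_cong_neutral[THEN iffD1, rotated -1]) (auto simp: indicator_def)
    then show ?thesis using has_sum_unique has_sum_finite[OF fin] by blast
  qed
  have "range (fun_calc ?f S) = complex_vector.span ?L"
  proof
    show "range (fun_calc ?f S) \<subseteq> complex_vector.span ?L"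
      unfolding fc by (intro image_subsetI complex_vector.span_sum complex_vector.span_scale) (rule complex_vector.span_base)
    show "complex_vector.span ?L \<subseteq> range (fun_calc ?f S)"
    proof
      fix x assume "x \<in> complex_vector.span ?L"
      then obtain u where u: "x = (\<Sum>v\<in>?L. u v *\<^sub>C v)"
        using complex_vector.span_finite[OF fin] by auto
      have "fun_calc ?f S x = x"
        unfolding fc by (subst (2) u, intro sum.cong refl) (simp add: u onset_cinner_sum[OF on fin])
      then show "x \<in> range (fun_calc ?f S)" by (metis rangeI)
    qed
  qed
  then have "op_rank (fun_calc ?f S) = card ?L"
    unfolding op_rank_def using onset_independent[OF on fin] by (simp add: complex_vector.dim_eq_card_independent)
  then show ?thesis by (simp add: counting_def)
qed

lemma counting_scaleR: "counting \<sigma> r S = counting 1 r (\<lambda>x. \<sigma> *\<^sub>R S x)"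
  by (simp add: counting_def)

text \<open>The eigenvectors with eigenvalue above \<open>r\<close> serve as \<open>Y\<close>: off
  them the expansion of the form is at most \<open>r\<close> times a Bessel sum.\<close>

lemma counting_witness:
  fixes S :: "'a::chilbert_space \<Rightarrow> 'a"
  assumes S: "csa S" and r: "r > 0"
  obtains Y where "card Y = counting 1 r S" "le_off S r Y"
proof -
  obtain E s where D: "diag S E s" using diag_exists[OF S] by blast
  let ?L = "{e \<in> E. s e > r}"
  have "inner x (S x) \<le> r * (norm x)\<^sup>2" if x: "\<forall>e\<in>?L. cinner e x = 0" for x
  proof -
    have "inner x (S x) \<le> (\<Sum>\<^sub>\<infinity>e\<in>E. r * (cmod (cinner e x))\<^sup>2)"
    proof (rule has_sum_mono[OF diag_form_has_sum[OF S D]])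
      show "((\<lambda>e. r * (cmod (cinner e x))\<^sup>2) has_sum (\<Sum>\<^sub>\<infinity>e\<in>E. r * (cmod (cinner e x))\<^sup>2)) E"
        by (intro has_sum_infsum summable_on_cmult_right onset_bessel_summable diagD(1)[OF D])
      fix e assume "e \<in> E"
      then show "s e * (cmod (cinner e x))\<^sup>2 \<le> r * (cmod (cinner e x))\<^sup>2"
        using x by (cases "s e > r") (auto intro!: mult_right_mono)
    qed
    also have "\<dots> = r * (\<Sum>\<^sub>\<infinity>e\<in>E. (cmod (cinner e x))\<^sup>2)" by (rule infsum_cmult_right')
    also have "\<dots> \<le> r * (norm x)\<^sup>2"
      using r by (intro mult_left_mono infsum_le_finite_sums onset_bessel_summable onset_bessel
          diagD(1)[OF D] onset_subset[OF diagD(1)[OF D]]) auto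
    finally show ?thesis .
  qed
  then show ?thesis
    using counting_diag[OF S D r] diag_finite_above[OF D r] by (intro that[of ?L]) (auto simp: le_off_def)
qed

lemma diag_form_finite:
  assumes "csa S" "diag S E s" "finite F" "F \<subseteq> E"
  shows "inner (\<Sum>e\<in>F. c e *\<^sub>C e) (S (\<Sum>e\<in>F. c e *\<^sub>C e)) = (\<Sum>e\<in>F. s e * (cmod (c e))\<^sup>2)"
proof -
  note lin = csaD(3)[OF assms(1)]
  have on: "onset F" by (rule onset_subset[OF diagD(1)[OF assms(2)] assms(4)])
  have "S (\<Sum>e\<in>F. c e *\<^sub>C e) = (\<Sum>e\<in>F. (of_real (s e) * c e) *\<^sub>C e)"
    unfolding bounded_clinear_sum[OF lin] bounded_clinear_scaleC[OF lin]
    using diagD(2)[OF assms(2)] assms(4)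
    by (intro sum.cong refl) (auto simp: scaleC_scaleC mult.commute simp flip: scaleC_of_real)
  then show ?thesis
    unfolding Re_cinner[symmetric]
    by (simp only: onset_cinner_sum_sum[OF on assms(3)] Re_sum)
       (intro sum.cong refl, simp only: cmod_power2, simp add: power2_eq_square algebra_simps)
qed

text \<open>If \<open>Y\<close> had fewer elements than there are eigenvalues above
  \<open>r\<close>, a nonzero combination of those eigenvectors would be orthogonal to
  \<open>Y\<close>, and its form strictly exceeds \<open>r\<close> times its squared norm.\<close>

lemma counting_le:
  fixes S :: "'a::chilbert_space \<Rightarrow> 'a"
  assumes S: "csa S" and r: "r > 0" and Y: "le_off S r Y"
  shows "counting 1 r S \<le> card Y"
proof (rule ccontr)
  obtain E s where D: "diag S E s" using diag_exists[OF S] by blast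
  let ?L = "{e \<in> E. s e > r}"
  note fin = diag_finite_above[OF D r]
  have on: "onset ?L" by (rule onset_subset[OF diagD(1)[OF D]]) auto
  assume "\<not> counting 1 r S \<le> card Y"
  then have less: "card Y < card ?L" by (simp add: counting_diag[OF S D r])
  have "finite Y" using Y by (simp add: le_off_def)
  then obtain c where c: "\<exists>w\<in>?L. c w \<noteq> 0" "\<forall>y\<in>Y. (\<Sum>w\<in>?L. cinner y w * c w) = 0"
    by (rule homogeneous_system_nontrivial[OF _ fin less])
  define x where "x = (\<Sum>w\<in>?L. c w *\<^sub>C w)"
  have "cinner y x = 0" if "y \<in> Y" for y
    using bspec[OF c(2) that] by (simp add: x_def cinner.sum_right cinner_scaleC_right mult.commute)
  then have "inner x (S x) \<le> r * (norm x)\<^sup>2" using Y by (simp add: le_off_def)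
  then have "(\<Sum>e\<in>?L. s e * (cmod (c e))\<^sup>2) \<le> r * (\<Sum>e\<in>?L. (cmod (c e))\<^sup>2)"
    unfolding x_def using diag_form_finite[OF S D fin, of c] onset_norm_sum[OF on fin, of c] by simp
  moreover have "r * (\<Sum>e\<in>?L. (cmod (c e))\<^sup>2) < (\<Sum>e\<in>?L. s e * (cmod (c e))\<^sup>2)"
  proof -
    obtain w where "w \<in> ?L" "c w \<noteq> 0" using c(1) by blast
    then show ?thesis
      unfolding sum_distrib_left
      by (intro sum_strict_mono_ex1[OF fin]) (auto intro!: mult_right_mono bexI[of _ w])
  qed
  ultimately show False by simp
qed

text \<open>The sum over \<open>E\<close> and the fixed basis of the nonnegative terms
  \<open>f (s e)\<close> times a squared coefficient is evaluated in both orders: Parseval in the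
  basis gives the eigenvalue sum, the expansion over \<open>E\<close> gives the diagonal of the
  operator.\<close>

lemma op_trace_fun_calc:
  fixes S :: "'a::chilbert_space \<Rightarrow> 'a"
  assumes S: "csa S" and D: "diag S E s" and f: "f 0 = 0" "\<And>e. e \<in> E \<Longrightarrow> 0 \<le> f (s e)"
    and sm: "(\<lambda>e. f (s e)) summable_on E"
  shows "op_trace (fun_calc f S) = of_real (\<Sum>\<^sub>\<infinity>e\<in>E. f (s e))"
proof -
  let ?B = "the_basis :: 'a set"
  note B = orthonormal_basis_the_basis[where 'a = 'a]
  define T where "T = (\<Sum>\<^sub>\<infinity>e\<in>E. f (s e))"
  have T: "((\<lambda>e. f (s e)) has_sum T) E" using sm by (simp add: T_def)
  have k: "\<bar>f (s e)\<bar> \<le> T" if "e \<in> E" for e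
    using finite_sum_le_has_sum[OF T, of "{e}"] f(2) that by auto
  define G where "G = (\<lambda>(e, b). f (s e) * (cmod (cinner e b))\<^sup>2)"
  have inner_sum: "((\<lambda>b. G (e, b)) has_sum f (s e)) ?B" if "e \<in> E" for e
  proof -
    have "((\<lambda>b. f (s e) * (cmod (cinner b e))\<^sup>2) has_sum f (s e) * (norm e)\<^sup>2) ?B"
      by (intro has_sum_cmult_right orthonormal_basis_parseval B)
    moreover have "cmod (cinner b e) = cmod (cinner e b)" for b
      by (metis cinner_commute complex_mod_cnj)
    ultimately show ?thesis using onset_norm[OF diagD(1)[OF D] that] by (simp add: G_def)
  qed
  have "G summable_on (E \<times> ?B)"
    by (rule summable_on_SigmaI[OF inner_sum]) (use sm f in \<open>auto simp: G_def\<close>)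
  with inner_sum T have "(G has_sum T) (E \<times> ?B)" by (intro has_sum_SigmaI) auto
  then have sw: "((\<lambda>(b, e). G (e, b)) has_sum T) (?B \<times> E)" by (rule iffD1[OF has_sum_swap])
  have row: "((\<lambda>e. G (e, b)) has_sum Re (cinner b (fun_calc f S b))) E"
    and real: "Im (cinner b (fun_calc f S b)) = 0" for b
  proof -
    have "((\<lambda>e. cinner b (f (s e) *\<^sub>R cinner e b *\<^sub>C e)) has_sum cinner b (fun_calc f S b)) E"
      by (rule has_sum_bounded_linear[OF cinner.bounded_linear_right
            fun_calc_has_sum[OF S D f(1) k]])
    moreover have "cinner b (f (s e) *\<^sub>R cinner e b *\<^sub>C e) = of_real (G (e, b))" for e
      by (simp only: cinner_rank_one G_def prod.case)
    ultimately have *: "((\<lambda>e. of_real (G (e, b))) has_sum cinner b (fun_calc f S b)) E" by simp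
    show "((\<lambda>e. G (e, b)) has_sum Re (cinner b (fun_calc f S b))) E"
      using has_sum_Re[OF *] by simp
    show "Im (cinner b (fun_calc f S b)) = 0"
      using has_sum_Im[OF *] has_sum_unique[OF has_sum_0_simp] by fastforce
  qed
  have "((\<lambda>b. Re (cinner b (fun_calc f S b))) has_sum T) ?B"
    by (rule has_sum_SigmaD[OF sw]) (simp add: row)
  then have "((\<lambda>b. complex_of_real (Re (cinner b (fun_calc f S b)))) has_sum of_real T) ?B"
    by (rule has_sum_of_real)
  moreover have "complex_of_real (Re (cinner b (fun_calc f S b))) = cinner b (fun_calc f S b)" for b
    by (simp add: complex_eq_iff real)
  ultimately show ?thesis unfolding op_trace_def T_def[symmetric] by (intro infsumI) simp
qed

section \<open>Hilbert-Schmidt operators\<close>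

text \<open>A bound on the squared Hilbert-Schmidt norm, quantified over all finite orthonormal
  sets: independent of a basis, and made of finite sums only.\<close>

definition hs_bound :: "('a::complex_inner \<Rightarrow> 'b::complex_inner) \<Rightarrow> real \<Rightarrow> bool" where
  "hs_bound A c \<longleftrightarrow> bounded_clinear A \<and> (\<forall>F. finite F \<longrightarrow> onset F \<longrightarrow> (\<Sum>e\<in>F. (norm (A e))\<^sup>2) \<le> c)"

lemma hs_boundD:
  assumes "hs_bound A c"
  shows "bounded_clinear A" "finite F \<Longrightarrow> onset F \<Longrightarrow> (\<Sum>e\<in>F. (norm (A e))\<^sup>2) \<le> c" "0 \<le> c"
proof -
  show "bounded_clinear A" "finite F \<Longrightarrow> onset F \<Longrightarrow> (\<Sum>e\<in>F. (norm (A e))\<^sup>2) \<le> c"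
    using assms by (auto simp: hs_bound_def)
  have "(\<Sum>e\<in>{}. (norm (A e))\<^sup>2) \<le> c"
    using assms by (simp only: hs_bound_def) (metis finite.emptyI onset_def empty_iff)
  then show "0 \<le> c" by simp
qed

lemma hs_bound_0: "hs_bound (\<lambda>x. 0) 0"
  by (simp add: hs_bound_def bounded_clinear_0)

lemma hs_bound_left:
  assumes A: "hs_bound A c" and B: "bounded_clinear B" "\<And>x. norm (B x) \<le> k * norm x"
  shows "hs_bound (\<lambda>x. B (A x)) (k\<^sup>2 * c)"
  unfolding hs_bound_def
proof (intro conjI allI impI)
  show "bounded_clinear (\<lambda>x. B (A x))" by (rule bounded_clinear_compose[OF B(1) hs_boundD(1)[OF A]])
  fix F :: "'a set" assume F: "finite F" "onset F"
  have "(\<Sum>e\<in>F. (norm (B (A e)))\<^sup>2) \<le> (\<Sum>e\<in>F. (k * norm (A e))\<^sup>2)"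
    by (intro sum_mono power_mono B) simp
  also have "\<dots> = k\<^sup>2 * (\<Sum>e\<in>F. (norm (A e))\<^sup>2)" by (simp add: power_mult_distrib sum_distrib_left)
  also have "\<dots> \<le> k\<^sup>2 * c" by (intro mult_left_mono hs_boundD(2)[OF A F]) simp
  finally show "(\<Sum>e\<in>F. (norm (B (A e)))\<^sup>2) \<le> k\<^sup>2 * c" .
qed

lemma hs_bound_scaleR:
  assumes "hs_bound A c"
  shows "hs_bound (\<lambda>x. r *\<^sub>R A x) (r\<^sup>2 * c)"
  using hs_bound_left[OF assms bounded_clinear_scaleR_left[OF bounded_clinear_id], of r "\<bar>r\<bar>"] by simp

lemma hs_bound_sum:
  fixes A :: "'i \<Rightarrow> 'a::complex_inner \<Rightarrow> 'b::complex_inner"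
  assumes "finite I" "\<And>i. i \<in> I \<Longrightarrow> hs_bound (A i) (c i)"
  shows "hs_bound (\<lambda>x. \<Sum>i\<in>I. A i x) (real (card I) * (\<Sum>i\<in>I. c i))"
  unfolding hs_bound_def
proof (intro conjI allI impI)
  show "bounded_clinear (\<lambda>x. \<Sum>i\<in>I. A i x)"
    by (rule bounded_clinear_sums, rule hs_boundD(1), rule assms(2))
  fix F :: "'a set" assume F: "finite F" "onset F"
  have "(norm (\<Sum>i\<in>I. A i e))\<^sup>2 \<le> real (card I) * (\<Sum>i\<in>I. (norm (A i e))\<^sup>2)" for e
  proof -
    have "(norm (\<Sum>i\<in>I. A i e))\<^sup>2 \<le> (\<Sum>i\<in>I. norm (A i e))\<^sup>2"
      by (intro power_mono norm_sum) simp
    also have "\<dots> \<le> (\<Sum>i\<in>I. (norm (A i e))\<^sup>2) * real (card I)" by (rule sum_squared_le_sum_of_squares)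
    finally show ?thesis by (simp add: mult.commute)
  qed
  then have "(\<Sum>e\<in>F. (norm (\<Sum>i\<in>I. A i e))\<^sup>2) \<le> (\<Sum>e\<in>F. real (card I) * (\<Sum>i\<in>I. (norm (A i e))\<^sup>2))"
    by (rule sum_mono)
  also have "\<dots> = real (card I) * (\<Sum>i\<in>I. \<Sum>e\<in>F. (norm (A i e))\<^sup>2)"
    unfolding sum_distrib_left[symmetric] by (subst sum.swap) (rule refl)
  also have "\<dots> \<le> real (card I) * (\<Sum>i\<in>I. c i)"
    by (intro mult_left_mono sum_mono hs_boundD(2) assms F) auto
  finally show "(\<Sum>e\<in>F. (norm (\<Sum>i\<in>I. A i e))\<^sup>2) \<le> real (card I) * (\<Sum>i\<in>I. c i)" .
qed

lemma hs_bound_diff: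
  assumes "hs_bound A c" "hs_bound B d"
  shows "hs_bound (\<lambda>x. A x - B x) (2 * (c + d))"
proof -
  have "hs_bound (\<lambda>x. \<Sum>i\<in>{True, False}. if i then A x else (-1) *\<^sub>R B x)
      (real (card {True, False}) * (\<Sum>i\<in>{True, False}. if i then c else (-1)\<^sup>2 * d))"
  proof (rule hs_bound_sum)
    fix i :: bool
    show "hs_bound (\<lambda>x. if i then A x else (-1) *\<^sub>R B x) (if i then c else (-1)\<^sup>2 * d)"
      using assms(1) hs_bound_scaleR[OF assms(2), of "-1"] by (cases i) simp_all
  qed simp
  then show ?thesis by simp
qed

lemma hs_bound_norm:
  assumes "hs_bound A c"
  shows "norm (A x) \<le> sqrt c * norm x"
proof (cases "x = 0")
  case True
  then show ?thesis by (simp add: bounded_clinear_zero[OF hs_boundD(1)[OF assms]])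
next
  case False
  let ?u = "(1 / norm x) *\<^sub>R x"
  have "onset {?u}" using onset_insert_unit[of "{}" x] False by (simp add: onset_def)
  from hs_boundD(2)[OF assms _ this] have "(norm (A ?u))\<^sup>2 \<le> c" by simp
  then have "norm (A ?u) \<le> sqrt c" by (rule real_le_rsqrt)
  then show ?thesis
    using False by (simp add: bounded_clinear_scaleR[OF hs_boundD(1)[OF assms]] field_simps)
qed

lemma has_sum_finite_sum:
  fixes g :: "'i \<Rightarrow> 'j \<Rightarrow> 'a::topological_comm_monoid_add"
  assumes "finite F" "\<And>f. f \<in> F \<Longrightarrow> (g f has_sum s f) A"
  shows "((\<lambda>e. \<Sum>f\<in>F. g f e) has_sum (\<Sum>f\<in>F. s f)) A"
  using assms by (induction F rule: finite_induct) (simp_all add: has_sum_add)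

text \<open>The squared matrix entries are summed by Parseval in the basis on one side and by Bessel
  on the other. Thus control on one basis for \<open>A\<close> becomes control on all orthonormal
  sets for \<open>A'\<close>; a second passage to the adjoint returns it to
  \<open>A\<close>.\<close>

lemma hs_bound_adj_of_basis:
  fixes A :: "'a::chilbert_space \<Rightarrow> 'b::complex_inner"
  assumes A: "bounded_clinear A" "adj A A'"
    and c: "\<And>G. finite G \<Longrightarrow> G \<subseteq> the_basis \<Longrightarrow> (\<Sum>e\<in>G. (norm (A e))\<^sup>2) \<le> c"
  shows "hs_bound A' c"
  unfolding hs_bound_def
proof (intro conjI allI impI)
  show "bounded_clinear A'" by (rule adj_bounded[OF A])
  fix F :: "'b set" assume F: "finite F" "onset F"
  have "((\<lambda>e. \<Sum>f\<in>F. (cmod (cinner e (A' f)))\<^sup>2) has_sum (\<Sum>f\<in>F. (norm (A' f))\<^sup>2)) the_basis"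
    by (intro has_sum_finite_sum F(1) orthonormal_basis_parseval orthonormal_basis_the_basis)
  then show "(\<Sum>f\<in>F. (norm (A' f))\<^sup>2) \<le> c"
  proof (rule has_sum_le_finite_sums)
    fix G :: "'a set" assume G: "finite G" "G \<subseteq> the_basis"
    have "(\<Sum>f\<in>F. (cmod (cinner e (A' f)))\<^sup>2) \<le> (norm (A e))\<^sup>2" for e
    proof -
      have "cmod (cinner e (A' f)) = cmod (cinner f (A e))" for f
        by (metis adjD[OF A(2)] cinner_commute complex_mod_cnj)
      then show ?thesis using onset_bessel[OF F(2,1), of "A e"] by simp
    qed
    then have "(\<Sum>e\<in>G. \<Sum>f\<in>F. (cmod (cinner e (A' f)))\<^sup>2) \<le> (\<Sum>e\<in>G. (norm (A e))\<^sup>2)" by (rule sum_mono)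
    also have "\<dots> \<le> c" by (rule c[OF G])
    finally show "(\<Sum>e\<in>G. \<Sum>f\<in>F. (cmod (cinner e (A' f)))\<^sup>2) \<le> c" .
  qed
qed

lemma onset_the_basis: "onset (the_basis :: 'a::chilbert_space set)"
  using orthonormal_basis_the_basis[where 'a = 'a] by (simp add: orthonormal_basis_def onset_def)

lemma hs_bound_adj:
  fixes A :: "'a::chilbert_space \<Rightarrow> 'b::complex_inner"
  assumes "hs_bound A c" "adj A A'"
  shows "hs_bound A' c"
  by (rule hs_bound_adj_of_basis[OF hs_boundD(1)[OF assms(1)] assms(2)])
     (intro hs_boundD(2)[OF assms(1)] onset_subset[OF onset_the_basis])

lemma hs_bound_right:
  fixes A :: "'b::chilbert_space \<Rightarrow> 'c::chilbert_space" and B :: "'a::complex_inner \<Rightarrow> 'b"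
  assumes A: "hs_bound A c" "adj A A'" and B: "adj B B'" "bounded_clinear B'" "\<And>x. norm (B' x) \<le> k * norm x"
  shows "hs_bound (\<lambda>x. A (B x)) (k\<^sup>2 * c)"
  by (rule hs_bound_adj[OF hs_bound_left[OF hs_bound_adj[OF A] B(2,3)]
        adj_compose[OF adj_sym[OF B(1)] adj_sym[OF A(2)]]])

lemma compact_op_left:
  assumes "compact_op A" "bounded_clinear B"
  shows "compact_op (\<lambda>x. B (A x))"
  unfolding compact_op_def
proof
  show "bounded_clinear (\<lambda>x. B (A x))"
    by (rule bounded_clinear_compose[OF assms(2)]) (use assms in \<open>simp add: compact_op_def\<close>)
  have comp: "compact (B ` closure (A ` cball 0 1))"
    using assms by (intro compact_continuous_image linear_continuous_on bounded_clinear_linear)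
      (auto simp: compact_op_def)
  have "(\<lambda>x. B (A x)) ` cball 0 1 \<subseteq> B ` closure (A ` cball 0 1)"
    using closure_subset[of "A ` cball 0 1"] by blast
  then have "closure ((\<lambda>x. B (A x)) ` cball 0 1) \<subseteq> B ` closure (A ` cball 0 1)"
    by (rule closure_minimal[OF _ compact_imp_closed[OF comp]])
  then show "compact (closure ((\<lambda>x. B (A x)) ` cball 0 1))"
    using compact_Int_closed[OF comp closed_closure, of "(\<lambda>x. B (A x)) ` cball 0 1"]
    by (simp only: Int_absorb1)
qed


text \<open>A finite orthonormal set \<open>F\<close> almost attaining the supremum of \<open>\<Sum>\<parallel>A e\<parallel>\<^sup>2\<close> leaves only a small operator
  on the complement of \<open>F\<close>, so \<open>A\<close> is a norm limit of operators of finite rank.\<close>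

lemma hs_bound_compact:
  fixes A :: "'a::complex_inner \<Rightarrow> 'b::chilbert_space"
  assumes A: "hs_bound A c"
  shows "compact_op A"
  unfolding compact_op_def
proof
  note lin = hs_boundD(1)[OF A]
  show "bounded_clinear A" by (rule lin)
  define \<Sigma> where "\<Sigma> F = (\<Sum>e\<in>F. (norm (A e))\<^sup>2)" for F
  define N where "N = \<Sigma> ` {F. finite F \<and> onset F}"
  have bdd: "bdd_above N" unfolding N_def \<Sigma>_def
    by (intro bdd_aboveI2[of _ _ c]) (use hs_boundD(2)[OF A] in auto)
  have ne: "N \<noteq> {}" unfolding N_def by (auto simp: onset_def intro!: exI[of _ "{}"])
  have tot: "\<exists>k. finite k \<and> closure (A ` cball 0 1) \<subseteq> (\<Union>x\<in>k. ball x r)" if r: "r > 0" for r :: real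
  proof -
    have "Sup N - (r / 4)\<^sup>2 < Sup N" using r by simp
    then obtain v where v: "v \<in> N" "Sup N - (r / 4)\<^sup>2 < v"
      unfolding less_cSup_iff[OF ne bdd] by (elim bexE)
    then obtain F where F: "finite F" "onset F" "Sup N - (r / 4)\<^sup>2 < \<Sigma> F"
      unfolding N_def by blast
    have small: "norm (A y) \<le> r / 4 * norm y" if y: "\<And>e. e \<in> F \<Longrightarrow> cinner e y = 0" for y
    proof (cases "y = 0")
      case False
      let ?u = "(1 / norm y) *\<^sub>R y"
      have on: "onset (insert ?u F)" by (rule onset_insert_unit[OF F(2) y False])
      have "?u \<notin> F"
      proof
        assume "?u \<in> F"
        then have "cinner ?u y = 0" by (rule y)
        then show False using False by (simp add: cinner.scaleR_left cinner_self)
      qed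
      then have "\<Sigma> (insert ?u F) = (norm (A ?u))\<^sup>2 + \<Sigma> F" using F by (simp add: \<Sigma>_def)
      moreover have "\<Sigma> (insert ?u F) \<le> Sup N"
        using on F by (intro cSup_upper bdd) (auto simp: N_def)
      ultimately have "(norm (A ?u))\<^sup>2 \<le> (r / 4)\<^sup>2" using F(3) by simp
      then have "norm (A ?u) \<le> r / 4" by (rule power2_le_imp_le) (use r in simp)
      then show ?thesis using False by (simp add: bounded_clinear_scaleR[OF lin] field_simps)
    qed (simp add: bounded_clinear_zero[OF lin])
    \<comment> \<open>The image of a polydisc of coefficients: it is compact, and for
      \<open>G = F\<close> it contains \<open>A p\<close> for the projection \<open>p\<close> of any
      vector of the unit ball.\<close>
    define C where "C G = {\<Sum>e\<in>G. c e *\<^sub>C A e |c. \<forall>e. cmod (c e) \<le> 1}" for G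
    have "compact (C G)" if "finite G" for G
      using that
    proof (induction G rule: finite_induct)
      case empty
      have "C {} = {0}" by (auto simp: C_def intro!: exI[of _ "\<lambda>_. 0"])
      then show ?case by simp
    next
      case (insert e G)
      have "C (insert e G) = {x + y |x y. x \<in> (\<lambda>c. c *\<^sub>C A e) ` cball 0 1 \<and> y \<in> C G}" (is "_ = ?R")
      proof
        show "C (insert e G) \<subseteq> ?R"
        proof
          fix z assume "z \<in> C (insert e G)"
          then obtain c where c: "\<forall>e. cmod (c e) \<le> 1" "z = (\<Sum>f\<in>insert e G. c f *\<^sub>C A f)"
            unfolding C_def by blast
          have "c e *\<^sub>C A e \<in> (\<lambda>c. c *\<^sub>C A e) ` cball 0 1" using c(1) by (intro imageI) simp
          moreover have "(\<Sum>f\<in>G. c f *\<^sub>C A f) \<in> C G" unfolding C_def using c(1) by blast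
          moreover have "z = c e *\<^sub>C A e + (\<Sum>f\<in>G. c f *\<^sub>C A f)" using c(2) insert.hyps by simp
          ultimately show "z \<in> ?R" by blast
        qed
        show "?R \<subseteq> C (insert e G)"
        proof
          fix z assume "z \<in> ?R"
          then obtain a b where ab: "cmod a \<le> 1" "\<forall>e. cmod (b e) \<le> 1"
            "z = a *\<^sub>C A e + (\<Sum>e\<in>G. b e *\<^sub>C A e)" by (auto simp: C_def)
          have "z = (\<Sum>f\<in>insert e G. (b(e := a)) f *\<^sub>C A f)"
            using insert.hyps ab(3) by (auto intro!: sum.cong)
          moreover have "\<forall>f. cmod ((b(e := a)) f) \<le> 1" using ab by simp
          ultimately show "z \<in> C (insert e G)" unfolding C_def by blast
        qed
      qed
      moreover have c1: "compact ((\<lambda>c. c *\<^sub>C A e) ` cball 0 1)"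
        by (intro compact_continuous_image linear_continuous_on scaleC.bounded_linear_left compact_cball)
      ultimately show ?case using compact_sums[OF c1 insert.IH] by (simp only:)
    qed
    from this[OF F(1)] have "compact (C F)" .
    then have "\<forall>e>0. \<exists>k. finite k \<and> C F \<subseteq> (\<Union>x\<in>k. ball x e)"
      unfolding compact_eq_totally_bounded by (elim conjE)
    then have "\<exists>k. finite k \<and> C F \<subseteq> (\<Union>x\<in>k. ball x (r / 4))"
      by (rule allE[of _ "r / 4"]) (use r in simp)
    then obtain k where k: "finite k" "C F \<subseteq> (\<Union>x\<in>k. ball x (r / 4))" by (elim exE conjE)
    have "closure (A ` cball 0 1) \<subseteq> (\<Union>x\<in>k. ball x r)"
    proof
      fix z assume "z \<in> closure (A ` cball 0 1)"
      then obtain x where x: "norm x \<le> 1" "dist (A x) z < r / 4"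
        using r unfolding closure_approachable by (auto dest!: spec[of _ "r / 4"])
      define p where "p = (\<Sum>e\<in>F. cinner e x *\<^sub>C e)"
      have "(norm (x - p))\<^sup>2 \<le> (norm x)\<^sup>2"
        unfolding p_def onset_pythagoras[OF F(2,1)] by (simp add: sum_nonneg)
      then have "norm (x - p) \<le> norm x" by (rule power2_le_imp_le) simp
      then have "norm (x - p) \<le> 1" using x(1) by (rule order_trans)
      moreover have "norm (A (x - p)) \<le> r / 4 * norm (x - p)"
        by (rule small) (simp add: p_def cinner.diff_right onset_cinner_sum[OF F(2,1)])
      ultimately have d: "norm (A (x - p)) \<le> r / 4"
        using r mult_left_mono[of "norm (x - p)" 1 "r / 4"] by linarith
      define cc where "cc e = (if e \<in> F then cinner e x else 0)" for e
      have "cmod (cc e) \<le> 1" for e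
        using cmod_cinner_le[of e x] onset_norm[OF F(2), of e] x(1) by (auto simp: cc_def)
      moreover have "A p = (\<Sum>e\<in>F. cc e *\<^sub>C A e)"
        by (simp add: p_def bounded_clinear_sum[OF lin] bounded_clinear_scaleC[OF lin] cc_def)
      ultimately have "A p \<in> C F" unfolding C_def by blast
      then obtain y where y: "y \<in> k" "dist y (A p) < r / 4" using k(2) by auto
      have "dist (A p) (A x) \<le> r / 4"
        using d by (simp add: dist_norm norm_minus_commute bounded_clinear_diff[OF lin])
      then have "dist y z < r"
        using y(2) x(2) dist_triangle[of y z "A p"] dist_triangle[of "A p" z "A x"] r by linarith
      then show "z \<in> (\<Union>x\<in>k. ball x r)" using y(1) by auto
    qed
    then show ?thesis using k(1) by blast
  qed
  show "compact (closure (A ` cball 0 1))"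
    unfolding compact_eq_totally_bounded using tot by (simp add: complete_eq_closed)
qed

lemma csa_hs:
  fixes A :: "'a::chilbert_space \<Rightarrow> 'a"
  assumes "hs_bound A c" "adj A A"
  shows "csa A"
  using hs_bound_compact[OF assms(1)] hs_boundD(1)[OF assms(1)] assms(2)
  by (simp add: csa_def self_adjoint_def adj_def)

text \<open>For exponent 2 the functional calculus applies \<open>t powr 1\<close>, the identity on
  the eigenvalues of \<open>A'\<close> after \<open>A\<close>, which are squared norms. Membership
  in the Schatten class then concerns the sum of the squared norms of \<open>A e\<close>.\<close>

lemma abs_powr_2:
  fixes A :: "'a::chilbert_space \<Rightarrow> 'b::complex_inner"
  assumes A: "compact_op A" "adj A A'"
  shows "abs_powr A 2 = (\<lambda>x. A' (A x))"
proof
  fix x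
  define S where "S = (\<lambda>x. A' (A x))"
  have lin: "bounded_clinear A" using A by (simp add: compact_op_def)
  have S: "csa S"
    using compact_op_left[OF A(1) adj_bounded[OF lin A(2)]] adjD[OF A(2)] adjD[OF adj_sym[OF A(2)]]
    by (simp add: csa_def self_adjoint_def S_def compact_op_def)
  obtain E s where D: "diag S E s" by (rule diag_exists[OF S])
  obtain k where k: "\<And>e. e \<in> E \<Longrightarrow> \<bar>s e\<bar> \<le> k" by (rule diag_bound[OF S D]) blast
  have s: "s e powr (2 / 2) = s e" if e: "e \<in> E" for e
  proof -
    have "of_real (s e) * cinner e e = cinner e (S e)"
      using diagD(2)[OF D e] by (simp add: cinner.scaleR_right scaleR_conv_of_real)
    also have "\<dots> = cinner (A e) (A e)" by (simp add: S_def adjD[OF A(2)])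
    finally have "complex_of_real (s e) = of_real ((norm (A e))\<^sup>2)"
      using onset_norm[OF diagD(1)[OF D] e] by (simp add: cinner_self)
    then have "s e = (norm (A e))\<^sup>2" by (simp only: of_real_eq_iff)
    then have "0 \<le> s e" by simp
    then show ?thesis by simp
  qed
  have "((\<lambda>e. (s e powr (2 / 2)) *\<^sub>R cinner e x *\<^sub>C e) has_sum fun_calc (\<lambda>t. t powr (2 / 2)) S x) E"
    by (rule fun_calc_has_sum[OF S D, of "\<lambda>t. t powr (2 / 2)" k]) (use k s in auto)
  then have "((\<lambda>e. s e *\<^sub>R cinner e x *\<^sub>C e) has_sum fun_calc (\<lambda>t. t powr (2 / 2)) S x) E"
    using s has_sum_cong[of E "\<lambda>e. (s e powr (2 / 2)) *\<^sub>R cinner e x *\<^sub>C e"] by force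
  then have "fun_calc (\<lambda>t. t powr (2 / 2)) S x = S x"
    using diag_has_sum[OF S D] has_sum_unique by blast
  then show "abs_powr A 2 x = A' (A x)"
    by (simp add: abs_powr_def adj_cadj[OF A(2)] S_def o_def)
qed

lemma cinner_gram: "adj A A' \<Longrightarrow> cinner e (A' (A e)) = of_real ((norm (A e))\<^sup>2)"
  by (simp only: adjD[symmetric] cinner_self)

lemma hs_bound_schatten:
  fixes A :: "'a::chilbert_space \<Rightarrow> 'b::chilbert_space"
  assumes A: "hs_bound A c"
  shows "A \<in> schatten 2" "schatten_norm 2 A \<le> sqrt c" "0 \<le> schatten_norm 2 A"
proof -
  obtain A' where A': "adj A A'" by (rule adj_exists[OF hs_boundD(1)[OF A]])
  note comp = hs_bound_compact[OF A]
  note fs = hs_boundD(2)[OF A _ onset_subset[OF onset_the_basis]]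
  have sm: "(\<lambda>e. (norm (A e))\<^sup>2) summable_on the_basis"
    by (rule nonneg_bdd_above_summable_on) (auto intro!: bdd_aboveI2[of _ _ c] fs)
  have "(\<lambda>e. complex_of_real ((norm (A e))\<^sup>2)) summable_on the_basis"
    by (rule summable_on_of_real[OF sm])
  then show "A \<in> schatten 2"
    by (simp only: schatten_def mem_Collect_eq comp abs_powr_2[OF comp A'] cinner_gram[OF A'] simp_thms)
  have tr: "op_trace (abs_powr A 2) = of_real (\<Sum>\<^sub>\<infinity>e\<in>the_basis. (norm (A e))\<^sup>2)"
    unfolding op_trace_def abs_powr_2[OF comp A'] cinner_gram[OF A']
    by (rule infsumI[OF has_sum_of_real[OF has_sum_infsum[OF sm]]])
  have "(\<Sum>\<^sub>\<infinity>e\<in>the_basis. (norm (A e))\<^sup>2) \<le> c" by (rule infsum_le_finite_sums[OF sm fs])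
  moreover have "0 \<le> (\<Sum>\<^sub>\<infinity>e\<in>the_basis. (norm (A e))\<^sup>2)" by (rule infsum_nonneg) simp
  ultimately show "schatten_norm 2 A \<le> sqrt c"
    by (simp add: schatten_norm_def tr powr_half_sqrt)
  show "0 \<le> schatten_norm 2 A" by (simp add: schatten_norm_def)
qed

text \<open>The Schatten norm sees only the chosen basis \<open>the_basis\<close>; passing to the
  adjoint and back upgrades this to every orthonormal set.\<close>

lemma schatten_hs_bound:
  fixes A :: "'a::chilbert_space \<Rightarrow> 'b::chilbert_space"
  assumes A: "A \<in> schatten 2"
  shows "hs_bound A ((schatten_norm 2 A)\<^sup>2)"
proof -
  have comp: "compact_op A" using A by (simp add: schatten_def)
  then have lin: "bounded_clinear A" by (simp add: compact_op_def)
  obtain A' where A': "adj A A'" by (rule adj_exists[OF lin])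
  have "(\<lambda>e. complex_of_real ((norm (A e))\<^sup>2)) summable_on the_basis"
    using A by (simp only: schatten_def mem_Collect_eq abs_powr_2[OF comp A'] cinner_gram[OF A'])
  from summable_on_Re[OF this] have sm: "(\<lambda>e. (norm (A e))\<^sup>2) summable_on the_basis" by simp
  define t where "t = (\<Sum>\<^sub>\<infinity>e\<in>the_basis. (norm (A e))\<^sup>2)"
  have "op_trace (abs_powr A 2) = of_real t"
    unfolding op_trace_def abs_powr_2[OF comp A'] cinner_gram[OF A'] t_def
    by (rule infsumI[OF has_sum_of_real[OF has_sum_infsum[OF sm]]])
  moreover have "0 \<le> t" unfolding t_def by (rule infsum_nonneg) simp
  ultimately have t: "(schatten_norm 2 A)\<^sup>2 = t" by (simp add: schatten_norm_def powr_half_sqrt)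
  have "hs_bound A' t"
    by (rule hs_bound_adj_of_basis[OF lin A']) (unfold t_def, rule finite_sum_le_infsum[OF sm], auto)
  then show ?thesis unfolding t by (rule hs_bound_adj[OF _ adj_sym[OF A']])
qed

text \<open>The Hilbert-Schmidt norm dominates the operator norm, so both limits are pointwise
  limits. This uniqueness evaluates the definite description in
  \<open>boundary_resolvent\<close>.\<close>

lemma schatten_tendsto_unique:
  fixes T :: "'i \<Rightarrow> 'a::chilbert_space \<Rightarrow> 'b::chilbert_space"
  assumes T: "schatten_tendsto 2 T T0 F" "schatten_tendsto 2 T T1 F" and F: "F \<noteq> bot"
  shows "T0 = T1"
proof
  fix x
  have lim: "((\<lambda>i. T i x) \<longlongrightarrow> T' x) F" if T': "schatten_tendsto 2 T T' F" for T'
  proof -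
    have lim0: "((\<lambda>i. schatten_norm 2 (\<lambda>y. T i y - T' y) * norm x) \<longlongrightarrow> 0 * norm x) F"
      using T' by (intro tendsto_intros) (simp add: schatten_tendsto_def)
    have ev: "\<forall>\<^sub>F i in F. norm (T i x - T' x) \<le> schatten_norm 2 (\<lambda>y. T i y - T' y) * norm x"
    proof -
      have "\<forall>\<^sub>F i in F. T i \<in> schatten 2" using T' by (simp add: schatten_tendsto_def)
      then show ?thesis
      proof eventually_elim
        case (elim i)
        have "T' \<in> schatten 2" using T' by (simp add: schatten_tendsto_def)
        note d = hs_bound_diff[OF schatten_hs_bound[OF elim] schatten_hs_bound[OF this]]
        show ?case
          using hs_bound_norm[OF schatten_hs_bound[OF hs_bound_schatten(1)[OF d]], of x]
            hs_bound_schatten(3)[OF d] by simp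
      qed
    qed
    have "((\<lambda>i. T i x - T' x) \<longlongrightarrow> 0) F"
      by (rule Lim_null_comparison[OF ev]) (use lim0 in simp)
    then show ?thesis by (rule LIM_zero_cancel)
  qed
  show "T0 x = T1 x" by (rule tendsto_unique[OF F lim[OF T(1)] lim[OF T(2)]])
qed

text \<open>Chebyshev's inequality for eigenvalues: each one above \<open>r\<close> contributes at
  least \<open>r\<^sup>2\<close> to the squared Hilbert-Schmidt norm.\<close>

lemma counting_hs_bound:
  fixes S :: "'a::chilbert_space \<Rightarrow> 'a"
  assumes S: "csa S" and hs: "hs_bound S c" and r: "r > 0"
  shows "real (counting 1 r S) \<le> c / r\<^sup>2"
proof -
  obtain E s where D: "diag S E s" by (rule diag_exists[OF S])
  let ?L = "{e \<in> E. s e > r}"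
  have on: "onset ?L" by (rule onset_subset[OF diagD(1)[OF D]]) auto
  have "real (card ?L) * r\<^sup>2 = (\<Sum>e\<in>?L. r\<^sup>2)" by simp
  also have "\<dots> \<le> (\<Sum>e\<in>?L. (norm (S e))\<^sup>2)"
  proof (rule sum_mono)
    fix e assume e: "e \<in> ?L"
    then have "norm (S e) = s e"
      using diagD(2)[OF D, of e] onset_norm[OF on e] r by simp
    then show "r\<^sup>2 \<le> (norm (S e))\<^sup>2" using e r by (intro power_mono) auto
  qed
  also have "\<dots> \<le> c" by (rule hs_boundD(2)[OF hs diag_finite_above[OF D r] on])
  finally show ?thesis using r by (simp add: counting_diag[OF S D r] field_simps)
qed

section \<open>Square roots\<close>

lemma nonneg_opD:
  assumes "nonneg_op A"
  shows "bounded_clinear A" "Im (cinner x (A x)) = 0" "0 \<le> inner x (A x)"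
proof -
  have "cinner x (A x) \<in> \<real>" "0 \<le> Re (cinner x (A x))" "bounded_clinear A"
    using assms by (auto simp: nonneg_op_def)
  then show "bounded_clinear A" "Im (cinner x (A x)) = 0" "0 \<le> inner x (A x)"
    by (auto simp: complex_is_Real_iff Re_cinner)
qed

lemma nonneg_op_sym:
  assumes A: "nonneg_op A"
  shows "cinner (A x) y = cinner x (A y)"
proof -
  note lin = nonneg_opD(1)[OF A]
  have 1: "Im (cinner (x + y) (A (x + y))) = 0" "Im (cinner (x + \<i> *\<^sub>C y) (A (x + \<i> *\<^sub>C y))) = 0"
    "Im (cinner x (A x)) = 0" "Im (cinner y (A y)) = 0"
    by (rule nonneg_opD(2)[OF A])+
  have "Im (cinner x (A y)) = - Im (cinner y (A x))"
    using 1 by (simp add: bounded_clinear_add[OF lin] cinner_add_left cinner_add_right)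
  moreover have "Re (cinner x (A y)) = Re (cinner y (A x))"
    using 1 by (simp add: bounded_clinear_add[OF lin] bounded_clinear_scaleC[OF lin] cinner_add_left
        cinner_add_right cinner_scaleC_left cinner_scaleC_right)
  ultimately have "cinner x (A y) = cnj (cinner y (A x))" by (simp add: complex_eq_iff)
  then show ?thesis by (simp add: cinner_commute[of "A x" y])
qed

lemma nonneg_op_adj: "nonneg_op A \<Longrightarrow> adj A A"
  by (simp add: adj_def nonneg_op_sym)

lemma nonneg_opI:
  assumes "bounded_clinear A" "adj A A" "\<And>x. 0 \<le> inner x (A x)"
  shows "nonneg_op A"
proof -
  have "cnj (cinner x (A x)) = cinner x (A x)" for x
    using adjD[OF assms(2), of x x] cinner_commute[of "A x" x] by simp
  then have "cinner x (A x) \<in> \<real>" for x by (simp add: Reals_cnj_iff)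
  then show ?thesis using assms by (simp add: nonneg_op_def Re_cinner)
qed

text \<open>The form of \<open>A\<close> at \<open>x - (1 / k) *\<^sub>R A x\<close> is nonnegative.
  In it the term quadratic in \<open>1 / k\<close> is controlled by \<open>k\<close> and cancels
  half of the linear one.\<close>

lemma nonneg_op_norm_sq_le:
  assumes A: "nonneg_op A" and k: "k > 0" "\<And>x. norm (A x) \<le> k * norm x"
  shows "(norm (A x))\<^sup>2 \<le> k * inner x (A x)"
proof -
  note lin = nonneg_opD(1)[OF A]
  define t where "t = 1 / k"
  have i: "inner (A x) x = inner x (A x)" by (rule inner_commute)
  have AA: "inner x (A (A x)) = (norm (A x))\<^sup>2"
    using nonneg_op_sym[OF A, of x "A x"] by (simp add: norm_sq_cinner flip: Re_cinner)
  have "inner (A x) (A (A x)) \<le> norm (A x) * norm (A (A x))" by (rule norm_cauchy_schwarz)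
  also have "\<dots> \<le> norm (A x) * (k * norm (A x))" by (intro mult_left_mono k) simp
  finally have q: "inner (A x) (A (A x)) \<le> k * (norm (A x))\<^sup>2" by (simp add: power2_eq_square mult_ac)
  have "0 \<le> inner (x - t *\<^sub>R A x) (A (x - t *\<^sub>R A x))" by (rule nonneg_opD(3)[OF A])
  also have "\<dots> = inner x (A x) - 2 * t * (norm (A x))\<^sup>2 + t\<^sup>2 * inner (A x) (A (A x))"
    by (simp add: bounded_clinear_diff[OF lin] bounded_clinear_scaleR[OF lin] inner_diff_left inner_diff_right
        AA power2_norm_eq_inner[symmetric] power2_eq_square[of t] algebra_simps)
  also have "\<dots> \<le> inner x (A x) - 2 * t * (norm (A x))\<^sup>2 + t\<^sup>2 * (k * (norm (A x))\<^sup>2)"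
    by (intro add_left_mono mult_left_mono q) simp
  also have "\<dots> = inner x (A x) - t * (norm (A x))\<^sup>2"
    using k(1) by (simp add: t_def power2_eq_square)
  finally show ?thesis using k(1) by (simp add: t_def field_simps)
qed

text \<open>For a contraction \<open>X\<close> the iterates \<open>Y\<close> of \<open>Y \<mapsto> (X + Y\<^sup>2) / 2\<close> are majorized by the scalar iteration
  started with \<open>X = 1\<close>; if \<open>Y\<close> is a fixed point, then \<open>(1 - Y)\<^sup>2 = 1 - X\<close>.\<close>

primrec root_iter :: "('a::real_vector \<Rightarrow> 'a) \<Rightarrow> nat \<Rightarrow> 'a \<Rightarrow> 'a" where
  "root_iter X 0 = (\<lambda>x. 0)"
| "root_iter X (Suc n) = (\<lambda>x. (1 / 2) *\<^sub>R (X x + root_iter X n (root_iter X n x)))"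

primrec root_maj :: "nat \<Rightarrow> real" where
  "root_maj 0 = 0"
| "root_maj (Suc n) = (1 + (root_maj n)\<^sup>2) / 2"

lemma root_maj_bounds: "0 \<le> root_maj n \<and> root_maj n \<le> 1"
proof (induction n)
  case (Suc n)
  then have "(root_maj n)\<^sup>2 \<le> 1\<^sup>2" by (intro power_mono) auto
  then show ?case by simp
qed simp

lemma root_maj_mono: "root_maj n \<le> root_maj (Suc n)"
proof -
  have "0 \<le> (1 - root_maj n)\<^sup>2" by simp
  then show ?thesis by (simp add: power2_diff)
qed

lemma root_maj_Cauchy: "Cauchy root_maj"
  by (intro LIMSEQ_imp_Cauchy[OF LIMSEQ_incseq_SUP] bdd_aboveI2[of _ _ 1] incseq_SucI root_maj_mono)
     (simp add: root_maj_bounds)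

lemma bounded_clinear_root_iter: "bounded_clinear X \<Longrightarrow> bounded_clinear (root_iter X n)"
proof (induction n)
  case 0
  then show ?case by (simp add: bounded_clinear_0)
next
  case (Suc n)
  then show ?case
    unfolding root_iter.simps
    by (intro bounded_clinear_scaleR_left bounded_clinear_plus)
       (simp, rule bounded_clinear_compose, simp_all)
qed

lemma root_iter_norm:
  fixes X :: "'a::complex_inner \<Rightarrow> 'a"
  assumes X: "\<And>x. norm (X x) \<le> norm x"
  shows "norm (root_iter X n x) \<le> root_maj n * norm x"
proof (induction n arbitrary: x)
  case (Suc n)
  have "norm (root_iter X n (root_iter X n x)) \<le> root_maj n * norm (root_iter X n x)" by (rule Suc.IH)
  also have "\<dots> \<le> root_maj n * (root_maj n * norm x)"
    by (intro mult_left_mono Suc.IH) (simp add: root_maj_bounds)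
  finally have "norm (X x + root_iter X n (root_iter X n x)) \<le> norm x + root_maj n * (root_maj n * norm x)"
    using X[of x] norm_triangle_ineq[of "X x"] by (meson add_mono order_trans)
  then show ?case
    unfolding root_iter.simps root_maj.simps norm_scaleR by (simp add: power2_eq_square algebra_simps)
qed simp

lemma root_iter_step:
  assumes X: "bounded_clinear X" "\<And>x. norm (X x) \<le> norm x"
  shows "norm (root_iter X (Suc n) x - root_iter X n x) \<le> (root_maj (Suc n) - root_maj n) * norm x"
proof (induction n arbitrary: x)
  case 0
  then show ?case using X(2)[of x] by simp
next
  case (Suc n)
  define Y Y' y y' where "Y = root_iter X n" and "Y' = root_iter X (Suc n)"
    and "y = root_maj n" and "y' = root_maj (Suc n)"
  have lin: "bounded_clinear Y'" unfolding Y'_def by (rule bounded_clinear_root_iter[OF X(1)])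
  have b: "norm (Y x) \<le> y * norm x" "norm (Y' x) \<le> y' * norm x" for x
    unfolding Y_def Y'_def y_def y'_def by (rule root_iter_norm[OF X(2)])+
  have p: "0 \<le> y" "0 \<le> y'" "0 \<le> y' - y"
    unfolding y_def y'_def using root_maj_bounds root_maj_mono[of n] by (simp_all del: root_maj.simps)
  have IH: "norm (Y' x - Y x) \<le> (y' - y) * norm x" for x
    unfolding Y_def Y'_def y_def y'_def by (rule Suc.IH)
  \<comment> \<open>The difference of the squares is split with the order of the factors kept, as
    \<open>Y'\<close> after \<open>Y' - Y\<close> plus \<open>Y' - Y\<close> after \<open>Y\<close>.
    The same splitting of \<open>y'\<^sup>2 - y\<^sup>2\<close> makes the bound the next step of the
    majorant.\<close>
  have "root_iter X (Suc (Suc n)) x - root_iter X (Suc n) x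
      = (1 / 2) *\<^sub>R (Y' (Y' x - Y x) + (Y' (Y x) - Y (Y x)))"
  proof -
    have "root_iter X (Suc (Suc n)) x = (1 / 2) *\<^sub>R (X x + Y' (Y' x))" by (simp add: Y'_def)
    moreover have "root_iter X (Suc n) x = (1 / 2) *\<^sub>R (X x + Y (Y x))" by (simp add: Y_def)
    ultimately show ?thesis by (simp add: bounded_clinear_diff[OF lin] algebra_simps)
  qed
  then have "norm (root_iter X (Suc (Suc n)) x - root_iter X (Suc n) x)
      \<le> 1 / 2 * (norm (Y' (Y' x - Y x)) + norm (Y' (Y x) - Y (Y x)))"
    by (simp add: norm_triangle_ineq)
  also have "\<dots> \<le> 1 / 2 * (y' * ((y' - y) * norm x) + (y' - y) * (y * norm x))"
  proof (intro mult_left_mono add_mono)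
    show "norm (Y' (Y' x - Y x)) \<le> y' * ((y' - y) * norm x)"
      using b(2)[of "Y' x - Y x"] mult_left_mono[OF IH p(2)] by (rule order_trans)
    show "norm (Y' (Y x) - Y (Y x)) \<le> (y' - y) * (y * norm x)"
      using IH[of "Y x"] mult_left_mono[OF b(1) p(3)] by (rule order_trans)
  qed simp
  also have "\<dots> = ((y'\<^sup>2 - y\<^sup>2) / 2) * norm x" by (simp add: power2_eq_square algebra_simps)
  also have "(y'\<^sup>2 - y\<^sup>2) / 2 = root_maj (Suc (Suc n)) - root_maj (Suc n)"
    by (simp add: y'_def y_def diff_divide_distrib add_divide_distrib)
  finally show ?case .
qed

lemma root_iter_diff:
  assumes X: "bounded_clinear X" "\<And>x. norm (X x) \<le> norm x" and "n \<le> m"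
  shows "norm (root_iter X m x - root_iter X n x) \<le> (root_maj m - root_maj n) * norm x"
  using \<open>n \<le> m\<close>
proof (induction m rule: dec_induct)
  case (step m)
  have "norm (root_iter X (Suc m) x - root_iter X n x)
      \<le> norm (root_iter X (Suc m) x - root_iter X m x) + norm (root_iter X m x - root_iter X n x)"
    by (metis add_diff_eq diff_add_cancel norm_triangle_ineq)
  also have "\<dots> \<le> (root_maj (Suc m) - root_maj m) * norm x + (root_maj m - root_maj n) * norm x"
    by (intro add_mono root_iter_step X step.IH)
  finally show ?case by (simp only: left_diff_distrib)
qed simp

lemma root_iter_convergent:
  fixes X :: "'a::chilbert_space \<Rightarrow> 'a"
  assumes X: "bounded_clinear X" "\<And>x. norm (X x) \<le> norm x"
  shows "convergent (\<lambda>n. root_iter X n x)"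
proof (rule Cauchy_convergent, rule metric_CauchyI)
  fix e :: real assume e: "e > 0"
  then have "e / (norm x + 1) > 0" by (simp add: add_nonneg_pos)
  then obtain M where M: "\<forall>i\<ge>M. \<forall>j\<ge>M. dist (root_maj i) (root_maj j) < e / (norm x + 1)"
    using root_maj_Cauchy unfolding Cauchy_def by blast
  have main: "dist (root_iter X i x) (root_iter X j x) < e" if ij: "M \<le> j" "j \<le> i" for i j
  proof -
    have "\<bar>root_maj i - root_maj j\<bar> < e / (norm x + 1)" using M ij by (simp add: dist_real_def)
    then have "root_maj i - root_maj j < e / (norm x + 1)" by simp
    then have "(root_maj i - root_maj j) * norm x \<le> e / (norm x + 1) * norm x"
      by (intro mult_right_mono) auto
    also have "\<dots> < e" using e by (simp add: field_simps add_pos_nonneg)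
    finally show ?thesis using root_iter_diff[OF X ij(2), of x] by (simp add: dist_norm)
  qed
  show "\<exists>M. \<forall>i\<ge>M. \<forall>j\<ge>M. dist (root_iter X i x) (root_iter X j x) < e"
  proof (intro exI allI impI)
    fix i j assume "M \<le> i" "M \<le> j"
    then show "dist (root_iter X i x) (root_iter X j x) < e"
      using main[of j i] main[of i j] by (cases "j \<le> i") (auto simp: dist_commute)
  qed
qed

text \<open>Adjointness, the fixed point equation and commutation hold for or are inherited from the
  iterates in the strong limit. The commutation clause is what later forces any two roots to
  commute.\<close>

lemma contraction_root:
  fixes X :: "'a::chilbert_space \<Rightarrow> 'a"
  assumes X: "bounded_clinear X" "\<And>x. norm (X x) \<le> norm x" "adj X X"
  obtains Y where "bounded_clinear Y" "adj Y Y" "\<forall>x. norm (Y x) \<le> norm x"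
    "\<forall>x. 2 *\<^sub>R Y x = X x + Y (Y x)"
    "\<forall>B. bounded_clinear B \<longrightarrow> (\<forall>x. B (X x) = X (B x)) \<longrightarrow> (\<forall>x. B (Y x) = Y (B x))"
proof -
  let ?I = "root_iter X"
  define Y where "Y x = lim (\<lambda>n. ?I n x)" for x
  have lim: "(\<lambda>n. ?I n x) \<longlonglongrightarrow> Y x" for x
    unfolding Y_def using root_iter_convergent[OF X(1,2)] by (simp only: convergent_LIMSEQ_iff)
  note lin = bounded_clinear_root_iter[OF X(1)]
  have n1: "norm (?I n x) \<le> norm x" for n x
    using root_iter_norm[OF X(2), of n x] mult_right_mono[OF conjunct2[OF root_maj_bounds[of n]], of "norm x"]
    by simp
  have nY: "norm (Y x) \<le> norm x" for x
    by (rule LIMSEQ_le_const2[OF tendsto_norm[OF lim]]) (use n1 in blast)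
  have linY: "bounded_clinear Y"
  proof (rule bounded_clinearI[where K = 1])
    show "Y (x + y) = Y x + Y y" for x y
      using lim[of "x + y"] unfolding bounded_clinear_add[OF lin]
      by (rule LIMSEQ_unique) (intro tendsto_add lim)
    show "Y (c *\<^sub>C x) = c *\<^sub>C Y x" for c x
      using lim[of "c *\<^sub>C x"] unfolding bounded_clinear_scaleC[OF lin]
      by (rule LIMSEQ_unique) (intro scaleC.tendsto tendsto_const lim)
    show "norm (Y x) \<le> norm x * 1" for x using nY by simp
  qed
  have adjI: "cinner (?I n x) y = cinner x (?I n y)" for n x y
  proof (induction n arbitrary: x y)
    case (Suc n)
    then show ?case
      by (simp add: cinner.scaleR_left cinner.scaleR_right cinner_add_left cinner_add_right adjD[OF X(3)])
  qed (simp add: cinner.zero_left cinner.zero_right)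
  have adjY: "adj Y Y"
    unfolding adj_def
  proof (intro allI)
    fix x y
    have "(\<lambda>n. cinner (?I n x) y) \<longlonglongrightarrow> cinner (Y x) y" by (intro cinner.tendsto lim tendsto_const)
    moreover have "(\<lambda>n. cinner (?I n x) y) \<longlonglongrightarrow> cinner x (Y y)"
      unfolding adjI by (intro cinner.tendsto lim tendsto_const)
    ultimately show "cinner (Y x) y = cinner x (Y y)" by (rule LIMSEQ_unique)
  qed
  have fix_pt: "2 *\<^sub>R Y x = X x + Y (Y x)" for x
  proof -
    have "(\<lambda>n. ?I n (?I n x - Y x)) \<longlonglongrightarrow> 0"
    proof (rule Lim_null_comparison)
      show "\<forall>\<^sub>F n in sequentially. norm (?I n (?I n x - Y x)) \<le> norm (?I n x - Y x)"
        by (intro always_eventually allI n1)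
      show "(\<lambda>n. norm (?I n x - Y x)) \<longlonglongrightarrow> 0"
        using lim[of x] by (simp only: tendsto_norm_zero_iff LIM_zero_iff)
    qed
    from tendsto_add[OF this lim[of "Y x"]]
    have "(\<lambda>n. ?I n (?I n x)) \<longlonglongrightarrow> Y (Y x)" by (simp add: bounded_clinear_diff[OF lin])
    then have "(\<lambda>n. X x + ?I n (?I n x)) \<longlonglongrightarrow> X x + Y (Y x)" by (intro tendsto_intros)
    moreover have "X x + ?I n (?I n x) = 2 *\<^sub>R ?I (Suc n) x" for n by simp
    ultimately have "(\<lambda>n. 2 *\<^sub>R ?I (Suc n) x) \<longlonglongrightarrow> X x + Y (Y x)" by (simp only:)
    moreover have "(\<lambda>n. 2 *\<^sub>R ?I (Suc n) x) \<longlonglongrightarrow> 2 *\<^sub>R Y x"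
      by (intro tendsto_scaleR tendsto_const LIMSEQ_Suc[OF lim])
    ultimately show ?thesis by (rule LIMSEQ_unique[symmetric])
  qed
  have comm: "B (Y x) = Y (B x)" if B: "bounded_clinear B" "\<forall>x. B (X x) = X (B x)" for B x
  proof -
    have "B (?I n x) = ?I n (B x)" for n x
    proof (induction n arbitrary: x)
      case (Suc n)
      then show ?case using B(2) by (simp add: bounded_clinear_scaleR[OF B(1)] bounded_clinear_add[OF B(1)])
    qed (simp add: bounded_clinear_zero[OF B(1)])
    then have "(\<lambda>n. B (?I n x)) \<longlonglongrightarrow> Y (B x)" by (simp only: lim)
    moreover have "(\<lambda>n. B (?I n x)) \<longlonglongrightarrow> B (Y x)"
      by (rule bounded_linear.tendsto[OF bounded_clinear_linear[OF B(1)] lim])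
    ultimately show ?thesis by (rule LIMSEQ_unique[symmetric])
  qed
  show ?thesis by (rule that[OF linY adjY]) (use nY fix_pt comm in auto)
qed

text \<open>With \<open>X = 1 - A / k\<close>, a contraction by \<open>nonneg_op_norm_sq_le\<close>,
  the fixed point \<open>Y\<close> satisfies \<open>(1 - Y)\<^sup>2 = 1 - X = A / k\<close>; hence
  the root is \<open>sqrt k\<close> times \<open>1 - Y\<close>.\<close>

lemma nonneg_op_root_exists:
  fixes A :: "'a::chilbert_space \<Rightarrow> 'a"
  assumes A: "nonneg_op A"
  obtains C where "nonneg_op C" "\<forall>x. C (C x) = A x"
    "\<forall>B. bounded_clinear B \<longrightarrow> (\<forall>x. B (A x) = A (B x)) \<longrightarrow> (\<forall>x. B (C x) = C (B x))"
proof -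
  note lin = nonneg_opD(1)[OF A]
  obtain k where k: "k > 0" "\<And>x. norm (A x) \<le> k * norm x" by (rule bounded_clinear_bound[OF lin]) blast
  define X where "X x = x - (1 / k) *\<^sub>R A x" for x
  have linX: "bounded_clinear X"
    unfolding X_def[abs_def]
    by (rule bounded_clinear_minus[OF bounded_clinear_id bounded_clinear_scaleR_left[OF lin]])
  have nX: "norm (X x) \<le> norm x" for x
  proof (rule power2_le_imp_le)
    have "(norm (X x))\<^sup>2 = (norm x)\<^sup>2 - 2 / k * inner x (A x) + (1 / k)\<^sup>2 * (norm (A x))\<^sup>2"
      unfolding X_def power2_norm_eq_inner inner_diff_left inner_diff_right inner_scaleR_left inner_scaleR_right
      by (simp add: inner_commute[of "A x" x] power2_eq_square diff_divide_distrib)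
    also have "\<dots> \<le> (norm x)\<^sup>2 - 2 / k * inner x (A x) + (1 / k)\<^sup>2 * (k * inner x (A x))"
      by (intro add_left_mono mult_left_mono nonneg_op_norm_sq_le[OF A k]) simp
    also have "\<dots> = (norm x)\<^sup>2 - 1 / k * inner x (A x)" using k(1) by (simp add: power2_eq_square)
    also have "\<dots> \<le> (norm x)\<^sup>2" using k(1) nonneg_opD(3)[OF A, of x] by simp
    finally show "(norm (X x))\<^sup>2 \<le> (norm x)\<^sup>2" .
  qed simp
  have adjX: "adj X X"
    unfolding adj_def X_def
    by (simp add: cinner.diff_left cinner.diff_right cinner.scaleR_left cinner.scaleR_right nonneg_op_sym[OF A])
  obtain Y where Y: "bounded_clinear Y" "adj Y Y" "\<forall>x. norm (Y x) \<le> norm x"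
    "\<forall>x. 2 *\<^sub>R Y x = X x + Y (Y x)"
    "\<forall>B. bounded_clinear B \<longrightarrow> (\<forall>x. B (X x) = X (B x)) \<longrightarrow> (\<forall>x. B (Y x) = Y (B x))"
    by (rule contraction_root[OF linX nX adjX])
  define C where "C x = sqrt k *\<^sub>R (x - Y x)" for x
  have linC: "bounded_clinear C"
    unfolding C_def[abs_def]
    by (rule bounded_clinear_scaleR_left[OF bounded_clinear_minus[OF bounded_clinear_id Y(1)]])
  have "nonneg_op C"
  proof (rule nonneg_opI[OF linC])
    show "adj C C"
      unfolding adj_def C_def
      by (simp add: cinner.diff_left cinner.diff_right cinner.scaleR_left cinner.scaleR_right adjD[OF Y(2)])
    fix x
    have "inner x (Y x) \<le> norm x * norm (Y x)" by (rule norm_cauchy_schwarz)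
    also have "\<dots> \<le> norm x * norm x" using Y(3) by (intro mult_left_mono) auto
    finally show "0 \<le> inner x (C x)"
      using k(1) by (simp add: C_def inner_diff_right power2_norm_eq_inner[symmetric] power2_eq_square)
  qed
  moreover have "C (C x) = A x" for x
  proof -
    have YY: "Y (Y x) = 2 *\<^sub>R Y x - X x" using Y(4)[rule_format, of x] by simp
    have "C (C x) = (sqrt k * sqrt k) *\<^sub>R (x - Y x - Y (x - Y x))"
      by (simp only: C_def bounded_clinear_scaleR[OF Y(1)] scaleR_diff_right[symmetric] scaleR_scaleR)
    also have "x - Y x - Y (x - Y x) = (1 / k) *\<^sub>R A x"
      unfolding bounded_clinear_diff[OF Y(1)] YY by (simp add: X_def scaleR_2)
    finally show ?thesis using k(1) by simp
  qed
  moreover have "B (C x) = C (B x)" if B: "bounded_clinear B" "\<forall>x. B (A x) = A (B x)" for B x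
  proof -
    have "\<forall>x. B (X x) = X (B x)"
      using B(2) by (simp add: X_def bounded_clinear_diff[OF B(1)] bounded_clinear_scaleR[OF B(1)])
    then have "\<forall>x. B (Y x) = Y (B x)" using Y(5) B(1) by blast
    then show ?thesis
      by (simp add: C_def bounded_clinear_diff[OF B(1)] bounded_clinear_scaleR[OF B(1)])
  qed
  ultimately show ?thesis by (intro that[of C]) auto
qed

lemma nonneg_op_form_zero:
  assumes A: "nonneg_op A" and "inner x (A x) = 0"
  shows "A x = 0"
proof -
  obtain k where k: "k > 0" "\<And>x. norm (A x) \<le> k * norm x"
    by (rule bounded_clinear_bound[OF nonneg_opD(1)[OF A]]) blast
  show ?thesis using nonneg_op_norm_sq_le[OF A k, of x] assms(2) by simp
qed

text \<open>For \<open>D = B - C\<close>, commutation gives \<open>B (D x) + C (D x) = 0\<close>.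
  Both forms at \<open>D x\<close> are nonnegative, so both vanish; then \<open>B\<close> and
  \<open>C\<close> annihilate \<open>D x\<close>, and \<open>D (D x) = 0\<close> with
  \<open>D\<close> symmetric.\<close>

lemma nonneg_op_root_unique:
  assumes B: "nonneg_op B" and C: "nonneg_op C" and sq: "\<And>x. B (B x) = C (C x)"
    and comm: "\<And>x. B (C x) = C (B x)"
  shows "B = C"
proof
  fix x
  note linB = nonneg_opD(1)[OF B] and linC = nonneg_opD(1)[OF C]
  define D where "D x = B x - C x" for x
  have "B (D x) + C (D x) = 0"
    by (simp add: D_def bounded_clinear_diff[OF linB] bounded_clinear_diff[OF linC] sq comm)
  then have "inner (D x) (B (D x)) + inner (D x) (C (D x)) = 0"
    by (simp flip: inner_add_right)
  with nonneg_opD(3)[OF B, of "D x"] nonneg_opD(3)[OF C, of "D x"]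
  have "inner (D x) (B (D x)) = 0" "inner (D x) (C (D x)) = 0" by linarith+
  then have "D (D x) = 0"
    unfolding D_def[of "D x"] using nonneg_op_form_zero[OF B, of "D x"] nonneg_op_form_zero[OF C, of "D x"] by simp
  moreover have "cinner (D x) (D x) = cinner x (D (D x))"
    unfolding D_def[of x]
    by (simp add: cinner.diff_left nonneg_op_sym[OF B] nonneg_op_sym[OF C] D_def cinner.diff_right
        bounded_clinear_diff[OF linB] bounded_clinear_diff[OF linC])
  ultimately show "B x = C x" by (simp add: cinner_self cinner.zero_right D_def)
qed

lemma op_sqrt:
  fixes A :: "'a::chilbert_space \<Rightarrow> 'a"
  assumes A: "nonneg_op A"
  shows "nonneg_op (op_sqrt A)" "op_sqrt A (op_sqrt A x) = A x"
proof -
  obtain C where C: "nonneg_op C" "\<forall>x. C (C x) = A x"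
    "\<forall>B. bounded_clinear B \<longrightarrow> (\<forall>x. B (A x) = A (B x)) \<longrightarrow> (\<forall>x. B (C x) = C (B x))"
    by (rule nonneg_op_root_exists[OF A])
  have "op_sqrt A = C"
    unfolding op_sqrt_def
  proof (rule the_equality)
    show "nonneg_op C \<and> C \<circ> C = A" using C by auto
    fix B assume B: "nonneg_op B \<and> B \<circ> B = A"
    then have BB: "B (B x) = A x" for x by (metis comp_apply)
    \<comment> \<open>A root \<open>B\<close> commutes with its own square \<open>A\<close>, hence
      with the particular root \<open>C\<close>.\<close>
    then have "\<forall>x. B (A x) = A (B x)" by (metis BB)
    then have "\<forall>x. B (C x) = C (B x)" using C(3) B nonneg_opD(1) by blast
    then show "B = C" using B C BB by (intro nonneg_op_root_unique) auto
  qed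
  then show "nonneg_op (op_sqrt A)" "op_sqrt A (op_sqrt A x) = A x" using C by auto
qed


section \<open>Comparison of counting functions\<close>

text \<open>Weyl's inequality: constraint sets unite while levels add. The three summands will be
  the real part, the remainder and the singular part.\<close>

lemma counting_le3:
  fixes S :: "'a::chilbert_space \<Rightarrow> 'a"
  assumes S: "csa S" and r: "r > 0" and Y: "le_off A a Y" "le_off B b Z" "le_off C c W" "a + b + c \<le> r"
    and le: "\<And>x. inner x (S x) \<le> inner x (A x) + inner x (B x) + inner x (C x)"
  shows "counting 1 r S \<le> card Y + card Z + card W"
proof -
  have "le_off S r (Y \<union> Z \<union> W)"
    unfolding le_off_def
  proof (intro conjI allI impI)
    show "finite (Y \<union> Z \<union> W)" using Y by (simp add: le_off_def)
    fix x assume "\<forall>y\<in>Y \<union> Z \<union> W. cinner y x = 0"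
    then have "inner x (A x) \<le> a * (norm x)\<^sup>2" "inner x (B x) \<le> b * (norm x)\<^sup>2"
      "inner x (C x) \<le> c * (norm x)\<^sup>2"
      using Y by (simp_all add: le_off_def)
    then have "inner x (S x) \<le> (a + b + c) * (norm x)\<^sup>2" using le[of x] by (simp add: algebra_simps)
    also have "\<dots> \<le> r * (norm x)\<^sup>2" using Y(4) by (intro mult_right_mono) auto
    finally show "inner x (S x) \<le> r * (norm x)\<^sup>2" .
  qed
  then have "counting 1 r S \<le> card (Y \<union> Z \<union> W)" by (rule counting_le[OF S r])
  also have "\<dots> \<le> card Y + card Z + card W"
    using card_Un_le[of "Y \<union> Z" W] card_Un_le[of Y Z] by linarith
  finally show ?thesis .
qed

lemma le_off_scaleR:
  assumes "le_off S r Y" "0 \<le> t" "t * r \<le> r'"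
  shows "le_off (\<lambda>x. t *\<^sub>R S x) r' Y"
  unfolding le_off_def
proof (intro conjI allI impI)
  show "finite Y" using assms by (simp add: le_off_def)
  fix x assume "\<forall>y\<in>Y. cinner y x = 0"
  then have "inner x (S x) \<le> r * (norm x)\<^sup>2" using assms by (simp add: le_off_def)
  then have "t * inner x (S x) \<le> t * (r * (norm x)\<^sup>2)" using assms(2) by (rule mult_left_mono)
  also have "\<dots> = (t * r) * (norm x)\<^sup>2" by simp
  also have "\<dots> \<le> r' * (norm x)\<^sup>2" using assms(3) by (intro mult_right_mono) auto
  finally show "inner x (t *\<^sub>R S x) \<le> r' * (norm x)\<^sup>2" by simp
qed

text \<open>For \<open>u = L' x\<close> the squared norm of \<open>u\<close> is the real scalar
  product of \<open>x\<close> with \<open>L u\<close>, so it is at most the norm of \<open>x\<close>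
  times \<open>sqrt r\<close> times the norm of \<open>u\<close>. The conditions on \<open>u\<close>
  become conditions on \<open>x\<close> by moving \<open>Y\<close> through \<open>L\<close>.\<close>

lemma le_off_gram_transpose:
  assumes L: "adj L L'" and Y: "le_off (\<lambda>x. L' (L x)) r Y" and r: "0 \<le> r"
  shows "le_off (\<lambda>x. L (L' x)) r (L ` Y)" "card (L ` Y) \<le> card Y"
proof -
  have fin: "finite Y" using Y by (simp add: le_off_def)
  then show "card (L ` Y) \<le> card Y" by (rule card_image_le)
  show "le_off (\<lambda>x. L (L' x)) r (L ` Y)"
    unfolding le_off_def
  proof (intro conjI allI impI)
    show "finite (L ` Y)" using fin by simp
    fix x assume x: "\<forall>y\<in>L ` Y. cinner y x = 0"
    define u where "u = L' x"
    have i: "inner a (L' b) = inner (L a) b" for a b by (simp add: adjD[OF L] flip: Re_cinner)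
    have "\<forall>y\<in>Y. cinner y u = 0" using x by (simp add: u_def adjD[OF L])
    then have "inner u (L' (L u)) \<le> r * (norm u)\<^sup>2" using Y by (simp add: le_off_def)
    then have Lu: "(norm (L u))\<^sup>2 \<le> r * (norm u)\<^sup>2" by (simp add: i power2_norm_eq_inner)
    have uu: "inner x (L u) = (norm u)\<^sup>2"
      by (simp add: inner_commute[of x] u_def power2_norm_eq_inner flip: i)
    then have "(norm u)\<^sup>2 \<le> norm x * norm (L u)" using norm_cauchy_schwarz[of x "L u"] by simp
    then have "((norm u)\<^sup>2)\<^sup>2 \<le> (norm x * norm (L u))\<^sup>2" by (intro power_mono) auto
    also have "\<dots> \<le> (norm x)\<^sup>2 * (r * (norm u)\<^sup>2)"
      unfolding power_mult_distrib by (intro mult_left_mono Lu) simp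
    finally have "(norm u)\<^sup>2 * (norm u)\<^sup>2 \<le> (r * (norm x)\<^sup>2) * (norm u)\<^sup>2"
      by (simp add: power2_eq_square mult_ac)
    then have "(norm u)\<^sup>2 \<le> r * (norm x)\<^sup>2"
      using r mult_right_le_imp_le[of "(norm u)\<^sup>2" "(norm u)\<^sup>2" "r * (norm x)\<^sup>2"]
      by (cases "u = 0") auto
    then show "inner x (L (L' x)) \<le> r * (norm x)\<^sup>2" using uu by (simp add: u_def)
  qed
qed

lemma csa_scaleR:
  assumes S: "csa S"
  shows "csa (\<lambda>x. t *\<^sub>R S x)"
  using compact_op_left[OF csaD(1)[OF S] bounded_clinear_scaleR_left[OF bounded_clinear_id], of t]
  by (simp add: csa_def self_adjoint_def cinner.scaleR_left cinner.scaleR_right csaD(4)[OF S]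
      bounded_clinear_scaleR_left csaD(3)[OF S])

text \<open>Nonnegativity of \<open>B\<close> makes the count nondecreasing: a set \<open>Y\<close>
  admissible at the larger parameter is admissible at the smaller one.\<close>

lemma counting_mono_measurable:
  fixes A B :: "'a::chilbert_space \<Rightarrow> 'a"
  assumes S: "\<And>t. csa (\<lambda>x. A x + t *\<^sub>R B x)" and B: "\<And>x. 0 \<le> inner x (B x)"
  shows "(\<lambda>t. real (counting 1 1 (\<lambda>x. A x + t *\<^sub>R B x))) \<in> borel_measurable borel"
proof (rule borel_measurable_mono, rule monoI)
  fix s t :: real assume st: "s \<le> t"
  obtain Y where Y: "card Y = counting 1 1 (\<lambda>x. A x + t *\<^sub>R B x)" "le_off (\<lambda>x. A x + t *\<^sub>R B x) 1 Y"
    by (rule counting_witness[OF S zero_less_one])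
  have "le_off (\<lambda>x. A x + s *\<^sub>R B x) 1 Y"
    unfolding le_off_def
  proof (intro conjI allI impI)
    show "finite Y" using Y(2) by (simp add: le_off_def)
    fix x assume "\<forall>y\<in>Y. cinner y x = 0"
    then have "inner x (A x + t *\<^sub>R B x) \<le> 1 * (norm x)\<^sup>2" using Y(2) by (simp add: le_off_def)
    moreover have "s * inner x (B x) \<le> t * inner x (B x)" by (rule mult_right_mono[OF st B])
    ultimately show "inner x (A x + s *\<^sub>R B x) \<le> 1 * (norm x)\<^sup>2" by (simp add: inner_add_right)
  qed
  from counting_le[OF S zero_less_one this]
  show "real (counting 1 1 (\<lambda>x. A x + s *\<^sub>R B x)) \<le> real (counting 1 1 (\<lambda>x. A x + t *\<^sub>R B x))"
    by (simp add: Y(1))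
qed

section \<open>Integration against the Cauchy kernel\<close>

lemma nn_integral_cauchy_tail:
  assumes s: "s > 0"
  shows "(\<integral>\<^sup>+t. ennreal (indicator {1 / s<..} t / (1 + t\<^sup>2)) \<partial>lborel) = ennreal (arctan s)"
proof -
  have "(\<integral>\<^sup>+t. ennreal (indicator {1 / s<..} t / (1 + t\<^sup>2)) \<partial>lborel)
      = (\<integral>\<^sup>+t. ennreal (1 / (1 + t\<^sup>2)) * indicator {1 / s..} t \<partial>lborel)"
  proof (rule nn_integral_cong_AE)
    show "AE t in lborel. ennreal (indicator {1 / s<..} t / (1 + t\<^sup>2)) = ennreal (1 / (1 + t\<^sup>2)) * indicator {1 / s..} t"
      using AE_lborel_singleton[of "1 / s"] by eventually_elim (auto simp: indicator_def)
  qed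
  also have "\<dots> = ennreal (pi / 2 - arctan (1 / s))"
  proof (rule nn_integral_FTC_atLeast)
    show "(arctan has_real_derivative 1 / (1 + x\<^sup>2)) (at x)" for x
      using DERIV_arctan[of x] by (simp add: inverse_eq_divide)
  qed (auto intro: tendsto_arctan_at_top)
  also have "pi / 2 - arctan (1 / s) = arctan s"
    using arctan_inverse[of s] s by (simp add: sgn_if inverse_eq_divide)
  finally show ?thesis .
qed

lemma integrable_cauchy: "integrable lborel (\<lambda>t::real. 1 / (1 + t\<^sup>2))"
proof (rule integrableI_bounded)
  have neg: "(\<integral>\<^sup>+t. ennreal (indicator {1<..} (- t) / (1 + t\<^sup>2)) \<partial>lborel) = ennreal (arctan 1)"
    using nn_integral_real_affine[of "\<lambda>t. ennreal (indicator {1<..} t / (1 + t\<^sup>2))" "-1" 0]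
      nn_integral_cauchy_tail[of 1] by simp
  have "(\<integral>\<^sup>+t. ennreal (norm (1 / (1 + t\<^sup>2) :: real)) \<partial>lborel)
      \<le> (\<integral>\<^sup>+t. indicator {-1..1} t + (ennreal (indicator {1 / 1<..} t / (1 + t\<^sup>2))
          + ennreal (indicator {1<..} (- t) / (1 + t\<^sup>2))) \<partial>lborel)"
  proof (rule nn_integral_mono)
    fix t :: real
    have "1 / (1 + t\<^sup>2) \<le> 1" by (simp add: divide_le_eq_1 add_pos_nonneg)
    then show "ennreal (norm (1 / (1 + t\<^sup>2))) \<le> indicator {-1..1} t + (ennreal (indicator {1 / 1<..} t / (1 + t\<^sup>2))
          + ennreal (indicator {1<..} (- t) / (1 + t\<^sup>2)))"
      by (auto simp: indicator_def simp flip: ennreal_1 ennreal_plus)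
  qed
  also have "\<dots> = emeasure lborel {-1..1::real} + (ennreal (arctan 1) + ennreal (arctan 1))"
    using nn_integral_cauchy_tail[of 1] neg by (subst nn_integral_add | simp)+
  also have "\<dots> < \<infinity>" by simp
  finally show "(\<integral>\<^sup>+t. ennreal (norm (1 / (1 + t\<^sup>2) :: real)) \<partial>lborel) < \<infinity>" .
qed simp

text \<open>Countability of \<open>E\<close> licenses the exchange of the sum over eigenvalues with
  the Lebesgue integral.\<close>

lemma diag_countable:
  assumes D: "diag S E s"
  shows "countable E"
proof -
  have "E \<subseteq> (\<Union>n::nat. {e \<in> E. 1 / (real n + 1) \<le> \<bar>s e\<bar>})"
  proof
    fix e assume e: "e \<in> E"
    then have "\<bar>s e\<bar> > 0" using diagD(3)[OF D] by auto
    then obtain n where "inverse (real (Suc n)) < \<bar>s e\<bar>" using reals_Archimedean by blast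
    then have "1 / (real n + 1) \<le> \<bar>s e\<bar>" by (simp add: inverse_eq_divide add.commute)
    then show "e \<in> (\<Union>n::nat. {e \<in> E. 1 / (real n + 1) \<le> \<bar>s e\<bar>})" using e by blast
  qed
  moreover have "countable (\<Union>n::nat. {e \<in> E. 1 / (real n + 1) \<le> \<bar>s e\<bar>})"
    by (rule countable_UN[OF countableI_type], rule countable_finite, rule diagD(4)[OF D]) simp
  ultimately show ?thesis by (rule countable_subset)
qed

lemma counting_ray:
  fixes S :: "'a::chilbert_space \<Rightarrow> 'a"
  assumes S: "csa S" and D: "diag S E s" and pos: "\<And>e. e \<in> E \<Longrightarrow> 0 < s e"
  shows "ennreal (real (counting 1 1 (\<lambda>x. t *\<^sub>R S x)) / (1 + t\<^sup>2))
      = (\<integral>\<^sup>+e. ennreal (indicator {1 / s e<..} t / (1 + t\<^sup>2)) \<partial>count_space E)"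
proof (cases "t > 0")
  case True
  have D': "diag (\<lambda>x. t *\<^sub>R S x) E (\<lambda>e. t * s e)"
    unfolding diag_def
  proof (intro conjI ballI allI impI)
    fix r :: real assume "r > 0"
    then have "finite {e \<in> E. r / t \<le> \<bar>s e\<bar>}" using True by (intro diagD(4)[OF D]) simp
    moreover have "{e \<in> E. r / t \<le> \<bar>s e\<bar>} = {e \<in> E. r \<le> \<bar>t * s e\<bar>}"
      using True by (auto simp: abs_mult field_simps)
    ultimately show "finite {e \<in> E. r \<le> \<bar>t * s e\<bar>}" by simp
  qed (use D True in \<open>auto simp: diag_def\<close>)
  let ?L = "{e \<in> E. t * s e > 1}"
  have fin: "finite ?L" by (rule diag_finite_above[OF D' zero_less_one])
  have "(\<integral>\<^sup>+e. ennreal (indicator {1 / s e<..} t / (1 + t\<^sup>2)) \<partial>count_space E)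
      = (\<integral>\<^sup>+e. ennreal (1 / (1 + t\<^sup>2)) * indicator ?L e \<partial>count_space E)"
  proof (rule nn_integral_cong)
    fix e assume "e \<in> space (count_space E)"
    then have "e \<in> E" by simp
    with pos[OF this] show "ennreal (indicator {1 / s e<..} t / (1 + t\<^sup>2)) = ennreal (1 / (1 + t\<^sup>2)) * indicator ?L e"
      by (auto simp: indicator_def field_simps)
  qed
  also have "\<dots> = ennreal (1 / (1 + t\<^sup>2)) * of_nat (card ?L)"
    by (subst nn_integral_cmult_indicator) (use fin in \<open>auto simp: emeasure_count_space_finite\<close>)
  also have "\<dots> = ennreal (1 / (1 + t\<^sup>2) * real (card ?L))"
    by (subst ennreal_mult) (auto simp: ennreal_of_nat_eq_real_of_nat)
  finally show ?thesis using counting_diag[OF csa_scaleR[OF S] D' zero_less_one] by simp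
next
  case False
  have "le_off (\<lambda>x. t *\<^sub>R S x) 1 {}"
    unfolding le_off_def
  proof (intro conjI allI impI)
    fix x
    have "0 \<le> inner x (S x)"
      by (rule has_sum_nonneg[OF diag_form_has_sum[OF S D]]) (use pos in \<open>auto simp: less_imp_le\<close>)
    then have "t * inner x (S x) \<le> 0" using False by (simp add: mult_nonpos_nonneg)
    then have "t * inner x (S x) \<le> (norm x)\<^sup>2" using zero_le_power2[of "norm x"] by linarith
    then show "inner x (t *\<^sub>R S x) \<le> 1 * (norm x)\<^sup>2" by simp
  qed simp
  from counting_le[OF csa_scaleR[OF S] zero_less_one this]
  have "counting 1 1 (\<lambda>x. t *\<^sub>R S x) = 0" by simp
  moreover have "(\<integral>\<^sup>+e. ennreal (indicator {1 / s e<..} t / (1 + t\<^sup>2)) \<partial>count_space E) = (\<integral>\<^sup>+e. 0 \<partial>count_space E)"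
  proof (rule nn_integral_cong)
    fix e assume "e \<in> space (count_space E)"
    then have "0 < 1 / s e" using pos by simp
    then have "\<not> 1 / s e < t" using False by linarith
    then show "ennreal (indicator {1 / s e<..} t / (1 + t\<^sup>2)) = 0" using False by (simp add: indicator_def)
  qed
  ultimately show ?thesis by simp
qed

text \<open>Fubini for the layer-cake formula: each eigenvalue \<open>s\<close> contributes \<open>\<integral> dt / (1 + t\<^sup>2)\<close> over \<open>t > 1 / s\<close>,
  which is \<open>arctan s\<close>.\<close>

lemma integral_counting_ray:
  fixes S :: "'a::chilbert_space \<Rightarrow> 'a"
  assumes S: "csa S" and nn: "\<And>x. 0 \<le> inner x (S x)"
    and tr: "\<And>F. finite F \<Longrightarrow> onset F \<Longrightarrow> (\<Sum>e\<in>F. inner e (S e)) \<le> c"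
  shows "has_bochner_integral lborel (\<lambda>t. real (counting 1 1 (\<lambda>x. t *\<^sub>R S x)) / (1 + t\<^sup>2)) (tr_arctan S)"
    and "tr_arctan S \<le> c"
proof -
  obtain E s where D: "diag S E s" by (rule diag_exists[OF S])
  have ses: "s e = inner e (S e)" if "e \<in> E" for e
    using diagD(2)[OF D that] onset_norm[OF diagD(1)[OF D] that] by (simp flip: power2_norm_eq_inner)
  have pos: "0 < s e" if "e \<in> E" for e
    using ses[OF that] nn[of e] diagD(3)[OF D that] by simp
  have fs: "(\<Sum>e\<in>F. arctan (s e)) \<le> c" if F: "finite F" "F \<subseteq> E" for F
  proof -
    have "(\<Sum>e\<in>F. arctan (s e)) \<le> (\<Sum>e\<in>F. inner e (S e))"
      using F pos ses by (intro sum_mono) (metis arctan_le_self less_imp_le subsetD)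
    also have "\<dots> \<le> c" by (rule tr[OF F(1) onset_subset[OF diagD(1)[OF D] F(2)]])
    finally show ?thesis .
  qed
  have an: "0 \<le> arctan (s e)" if "e \<in> E" for e using pos[OF that] by simp
  have sm: "(\<lambda>e. arctan (s e)) summable_on E"
  proof (rule nonneg_bdd_above_summable_on[OF an])
    show "bdd_above (sum (\<lambda>e. arctan (s e)) ` {F. F \<subseteq> E \<and> finite F})"
      by (rule bdd_aboveI2[of _ _ c]) (use fs in auto)
  qed
  have "op_trace (fun_calc arctan S) = of_real (\<Sum>\<^sub>\<infinity>e\<in>E. arctan (s e))"
    by (rule op_trace_fun_calc[OF S D _ an sm]) auto
  then have ta: "tr_arctan S = (\<Sum>\<^sub>\<infinity>e\<in>E. arctan (s e))" by (simp add: tr_arctan_def)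
  then show "tr_arctan S \<le> c" using infsum_le_finite_sums[OF sm fs] by simp
  have ta0: "0 \<le> tr_arctan S" unfolding ta by (rule infsum_nonneg) (rule an)
  have "(\<integral>\<^sup>+t. ennreal (real (counting 1 1 (\<lambda>x. t *\<^sub>R S x)) / (1 + t\<^sup>2)) \<partial>lborel)
      = (\<integral>\<^sup>+t. \<integral>\<^sup>+e. ennreal (indicator {1 / s e<..} t / (1 + t\<^sup>2)) \<partial>count_space E \<partial>lborel)"
    by (simp only: counting_ray[OF S D pos])
  also have "\<dots> = (\<integral>\<^sup>+e. \<integral>\<^sup>+t. ennreal (indicator {1 / s e<..} t / (1 + t\<^sup>2)) \<partial>lborel \<partial>count_space E)"
    by (rule nn_integral_count_space_nn_integral[OF diag_countable[OF D]]) simp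
  also have "\<dots> = (\<integral>\<^sup>+e. ennreal (arctan (s e)) \<partial>count_space E)"
    by (intro nn_integral_cong nn_integral_cauchy_tail pos) simp
  also have "\<dots> = ennreal (tr_arctan S)"
  proof -
    have "Infinite_Sum.abs_summable_on (\<lambda>e. arctan (s e)) E"
      by (rule iffD1[OF summable_on_iff_abs_summable_on_real sm])
    then have abs: "Infinite_Set_Sum.abs_summable_on (\<lambda>e. arctan (s e)) E"
      by (simp only: abs_summable_equivalent)
    show ?thesis
      by (simp only: nn_integral_conv_infsetsum[OF abs an] infsetsum_infsum[OF abs] ta)
  qed
  finally have nnI: "(\<integral>\<^sup>+t. ennreal (real (counting 1 1 (\<lambda>x. t *\<^sub>R S x)) / (1 + t\<^sup>2)) \<partial>lborel) = ennreal (tr_arctan S)" .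
  have "(\<lambda>t. real (counting 1 1 (\<lambda>x. t *\<^sub>R S x))) \<in> borel_measurable borel"
    using counting_mono_measurable[of "\<lambda>x. 0" S] csa_scaleR[OF S] nn by simp
  then show "has_bochner_integral lborel (\<lambda>t. real (counting 1 1 (\<lambda>x. t *\<^sub>R S x)) / (1 + t\<^sup>2)) (tr_arctan S)"
    by (intro has_bochner_integral_nn_integral ta0 nnI) (auto intro!: AE_I2 borel_measurable_divide)
qed


section \<open>The abstract estimate\<close>

text \<open>Here \<open>A\<close> and \<open>B\<close> are the real and imaginary parts of the sandwiched resolvent, \<open>L L\<^sup>*\<close> is the singular
  part of \<open>B\<close> and \<open>D\<close> collects bounded remainders.\<close>

locale cauchy_average =
  fixes A B D :: "'h::chilbert_space \<Rightarrow> 'h" and L :: "'g::chilbert_space \<Rightarrow> 'h" and L'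
    and \<tau> \<epsilon> a b c l :: real
  assumes AB: "\<And>t. csa (\<lambda>x. \<tau> *\<^sub>R A x + t *\<^sub>R B x)" and A: "csa A" "hs_bound A a" and \<tau>: "\<bar>\<tau>\<bar> = 1"
    and B: "csa B" "\<And>x. 0 \<le> inner x (B x)"
      "\<And>F. finite F \<Longrightarrow> onset F \<Longrightarrow> (\<Sum>e\<in>F. inner e (B e)) \<le> b"
    and D: "csa D" "\<And>x. 0 \<le> inner x (D x)"
      "\<And>F. finite F \<Longrightarrow> onset F \<Longrightarrow> (\<Sum>e\<in>F. inner e (D e)) \<le> c"
    and L: "adj L L'" "hs_bound L l" "bounded_clinear L'"
    and \<epsilon>: "0 < \<epsilon>" "\<epsilon> < 1"
    and upper: "\<And>x. inner x (B x) \<le> (1 + \<epsilon> / 4) * (norm (L' x))\<^sup>2 + inner x (D x)"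
    and lower: "\<And>x. (norm (L' x))\<^sup>2 \<le> (1 + \<epsilon> / 4) * inner x (B x) + inner x (D x)"
begin

definition N :: "real \<Rightarrow> real" where
  "N t = real (counting 1 1 (\<lambda>x. \<tau> *\<^sub>R A x + t *\<^sub>R B x))"

definition ray :: "('x::chilbert_space \<Rightarrow> 'x) \<Rightarrow> real \<Rightarrow> real" where
  "ray S t = real (counting 1 1 (\<lambda>x. t *\<^sub>R S x))"

text \<open>The Gram operator on the small space. The scale \<open>r\<close> will be
  \<open>1 / (1 - \<epsilon>)\<close> or \<open>1 / (1 + \<epsilon>)\<close>, that is, the rescaling
  of V in \<open>sim_along\<close>.\<close>

definition G :: "real \<Rightarrow> 'g \<Rightarrow> 'g" where
  "G r x = r *\<^sub>R L' (L x)"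

lemma inner_gram: "inner x (L' (L x)) = (norm (L x))\<^sup>2"
  by (simp add: adjD[OF L(1), symmetric] cinner_self flip: Re_cinner)

lemma inner_cogram: "inner x (L (L' x)) = (norm (L' x))\<^sup>2"
  by (simp add: adjD[OF adj_sym[OF L(1)], symmetric] cinner_self flip: Re_cinner)

lemma csa_G: "csa (G r)"
proof -
  obtain k where "k > 0" "\<And>x. norm (L' x) \<le> k * norm x" by (rule bounded_clinear_bound[OF L(3)]) blast
  then have "hs_bound (\<lambda>x. L' (L x)) (k\<^sup>2 * l)" by (intro hs_bound_left[OF L(2,3)])
  moreover have "adj (\<lambda>x. L' (L x)) (\<lambda>x. L' (L x))" by (rule adj_compose[OF adj_sym[OF L(1)] L(1)])
  ultimately have "csa (\<lambda>x. L' (L x))" by (rule csa_hs)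
  then show ?thesis unfolding G_def[abs_def] by (rule csa_scaleR)
qed

lemma ray_integral:
  assumes "csa S" "\<And>x. 0 \<le> inner x (S x)" "\<And>F. finite F \<Longrightarrow> onset F \<Longrightarrow> (\<Sum>e\<in>F. inner e (S e)) \<le> m"
  shows "integrable lborel (\<lambda>t. ray S t / (1 + t\<^sup>2))" "(LINT t|lborel. ray S t / (1 + t\<^sup>2)) = tr_arctan S"
    "tr_arctan S \<le> m"
  using integral_counting_ray[OF assms]
  by (auto simp: ray_def has_bochner_integral_iff)

lemma G_nonneg: "0 \<le> r \<Longrightarrow> 0 \<le> inner x (G r x)"
  by (simp add: G_def inner_gram)

lemma G_trace:
  assumes "0 \<le> r" "finite F" "onset F"
  shows "(\<Sum>e\<in>F. inner e (G r e)) \<le> r * l"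
  using mult_left_mono[OF hs_boundD(2)[OF L(2) assms(2,3)] assms(1)]
  by (simp add: G_def inner_gram sum_distrib_left)

lemma trace_scaleR:
  assumes "0 \<le> r" "(\<Sum>e\<in>F. inner e (S e)) \<le> c'"
  shows "(\<Sum>e\<in>F. inner e (r *\<^sub>R S e)) \<le> r * c'"
  using mult_left_mono[OF assms(2,1)] by (simp add: sum_distrib_left)

text \<open>The range \<open>\<bar>q\<bar> \<le> 2\<close> admits both \<open>\<tau>\<close> and the
  multiple \<open>- \<tau> * (1 + \<epsilon> / 4)\<close> of the lower estimate. At
  \<open>r = \<epsilon> / 4\<close> the bound reads
  \<open>64 * a / \<epsilon>\<^sup>2\<close>.\<close>

lemma counting_A:
  assumes "r > 0" "\<bar>q\<bar> \<le> 2"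
  shows "real (counting 1 r (\<lambda>x. q *\<^sub>R A x)) \<le> 4 * a / r\<^sup>2"
proof -
  have "\<bar>q\<bar>\<^sup>2 \<le> 2\<^sup>2" by (intro power_mono assms) simp
  then have "q\<^sup>2 * a \<le> 4 * a" using hs_boundD(3)[OF A(2)] by (intro mult_right_mono) auto
  then have "q\<^sup>2 * a / r\<^sup>2 \<le> 4 * a / r\<^sup>2" by (rule divide_right_mono) simp
  with counting_hs_bound[OF csa_scaleR[OF A(1)] hs_bound_scaleR[OF A(2)] assms(1), of q]
  show ?thesis by linarith
qed

lemma ray_witness:
  assumes "csa S" "t > 0"
  obtains Y where "real (card Y) = ray S t" "le_off S (1 / t) Y"
proof -
  obtain Y where Y: "card Y = counting 1 1 (\<lambda>x. t *\<^sub>R S x)" "le_off (\<lambda>x. t *\<^sub>R S x) 1 Y"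
    by (rule counting_witness[OF csa_scaleR[OF assms(1)] zero_less_one])
  have "le_off (\<lambda>x. (1 / t) *\<^sub>R t *\<^sub>R S x) (1 / t) Y"
    by (rule le_off_scaleR[OF Y(2)]) (use assms in auto)
  then show ?thesis using Y(1) assms by (intro that[of Y]) (simp_all add: ray_def)
qed

text \<open>For \<open>t > 0\<close> the level 1 is distributed as \<open>\<epsilon> / 4\<close> for
  \<open>A\<close>, \<open>\<epsilon> / 4\<close> for \<open>t D\<close> and
  \<open>1 - \<epsilon> / 2\<close> for the singular part. The last is affordable because \<open>(1
  + \<epsilon> / 4) * (1 - \<epsilon>) \<le> 1 - \<epsilon> / 2\<close>.\<close>

lemma N_upper:
  "N t \<le> 64 * a / \<epsilon>\<^sup>2 + ray (\<lambda>x. (4 / \<epsilon>) *\<^sub>R D x) t + ray (G (1 / (1 - \<epsilon>))) t"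
proof -
  have e4: "0 < \<epsilon> / 4" using \<epsilon> by simp
  obtain Y where Y: "card Y = counting 1 (\<epsilon> / 4) (\<lambda>x. \<tau> *\<^sub>R A x)" "le_off (\<lambda>x. \<tau> *\<^sub>R A x) (\<epsilon> / 4) Y"
    by (rule counting_witness[OF csa_scaleR[OF A(1)] e4])
  have cY: "real (card Y) \<le> 64 * a / \<epsilon>\<^sup>2"
    using counting_A[of "\<epsilon> / 4" \<tau>] \<epsilon> \<tau> by (simp add: Y(1) power_divide)
  have ray0: "0 \<le> ray S t" for S :: "'x::chilbert_space \<Rightarrow> 'x" by (simp add: ray_def)
  have emp: "le_off (\<lambda>x. 0) 0 {}" by (simp add: le_off_def)
  show ?thesis
  proof (cases "t > 0")
    case True
    obtain Z where Z: "real (card Z) = ray (\<lambda>x. (4 / \<epsilon>) *\<^sub>R D x) t" "le_off (\<lambda>x. (4 / \<epsilon>) *\<^sub>R D x) (1 / t) Z"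
      by (rule ray_witness[OF csa_scaleR[OF D(1)] True])
    obtain W where W: "real (card W) = ray (G (1 / (1 - \<epsilon>))) t" "le_off (G (1 / (1 - \<epsilon>))) (1 / t) W"
      by (rule ray_witness[OF csa_G True])
    have "le_off (\<lambda>x. (t * \<epsilon> / 4) *\<^sub>R (4 / \<epsilon>) *\<^sub>R D x) (\<epsilon> / 4) Z"
      by (rule le_off_scaleR[OF Z(2)]) (use \<epsilon> True in auto)
    then have Z': "le_off (\<lambda>x. t *\<^sub>R D x) (\<epsilon> / 4) Z" using \<epsilon> by simp
    have "le_off (\<lambda>x. (1 - \<epsilon>) *\<^sub>R G (1 / (1 - \<epsilon>)) x) ((1 - \<epsilon>) / t) W"
      by (rule le_off_scaleR[OF W(2)]) (use \<epsilon> in auto)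
    then have W1: "le_off (\<lambda>x. L' (L x)) ((1 - \<epsilon>) / t) W" using \<epsilon> by (simp add: G_def)
    note W2 = le_off_gram_transpose[OF L(1) W1]
    have "0 \<le> (1 - \<epsilon>) / t" using \<epsilon> True by simp
    note W2 = W2[OF this]
    have q: "t * (1 + \<epsilon> / 4) * ((1 - \<epsilon>) / t) \<le> 1 - \<epsilon> / 2"
    proof -
      have "t * (1 + \<epsilon> / 4) * ((1 - \<epsilon>) / t) = (1 + \<epsilon> / 4) * (1 - \<epsilon>)" using True by simp
      also have "\<dots> = 1 - \<epsilon> * (3 / 4) - \<epsilon>\<^sup>2 / 4" by (simp add: power2_eq_square field_simps)
      also have "\<dots> \<le> 1 - \<epsilon> / 2" using \<epsilon> zero_le_power2[of \<epsilon>] by argo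
      finally show ?thesis .
    qed
    have W3: "le_off (\<lambda>x. (t * (1 + \<epsilon> / 4)) *\<^sub>R L (L' x)) (1 - \<epsilon> / 2) (L ` W)"
      by (rule le_off_scaleR[OF W2(1)]) (use \<epsilon> True q in auto)
    have "counting 1 1 (\<lambda>x. \<tau> *\<^sub>R A x + t *\<^sub>R B x) \<le> card Y + card Z + card (L ` W)"
    proof (rule counting_le3[OF AB zero_less_one Y(2) Z' W3])
      fix x
      have "t * inner x (B x) \<le> t * ((1 + \<epsilon> / 4) * (norm (L' x))\<^sup>2 + inner x (D x))"
        using True by (intro mult_left_mono upper) simp
      then show "inner x (\<tau> *\<^sub>R A x + t *\<^sub>R B x) \<le>
          inner x (\<tau> *\<^sub>R A x) + inner x (t *\<^sub>R D x) + inner x ((t * (1 + \<epsilon> / 4)) *\<^sub>R L (L' x))"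
        by (simp add: inner_add_right inner_cogram algebra_simps)
    qed simp
    then show ?thesis using cY Z(1) W(1) W2(2) unfolding N_def by linarith
  next
    case False
    have Y1: "le_off (\<lambda>x. \<tau> *\<^sub>R A x) 1 Y"
      using le_off_scaleR[OF Y(2), of 1 1] \<epsilon> by simp
    have "counting 1 1 (\<lambda>x. \<tau> *\<^sub>R A x + t *\<^sub>R B x) \<le> card Y + card ({} :: 'h set) + card ({} :: 'h set)"
    proof (rule counting_le3[OF AB zero_less_one Y1 emp emp])
      fix x
      have "t * inner x (B x) \<le> 0" using False by (intro mult_nonpos_nonneg B) simp
      then show "inner x (\<tau> *\<^sub>R A x + t *\<^sub>R B x) \<le> inner x (\<tau> *\<^sub>R A x) + inner x 0 + inner x 0"
        by (simp add: inner_add_right)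
    qed simp
    then show ?thesis
      using cY ray0[of "\<lambda>x. (4 / \<epsilon>) *\<^sub>R D x"] ray0[of "G (1 / (1 - \<epsilon>))"] unfolding N_def by simp
  qed
qed

text \<open>The roles are reversed: the singular form is bounded by the full form times
  \<open>1 + \<epsilon> / 4\<close>, minus the multiple of \<open>A\<close> contained in it, plus
  \<open>t D\<close>. The levels add up to \<open>1 + \<epsilon> * (3 / 4)\<close>, which is at most
  \<open>1 + \<epsilon>\<close>.\<close>

lemma N_lower:
  "ray (G (1 / (1 + \<epsilon>))) t \<le> N t + 64 * a / \<epsilon>\<^sup>2 + ray (\<lambda>x. (4 / \<epsilon>) *\<^sub>R D x) t"
proof -
  have a0: "0 \<le> 64 * a / \<epsilon>\<^sup>2" using hs_boundD(3)[OF A(2)] by simp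
  have emp: "le_off (\<lambda>x. 0) 0 {}" by (simp add: le_off_def)
  show ?thesis
  proof (cases "t > 0")
    case True
    let ?q = "1 + \<epsilon> / 4"
    have e4: "0 < \<epsilon> / 4" using \<epsilon> by simp
    obtain Y where Y: "card Y = counting 1 (\<epsilon> / 4) (\<lambda>x. (- \<tau> * ?q) *\<^sub>R A x)"
      "le_off (\<lambda>x. (- \<tau> * ?q) *\<^sub>R A x) (\<epsilon> / 4) Y"
      by (rule counting_witness[OF csa_scaleR[OF A(1)] e4])
    have cY: "real (card Y) \<le> 64 * a / \<epsilon>\<^sup>2"
      using counting_A[of "\<epsilon> / 4" "- \<tau> * ?q"] \<epsilon> \<tau> by (simp add: Y(1) power_divide abs_mult)
    obtain Z where Z: "real (card Z) = ray (\<lambda>x. (4 / \<epsilon>) *\<^sub>R D x) t" "le_off (\<lambda>x. (4 / \<epsilon>) *\<^sub>R D x) (1 / t) Z"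
      by (rule ray_witness[OF csa_scaleR[OF D(1)] True])
    have "le_off (\<lambda>x. (t * \<epsilon> / 4) *\<^sub>R (4 / \<epsilon>) *\<^sub>R D x) (\<epsilon> / 4) Z"
      by (rule le_off_scaleR[OF Z(2)]) (use \<epsilon> True in auto)
    then have Z': "le_off (\<lambda>x. t *\<^sub>R D x) (\<epsilon> / 4) Z" using \<epsilon> by simp
    obtain W where W: "card W = counting 1 1 (\<lambda>x. \<tau> *\<^sub>R A x + t *\<^sub>R B x)"
      "le_off (\<lambda>x. \<tau> *\<^sub>R A x + t *\<^sub>R B x) 1 W"
      by (rule counting_witness[OF AB zero_less_one])
    have W': "le_off (\<lambda>x. ?q *\<^sub>R (\<tau> *\<^sub>R A x + t *\<^sub>R B x)) ?q W"
      by (rule le_off_scaleR[OF W(2)]) (use \<epsilon> in auto)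
    define U where "U = Y \<union> Z \<union> W"
    have cU: "card U \<le> card Y + card Z + card W"
      unfolding U_def using card_Un_le[of "Y \<union> Z" W] card_Un_le[of Y Z] by linarith
    have U: "le_off (\<lambda>x. L (L' x)) ((1 + \<epsilon>) / t) U"
      unfolding le_off_def
    proof (intro conjI allI impI)
      show "finite U" using Y Z W by (simp add: U_def le_off_def)
      fix x assume "\<forall>y\<in>U. cinner y x = 0"
      then have 1: "inner x ((- \<tau> * ?q) *\<^sub>R A x) \<le> \<epsilon> / 4 * (norm x)\<^sup>2" "inner x (t *\<^sub>R D x) \<le> \<epsilon> / 4 * (norm x)\<^sup>2"
        "inner x (?q *\<^sub>R (\<tau> *\<^sub>R A x + t *\<^sub>R B x)) \<le> ?q * (norm x)\<^sup>2"
        using Y(2) Z' W' unfolding le_off_def U_def by blast+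
      have "t * (norm (L' x))\<^sup>2 \<le> t * (?q * inner x (B x) + inner x (D x))"
        using True by (intro mult_left_mono lower) simp
      also have "\<dots> = inner x ((- \<tau> * ?q) *\<^sub>R A x) + inner x (t *\<^sub>R D x) + inner x (?q *\<^sub>R (\<tau> *\<^sub>R A x + t *\<^sub>R B x))"
        by (simp add: inner_add_right algebra_simps)
      also have "\<dots> \<le> \<epsilon> / 4 * (norm x)\<^sup>2 + \<epsilon> / 4 * (norm x)\<^sup>2 + ?q * (norm x)\<^sup>2"
        by (intro add_mono 1)
      also have "\<dots> = (1 + \<epsilon> * (3 / 4)) * (norm x)\<^sup>2" by (simp add: algebra_simps)
      also have "\<dots> \<le> (1 + \<epsilon>) * (norm x)\<^sup>2" using \<epsilon> by (intro mult_right_mono) auto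
      finally show "inner x (L (L' x)) \<le> (1 + \<epsilon>) / t * (norm x)\<^sup>2"
        using True by (simp add: inner_cogram field_simps)
    qed
    have "0 \<le> (1 + \<epsilon>) / t" using \<epsilon> True by simp
    note U2 = le_off_gram_transpose[OF adj_sym[OF L(1)] U this]
    have "le_off (\<lambda>x. (t / (1 + \<epsilon>)) *\<^sub>R L' (L x)) 1 (L' ` U)"
      by (rule le_off_scaleR[OF U2(1)]) (use \<epsilon> True in auto)
    then have "le_off (\<lambda>x. t *\<^sub>R G (1 / (1 + \<epsilon>)) x) 1 (L' ` U)" by (simp add: G_def)
    from counting_le[OF csa_scaleR[OF csa_G] zero_less_one this]
    have "ray (G (1 / (1 + \<epsilon>))) t \<le> real (card U)" using U2(2) by (simp add: ray_def)
    then show ?thesis using cU cY Z(1) W(1) unfolding N_def by linarith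
  next
    case False
    have "le_off (\<lambda>x. t *\<^sub>R G (1 / (1 + \<epsilon>)) x) 1 {}"
      unfolding le_off_def
    proof (intro conjI allI impI)
      fix x
      have "t * inner x (G (1 / (1 + \<epsilon>)) x) \<le> 0"
        using False \<epsilon> by (intro mult_nonpos_nonneg G_nonneg) auto
      then have "t * inner x (G (1 / (1 + \<epsilon>)) x) \<le> (norm x)\<^sup>2" using zero_le_power2[of "norm x"] by linarith
      then show "inner x (t *\<^sub>R G (1 / (1 + \<epsilon>)) x) \<le> 1 * (norm x)\<^sup>2" by simp
    qed simp
    from counting_le[OF csa_scaleR[OF csa_G] zero_less_one this]
    have "ray (G (1 / (1 + \<epsilon>))) t = 0" by (simp add: ray_def)
    then show ?thesis using a0 by (simp add: N_def ray_def)
  qed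
qed

text \<open>A rough split of the level into two halves, made only to have an integrable majorant of
  \<open>N\<close>.\<close>

lemma N_crude: "N t \<le> 16 * a + ray (\<lambda>x. 2 *\<^sub>R B x) t"
proof -
  obtain Y where Y: "card Y = counting 1 (1 / 2) (\<lambda>x. \<tau> *\<^sub>R A x)" "le_off (\<lambda>x. \<tau> *\<^sub>R A x) (1 / 2) Y"
    by (rule counting_witness[OF csa_scaleR[OF A(1)]]) auto
  obtain Z where Z: "card Z = counting 1 1 (\<lambda>x. t *\<^sub>R 2 *\<^sub>R B x)" "le_off (\<lambda>x. t *\<^sub>R 2 *\<^sub>R B x) 1 Z"
    by (rule counting_witness[OF csa_scaleR[OF csa_scaleR[OF B(1)]] zero_less_one])
  have emp: "le_off (\<lambda>x. 0) 0 {}" by (simp add: le_off_def)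
  have "le_off (\<lambda>x. (1 / 2) *\<^sub>R t *\<^sub>R 2 *\<^sub>R B x) (1 / 2) Z"
    by (rule le_off_scaleR[OF Z(2)]) auto
  then have "le_off (\<lambda>x. t *\<^sub>R B x) (1 / 2) Z" by simp
  from counting_le3[OF AB zero_less_one Y(2) this emp]
  have "counting 1 1 (\<lambda>x. \<tau> *\<^sub>R A x + t *\<^sub>R B x) \<le> card Y + card Z + card {}"
    by (simp add: inner_add_right)
  moreover have "real (card Y) \<le> 16 * a"
    using counting_A[of "1 / 2" \<tau>] \<tau> by (simp add: Y(1) power_divide)
  ultimately show ?thesis by (simp add: N_def ray_def Z(1))
qed

lemma N_integrable: "integrable lborel (\<lambda>t. N t / (1 + t\<^sup>2))"
proof (rule Bochner_Integration.integrable_bound)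
  show "integrable lborel (\<lambda>t. 16 * a * (1 / (1 + t\<^sup>2)) + ray (\<lambda>x. 2 *\<^sub>R B x) t / (1 + t\<^sup>2))"
    by (intro Bochner_Integration.integrable_add integrable_mult_right integrable_cauchy
        ray_integral(1)[OF csa_scaleR[OF B(1)] _ trace_scaleR[of 2]])
       (auto intro: B)
  have "N \<in> borel_measurable borel"
    unfolding N_def[abs_def] by (rule counting_mono_measurable[OF AB B(2)])
  then show "(\<lambda>t. N t / (1 + t\<^sup>2)) \<in> borel_measurable lborel" by (intro borel_measurable_divide) auto
  show "AE t in lborel. norm (N t / (1 + t\<^sup>2))
      \<le> norm (16 * a * (1 / (1 + t\<^sup>2)) + ray (\<lambda>x. 2 *\<^sub>R B x) t / (1 + t\<^sup>2))"
  proof (rule AE_I2)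
    fix t :: real
    have "0 < 1 + t\<^sup>2" by (simp add: add_pos_nonneg)
    then have "N t / (1 + t\<^sup>2) \<le> 16 * a * (1 / (1 + t\<^sup>2)) + ray (\<lambda>x. 2 *\<^sub>R B x) t / (1 + t\<^sup>2)"
      using divide_right_mono[OF N_crude[of t], of "1 + t\<^sup>2"] by (simp add: add_divide_distrib)
    moreover have "0 \<le> N t / (1 + t\<^sup>2)" by (simp add: N_def)
    ultimately show "norm (N t / (1 + t\<^sup>2))
      \<le> norm (16 * a * (1 / (1 + t\<^sup>2)) + ray (\<lambda>x. 2 *\<^sub>R B x) t / (1 + t\<^sup>2))"
      by simp
  qed
qed

text \<open>The first summand pays for the eigenvalues of \<open>A\<close> above
  \<open>\<epsilon> / 4\<close>, whose number is bounded independently of \<open>t\<close>; the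
  second bounds \<open>tr_arctan\<close> of \<open>(4 / \<epsilon>) *\<^sub>R D\<close>. Neither
  involves \<open>L\<close>, so both stay bounded at the threshold.\<close>

definition err :: real where
  "err = 64 * a / \<epsilon>\<^sup>2 * (LINT t|lborel. 1 / (1 + t\<^sup>2)) + 4 / \<epsilon> * c"

lemma
  shows integral_N_upper: "(LINT t|lborel. N t / (1 + t\<^sup>2)) \<le> tr_arctan (G (1 / (1 - \<epsilon>))) + err"
    and integral_N_lower: "tr_arctan (G (1 / (1 + \<epsilon>))) \<le> (LINT t|lborel. N t / (1 + t\<^sup>2)) + err"
proof -
  let ?K = "\<lambda>t::real. 1 / (1 + t\<^sup>2)" and ?a = "64 * a / \<epsilon>\<^sup>2"
  let ?D = "ray (\<lambda>x. (4 / \<epsilon>) *\<^sub>R D x)"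
  have nnD: "0 \<le> inner x ((4 / \<epsilon>) *\<^sub>R D x)" for x using D(2)[of x] \<epsilon> by simp
  have trD: "(\<Sum>e\<in>F. inner e ((4 / \<epsilon>) *\<^sub>R D e)) \<le> 4 / \<epsilon> * c" if "finite F" "onset F" for F
    by (rule trace_scaleR[OF _ D(3)[OF that]]) (use \<epsilon> in simp)
  have D': "integrable lborel (\<lambda>t. ?D t / (1 + t\<^sup>2))"
    "(LINT t|lborel. ?D t / (1 + t\<^sup>2)) = tr_arctan (\<lambda>x. (4 / \<epsilon>) *\<^sub>R D x)"
    "tr_arctan (\<lambda>x. (4 / \<epsilon>) *\<^sub>R D x) \<le> 4 / \<epsilon> * c"
    by (rule ray_integral[OF csa_scaleR[OF D(1)] nnD trD], assumption+)+
  have G': "integrable lborel (\<lambda>t. ray (G r) t / (1 + t\<^sup>2))"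
    "(LINT t|lborel. ray (G r) t / (1 + t\<^sup>2)) = tr_arctan (G r)" if "0 \<le> r" for r
    by (rule ray_integral[OF csa_G G_nonneg[OF that] G_trace[OF that]], assumption+)+
  have p: "0 \<le> 1 / (1 - \<epsilon>)" "0 \<le> 1 / (1 + \<epsilon>)" using \<epsilon> by auto
  note ia = integrable_mult_right[OF integrable_cauchy, of ?a]
  have pos: "0 \<le> 1 + t\<^sup>2" for t :: real by (simp add: add_nonneg_nonneg)
  have "(LINT t|lborel. N t / (1 + t\<^sup>2))
      \<le> (LINT t|lborel. ?a * ?K t + ?D t / (1 + t\<^sup>2) + ray (G (1 / (1 - \<epsilon>))) t / (1 + t\<^sup>2))"
    by (intro integral_mono N_integrable Bochner_Integration.integrable_add ia D'(1) G'(1) p)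
       (use divide_right_mono[OF N_upper pos] in \<open>simp add: add_divide_distrib\<close>)
  also have "\<dots> = ?a * (LINT t|lborel. ?K t) + (LINT t|lborel. ?D t / (1 + t\<^sup>2)) + tr_arctan (G (1 / (1 - \<epsilon>)))"
    by (simp only: integral_mult_right_zero G'(2)[OF p(1)] Bochner_Integration.integral_add[OF ia D'(1)]
        Bochner_Integration.integral_add[OF Bochner_Integration.integrable_add[OF ia D'(1)] G'(1)[OF p(1)]])
  finally show "(LINT t|lborel. N t / (1 + t\<^sup>2)) \<le> tr_arctan (G (1 / (1 - \<epsilon>))) + err"
    using D'(2,3) unfolding err_def by linarith
  have "tr_arctan (G (1 / (1 + \<epsilon>))) = (LINT t|lborel. ray (G (1 / (1 + \<epsilon>))) t / (1 + t\<^sup>2))"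
    by (rule G'(2)[OF p(2), symmetric])
  also have "\<dots> \<le> (LINT t|lborel. N t / (1 + t\<^sup>2) + ?a * ?K t + ?D t / (1 + t\<^sup>2))"
    by (intro integral_mono N_integrable Bochner_Integration.integrable_add ia D'(1) G'(1) p)
       (use divide_right_mono[OF N_lower pos] in \<open>simp add: add_divide_distrib\<close>)
  also have "\<dots> = (LINT t|lborel. N t / (1 + t\<^sup>2)) + ?a * (LINT t|lborel. ?K t) + (LINT t|lborel. ?D t / (1 + t\<^sup>2))"
    by (simp only: integral_mult_right_zero Bochner_Integration.integral_add[OF N_integrable ia]
        Bochner_Integration.integral_add[OF Bochner_Integration.integrable_add[OF N_integrable ia] D'(1)])
  finally show "tr_arctan (G (1 / (1 + \<epsilon>))) \<le> (LINT t|lborel. N t / (1 + t\<^sup>2)) + err"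
    using D'(2,3) unfolding err_def by linarith
qed

end

section \<open>Operators on the lattice\<close>

lemma lat_eqI: "(\<And>n. lat_fun f n = lat_fun g n) \<Longrightarrow> f = g"
  by (metis ext lat_fun_inject)

lemma lat_fun_Abs: "(\<lambda>n. (norm (f n))\<^sup>2) summable_on UNIV \<Longrightarrow> lat_fun (Abs_lat f) = f"
  by (simp add: Abs_lat_inverse)

lemma lat_fun_Abs_le:
  assumes "\<And>n. norm (f n) \<le> k * norm (lat_fun g n)"
  shows "lat_fun (Abs_lat f) = f" "norm (Abs_lat f) \<le> \<bar>k\<bar> * norm g"
proof -
  have le: "(norm (f n))\<^sup>2 \<le> k\<^sup>2 * (norm (lat_fun g n))\<^sup>2" for n
    using power_mono[OF assms[of n], of 2] by (simp add: power_mult_distrib)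
  have sm: "(\<lambda>n. k\<^sup>2 * (norm (lat_fun g n))\<^sup>2) summable_on UNIV"
    by (intro summable_on_cmult_right lat_summable)
  have sf: "(\<lambda>n. (norm (f n))\<^sup>2) summable_on UNIV"
    by (rule summable_on_comparison_test[OF sm]) (auto intro: le)
  show eq: "lat_fun (Abs_lat f) = f" by (rule lat_fun_Abs[OF sf])
  have "(norm (Abs_lat f))\<^sup>2 \<le> (\<Sum>\<^sub>\<infinity>n. k\<^sup>2 * (norm (lat_fun g n))\<^sup>2)"
    unfolding norm_lat_sq eq by (rule infsum_mono[OF sf sm le])
  also have "\<dots> = (\<bar>k\<bar> * norm g)\<^sup>2"
    by (simp add: infsum_cmult_right' norm_lat_sq[symmetric] power_mult_distrib)
  finally show "norm (Abs_lat f) \<le> \<bar>k\<bar> * norm g" by (rule power2_le_imp_le) simp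
qed

lemma bounded_clinear_lat_eval: "bounded_clinear (\<lambda>f. lat_fun f n)"
  by (rule bounded_clinearI[where K = 1]) (simp_all add: plus_lat.rep_eq scaleC_lat.rep_eq norm_lat_coord)

lemma lat_fun_sum: "lat_fun (sum f I) n = (\<Sum>i\<in>I. lat_fun (f i) n)"
  by (rule bounded_clinear_sum[OF bounded_clinear_lat_eval])

lemma lat_has_sum_eval: "(f has_sum s) I \<Longrightarrow> ((\<lambda>i. lat_fun (f i) n) has_sum lat_fun s n) I"
  by (rule has_sum_bounded_linear[OF bounded_clinear_linear[OF bounded_clinear_lat_eval]])

section \<open>Single-site vectors and tensor products\<close>

definition single :: "int \<Rightarrow> 'g::complex_inner \<Rightarrow> 'g lat" where
  "single n g = Abs_lat (\<lambda>m. if m = n then g else 0)"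

lemma lat_fun_single: "lat_fun (single n g) m = (if m = n then g else 0)"
proof -
  have "(\<lambda>m. (norm (if m = n then g else 0))\<^sup>2) summable_on UNIV"
    by (rule finite_nonzero_values_imp_summable_on) (rule finite_subset[of _ "{n}"], auto)
  then show ?thesis unfolding single_def by (simp add: lat_fun_Abs)
qed

lemma cinner_single: "cinner (single n g) f = cinner g (lat_fun f n)"
proof -
  have "cinner (single n g) f = (\<Sum>\<^sub>\<infinity>m\<in>{n}. cinner (lat_fun (single n g) m) (lat_fun f m))"
    unfolding cinner_lat_def by (rule infsum_cong_neutral) (auto simp: lat_fun_single cinner.zero_left)
  then show ?thesis by (simp add: lat_fun_single)
qed

text \<open>The coordinates of every value of the adjoint of the difference are detected by
  single-site vectors and vanish, so the adjoint and with it the difference is zero.\<close>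

lemma eq_on_singles:
  fixes A B :: "'g::chilbert_space lat \<Rightarrow> 'b::complex_inner"
  assumes A: "bounded_clinear A" "bounded_clinear B" and eq: "\<And>n g. A (single n g) = B (single n g)"
  shows "A = B"
proof
  fix f
  define D where "D = (\<lambda>f. A f - B f)"
  have D: "bounded_clinear D" unfolding D_def by (rule bounded_clinear_minus[OF A])
  obtain D' where D': "adj D D'" by (rule adj_exists[OF D])
  have "cinner f (D' y) = 0" for y
  proof -
    have "lat_fun (D' y) n = 0" for n
    proof (rule cinner_eqI)
      fix g
      have "cinner g (lat_fun (D' y) n) = cinner (D (single n g)) y"
        by (simp only: cinner_single[symmetric] adjD[OF D'])
      then show "cinner g (lat_fun (D' y) n) = cinner g 0"
        by (simp add: D_def eq cinner.zero_left cinner.zero_right)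
    qed
    then show ?thesis by (simp add: cinner_lat_def cinner.zero_right)
  qed
  then have "cinner (D f) (D f) = 0" by (simp add: adjD[OF D'])
  then show "A f = B f" by (simp add: cinner_self D_def)
qed

lemma lat_fun_tensor: "lat_fun (\<phi> \<otimes>\<^sub>l g) n = lat_fun \<phi> n *\<^sub>C g"
  and norm_tensor_le: "norm (\<phi> \<otimes>\<^sub>l g) \<le> norm g * norm \<phi>"
proof -
  have "norm (lat_fun \<phi> n *\<^sub>C g) \<le> norm g * norm (lat_fun \<phi> n)" for n by (simp add: norm_scaleC mult.commute)
  note * = lat_fun_Abs_le[of "\<lambda>n. lat_fun \<phi> n *\<^sub>C g", OF this]
  show "lat_fun (\<phi> \<otimes>\<^sub>l g) n = lat_fun \<phi> n *\<^sub>C g" "norm (\<phi> \<otimes>\<^sub>l g) \<le> norm g * norm \<phi>"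
    unfolding lat_tensor_def using * by (simp_all add: fun_eq_iff)
qed

lemma single_tensor: "single n g = single n 1 \<otimes>\<^sub>l g"
  by (rule lat_eqI) (simp add: lat_fun_tensor lat_fun_single scaleC_one scaleC.zero_left)

text \<open>Uniqueness behind the definite description: single-site vectors are elementary tensors,
  and they determine a bounded operator.\<close>

lemma tensor_op_eqI:
  fixes C :: "'g::chilbert_space lat \<Rightarrow> 'b::complex_inner"
  assumes C: "bounded_clinear C" "\<And>\<phi> g. C (\<phi> \<otimes>\<^sub>l g) = \<tau>' (A \<phi>) (B g)"
  shows "tensor_op lat_tensor \<tau>' A B = C"
  unfolding tensor_op_def
proof (rule the_equality)
  show "bounded_clinear C \<and> (\<forall>x y. C (x \<otimes>\<^sub>l y) = \<tau>' (A x) (B y))" using C by blast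
  fix C' assume C': "bounded_clinear C' \<and> (\<forall>x y. C' (x \<otimes>\<^sub>l y) = \<tau>' (A x) (B y))"
  have "C' (single n g) = C (single n g)" for n g
    unfolding single_tensor[of n g] using C' C(2) by simp
  then show "C' = C" by (rule eq_on_singles[OF conjunct1[OF C'] C(1)])
qed

text \<open>Explicit model of the tensor product of multiplication by \<open>w\<close> with
  \<open>X\<close>. The weight, the sign of \<open>J_op\<close> and the constant 1 are its
  instances.\<close>

definition pw :: "(int \<Rightarrow> complex) \<Rightarrow> ('g::complex_inner \<Rightarrow> 'g) \<Rightarrow> 'g lat \<Rightarrow> 'g lat" where
  "pw w X f = Abs_lat (\<lambda>n. w n *\<^sub>C X (lat_fun f n))"

lemma
  assumes w: "\<And>n. cmod (w n) \<le> 1" and X: "bounded_clinear X"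
  shows lat_fun_pw: "lat_fun (pw w X f) n = w n *\<^sub>C X (lat_fun f n)"
    and bounded_clinear_pw: "bounded_clinear (pw w X)"
proof -
  obtain k where k: "k > 0" "\<And>x. norm (X x) \<le> k * norm x" by (rule bounded_clinear_bound[OF X]) blast
  have "norm (w n *\<^sub>C X (lat_fun f n)) \<le> k * norm (lat_fun f n)" for n f
    unfolding norm_scaleC using mult_mono[OF w[of n] k(2)[of "lat_fun f n"]] by simp
  note * = lat_fun_Abs_le[of "\<lambda>n. w n *\<^sub>C X (lat_fun _ n)", OF this]
  show 1: "lat_fun (pw w X f) n = w n *\<^sub>C X (lat_fun f n)" for f n
    unfolding pw_def using *(1) by (simp add: fun_eq_iff)
  show "bounded_clinear (pw w X)"
  proof (rule bounded_clinearI[where K = k])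
    show "pw w X (f + g) = pw w X f + pw w X g" for f g
      by (rule lat_eqI) (simp add: 1 plus_lat.rep_eq bounded_clinear_add[OF X] scaleC_add_right)
    show "pw w X (c *\<^sub>C f) = c *\<^sub>C pw w X f" for c f
      by (rule lat_eqI) (simp add: 1 scaleC_lat.rep_eq bounded_clinear_scaleC[OF X] scaleC_scaleC mult.commute)
    show "norm (pw w X f) \<le> norm f * k" for f
      unfolding pw_def using *(2)[of f] k(1) by (simp add: mult.commute)
  qed
qed

lemma adj_pw:
  assumes w: "\<And>n. cmod (w n) \<le> 1" and X: "bounded_clinear X" "adj X X'"
  shows "adj (pw w X) (pw (\<lambda>n. cnj (w n)) X')"
proof -
  have w': "cmod (cnj (w n)) \<le> 1" for n using w by simp
  note 1 = lat_fun_pw[OF w X(1)] and 2 = lat_fun_pw[of "\<lambda>n. cnj (w n)" X', OF w' adj_bounded[OF X]]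
  show ?thesis
    unfolding adj_def cinner_lat_def
    by (simp add: 1 2 cinner_scaleC_left cinner_scaleC_right adjD[OF X(2)])
qed

lemma lat_fun_mult_op: "(\<And>n. cmod (w n) \<le> 1) \<Longrightarrow> lat_fun (mult_op w \<phi>) n = w n * lat_fun \<phi> n"
  using lat_fun_pw[of w "\<lambda>x. x" \<phi> n] bounded_clinear_id
  by (simp add: pw_def mult_op_def scaleC_complex_def)

lemma mult_op_tensor:
  fixes X :: "'g::chilbert_space \<Rightarrow> 'g"
  assumes w: "\<And>n. cmod (w n) \<le> 1" and X: "bounded_clinear X"
  shows "mult_op w \<otimes>\<^sub>o X = pw w X"
  unfolding lat_op_tensor_def
proof (rule tensor_op_eqI[OF bounded_clinear_pw[OF w X]])
  fix \<phi> :: "complex lat" and g :: 'g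
  show "pw w X (\<phi> \<otimes>\<^sub>l g) = mult_op w \<phi> \<otimes>\<^sub>l X g"
    by (rule lat_eqI)
       (simp add: lat_fun_pw[OF w X] lat_fun_tensor lat_fun_mult_op[OF w] bounded_clinear_scaleC[OF X] scaleC_scaleC)
qed

lemma id_tensor:
  fixes X :: "'g::chilbert_space \<Rightarrow> 'g"
  assumes X: "bounded_clinear X"
  shows "id \<otimes>\<^sub>o X = pw (\<lambda>_. 1) X"
proof -
  have w: "cmod ((\<lambda>_. 1) n) \<le> 1" for n :: int by simp
  have "mult_op (\<lambda>_. 1) = id"
    by (intro ext lat_eqI) (simp add: lat_fun_mult_op)
  then show ?thesis using mult_op_tensor[OF w X] by simp
qed

section \<open>Translations and the lattice Laplacian\<close>

definition shift :: "int \<Rightarrow> 'g::complex_inner lat \<Rightarrow> 'g lat" where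
  "shift k f = Abs_lat (\<lambda>n. lat_fun f (n - k))"

lemma lat_fun_shift: "lat_fun (shift k f) n = lat_fun f (n - k)"
  and norm_shift: "norm (shift k f) = norm f"
proof -
  have bij: "bij_betw (\<lambda>n. n - k) UNIV UNIV" by (rule bij_betwI[of _ _ _ "\<lambda>n. n + k"]) auto
  have sm: "(\<lambda>n. (norm (lat_fun f (n - k)))\<^sup>2) summable_on UNIV"
    using lat_summable[of f] summable_on_reindex_bij_betw[OF bij, of "\<lambda>n. (norm (lat_fun f n))\<^sup>2"] by simp
  show 1: "lat_fun (shift k f) n = lat_fun f (n - k)" for n
    unfolding shift_def by (simp add: lat_fun_Abs[OF sm])
  have "(norm (shift k f))\<^sup>2 = (norm f)\<^sup>2"
    unfolding norm_lat_sq 1 using infsum_reindex_bij_betw[OF bij, of "\<lambda>n. (norm (lat_fun f n))\<^sup>2"] by simp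
  then show "norm (shift k f) = norm f" by simp
qed

lemma bounded_clinear_shift: "bounded_clinear (shift k)"
  by (rule bounded_clinearI[where K = 1])
     (auto intro!: lat_eqI simp: lat_fun_shift plus_lat.rep_eq scaleC_lat.rep_eq norm_shift)

lemma cinner_shift: "cinner (shift k f) g = cinner f (shift (- k) g)"
proof -
  have bij: "bij_betw (\<lambda>n. n + k) UNIV UNIV" by (rule bij_betwI[of _ _ _ "\<lambda>n. n - k"]) auto
  show ?thesis
    unfolding cinner_lat_def lat_fun_shift
    using infsum_reindex_bij_betw[OF bij, of "\<lambda>n. cinner (lat_fun f (n - k)) (lat_fun g n)"] by simp
qed

text \<open>Already the Laplacian tensored with the identity. Writing it through shifts makes
  boundedness and symmetry immediate.\<close>

definition lap :: "real \<Rightarrow> 'g::complex_inner lat \<Rightarrow> 'g lat" where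
  "lap h f = of_real (1 / h\<^sup>2) *\<^sub>C (2 *\<^sub>C f - shift 1 f - shift (- 1) f)"

lemma bounded_clinear_lap: "bounded_clinear (lap h)"
  unfolding lap_def[abs_def]
  by (intro bounded_clinear_scaleC_left bounded_clinear_minus bounded_clinear_shift bounded_clinear_id)

lemma lat_fun_lap:
  "lat_fun (lap h f) n = of_real (1 / h\<^sup>2) *\<^sub>C (2 *\<^sub>C lat_fun f n - lat_fun f (n - 1) - lat_fun f (n + 1))"
  by (simp add: lap_def scaleC_lat.rep_eq minus_lat.rep_eq lat_fun_shift)

lemma neg_laplacian_eq_lap: "neg_laplacian h = lap h"
proof
  fix \<phi> :: "complex lat"
  have "lap h \<phi> = Abs_lat (lat_fun (lap h \<phi>))" by (simp add: lat_fun_inverse)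
  then show "neg_laplacian h \<phi> = lap h \<phi>"
    by (simp add: neg_laplacian_def lat_fun_lap[abs_def] scaleC_complex_def algebra_simps)
qed

lemma lap_tensor_id: "neg_laplacian h \<otimes>\<^sub>o id = (lap h :: 'g::chilbert_space lat \<Rightarrow> 'g lat)"
  unfolding lat_op_tensor_def neg_laplacian_eq_lap
proof (rule tensor_op_eqI[OF bounded_clinear_lap])
  fix \<phi> :: "complex lat" and g :: 'g
  show "lap h (\<phi> \<otimes>\<^sub>l g) = lap h \<phi> \<otimes>\<^sub>l id g"
    by (rule lat_eqI)
       (simp only: lat_fun_lap lat_fun_tensor id_apply scaleC_complex_def scaleC_scaleC scaleC.diff_right
         right_diff_distrib scaleC.diff_left mult.assoc)
qed

lemma H_free_eq:
  fixes Q :: "'g::chilbert_space \<Rightarrow> 'g"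
  assumes "bounded_clinear Q"
  shows "H_free h Q f = lap h f + pw (\<lambda>_. 1) Q f"
  unfolding H_free_def lap_tensor_id id_tensor[OF assms] ..

text \<open>The adjoint of \<open>g \<mapsto> \<phi> \<otimes> g\<close>.\<close>

definition red :: "complex lat \<Rightarrow> 'g::complex_inner lat \<Rightarrow> 'g" where
  "red \<phi> f = (\<Sum>\<^sub>\<infinity>n. cnj (lat_fun \<phi> n) *\<^sub>C lat_fun f n)"

lemma red_has_sum:
  fixes f :: "'g::chilbert_space lat"
  shows "((\<lambda>n. cnj (lat_fun \<phi> n) *\<^sub>C lat_fun f n) has_sum red \<phi> f) UNIV"
proof -
  have "norm (cnj (lat_fun \<phi> n) *\<^sub>C lat_fun f n) \<le> (norm (lat_fun \<phi> n))\<^sup>2 + (norm (lat_fun f n))\<^sup>2" for n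
  proof -
    have "0 \<le> (cmod (lat_fun \<phi> n) - norm (lat_fun f n))\<^sup>2" "0 \<le> cmod (lat_fun \<phi> n) * norm (lat_fun f n)" by simp_all
    then show ?thesis unfolding norm_scaleC complex_mod_cnj power2_diff by linarith
  qed
  then have "(\<lambda>n. norm (cnj (lat_fun \<phi> n) *\<^sub>C lat_fun f n)) summable_on UNIV"
    by (rule Infinite_Sum.abs_summable_on_comparison_test'[OF summable_on_add[OF lat_summable[of \<phi>] lat_summable[of f]]])
  from abs_summable_summable[OF this] show ?thesis unfolding red_def by (rule has_sum_infsum)
qed

lemma adj_tensor_red: "adj (\<lambda>g. \<phi> \<otimes>\<^sub>l g) (red \<phi> :: 'g::chilbert_space lat \<Rightarrow> 'g)"
  unfolding adj_def
proof (intro allI)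
  fix g :: 'g and f
  have "((\<lambda>n. cinner g (cnj (lat_fun \<phi> n) *\<^sub>C lat_fun f n)) has_sum cinner g (red \<phi> f)) UNIV"
    by (rule has_sum_bounded_linear[OF cinner.bounded_linear_right red_has_sum])
  then have "cinner g (red \<phi> f) = (\<Sum>\<^sub>\<infinity>n. cinner g (cnj (lat_fun \<phi> n) *\<^sub>C lat_fun f n))"
    by (rule infsumI[symmetric])
  then show "cinner (\<phi> \<otimes>\<^sub>l g) f = cinner g (red \<phi> f)"
    by (simp add: cinner_lat_def lat_fun_tensor cinner_scaleC_left cinner_scaleC_right)
qed

lemma bounded_clinear_tensor: "bounded_clinear (\<lambda>g::'g::complex_inner. \<phi> \<otimes>\<^sub>l g)"
  by (rule bounded_clinearI[where K = "norm \<phi>"])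
     (auto intro!: lat_eqI norm_tensor_le simp: lat_fun_tensor plus_lat.rep_eq scaleC_lat.rep_eq
       scaleC_add_right scaleC_scaleC mult.commute)

lemma bounded_clinear_red: "bounded_clinear (red \<phi> :: 'g::chilbert_space lat \<Rightarrow> 'g)"
  by (rule adj_bounded[OF bounded_clinear_tensor adj_tensor_red])

lemma red_scaleC: "red (c *\<^sub>C \<phi>) f = cnj c *\<^sub>C red \<phi> (f :: 'g::chilbert_space lat)"
proof (rule cinner_eqI)
  fix g :: 'g
  have "(c *\<^sub>C \<phi>) \<otimes>\<^sub>l g = c *\<^sub>C (\<phi> \<otimes>\<^sub>l g)"
    by (rule lat_eqI) (simp add: lat_fun_tensor scaleC_lat.rep_eq scaleC_scaleC scaleC_complex_def)
  then show "cinner g (red (c *\<^sub>C \<phi>) f) = cinner g (cnj c *\<^sub>C red \<phi> f)"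
    by (simp only: adjD[OF adj_tensor_red, symmetric] cinner_scaleC_left cinner_scaleC_right)
qed

lemma red_add: "red (\<phi> + \<psi>) f = red \<phi> f + red \<psi> (f :: 'g::chilbert_space lat)"
proof (rule cinner_eqI)
  fix g :: 'g
  have "(\<phi> + \<psi>) \<otimes>\<^sub>l g = \<phi> \<otimes>\<^sub>l g + \<psi> \<otimes>\<^sub>l g"
    by (rule lat_eqI) (simp add: lat_fun_tensor plus_lat.rep_eq scaleC_add_left)
  then show "cinner g (red (\<phi> + \<psi>) f) = cinner g (red \<phi> f + red \<psi> f)"
    by (simp only: adjD[OF adj_tensor_red, symmetric] cinner_add_left cinner_add_right)
qed

lemma red_single: "red \<phi> (single n g) = cnj (lat_fun \<phi> n) *\<^sub>C (g :: 'g::chilbert_space)"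
proof (rule cinner_eqI)
  fix x
  have "cinner x (red \<phi> (single n g)) = cinner (\<phi> \<otimes>\<^sub>l x) (single n g)" by (simp add: adjD[OF adj_tensor_red])
  also have "\<dots> = cnj (cinner (single n g) (\<phi> \<otimes>\<^sub>l x))" by (rule cinner_commute)
  also have "\<dots> = cnj (lat_fun \<phi> n * cinner g x)" by (simp add: cinner_single lat_fun_tensor cinner_scaleC_right)
  also have "\<dots> = cinner x (cnj (lat_fun \<phi> n) *\<^sub>C g)"
    by (simp add: cinner_scaleC_right cinner_commute[of x g])
  finally show "cinner x (red \<phi> (single n g)) = cinner x (cnj (lat_fun \<phi> n) *\<^sub>C g)" .
qed

lemma red_tensor: "red \<psi> (\<phi> \<otimes>\<^sub>l g) = cinner \<psi> \<phi> *\<^sub>C (g :: 'g::chilbert_space)"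
proof -
  have "((\<lambda>n. cinner (lat_fun \<psi> n) (lat_fun \<phi> n)) has_sum cinner \<psi> \<phi>) UNIV"
    unfolding cinner_lat_def by (intro has_sum_infsum lat_cinner_summable)
  then have "((\<lambda>n. cinner (lat_fun \<psi> n) (lat_fun \<phi> n) *\<^sub>C g) has_sum cinner \<psi> \<phi> *\<^sub>C g) UNIV"
    by (rule has_sum_bounded_linear[OF scaleC.bounded_linear_left])
  moreover have "((\<lambda>n. cinner (lat_fun \<psi> n) (lat_fun \<phi> n) *\<^sub>C g) has_sum red \<psi> (\<phi> \<otimes>\<^sub>l g)) UNIV"
    using red_has_sum[of \<psi> "\<phi> \<otimes>\<^sub>l g"] by (simp add: lat_fun_tensor scaleC_scaleC cinner_complex_def)
  ultimately show ?thesis using has_sum_unique by blast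
qed

lemma tensor_op_functional:
  fixes X :: "'g::chilbert_space \<Rightarrow> 'g"
  assumes X: "bounded_clinear X"
  shows "tensor_op lat_tensor scaleC (cinner \<psi>) X = (\<lambda>f. X (red \<psi> f))"
  by (rule tensor_op_eqI[OF bounded_clinear_compose[OF X bounded_clinear_red]])
     (simp add: red_tensor bounded_clinear_scaleC[OF X])

lemma red_pw:
  fixes X :: "'g::chilbert_space \<Rightarrow> 'g"
  assumes w: "\<And>n. cmod (w n) \<le> 1" and X: "bounded_clinear X"
  shows "red \<phi> (pw w X f) = X (red (mult_op (\<lambda>n. cnj (w n)) \<phi>) f)"
proof -
  have w': "cmod (cnj (w n)) \<le> 1" for n using w by simp
  have "((\<lambda>n. cnj (lat_fun \<phi> n) *\<^sub>C lat_fun (pw w X f) n) has_sum X (red (mult_op (\<lambda>n. cnj (w n)) \<phi>) f)) UNIV"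
    using has_sum_bounded_linear[OF bounded_clinear_linear[OF X] red_has_sum[of "mult_op (\<lambda>n. cnj (w n)) \<phi>" f]]
    by (simp add: lat_fun_pw[OF w X] lat_fun_mult_op[OF w'] bounded_clinear_scaleC[OF X] scaleC_scaleC mult.commute)
  then show ?thesis using has_sum_unique[OF red_has_sum] by blast
qed

section \<open>Integral operators with dominated kernels\<close>

locale kernel_weight =
  fixes u :: "int \<Rightarrow> real"
  assumes u_summable: "(\<lambda>n. (u n)\<^sup>2) summable_on UNIV"
begin

definition U :: real where "U = (\<Sum>\<^sub>\<infinity>n. (u n)\<^sup>2)"

definition dom :: "real \<Rightarrow> (int \<Rightarrow> int \<Rightarrow> complex) \<Rightarrow> bool" where
  "dom C a \<longleftrightarrow> (\<forall>n m. cmod (a n m) \<le> C * \<bar>u n\<bar> * \<bar>u m\<bar>)"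

definition row :: "(int \<Rightarrow> int \<Rightarrow> complex) \<Rightarrow> int \<Rightarrow> complex lat" where
  "row a n = Abs_lat (\<lambda>m. cnj (a n m))"

text \<open>The integral operator with kernel \<open>a\<close>, tensored with \<open>X\<close>: at
  the site \<open>n\<close> it applies \<open>X\<close> to the sum over \<open>m\<close> of
  \<open>a n m\<close> times the value of \<open>f\<close> at \<open>m\<close>. \<open>row\<close>
  stores conjugates because \<open>red\<close> conjugates its first argument.\<close>

definition kop :: "(int \<Rightarrow> int \<Rightarrow> complex) \<Rightarrow> ('g::complex_inner \<Rightarrow> 'g) \<Rightarrow> 'g lat \<Rightarrow> 'g lat" where
  "kop a X f = Abs_lat (\<lambda>n. X (red (row a n) f))"

lemma U_nonneg: "0 \<le> U"
  unfolding U_def by (rule infsum_nonneg) simp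

lemma
  assumes "dom C a"
  shows lat_fun_row: "lat_fun (row a n) m = cnj (a n m)"
    and norm_row: "(norm (row a n))\<^sup>2 \<le> (C\<^sup>2 * U) * (u n)\<^sup>2"
proof -
  have le: "(norm (cnj (a n m)))\<^sup>2 \<le> (C * u n)\<^sup>2 * (u m)\<^sup>2" for m
    using power_mono[of "cmod (a n m)" "C * \<bar>u n\<bar> * \<bar>u m\<bar>" 2] assms by (simp add: dom_def power_mult_distrib)
  have sm: "(\<lambda>m. (C * u n)\<^sup>2 * (u m)\<^sup>2) summable_on UNIV" by (intro summable_on_cmult_right u_summable)
  have sf: "(\<lambda>m. (norm (cnj (a n m)))\<^sup>2) summable_on UNIV"
    by (rule summable_on_comparison_test[OF sm]) (auto intro: le[simplified])
  show 1: "lat_fun (row a n) m = cnj (a n m)" for m unfolding row_def by (simp add: lat_fun_Abs[OF sf])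
  have "(norm (row a n))\<^sup>2 \<le> (\<Sum>\<^sub>\<infinity>m. (C * u n)\<^sup>2 * (u m)\<^sup>2)"
    unfolding norm_lat_sq 1 by (rule infsum_mono[OF sf sm le])
  also have "\<dots> = (C * u n)\<^sup>2 * U" by (simp only: infsum_cmult_right' U_def)
  finally show "(norm (row a n))\<^sup>2 \<le> (C\<^sup>2 * U) * (u n)\<^sup>2" by (simp add: power_mult_distrib mult_ac)
qed

lemma norm_red_le: "norm (red \<phi> (f :: 'g::chilbert_space lat)) \<le> norm \<phi> * norm f"
proof -
  have "(norm (red \<phi> f))\<^sup>2 = cmod (cinner (\<phi> \<otimes>\<^sub>l red \<phi> f) f)"
    by (simp add: adjD[OF adj_tensor_red] cinner_self norm_power)
  also have "\<dots> \<le> norm (\<phi> \<otimes>\<^sub>l red \<phi> f) * norm f" by (rule cmod_cinner_le)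
  also have "\<dots> \<le> (norm (red \<phi> f) * norm \<phi>) * norm f" by (intro mult_right_mono norm_tensor_le) simp
  finally have "norm (red \<phi> f) * norm (red \<phi> f) \<le> norm (red \<phi> f) * (norm \<phi> * norm f)"
    by (simp add: power2_eq_square mult_ac)
  then show ?thesis by (cases "red \<phi> f = 0") simp_all
qed

lemma lat_fun_kop:
  fixes X :: "'g::chilbert_space \<Rightarrow> 'g"
  assumes a: "dom C a" and X: "bounded_clinear X"
  shows "lat_fun (kop a X f) n = X (red (row a n) f)"
proof -
  obtain k where k: "k > 0" "\<And>x. norm (X x) \<le> k * norm x" by (rule bounded_clinear_bound[OF X]) blast
  have le: "(norm (X (red (row a n) f)))\<^sup>2 \<le> (k\<^sup>2 * (norm f)\<^sup>2 * (C\<^sup>2 * U)) * (u n)\<^sup>2" for n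
  proof -
    have "norm (X (red (row a n) f)) \<le> k * (norm (row a n) * norm f)"
      using k(2)[of "red (row a n) f"] mult_left_mono[OF norm_red_le[of "row a n" f], of k] k(1) by linarith
    then have "(norm (X (red (row a n) f)))\<^sup>2 \<le> (k * (norm (row a n) * norm f))\<^sup>2" by (intro power_mono) auto
    also have "\<dots> = k\<^sup>2 * (norm f)\<^sup>2 * (norm (row a n))\<^sup>2" by (simp add: power_mult_distrib mult_ac)
    also have "\<dots> \<le> k\<^sup>2 * (norm f)\<^sup>2 * ((C\<^sup>2 * U) * (u n)\<^sup>2)" by (intro mult_left_mono norm_row[OF a]) simp
    finally show ?thesis by (simp add: mult_ac)
  qed
  have "(\<lambda>n. (norm (X (red (row a n) f)))\<^sup>2) summable_on UNIV"
    by (rule summable_on_comparison_test[OF summable_on_cmult_right[OF u_summable]]) (use le in auto)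
  then show ?thesis unfolding kop_def by (simp add: lat_fun_Abs)
qed

text \<open>At each site the operator is \<open>X\<close> after \<open>red\<close>, the adjoint of a
  tensor map, so its squared Hilbert-Schmidt norm is at most that of \<open>X\<close> times the
  squared norm of the row. Domination makes the rows summable over sites; boundedness is then read
  off from one-element orthonormal sets.\<close>

lemma hs_bound_kop:
  fixes X :: "'g::chilbert_space \<Rightarrow> 'g"
  assumes a: "dom C a" and X: "hs_bound X c"
  shows "hs_bound (kop a X) (C\<^sup>2 * U\<^sup>2 * c)"
proof -
  note linX = hs_boundD(1)[OF X]
  note ev = lat_fun_kop[OF a linX]
  obtain X' where X': "adj X X'" by (rule adj_exists[OF linX])
  have row_hs: "hs_bound (\<lambda>f. X (red (row a n) f)) ((norm (row a n))\<^sup>2 * c)" for n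
  proof (rule hs_bound_adj)
    show "hs_bound (\<lambda>g. row a n \<otimes>\<^sub>l X' g) ((norm (row a n))\<^sup>2 * c)"
      by (rule hs_bound_left[OF hs_bound_adj[OF X X'] bounded_clinear_tensor])
         (simp add: norm_tensor_le[of "row a n"] mult.commute)
    show "adj (\<lambda>g. row a n \<otimes>\<^sub>l X' g) (\<lambda>f. X (red (row a n) f))"
      by (rule adj_compose[OF adj_tensor_red adj_sym[OF X']])
  qed
  have sums: "(\<Sum>f\<in>F. (norm (kop a X f))\<^sup>2) \<le> C\<^sup>2 * U\<^sup>2 * c" if F: "finite F" "onset F" for F
  proof -
    have hs: "((\<lambda>n. \<Sum>f\<in>F. (norm (lat_fun (kop a X f) n))\<^sup>2) has_sum (\<Sum>f\<in>F. (norm (kop a X f))\<^sup>2)) UNIV"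
      by (intro has_sum_finite_sum F(1)) (simp only: norm_lat_sq has_sum_infsum[OF lat_summable])
    have hU: "((\<lambda>n. (C\<^sup>2 * U * c) * (u n)\<^sup>2) has_sum (C\<^sup>2 * U * c) * U) UNIV"
      unfolding U_def by (intro has_sum_cmult_right has_sum_infsum u_summable)
    have "(\<Sum>f\<in>F. (norm (kop a X f))\<^sup>2) \<le> (C\<^sup>2 * U * c) * U"
    proof (rule has_sum_mono[OF hs hU])
      fix n
      have "(\<Sum>f\<in>F. (norm (lat_fun (kop a X f) n))\<^sup>2) \<le> (norm (row a n))\<^sup>2 * c"
        unfolding ev by (rule hs_boundD(2)[OF row_hs F])
      also have "\<dots> \<le> ((C\<^sup>2 * U) * (u n)\<^sup>2) * c"
        by (intro mult_right_mono norm_row[OF a] hs_boundD(3)[OF X])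
      finally show "(\<Sum>f\<in>F. (norm (lat_fun (kop a X f) n))\<^sup>2) \<le> (C\<^sup>2 * U * c) * (u n)\<^sup>2"
        by (simp add: mult_ac)
    qed
    then show ?thesis by (simp add: power2_eq_square mult_ac)
  qed
  obtain k where k: "k > 0" "\<And>x. norm (X x) \<le> k * norm x" by (rule bounded_clinear_bound[OF linX]) blast
  have add: "kop a X (f + g) = kop a X f + kop a X g" for f g
    by (rule lat_eqI)
       (simp add: ev plus_lat.rep_eq bounded_clinear_add[OF linX] bounded_clinear_add[OF bounded_clinear_red])
  have scale: "kop a X (b *\<^sub>C f) = b *\<^sub>C kop a X f" for b f
    by (rule lat_eqI)
       (simp add: ev scaleC_lat.rep_eq bounded_clinear_scaleC[OF linX] bounded_clinear_scaleC[OF bounded_clinear_red])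
  have "bounded_clinear (kop a X)"
  proof (rule bounded_clinearI[OF add scale])
    fix f
    show "norm (kop a X f) \<le> norm f * sqrt (C\<^sup>2 * U\<^sup>2 * c)"
    proof (cases "f = 0")
      case True
      have "kop a X (0 *\<^sub>C f) = 0 *\<^sub>C kop a X f" by (rule scale)
      then show ?thesis using True by (simp add: scaleC.zero_left)
    next
      case False
      let ?e = "(1 / norm f) *\<^sub>R f"
      have "onset {?e}" using onset_insert_unit[of "{}" f] False by (simp add: onset_def)
      from sums[OF _ this] have "norm (kop a X ?e) \<le> sqrt (C\<^sup>2 * U\<^sup>2 * c)" by (intro real_le_rsqrt) simp
      moreover have "kop a X ?e = (1 / norm f) *\<^sub>R kop a X f"
        using scale[of "of_real (1 / norm f)" f] by (simp only: scaleC_of_real)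
      ultimately show ?thesis using False by (simp add: field_simps)
    qed
  qed
  then show ?thesis using sums by (simp add: hs_bound_def)
qed

lemma adj_kop:
  fixes X :: "'g::chilbert_space \<Rightarrow> 'g"
  assumes a: "dom C a" and X: "hs_bound X c" "adj X X'"
  shows "adj (kop a X) (kop (\<lambda>n m. cnj (a m n)) X')"
proof -
  let ?a = "\<lambda>n m. cnj (a m n)"
  have a': "dom C ?a"
    unfolding dom_def
  proof (intro allI)
    fix n m
    have "cmod (a m n) \<le> C * \<bar>u m\<bar> * \<bar>u n\<bar>" using a by (simp add: dom_def)
    then show "cmod (cnj (a m n)) \<le> C * \<bar>u n\<bar> * \<bar>u m\<bar>" by (simp add: mult_ac)
  qed
  note X'hs = hs_bound_adj[OF X]
  note lin = hs_boundD(1)[OF hs_bound_kop[OF a X(1)]] and lin' = hs_boundD(1)[OF hs_bound_kop[OF a' X'hs]]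
  note ev = lat_fun_kop[OF a hs_boundD(1)[OF X(1)]] and ev' = lat_fun_kop[OF a' hs_boundD(1)[OF X'hs]]
  obtain B where B: "adj (kop a X) B" by (rule adj_exists[OF lin])
  have "B = kop ?a X'"
  proof (rule eq_on_singles[OF adj_bounded[OF lin B] lin'], rule lat_eqI, rule cinner_eqI)
    fix m n and g x :: 'g
    have "cinner x (lat_fun (B (single m g)) n) = cinner (kop a X (single n x)) (single m g)"
      by (simp only: cinner_single[symmetric] adjD[OF B])
    also have "\<dots> = cnj (cinner g (lat_fun (kop a X (single n x)) m))"
      by (subst cinner_commute) (simp only: cinner_single)
    also have "\<dots> = cinner (X (a m n *\<^sub>C x)) g"
      by (simp add: ev red_single lat_fun_row[OF a] flip: cinner_commute)
    also have "\<dots> = cinner x (X' (cnj (a m n) *\<^sub>C g))"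
      by (simp add: adjD[OF X(2)] cinner_scaleC_left cinner_scaleC_right
          bounded_clinear_scaleC[OF hs_boundD(1)[OF X'hs]])
    also have "\<dots> = cinner x (lat_fun (kop ?a X' (single m g)) n)"
      by (simp add: ev' red_single lat_fun_row[OF a'])
    finally show "cinner x (lat_fun (B (single m g)) n) = cinner x (lat_fun (kop ?a X' (single m g)) n)" .
  qed
  then show ?thesis using B by simp
qed

lemma row_eqI: "dom C a \<Longrightarrow> (\<And>m. lat_fun \<phi> m = cnj (a n m)) \<Longrightarrow> row a n = \<phi>"
  by (rule lat_eqI) (simp add: lat_fun_row)

lemma kop_add:
  fixes X :: "'g::chilbert_space \<Rightarrow> 'g"
  assumes a: "dom C a" "dom C' b" and X: "bounded_clinear X"
  shows "kop (\<lambda>n m. a n m + b n m) X f = kop a X f + kop b X f"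
proof -
  have ab: "dom (C + C') (\<lambda>n m. a n m + b n m)"
    using a unfolding dom_def by (auto intro!: order_trans[OF norm_triangle_ineq] simp: algebra_simps add_mono)
  have "row (\<lambda>n m. a n m + b n m) n = row a n + row b n" for n
    by (rule row_eqI[OF ab]) (simp add: plus_lat.rep_eq lat_fun_row[OF a(1)] lat_fun_row[OF a(2)])
  then show ?thesis
    by (intro lat_eqI) (simp add: lat_fun_kop[OF ab X] lat_fun_kop[OF a(1) X] lat_fun_kop[OF a(2) X]
        plus_lat.rep_eq red_add bounded_clinear_add[OF X])
qed

lemma kop_scaleC:
  fixes X :: "'g::chilbert_space \<Rightarrow> 'g"
  assumes a: "dom C a" and X: "bounded_clinear X"
  shows "kop (\<lambda>n m. b * a n m) X f = b *\<^sub>C kop a X f"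
proof -
  have ba: "dom (cmod b * C) (\<lambda>n m. b * a n m)"
    using a mult_left_mono[OF _ norm_ge_zero[of b]] by (simp add: dom_def norm_mult mult.assoc)
  have "row (\<lambda>n m. b * a n m) n = cnj b *\<^sub>C row a n" for n
    by (rule row_eqI[OF ba]) (simp add: scaleC_lat.rep_eq lat_fun_row[OF a] scaleC_complex_def)
  then show ?thesis
    by (intro lat_eqI) (simp add: lat_fun_kop[OF ba X] lat_fun_kop[OF a X]
        scaleC_lat.rep_eq red_scaleC bounded_clinear_scaleC[OF X])
qed

lemma kop_rank_one:
  fixes X :: "'g::chilbert_space \<Rightarrow> 'g"
  assumes v: "dom C (\<lambda>n m. lat_fun v n * cnj (lat_fun v m))" and X: "bounded_clinear X"
  shows "kop (\<lambda>n m. lat_fun v n * cnj (lat_fun v m)) X f = v \<otimes>\<^sub>l X (red v f)"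
proof -
  have "row (\<lambda>n m. lat_fun v n * cnj (lat_fun v m)) n = cnj (lat_fun v n) *\<^sub>C v" for n
    by (rule row_eqI[OF v]) (simp add: scaleC_lat.rep_eq scaleC_complex_def)
  then show ?thesis
    by (intro lat_eqI) (simp add: lat_fun_kop[OF v X] lat_fun_tensor red_scaleC bounded_clinear_scaleC[OF X])
qed

end

section \<open>Lattice sums and the Green function\<close>

lemma int_summableI:
  fixes f :: "int \<Rightarrow> real"
  assumes "\<And>n. 0 \<le> f n" "summable (\<lambda>n. f (int n))" "summable (\<lambda>n. f (- int n))"
  shows "f summable_on UNIV"
proof -
  have "f summable_on range int"
    by (subst summable_on_reindex) (auto simp: o_def inj_on_def intro!: summable_nonneg_imp_summable_on assms)
  moreover have "f summable_on range (\<lambda>n. - int n)"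
    by (subst summable_on_reindex) (auto simp: o_def inj_on_def intro!: summable_nonneg_imp_summable_on assms)
  ultimately have "f summable_on (range int \<union> range (\<lambda>n. - int n))" by (rule summable_on_union)
  moreover have "range int \<union> range (\<lambda>n. - int n) = UNIV"
  proof -
    have "n \<in> range int \<union> range (\<lambda>n. - int n)" for n
      by (cases n rule: int_cases2) auto
    then show ?thesis by blast
  qed
  ultimately show ?thesis by simp
qed

lemma int_geometric_summable:
  assumes "0 \<le> r" "r < (1::real)"
  shows "(\<lambda>j::int. b * r ^ nat \<bar>j\<bar>) summable_on UNIV"
  by (intro summable_on_cmult_right int_summableI) (use assms in \<open>auto intro: summable_geometric\<close>)

section \<open>The weight and its growth\<close>

definition psi :: "real \<Rightarrow> int \<Rightarrow> real" where
  "psi \<nu> n = sqrt (1 + (of_int n)\<^sup>2) powr (- \<nu> / 2)"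

lemma weight_psi: "weight \<nu> n = of_real (psi \<nu> n)"
  by (simp add: weight_def psi_def)

lemma psi_pos: "0 < psi \<nu> n"
proof -
  have "0 < 1 + (real_of_int n)\<^sup>2" by (simp add: add_pos_nonneg)
  then show ?thesis by (simp add: psi_def)
qed

lemma psi_le_1: "0 \<le> \<nu> \<Longrightarrow> psi \<nu> n \<le> 1"
  using powr_mono[of "- \<nu> / 2" 0 "sqrt (1 + (real_of_int n)\<^sup>2)"] by (auto simp: psi_def split: if_splits)

text \<open>The factor \<open>1 + \<bar>n\<bar>\<close> absorbs the growth \<open>\<bar>n - m\<bar> \<le> (1 + \<bar>n\<bar>) (1 + \<bar>m\<bar>)\<close> of the Green function at a threshold.\<close>

definition growth :: "real \<Rightarrow> int \<Rightarrow> real" where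
  "growth \<nu> n = psi \<nu> n * (1 + \<bar>of_int n\<bar>)"

lemma growth_pos: "0 < growth \<nu> n"
  unfolding growth_def by (intro mult_pos_pos psi_pos) (simp add: add_pos_nonneg)

text \<open>The squared values are of order \<open>\<bar>n\<bar>\<close> to the power
  \<open>2 - \<nu>\<close>, and \<open>\<nu> > 3\<close> brings this below -1. The factor 4 comes
  from \<open>1 + n \<le> 2 * n\<close>.\<close>

lemma growth_summable:
  assumes \<nu>: "\<nu> > 3"
  shows "(\<lambda>n. (growth \<nu> n)\<^sup>2) summable_on UNIV"
proof -
  have le: "(growth \<nu> (int n))\<^sup>2 \<le> 4 * real n powr (2 - \<nu>)" if "n \<ge> 1" for n
  proof -
    define b where "b = sqrt (1 + (real n)\<^sup>2)"
    have nb: "real n \<le> b" "0 < real n" using that by (auto simp: b_def intro: real_le_rsqrt)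
    have "(b powr (- \<nu> / 2))\<^sup>2 = b powr (- \<nu>)"
      using nb by (simp add: power2_eq_square flip: powr_add)
    also have "\<dots> \<le> real n powr (- \<nu>)" using nb \<nu> by (intro powr_mono2') auto
    finally have 1: "(psi \<nu> (int n))\<^sup>2 \<le> real n powr (- \<nu>)" by (simp add: psi_def b_def)
    have "1 + real n \<le> 2 * real n" using that by simp
    then have 2: "(1 + real n)\<^sup>2 \<le> (2 * real n)\<^sup>2" by (intro power_mono) auto
    have "(growth \<nu> (int n))\<^sup>2 = (psi \<nu> (int n))\<^sup>2 * (1 + real n)\<^sup>2" by (simp add: growth_def power_mult_distrib)
    also have "\<dots> \<le> real n powr (- \<nu>) * (2 * real n)\<^sup>2" by (intro mult_mono 1 2) auto
    also have "\<dots> = 4 * (real n powr (- \<nu>) * real n powr 2)" using nb(2) by (simp add: powr_numeral power_mult_distrib)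
    also have "\<dots> = 4 * real n powr (2 - \<nu>)" by (simp only: powr_add[symmetric] uminus_add_conv_diff)
    finally show ?thesis .
  qed
  have sm: "summable (\<lambda>n. (growth \<nu> (int n))\<^sup>2)"
  proof (rule summable_comparison_test'[where N = 1])
    show "summable (\<lambda>n. 4 * real n powr (2 - \<nu>))"
      by (rule summable_mult) (use \<nu> in \<open>simp add: summable_real_powr_iff\<close>)
  qed (use le in auto)
  moreover have "growth \<nu> (- n) = growth \<nu> n" for n by (simp add: growth_def psi_def)
  ultimately show ?thesis by (intro int_summableI) simp_all
qed

lemma growth_dominates: "psi \<nu> n * psi \<nu> m * (1 + \<bar>of_int (n - m)\<bar>) \<le> growth \<nu> n * growth \<nu> m"
proof -
  have "1 + \<bar>real_of_int (n - m)\<bar> \<le> (1 + \<bar>of_int n\<bar>) * (1 + \<bar>of_int m\<bar>)"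
  proof -
    have "\<bar>real_of_int (n - m)\<bar> \<le> \<bar>of_int n\<bar> + \<bar>of_int m\<bar>" by simp
    moreover have "0 \<le> \<bar>real_of_int n\<bar> * \<bar>real_of_int m\<bar>" by simp
    ultimately show ?thesis by (simp only: distrib_left distrib_right mult_1 mult_1_right)
  qed
  then have "psi \<nu> n * psi \<nu> m * (1 + \<bar>of_int (n - m)\<bar>)
      \<le> psi \<nu> n * psi \<nu> m * ((1 + \<bar>of_int n\<bar>) * (1 + \<bar>of_int m\<bar>))"
    using psi_pos[of \<nu> n] psi_pos[of \<nu> m] by (intro mult_left_mono) auto
  then show ?thesis by (simp add: growth_def mult_ac)
qed

text \<open>The two roots have product 1. Were both on the unit circle, they would be conjugate, and
  their sum \<open>2 * w\<close> would be real.\<close>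

lemma small_root_exists:
  assumes w: "Im w \<noteq> 0"
  obtains r where "cmod r < 1" "r\<^sup>2 - 2 * w * r + 1 = 0"
proof -
  define q where "q = csqrt (w\<^sup>2 - 1)"
  have q2: "q\<^sup>2 = w\<^sup>2 - 1" by (simp add: q_def)
  have root: "(w + q)\<^sup>2 - 2 * w * (w + q) + 1 = 0" "(w - q)\<^sup>2 - 2 * w * (w - q) + 1 = 0"
    using q2 by (simp_all add: power2_eq_square algebra_simps)
  have prod: "(w + q) * (w - q) = 1" using q2 by (simp add: power2_eq_square algebra_simps)
  then have np: "cmod (w + q) * cmod (w - q) = 1" by (metis norm_mult norm_one)
  have "cmod (w + q) \<noteq> 1"
  proof
    assume 1: "cmod (w + q) = 1"
    have "(w + q) * cnj (w + q) = of_real ((cmod (w + q))\<^sup>2)" by (simp only: complex_norm_square)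
    then have "(w + q) * cnj (w + q) = 1" using 1 by simp
    then have "(w + q) * (w - q) = (w + q) * cnj (w + q)" using prod by simp
    moreover have "w + q \<noteq> 0" using 1 by auto
    ultimately have "w - q = cnj (w + q)" by (metis mult_cancel_left)
    moreover have "2 * w = (w + q) + (w - q)" by simp
    ultimately have "Im (2 * w) = Im ((w + q) + cnj (w + q))" by (simp only:)
    moreover have "Im ((w + q) + cnj (w + q)) = 0" by simp
    ultimately show False using w by simp
  qed
  then consider "cmod (w + q) < 1" | "cmod (w + q) > 1" by linarith
  then show ?thesis
  proof cases
    case 1
    then show ?thesis using root(1) by (rule that)
  next
    case 2
    have "cmod (w - q) < 1"
    proof (rule ccontr)
      assume "\<not> cmod (w - q) < 1"
      then have "1 * 1 < cmod (w + q) * cmod (w - q)" using 2 by (intro mult_less_le_imp_less) auto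
      then show False using np by simp
    qed
    then show ?thesis using root(2) by (rule that)
  qed
qed

text \<open>The prefactor is forced by the jump at the origin:
  \<open>2 * w * b - 2 * b * r = h\<^sup>2\<close> together with
  \<open>2 * w * r = r\<^sup>2 + 1\<close> gives
  \<open>b = h\<^sup>2 * r / (1 - r\<^sup>2)\<close>.\<close>

definition green :: "real \<Rightarrow> complex \<Rightarrow> int \<Rightarrow> complex" where
  "green h r j = of_real (h\<^sup>2) * r / (1 - r\<^sup>2) * r ^ nat \<bar>j\<bar>"

lemma green_recurrence:
  assumes r: "r\<^sup>2 - 2 * w * r + 1 = 0" "r\<^sup>2 \<noteq> 1"
  shows "2 * w * green h r j - green h r (j - 1) - green h r (j + 1) = (if j = 0 then of_real (h\<^sup>2) else 0)"
proof -
  define b where "b = of_real (h\<^sup>2) * r / (1 - r\<^sup>2)"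
  have g: "green h r j = b * r ^ nat \<bar>j\<bar>" for j by (simp add: green_def b_def)
  have r0: "r \<noteq> 0" using r(1) by auto
  have step: "2 * w * (b * r ^ Suc k) - b * r ^ k - b * r ^ Suc (Suc k) = 0" for k
  proof -
    have "2 * w * (b * r ^ Suc k) - b * r ^ k - b * r ^ Suc (Suc k) = - b * r ^ k * (r\<^sup>2 - 2 * w * r + 1)"
      by (simp add: power2_eq_square algebra_simps)
    then show ?thesis using r(1) by simp
  qed
  consider "j = 0" | "j \<ge> 1" | "j \<le> - 1" by linarith
  then show ?thesis
  proof cases
    case 1
    have "b * (1 - r\<^sup>2) = of_real (h\<^sup>2) * r" using r(2) by (simp add: b_def)
    moreover have "(2 * w * b - 2 * b * r) * r = b * (2 * w * r - 2 * r\<^sup>2)"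
      by (simp add: power2_eq_square algebra_simps)
    moreover have "2 * w * r = r\<^sup>2 + 1" using r(1) by (simp add: algebra_simps)
    ultimately have "(2 * w * b - 2 * b * r) * r = of_real (h\<^sup>2) * r" by simp
    then have "2 * w * b - 2 * b * r = of_real (h\<^sup>2)" using r0 by (simp only: mult_cancel_right) simp
    then show ?thesis using 1 by (simp add: g algebra_simps)
  next
    case 2
    then have "nat \<bar>j\<bar> = Suc (nat (j - 1))" "nat \<bar>j - 1\<bar> = nat (j - 1)" "nat \<bar>j + 1\<bar> = Suc (Suc (nat (j - 1)))"
      by auto
    then show ?thesis using step[of "nat (j - 1)"] 2 by (simp only: g) simp
  next
    case 3
    then have "nat \<bar>j\<bar> = Suc (nat (- j - 1))" "nat \<bar>j + 1\<bar> = nat (- j - 1)" "nat \<bar>j - 1\<bar> = Suc (Suc (nat (- j - 1)))"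
      by auto
    then show ?thesis using step[of "nat (- j - 1)"] 3 by (simp only: g) (simp add: algebra_simps)
  qed
qed

lemma green_summable:
  assumes "cmod r < 1"
  shows "(\<lambda>j. cmod (green h r j)) summable_on UNIV"
  unfolding green_def norm_mult norm_power by (rule int_geometric_summable) (use assms in auto)

text \<open>A series of translates in the lattice norm: translates are isometric, so an absolutely
  summable \<open>g\<close> gives a square-summable result at once.\<close>

definition conv :: "(int \<Rightarrow> complex) \<Rightarrow> 'g::complex_inner lat \<Rightarrow> 'g lat" where
  "conv g y = (\<Sum>\<^sub>\<infinity>j. g j *\<^sub>C shift j y)"

lemma conv_has_sum:
  fixes y :: "'g::chilbert_space lat"
  assumes "(\<lambda>j. cmod (g j)) summable_on UNIV"
  shows "((\<lambda>j. g j *\<^sub>C lat_fun y (n - j)) has_sum lat_fun (conv g y) n) UNIV"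
proof -
  have "(\<lambda>j. norm (g j *\<^sub>C shift j y)) summable_on UNIV"
    unfolding norm_scaleC norm_shift by (intro summable_on_cmult_left assms)
  from abs_summable_summable[OF this]
  have "((\<lambda>j. g j *\<^sub>C shift j y) has_sum conv g y) UNIV" unfolding conv_def by (rule has_sum_infsum)
  from lat_has_sum_eval[OF this, of n] show ?thesis by (simp add: scaleC_lat.rep_eq lat_fun_shift)
qed

lemma conv_green:
  fixes y :: "'g::chilbert_space lat"
  assumes r: "cmod r < 1" "r\<^sup>2 - 2 * w * r + 1 = 0"
  shows "(2 * w) *\<^sub>C lat_fun (conv (green h r) y) n - lat_fun (conv (green h r) y) (n - 1)
      - lat_fun (conv (green h r) y) (n + 1) = of_real (h\<^sup>2) *\<^sub>C lat_fun y n"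
proof -
  let ?g = "green h r" and ?c = "\<lambda>n. lat_fun (conv (green h r) y) n"
  note hs = conv_has_sum[OF green_summable[OF r(1)], of h y]
  have r1: "r\<^sup>2 \<noteq> 1"
  proof
    assume "r\<^sup>2 = 1"
    then have "(cmod r)\<^sup>2 = 1" by (metis norm_one norm_power)
    then show False using r(1) by (simp add: abs_square_eq_1)
  qed
  have bij: "bij_betw (\<lambda>j. j + k) UNIV UNIV" for k :: int by (rule bij_betwI[of _ _ _ "\<lambda>n. n - k"]) auto
  have m1: "((\<lambda>j. ?g (j - 1) *\<^sub>C lat_fun y (n - j)) has_sum ?c (n - 1)) UNIV"
    using has_sum_reindex_bij_betw[OF bij[of "-1"], of "\<lambda>j. ?g j *\<^sub>C lat_fun y (n - 1 - j)" "?c (n - 1)"] hs[of "n - 1"]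
    by (simp add: algebra_simps)
  have p1: "((\<lambda>j. ?g (j + 1) *\<^sub>C lat_fun y (n - j)) has_sum ?c (n + 1)) UNIV"
    using has_sum_reindex_bij_betw[OF bij[of 1], of "\<lambda>j. ?g j *\<^sub>C lat_fun y (n + 1 - j)" "?c (n + 1)"] hs[of "n + 1"]
    by (simp add: algebra_simps)
  have "((\<lambda>j. (2 * w) *\<^sub>C ?g j *\<^sub>C lat_fun y (n - j) + - (?g (j - 1) *\<^sub>C lat_fun y (n - j))
        + - (?g (j + 1) *\<^sub>C lat_fun y (n - j))) has_sum
      ((2 * w) *\<^sub>C ?c n + - ?c (n - 1) + - ?c (n + 1))) UNIV"
    using m1 p1
    by (intro has_sum_add has_sum_bounded_linear[OF scaleC.bounded_linear_right hs]) (simp_all only: has_sum_uminus minus_minus)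
  moreover have "(2 * w) *\<^sub>C ?g j *\<^sub>C lat_fun y (n - j) + - (?g (j - 1) *\<^sub>C lat_fun y (n - j))
        + - (?g (j + 1) *\<^sub>C lat_fun y (n - j)) = (if j = 0 then of_real (h\<^sup>2) *\<^sub>C lat_fun y n else 0)" for j
  proof -
    have "(2 * w) *\<^sub>C ?g j *\<^sub>C lat_fun y (n - j) + - (?g (j - 1) *\<^sub>C lat_fun y (n - j))
        + - (?g (j + 1) *\<^sub>C lat_fun y (n - j)) = (2 * w * ?g j - ?g (j - 1) - ?g (j + 1)) *\<^sub>C lat_fun y (n - j)"
      by (simp only: scaleC.diff_left scaleC_scaleC) simp
    then show ?thesis unfolding green_recurrence[OF r(2) r1] by (simp add: scaleC.zero_left)
  qed
  ultimately have "((\<lambda>j::int. if j = 0 then of_real (h\<^sup>2) *\<^sub>C lat_fun y n else 0) has_sum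
      ((2 * w) *\<^sub>C ?c n + - ?c (n - 1) + - ?c (n + 1))) UNIV" by (simp only:)
  moreover have "((\<lambda>j::int. if j = 0 then of_real (h\<^sup>2) *\<^sub>C lat_fun y n else 0) has_sum of_real (h\<^sup>2) *\<^sub>C lat_fun y n) UNIV"
    by (rule has_sum_finite_neutralI[of "{0}"]) auto
  ultimately have "(2 * w) *\<^sub>C ?c n + - ?c (n - 1) + - ?c (n + 1) = of_real (h\<^sup>2) *\<^sub>C lat_fun y n"
    by (rule has_sum_unique)
  then show ?thesis by simp
qed

section \<open>Boundary values of the Green function\<close>

text \<open>The limit of the root in the unit disc as the spectral parameter approaches the real axis from above.\<close>

definition root0 :: "real \<Rightarrow> complex" where
  "root0 w = (if \<bar>w\<bar> < 1 then cis (arccos w)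
     else if w > 1 then of_real (w - sqrt (w\<^sup>2 - 1)) else of_real (w + sqrt (w\<^sup>2 - 1)))"

lemma root0_inside:
  assumes "\<bar>w\<bar> < 1"
  shows "root0 w = cis (arccos w)" "cos (arccos w) = w" "sin (arccos w) = sqrt (1 - w\<^sup>2)" "0 < sqrt (1 - w\<^sup>2)"
proof -
  show "root0 w = cis (arccos w)" using assms by (simp add: root0_def)
  show "cos (arccos w) = w" using assms by simp
  show "sin (arccos w) = sqrt (1 - w\<^sup>2)" using assms by (simp add: sin_arccos_abs)
  show "0 < sqrt (1 - w\<^sup>2)" using assms by (simp add: abs_square_less_1)
qed

lemma root0_outside:
  assumes "\<bar>w\<bar> > 1"
  obtains \<rho> where "root0 w = of_real \<rho>" "\<bar>\<rho>\<bar> < 1" "\<rho>\<^sup>2 - 2 * w * \<rho> + 1 = 0" "\<rho> \<noteq> 0"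
    "\<bar>\<rho> / (1 - \<rho>\<^sup>2)\<bar> = 1 / (2 * sqrt (w\<^sup>2 - 1))"
proof -
  note goal = that
  define q where "q = sqrt (w\<^sup>2 - 1)"
  have "1\<^sup>2 < \<bar>w\<bar>\<^sup>2" using assms by (intro power_strict_mono) auto
  then have q: "0 < q" "q\<^sup>2 = w\<^sup>2 - 1" by (auto simp: q_def)
  \<comment> \<open>Here \<open>\<rho>'\<close> is the other real root, outside the disc; stating
    the facts for the pair treats both signs of \<open>w\<close> at once.\<close>
  have main: thesis if \<rho>: "root0 w = of_real \<rho>" "\<rho> * \<rho>' = 1" "\<rho> + \<rho>' = 2 * w" "\<bar>\<rho>'\<bar> > 1" "\<bar>\<rho>' - \<rho>\<bar> = 2 * q" for \<rho> \<rho>'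
  proof (rule goal[OF \<rho>(1)])
    have np: "\<bar>\<rho>\<bar> * \<bar>\<rho>'\<bar> = 1" using \<rho>(2) by (simp flip: abs_mult)
    show "\<bar>\<rho>\<bar> < 1"
    proof (rule ccontr)
      assume "\<not> \<bar>\<rho>\<bar> < 1"
      then have "1 * 1 < \<bar>\<rho>\<bar> * \<bar>\<rho>'\<bar>" using \<rho>(4) by (intro mult_le_less_imp_less) auto
      then show False using np by simp
    qed
    then have "\<bar>\<rho>\<bar>\<^sup>2 < 1" by (simp add: abs_square_less_1)
    have "\<rho>\<^sup>2 - 2 * w * \<rho> + 1 = \<rho>\<^sup>2 - (\<rho> + \<rho>') * \<rho> + \<rho> * \<rho>'" using \<rho>(2,3) by simp
    also have "\<dots> = 0" by (simp add: power2_eq_square algebra_simps)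
    finally show "\<rho>\<^sup>2 - 2 * w * \<rho> + 1 = 0" .
    show r0: "\<rho> \<noteq> 0" using \<rho>(2) by auto
    have "1 - \<rho>\<^sup>2 = \<rho> * (\<rho>' - \<rho>)" using \<rho>(2) by (simp add: power2_eq_square algebra_simps)
    then have "\<rho> / (1 - \<rho>\<^sup>2) = 1 / (\<rho>' - \<rho>)" using r0 by simp
    then show "\<bar>\<rho> / (1 - \<rho>\<^sup>2)\<bar> = 1 / (2 * sqrt (w\<^sup>2 - 1))" using \<rho>(5) by (simp add: q_def)
  qed
  consider "w > 1" | "w < - 1" using assms by linarith
  then show thesis
  proof cases
    case 1
    show thesis
    proof (rule main[of "w - q" "w + q"])
      show "root0 w = complex_of_real (w - q)" using 1 by (simp add: root0_def q_def)
      show "(w - q) * (w + q) = 1" using q(2) by (simp add: power2_eq_square algebra_simps)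
    qed (use 1 q in auto)
  next
    case 2
    show thesis
    proof (rule main[of "w + q" "w - q"])
      show "root0 w = complex_of_real (w + q)" using 2 by (simp add: root0_def q_def)
      show "(w + q) * (w - q) = 1" using q(2) by (simp add: power2_eq_square algebra_simps)
    qed (use 2 q in auto)
  qed
qed

text \<open>The second root \<open>1 / root0 w\<close> keeps a positive distance from the roots \<open>r\<close> in the unit disc: it lies
  outside the disc if \<open>\<bar>w\<bar> > 1\<close>, and in the opposite half plane if \<open>\<bar>w\<bar> < 1\<close>.\<close>

lemma root_distance:
  assumes w: "\<bar>w\<bar> \<noteq> 1"
  obtains \<delta> where "0 < \<delta>" "\<forall>e r. e > 0 \<longrightarrow> cmod r < 1 \<longrightarrow> r\<^sup>2 - 2 * (of_real w - \<i> * of_real e) * r + 1 = 0 \<longrightarrow>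
    cmod (r - root0 w) \<le> e / \<delta>"
proof -
  have r0: "(root0 w)\<^sup>2 - 2 * of_real w * root0 w + 1 = 0" "root0 w \<noteq> 0"
  proof -
    have "(root0 w)\<^sup>2 - 2 * of_real w * root0 w + 1 = 0 \<and> root0 w \<noteq> 0"
    proof (cases "\<bar>w\<bar> < 1")
      case True
      note * = root0_inside[OF True]
      have "(cos (arccos w))\<^sup>2 + (sin (arccos w))\<^sup>2 = 1" by simp
      then show ?thesis
        using * by (auto simp: complex_eq_iff power2_eq_square algebra_simps)
    next
      case False
      then have "\<bar>w\<bar> > 1" using w by simp
      then obtain \<rho> where \<rho>: "root0 w = of_real \<rho>" "\<rho>\<^sup>2 - 2 * w * \<rho> + 1 = 0" "\<rho> \<noteq> 0" by (rule root0_outside)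
      have "complex_of_real (\<rho>\<^sup>2 - 2 * w * \<rho> + 1) = 0" unfolding \<rho>(2) by simp
      then show ?thesis using \<rho>(1,3) by simp
    qed
    then show "(root0 w)\<^sup>2 - 2 * of_real w * root0 w + 1 = 0" "root0 w \<noteq> 0" by auto
  qed
  define r1 where "r1 = 1 / root0 w"
  have s: "root0 w + r1 = 2 * of_real w" "root0 w * r1 = 1"
  proof -
    have "(root0 w)\<^sup>2 + 1 = 2 * of_real w * root0 w" using r0(1) by (simp add: algebra_simps)
    then show "root0 w + r1 = 2 * of_real w" using r0(2) by (simp add: r1_def power2_eq_square field_simps)
    show "root0 w * r1 = 1" using r0(2) by (simp add: r1_def)
  qed
  have "\<exists>\<delta>>0. \<forall>e r. e > 0 \<longrightarrow> cmod r < 1 \<longrightarrow> r\<^sup>2 - 2 * (of_real w - \<i> * of_real e) * r + 1 = 0 \<longrightarrow> 2 * \<delta> \<le> cmod (r - r1)"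
  proof (cases "\<bar>w\<bar> < 1")
    case True
    note i = root0_inside[OF True]
    have "r1 = cis (- arccos w)" unfolding r1_def i(1) inverse_eq_divide[symmetric] by (rule cis_inverse)
    then have r1: "Im r1 = - sqrt (1 - w\<^sup>2)" by (simp add: i(3))
    have "2 * (sqrt (1 - w\<^sup>2) / 2) \<le> cmod (r - r1)"
      if e: "e > 0" and r: "cmod r < 1" "r\<^sup>2 - 2 * (of_real w - \<i> * of_real e) * r + 1 = 0" for e r
    proof -
      have rn: "r \<noteq> 0" using r(2) by auto
      have "r\<^sup>2 + 1 = 2 * (of_real w - \<i> * of_real e) * r" using r(2) by (simp add: algebra_simps)
      \<comment> \<open>Multiplying by the conjugate of \<open>r\<close> and taking imaginary parts
        gives \<open>Im r * (1 - (cmod r)\<^sup>2) = 2 * e * (cmod r)\<^sup>2\<close>, so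
        \<open>r\<close> lies in the upper half plane.\<close>
      then have "(r\<^sup>2 + 1) * cnj r = 2 * (of_real w - \<i> * of_real e) * (r * cnj r)" by (simp add: mult_ac)
      then have "r * (r * cnj r) + cnj r = 2 * (of_real w - \<i> * of_real e) * (r * cnj r)"
        by (simp add: power2_eq_square algebra_simps)
      then have "r * of_real ((cmod r)\<^sup>2) + cnj r = 2 * (of_real w - \<i> * of_real e) * of_real ((cmod r)\<^sup>2)"
        by (simp only: complex_norm_square)
      from arg_cong[where f = Im, OF this]
      have "Im r * (1 - (cmod r)\<^sup>2) = 2 * e * (cmod r)\<^sup>2" by (simp add: algebra_simps)
      moreover have "0 < 2 * e * (cmod r)\<^sup>2" using e rn by simp
      moreover have "0 < 1 - (cmod r)\<^sup>2" using r(1) by (simp add: abs_square_less_1)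
      ultimately have "0 < Im r" by (metis zero_less_mult_pos2)
      then have "sqrt (1 - w\<^sup>2) \<le> \<bar>Im (r - r1)\<bar>" using i(4) by (simp add: r1)
      also have "\<dots> \<le> cmod (r - r1)" by (rule abs_Im_le_cmod)
      finally show ?thesis by simp
    qed
    then show ?thesis using i(4) by (intro exI[of _ "sqrt (1 - w\<^sup>2) / 2"]) auto
  next
    case False
    then have "\<bar>w\<bar> > 1" using w by simp
    then obtain \<rho> where \<rho>: "root0 w = of_real \<rho>" "\<bar>\<rho>\<bar> < 1" "\<rho> \<noteq> 0" by (rule root0_outside)
    have "cmod r1 > 1" using \<rho> by (simp add: r1_def norm_divide)
    moreover have "2 * ((cmod r1 - 1) / 2) \<le> cmod (r - r1)" if "cmod r < 1" for r
      using norm_triangle_ineq2[of r1 r] that by (simp add: norm_minus_commute)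
    ultimately show ?thesis by (intro exI[of _ "(cmod r1 - 1) / 2"]) auto
  qed
  then obtain \<delta> where \<delta>: "0 < \<delta>" "\<forall>e r. e > 0 \<longrightarrow> cmod r < 1 \<longrightarrow> r\<^sup>2 - 2 * (of_real w - \<i> * of_real e) * r + 1 = 0 \<longrightarrow> 2 * \<delta> \<le> cmod (r - r1)"
    by (elim exE conjE)
  show ?thesis
  proof (rule that[OF \<delta>(1)], intro allI impI)
    fix e r assume e: "(e::real) > 0" and r: "cmod r < 1" "r\<^sup>2 - 2 * (of_real w - \<i> * of_real e) * r + 1 = 0"
    \<comment> \<open>The unperturbed quadratic evaluated at the perturbed root: only the linear
      coefficient differs, which leaves \<open>2 * e\<close> times the modulus of \<open>r\<close>.
      The distance \<open>2 * \<delta>\<close> to \<open>r1\<close> cancels this 2.\<close>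
    have "(r - root0 w) * (r - r1) = r\<^sup>2 - (root0 w + r1) * r + root0 w * r1"
      by (simp add: power2_eq_square algebra_simps)
    also have "\<dots> = - (2 * \<i> * of_real e * r)" unfolding s using r(2) by (simp add: algebra_simps)
    finally have "cmod (r - root0 w) * cmod (r - r1) = cmod (- (2 * \<i> * of_real e * r))"
      by (metis norm_mult)
    also have "\<dots> = 2 * e * cmod r" using e by (simp add: norm_mult)
    also have "\<dots> \<le> 2 * e * 1" using e r(1) by (intro mult_left_mono) auto
    finally have "cmod (r - root0 w) * cmod (r - r1) \<le> 2 * e" by simp
    moreover have "cmod (r - root0 w) * (2 * \<delta>) \<le> cmod (r - root0 w) * cmod (r - r1)"
      using \<delta>(2) e r by (intro mult_left_mono) auto
    ultimately show "cmod (r - root0 w) \<le> e / \<delta>" using \<delta>(1) by (simp add: field_simps)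
  qed
qed

lemma root0_facts:
  assumes w: "\<bar>w\<bar> \<noteq> 1"
  shows "cmod (root0 w) \<le> 1" "(root0 w)\<^sup>2 \<noteq> 1"
proof -
  have "cmod (root0 w) \<le> 1 \<and> (root0 w)\<^sup>2 \<noteq> 1"
  proof (cases "\<bar>w\<bar> < 1")
    case True
    note i = root0_inside[OF True]
    have "Re (cis (arccos w) ^ 2) = w\<^sup>2 - (sqrt (1 - w\<^sup>2))\<^sup>2" using i by (simp add: power2_eq_square)
    also have "\<dots> \<noteq> 1" using i(4) abs_square_less_1[of w] True by simp
    finally show ?thesis unfolding i(1) by (metis norm_cis one_complex.sel(1) order_refl)
  next
    case False
    then have "\<bar>w\<bar> > 1" using w by simp
    then obtain \<rho> where \<rho>: "root0 w = of_real \<rho>" "\<bar>\<rho>\<bar> < 1" by (rule root0_outside)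
    have "\<rho>\<^sup>2 \<noteq> 1" using \<rho>(2) by (simp add: abs_square_eq_1)
    then have "complex_of_real (\<rho>\<^sup>2) \<noteq> 1" by (metis of_real_eq_1_iff)
    moreover have "(root0 w)\<^sup>2 = complex_of_real (\<rho>\<^sup>2)" by (simp add: \<rho>(1))
    ultimately have "(root0 w)\<^sup>2 \<noteq> 1" by (simp only:) simp
    then show ?thesis using \<rho> by simp
  qed
  then show "cmod (root0 w) \<le> 1" "(root0 w)\<^sup>2 \<noteq> 1" by auto
qed

text \<open>In open channels the limiting root has modulus one, so the difference of powers is
  estimated by \<open>\<bar>j\<bar>\<close> times the difference of the roots. This linear growth is
  what the weight \<open>growth\<close> accommodates.\<close>

lemma green_difference:
  assumes "cmod r \<le> 1" "cmod r0 \<le> 1"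
  shows "cmod (green h r j - green h r0 j) \<le>
    (cmod (of_real (h\<^sup>2) * r / (1 - r\<^sup>2) - of_real (h\<^sup>2) * r0 / (1 - r0\<^sup>2))
      + cmod (of_real (h\<^sup>2) * r0 / (1 - r0\<^sup>2)) * cmod (r - r0)) * (1 + \<bar>of_int j\<bar>)"
proof -
  define b b0 where "b = of_real (h\<^sup>2) * r / (1 - r\<^sup>2)" and "b0 = of_real (h\<^sup>2) * r0 / (1 - r0\<^sup>2)"
  let ?n = "nat \<bar>j\<bar>"
  have "green h r j = b * r ^ ?n" "green h r0 j = b0 * r0 ^ ?n"
    by (simp_all add: green_def b_def b0_def)
  then have "green h r j - green h r0 j = (b - b0) * r ^ ?n + b0 * (r ^ ?n - r0 ^ ?n)"
    by (simp add: algebra_simps)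
  then have "cmod (green h r j - green h r0 j) \<le> cmod (b - b0) * cmod r ^ ?n + cmod b0 * cmod (r ^ ?n - r0 ^ ?n)"
    by (metis norm_mult norm_power norm_triangle_ineq)
  also have "\<dots> \<le> cmod (b - b0) * 1 + cmod b0 * (real ?n * cmod (r - r0))"
    by (intro add_mono mult_left_mono power_le_one norm_power_diff assms) auto
  also have "\<dots> \<le> cmod (b - b0) * (1 + real ?n) + cmod b0 * cmod (r - r0) * (1 + real ?n)"
    by (simp add: algebra_simps)
  also have "\<dots> = (cmod (b - b0) + cmod b0 * cmod (r - r0)) * (1 + \<bar>of_int j\<bar>)" by (simp add: distrib_right)
  finally show ?thesis unfolding b_def b0_def .
qed

text \<open>The prefactor becomes \<open>\<i>\<close> times \<open>\<kappa>\<close>. The real part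
  is therefore \<open>- \<kappa> * sin (\<bar>j\<bar> * \<theta>)\<close>, and since the sine is at
  most \<open>\<bar>j\<bar> * \<bar>sin \<theta>\<bar>\<close>, the singular \<open>\<kappa>\<close>
  cancels to \<open>h\<^sup>2 / 2\<close>: only the imaginary part blows up at a threshold.\<close>

lemma green_boundary_inside:
  fixes h w :: real and j :: int
  assumes "\<bar>w\<bar> < 1"
  defines "\<theta> \<equiv> arccos w" and "\<kappa> \<equiv> h\<^sup>2 / (2 * sqrt (1 - w\<^sup>2))"
  shows "Im (green h (root0 w) j) = \<kappa> * cos (of_int j * \<theta>)"
    and "\<bar>Re (green h (root0 w) j)\<bar> \<le> h\<^sup>2 / 2 * \<bar>of_int j\<bar>"
proof -
  note i = root0_inside[OF assms(1)]
  define s where "s = sqrt (1 - w\<^sup>2)"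
  have s: "0 < s" "sin \<theta> = s" "cos \<theta> = w" using i by (simp_all add: s_def \<theta>_def)
  have ws: "w\<^sup>2 + s\<^sup>2 = 1" using sin_cos_squared_add2[of \<theta>] s by (simp add: add.commute)
  have eq: "(1 - (cis \<theta>)\<^sup>2) = - 2 * \<i> * of_real s * cis \<theta>"
    using s ws by (simp add: complex_eq_iff power2_eq_square algebra_simps)
  have b: "of_real (h\<^sup>2) * cis \<theta> / (1 - (cis \<theta>)\<^sup>2) = \<i> * of_real \<kappa>"
    unfolding eq using s(1) by (simp add: \<kappa>_def s_def[symmetric] field_simps)
  have "real (nat \<bar>j\<bar>) = \<bar>of_int j\<bar>" by simp
  then have pow: "cis \<theta> ^ nat \<bar>j\<bar> = cis (\<bar>of_int j\<bar> * \<theta>)" by (simp only: Complex.DeMoivre)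
  have g: "green h (root0 w) j = \<i> * of_real \<kappa> * cis (\<bar>of_int j\<bar> * \<theta>)"
    unfolding green_def i(1) \<theta>_def[symmetric] b pow ..
  have "cos (\<bar>of_int j\<bar> * \<theta>) = cos (of_int j * \<theta>)" by (cases "j \<ge> 0") (simp_all add: abs_if)
  then show "Im (green h (root0 w) j) = \<kappa> * cos (of_int j * \<theta>)" by (simp add: g)
  have "cmod (cis \<theta> ^ nat \<bar>j\<bar> - cis (- \<theta>) ^ nat \<bar>j\<bar>) \<le> real (nat \<bar>j\<bar>) * cmod (cis \<theta> - cis (- \<theta>))"
    by (rule norm_power_diff) simp_all
  moreover have "cis x - cis (- x) = 2 * \<i> * of_real (sin x)" for x by (simp add: complex_eq_iff)
  ultimately have sin_le: "\<bar>sin (\<bar>of_int j\<bar> * \<theta>)\<bar> \<le> \<bar>of_int j\<bar> * \<bar>sin \<theta>\<bar>"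
    by (simp add: Complex.DeMoivre norm_mult)
  have k: "0 \<le> \<kappa>" using s(1) by (simp add: \<kappa>_def s_def[symmetric])
  then have "\<bar>Re (green h (root0 w) j)\<bar> = \<kappa> * \<bar>sin (\<bar>of_int j\<bar> * \<theta>)\<bar>"
    by (simp add: g abs_mult)
  also have "\<dots> \<le> \<kappa> * (\<bar>of_int j\<bar> * s)"
    by (rule mult_left_mono[OF _ k]) (use sin_le s in simp)
  also have "\<dots> = h\<^sup>2 / 2 * \<bar>of_int j\<bar>"
    using s(1) by (simp add: \<kappa>_def s_def[symmetric])
  finally show "\<bar>Re (green h (root0 w) j)\<bar> \<le> h\<^sup>2 / 2 * \<bar>of_int j\<bar>" .
qed

lemma green_boundary_outside:
  assumes "\<bar>w\<bar> > 1"
  shows "Im (green h (root0 w) j) = 0" "\<bar>Re (green h (root0 w) j)\<bar> \<le> h\<^sup>2 / (2 * sqrt (w\<^sup>2 - 1))"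
proof -
  obtain \<rho> where \<rho>: "root0 w = of_real \<rho>" "\<bar>\<rho>\<bar> < 1" "\<bar>\<rho> / (1 - \<rho>\<^sup>2)\<bar> = 1 / (2 * sqrt (w\<^sup>2 - 1))"
    using assms by (rule root0_outside)
  have g: "green h (root0 w) j = of_real (h\<^sup>2 * (\<rho> / (1 - \<rho>\<^sup>2)) * \<rho> ^ nat \<bar>j\<bar>)"
    by (simp add: green_def \<rho>(1))
  then show "Im (green h (root0 w) j) = 0" by (simp only: Im_complex_of_real)
  have "\<bar>Re (green h (root0 w) j)\<bar> = h\<^sup>2 * (1 / (2 * sqrt (w\<^sup>2 - 1))) * \<bar>\<rho>\<bar> ^ nat \<bar>j\<bar>"
    unfolding g Re_complex_of_real abs_mult power_abs[symmetric] \<rho>(3) by simp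
  also have "\<dots> \<le> h\<^sup>2 * (1 / (2 * sqrt (w\<^sup>2 - 1))) * 1"
    using \<rho>(2,3) by (intro mult_left_mono power_le_one mult_nonneg_nonneg) (auto simp flip: \<rho>(3))
  finally show "\<bar>Re (green h (root0 w) j)\<bar> \<le> h\<^sup>2 / (2 * sqrt (w\<^sup>2 - 1))" by simp
qed

section \<open>The sandwiched resolvent and its boundary values\<close>

text \<open>Both shapes of \<open>Q\<close> enter as one: a finite resolution of the identity by
  orthogonal projections on which \<open>Q\<close> acts as a scalar. For \<open>Q = 0\<close> the
  family consists of the identity alone.\<close>

locale lattice_model =
  fixes h \<nu> cK :: real and Q K K' :: "'g::chilbert_space \<Rightarrow> 'g" and V :: "'g lat \<Rightarrow> 'g lat"
    and I :: "nat set" and \<mu> :: "nat \<Rightarrow> real" and p :: "nat \<Rightarrow> 'g \<Rightarrow> 'g"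
  assumes h: "h > 0" and \<nu>: "\<nu> > 3" and I: "finite I"
    and p: "\<And>t. t \<in> I \<Longrightarrow> bounded_clinear (p t)" "\<And>t. t \<in> I \<Longrightarrow> adj (p t) (p t)"
      "\<And>t x. t \<in> I \<Longrightarrow> p t (p t x) = p t x"
    and sum_p: "\<And>x. (\<Sum>t\<in>I. p t x) = x"
    and Q: "self_adjoint Q" "\<And>t x. t \<in> I \<Longrightarrow> Q (p t x) = \<mu> t *\<^sub>R p t x"
    and V: "nonneg_op V" and K: "hs_bound K cK" "adj K K'"

sublocale lattice_model \<subseteq> kernel_weight "growth \<nu>"
  by unfold_locales (rule growth_summable[OF \<nu>])

context lattice_model
begin

section \<open>Kernel operators between square roots of the potential\<close>

definition rV :: "'g lat \<Rightarrow> 'g lat" where "rV = op_sqrt V"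

definition kV :: real where "kV = onorm rV"

lemma rV: "nonneg_op rV" "bounded_clinear rV" "adj rV rV" "rV (rV x) = V x" "norm (rV x) \<le> kV * norm x"
proof -
  show n: "nonneg_op rV" "rV (rV x) = V x" unfolding rV_def by (rule op_sqrt[OF V])+
  show b: "bounded_clinear rV" by (rule nonneg_opD(1)[OF n(1)])
  show "adj rV rV" by (rule nonneg_op_adj[OF n(1)])
  show "norm (rV x) \<le> kV * norm x" unfolding kV_def by (rule onorm[OF bounded_clinear_linear[OF b]])
qed

lemma K': "bounded_clinear K" "bounded_clinear K'" "hs_bound K' cK" "adj K' K"
  using hs_boundD(1)[OF K(1)] adj_bounded[OF hs_boundD(1)[OF K(1)] K(2)] hs_bound_adj[OF K] adj_sym[OF K(2)]
  by auto

lemma norm_p: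
  assumes "t \<in> I"
  shows "norm (p t x) \<le> norm x"
proof -
  have "(norm (p t x))\<^sup>2 = cmod (cinner x (p t x))"
    using adjD[OF p(2)[OF assms], of x "p t x"] p(3)[OF assms, of x]
    by (metis cinner_self norm_of_real abs_of_nonneg zero_le_power2)
  also have "\<dots> \<le> norm x * norm (p t x)" by (rule cmod_cinner_le)
  finally have "norm (p t x) * norm (p t x) \<le> norm x * norm (p t x)" by (simp add: power2_eq_square)
  then show ?thesis by (cases "p t x = 0") simp_all
qed

text \<open>The internal factor of the channel \<open>t\<close>. The outer \<open>K\<close> and
  \<open>K'\<close> of the sandwich are absorbed here, which leaves scalar kernels on the
  lattice.\<close>

definition X :: "nat \<Rightarrow> 'g \<Rightarrow> 'g" where "X t g = K (p t (K' g))"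

definition cX :: real where "cX = (sqrt cK)\<^sup>2 * cK"

lemma X:
  assumes "t \<in> I"
  shows "hs_bound (X t) cX" "adj (X t) (X t)" "bounded_clinear (X t)"
proof -
  have cK: "0 \<le> sqrt cK" using hs_boundD(3)[OF K(1)] by simp
  have "norm (K (p t y)) \<le> sqrt cK * norm y" for y
    using hs_bound_norm[OF K(1), of "p t y"] mult_left_mono[OF norm_p[OF assms, of y] cK] by linarith
  from hs_bound_left[OF K'(3) bounded_clinear_compose[OF K'(1) p(1)[OF assms]] this]
  show hs: "hs_bound (X t) cX" unfolding X_def[abs_def] cX_def .
  show "bounded_clinear (X t)" by (rule hs_boundD(1)[OF hs])
  show "adj (X t) (X t)"
    unfolding adj_def X_def by (simp add: adjD[OF K(2)] adjD[OF K'(4)] adjD[OF p(2)[OF assms]])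
qed

text \<open>One shape for the sandwiched resolvent, its boundary value, their difference, and real
  and imaginary parts. It is linear in the kernels and controlled by their domination constant, so
  limits and parts are taken on scalar kernels.\<close>

definition T :: "(nat \<Rightarrow> int \<Rightarrow> int \<Rightarrow> complex) \<Rightarrow> 'g lat \<Rightarrow> 'g lat" where
  "T a u = rV (\<Sum>t\<in>I. kop (a t) (X t) (rV u))"

definition cT :: real where "cT = kV\<^sup>2 * (kV\<^sup>2 * (real (card I) * (real (card I) * (U\<^sup>2 * cX))))"

lemma adj_T:
  assumes a: "\<And>t. t \<in> I \<Longrightarrow> dom C (a t)"
  shows "adj (T a) (T (\<lambda>t n m. cnj (a t m n)))"
  unfolding adj_def T_def
  by (simp add: adjD[OF rV(3)] cinner.sum_left cinner.sum_right adjD[OF adj_kop[OF a X(1,2)]] bounded_clinear_sum[OF rV(2)])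

lemma hs_bound_T:
  assumes a: "\<And>t. t \<in> I \<Longrightarrow> dom C (a t)"
  shows "hs_bound (T a) (cT * C\<^sup>2)"
proof -
  let ?S = "\<lambda>u. \<Sum>t\<in>I. kop (a t) (X t) u"
  have S: "hs_bound ?S (real (card I) * (\<Sum>t\<in>I. C\<^sup>2 * U\<^sup>2 * cX))"
    by (rule hs_bound_sum[OF I]) (rule hs_bound_kop[OF a X(1)])
  obtain S' where S': "adj ?S S'" by (rule adj_exists[OF hs_boundD(1)[OF S]])
  have hs: "hs_bound (\<lambda>u. rV (?S (rV u))) (kV\<^sup>2 * (kV\<^sup>2 * (real (card I) * (\<Sum>t\<in>I. C\<^sup>2 * U\<^sup>2 * cX))))"
    by (rule hs_bound_left[OF hs_bound_right[OF S S' rV(3,2,5)] rV(2,5)])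
  have eq: "kV\<^sup>2 * (kV\<^sup>2 * (real (card I) * (\<Sum>t\<in>I. C\<^sup>2 * U\<^sup>2 * cX))) = cT * C\<^sup>2"
    by (simp add: cT_def mult_ac)
  show ?thesis using hs unfolding T_def[abs_def] eq .
qed

lemma T_add:
  assumes a: "\<And>t. t \<in> I \<Longrightarrow> dom C (a t)" and b: "\<And>t. t \<in> I \<Longrightarrow> dom C' (b t)"
  shows "T (\<lambda>t n m. a t n m + b t n m) u = T a u + T b u"
  unfolding T_def bounded_clinear_add[OF rV(2), symmetric] sum.distrib[symmetric]
  by (intro arg_cong[where f = rV] sum.cong refl kop_add[OF a b X(3)])

lemma T_scaleC:
  assumes a: "\<And>t. t \<in> I \<Longrightarrow> dom C (a t)"
  shows "T (\<lambda>t n m. b * a t n m) u = b *\<^sub>C T a u"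
  unfolding T_def bounded_clinear_scaleC[OF rV(2), symmetric] scaleC.sum_right
  by (intro arg_cong[where f = rV] sum.cong refl kop_scaleC[OF a X(3)])

lemma dom_scale: "dom C a \<Longrightarrow> dom (cmod b * C) (\<lambda>n m. b * a n m)"
  using mult_left_mono[OF _ norm_ge_zero[of b]] by (simp add: dom_def norm_mult mult.assoc)

text \<open>The kernels are symmetric rather than Hermitian and each \<open>X t\<close> is
  self-adjoint, so the adjoint conjugates the kernel entrywise; real and imaginary parts of the
  operator are those of the entries.\<close>

lemma
  assumes a: "\<And>t. t \<in> I \<Longrightarrow> dom C (a t)" and sym: "\<And>t n m. a t n m = a t m n"
  shows re_part_T: "re_part (T a) = T (\<lambda>t n m. of_real (Re (a t n m)))"
    and im_part_T: "im_part (T a) = T (\<lambda>t n m. of_real (Im (a t n m)))"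
proof -
  let ?c = "\<lambda>t n m. cnj (a t n m)"
  have c: "dom C (?c t)" if "t \<in> I" for t using a[OF that] by (simp add: dom_def)
  have "T (\<lambda>t n m. cnj (a t m n)) = T ?c" by (intro arg_cong[where f = T] ext) (simp add: sym[of _ _ ])
  then have ca: "cadj (T a) = T ?c" using adj_cadj[OF adj_T[OF a]] by simp
  have m: "dom (cmod (-1) * C) (\<lambda>n m. - 1 * ?c t n m)" if "t \<in> I" for t by (rule dom_scale[OF c[OF that]])
  have sum_dom: "dom (C + C') (\<lambda>n m. a t n m + b n m)" if "t \<in> I" "dom C' b" for t b C'
    using a[OF that(1)] that(2) unfolding dom_def
    by (auto intro!: order_trans[OF norm_triangle_ineq] simp: distrib_right add_mono)
  have "re_part (T a) u = T (\<lambda>t n m. of_real (Re (a t n m))) u" for u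
  proof -
    have 1: "T (\<lambda>t n m. a t n m + ?c t n m) u = T a u + T ?c u" by (rule T_add[OF a c])
    have 2: "T (\<lambda>t n m. (1 / 2) * (a t n m + ?c t n m)) u = (1 / 2) *\<^sub>C T (\<lambda>t n m. a t n m + ?c t n m) u"
      by (rule T_scaleC[OF sum_dom[OF _ c]])
    have "re_part (T a) u = T (\<lambda>t n m. (1 / 2) * (a t n m + ?c t n m)) u"
      by (simp only: re_part_def ca 1 2)
    moreover have "(1 / 2) * (a t n m + ?c t n m) = of_real (Re (a t n m))" for t n m
      by (simp add: complex_eq_iff)
    ultimately show ?thesis by (simp only:)
  qed
  then show "re_part (T a) = T (\<lambda>t n m. of_real (Re (a t n m)))" by blast
  have "im_part (T a) u = T (\<lambda>t n m. of_real (Im (a t n m))) u" for u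
  proof -
    have 1: "T (\<lambda>t n m. a t n m + - 1 * ?c t n m) u = T a u + T (\<lambda>t n m. - 1 * ?c t n m) u"
      by (rule T_add[OF a m])
    have 2: "T (\<lambda>t n m. - 1 * ?c t n m) u = - 1 *\<^sub>C T ?c u" by (rule T_scaleC[OF c])
    have 3: "T a u - T ?c u = T (\<lambda>t n m. a t n m + - 1 * ?c t n m) u"
      unfolding 1 2 by (simp add: scaleC.minus_left scaleC_one)
    have 4: "T (\<lambda>t n m. (1 / (2 * \<i>)) * (a t n m + - 1 * ?c t n m)) u
        = (1 / (2 * \<i>)) *\<^sub>C T (\<lambda>t n m. a t n m + - 1 * ?c t n m) u"
      by (rule T_scaleC[OF sum_dom[OF _ m]])
    have "im_part (T a) u = T (\<lambda>t n m. (1 / (2 * \<i>)) * (a t n m + - 1 * ?c t n m)) u"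
      by (simp only: im_part_def ca 3 4)
    moreover have "(1 / (2 * \<i>)) * (a t n m + - 1 * ?c t n m) = of_real (Im (a t n m))" for t n m
      by (simp add: complex_eq_iff Re_divide Im_divide)
    ultimately show ?thesis by (simp only:)
  qed
  then show "im_part (T a) = T (\<lambda>t n m. of_real (Im (a t n m)))" by blast
qed

definition kern :: "(int \<Rightarrow> complex) \<Rightarrow> int \<Rightarrow> int \<Rightarrow> complex" where
  "kern g n m = of_real (psi \<nu> n * psi \<nu> m) * g (n - m)"

lemma dom_kern:
  assumes "\<And>j. cmod (g j) \<le> C * (1 + \<bar>of_int j\<bar>)"
  shows "dom C (kern g)"
  unfolding dom_def
proof (intro allI)
  fix n m
  have C: "0 \<le> C" using order_trans[OF norm_ge_zero assms[of 0]] by simp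
  have ps: "0 \<le> psi \<nu> n * psi \<nu> m" using psi_pos[of \<nu>] by (simp add: less_imp_le)
  have "cmod (kern g n m) = psi \<nu> n * psi \<nu> m * cmod (g (n - m))"
    using ps by (simp add: kern_def norm_mult abs_mult psi_pos less_imp_le)
  also have "\<dots> \<le> psi \<nu> n * psi \<nu> m * (C * (1 + \<bar>of_int (n - m)\<bar>))"
    by (rule mult_left_mono[OF assms ps])
  also have "\<dots> = C * (psi \<nu> n * psi \<nu> m * (1 + \<bar>of_int (n - m)\<bar>))" by (simp only: mult_ac)
  also have "\<dots> \<le> C * (growth \<nu> n * growth \<nu> m)" by (rule mult_left_mono[OF growth_dominates C])
  finally show "cmod (kern g n m) \<le> C * \<bar>growth \<nu> n\<bar> * \<bar>growth \<nu> m\<bar>"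
    using growth_pos[of \<nu>] by (simp add: less_imp_le mult.assoc)
qed

lemma green_le:
  assumes "cmod r \<le> 1"
  shows "cmod (green h r j) \<le> cmod (of_real (h\<^sup>2) * r / (1 - r\<^sup>2)) * (1 + \<bar>of_int j\<bar>)"
proof -
  have "cmod (green h r j) = cmod (of_real (h\<^sup>2) * r / (1 - r\<^sup>2)) * cmod r ^ nat \<bar>j\<bar>"
    by (simp only: green_def norm_mult norm_power)
  also have "\<dots> \<le> cmod (of_real (h\<^sup>2) * r / (1 - r\<^sup>2)) * (1 + \<bar>of_int j\<bar>)"
  proof (rule mult_left_mono[OF _ norm_ge_zero])
    show "cmod r ^ nat \<bar>j\<bar> \<le> 1 + \<bar>of_int j\<bar>"
      using power_le_one[OF norm_ge_zero assms, of "nat \<bar>j\<bar>"] by linarith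
  qed
  finally show ?thesis .
qed

section \<open>The factor of the perturbation and the free operator\<close>

lemma wt: "cmod (weight \<nu> n) \<le> 1" "cnj (weight \<nu> n) = weight \<nu> n"
  using psi_le_1[of \<nu> n] psi_pos[of \<nu> n] \<nu> by (simp_all add: weight_psi)

definition M :: "'g lat \<Rightarrow> 'g lat" where "M = factor_op \<nu> K V"

definition M' :: "'g lat \<Rightarrow> 'g lat" where "M' u = pw (weight \<nu>) K' (rV u)"

lemma M_eq: "M f = rV (pw (weight \<nu>) K f)"
  by (simp add: M_def factor_op_def rV_def mult_op_tensor[OF wt(1) K'(1)])

lemma adj_M: "adj M M'"
proof -
  have "adj (pw (weight \<nu>) K) (pw (weight \<nu>) K')"
    using adj_pw[OF wt(1) K'(1) K(2)] unfolding wt(2) .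
  from adj_compose[OF rV(3) this] show ?thesis unfolding M_eq[abs_def] M'_def[abs_def] .
qed

lemma linQ: "bounded_clinear Q" "adj Q Q"
  using Q(1) by (simp_all add: self_adjoint_def adj_def)

lemma one_le: "cmod ((\<lambda>_. 1) n) \<le> 1" for n :: int
  by simp

lemma H_eq: "H_free h Q f = lap h f + pw (\<lambda>_. 1) Q f"
  by (rule H_free_eq[OF linQ(1)])

lemma bounded_clinear_H: "bounded_clinear (H_free h Q)"
  unfolding H_eq[abs_def] by (rule bounded_clinear_plus[OF bounded_clinear_lap bounded_clinear_pw[OF one_le linQ(1)]])

lemma sym_H: "cinner (H_free h Q f) g = cinner f (H_free h Q g)"
proof -
  have "cinner (lap h f) g = cinner f (lap h g)"
    by (simp only: lap_def cinner_scaleC_left cinner_scaleC_right cinner.diff_left cinner.diff_right cinner_shift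
        minus_minus complex_cnj_complex_of_real complex_cnj_numeral)
       (simp only: diff_diff_eq add.commute)
  moreover have "cinner (pw (\<lambda>_. 1) Q f) g = cinner f (pw (\<lambda>_. 1) Q g)"
    using adjD[OF adj_pw[OF one_le linQ]] by simp
  ultimately show ?thesis by (simp add: H_eq cinner_add_left cinner_add_right)
qed

text \<open>A symmetric operator has no nonreal eigenvalue. Injectivity together with an explicit
  preimage evaluates the \<open>inv\<close> in the resolvent.\<close>

lemma inj_H:
  assumes "Im z \<noteq> 0"
  shows "inj (\<lambda>x. H_free h Q x - z *\<^sub>C x)"
proof (rule injI)
  fix x y assume eq: "H_free h Q x - z *\<^sub>C x = H_free h Q y - z *\<^sub>C y"
  define d where "d = x - y"
  have "H_free h Q d = z *\<^sub>C d"
    using eq by (simp add: d_def bounded_clinear_diff[OF bounded_clinear_H] scaleC.diff_right algebra_simps)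
  then have "cinner d (H_free h Q d) = z * of_real ((norm d)\<^sup>2)"
    by (simp add: cinner_scaleC_right cinner_self)
  moreover have "cinner d (H_free h Q d) = cnj (cinner d (H_free h Q d))"
    using sym_H[of d d] cinner_commute[of d "H_free h Q d"] by simp
  ultimately have "Im (z * of_real ((norm d)\<^sup>2)) = Im (cnj (z * of_real ((norm d)\<^sup>2)))" by metis
  moreover have "Im (z * of_real ((norm d)\<^sup>2)) = Im z * (norm d)\<^sup>2" by (simp flip: of_real_power)
  ultimately have "Im z * (norm d)\<^sup>2 = - (Im z * (norm d)\<^sup>2)" by (simp only: cnj.simps)
  then have "Im z * (norm d)\<^sup>2 = 0" by linarith
  then show "x = y" using assms by (simp add: d_def)
qed

text \<open>With \<open>w = w0 lam t\<close>, the equation \<open>r\<^sup>2 - 2 w r + 1 = 0\<close> characterizes the solutions \<open>r ^ n\<close> of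
  \<open>(-\<Delta>\<^sub>h + \<mu>\<^sub>t - lam) u = 0\<close>; the channel \<open>t\<close> is open iff \<open>\<bar>w\<bar> < 1\<close>.\<close>

definition w0 :: "real \<Rightarrow> nat \<Rightarrow> real" where
  "w0 lam t = 1 - h\<^sup>2 * (lam - \<mu> t) / 2"

text \<open>The resolvent acts in the channel \<open>t\<close> as convolution with the lattice Green function.\<close>

lemma sandwiched_resolvent_eq:
  assumes e: "e > 0"
    and r: "\<And>t. t \<in> I \<Longrightarrow> cmod (r t) < 1"
      "\<And>t. t \<in> I \<Longrightarrow> (r t)\<^sup>2 - 2 * (of_real (w0 lam t) - \<i> * of_real (h\<^sup>2 * e / 2)) * r t + 1 = 0"
  shows "sandwiched_resolvent (H_free h Q) M (Complex lam e) = T (\<lambda>t. kern (green h (r t)))"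
proof
  fix u
  define z where "z = Complex lam e"
  define s where "s = rV u"
  define y where "y = pw (weight \<nu>) K' s"
  define c where "c t = conv (green h (r t)) y" for t
  \<comment> \<open>Ansatz for the resolvent applied to \<open>y\<close>: the convolutions are
    projected onto their channels and added.\<close>
  define x where "x = (\<Sum>t\<in>I. pw (\<lambda>_. 1) (p t) (c t))"
  define W where "W t = of_real (w0 lam t) - \<i> * of_real (h\<^sup>2 * e / 2)" for t
  have W: "2 * W t = 2 - of_real (h\<^sup>2) * (z - of_real (\<mu> t))" for t
    by (simp add: W_def w0_def z_def complex_eq_iff field_simps)
  have xn: "lat_fun x n = (\<Sum>t\<in>I. p t (lat_fun (c t) n))" for n
    unfolding x_def lat_fun_sum by (intro sum.cong refl) (simp add: lat_fun_pw[OF one_le p(1)] scaleC_one)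
  have cn: "(2 * W t) *\<^sub>C lat_fun (c t) n - lat_fun (c t) (n - 1) - lat_fun (c t) (n + 1) = of_real (h\<^sup>2) *\<^sub>C lat_fun y n"
    if "t \<in> I" for t n
    unfolding c_def W_def by (rule conv_green[OF r(1)[OF that] r(2)[OF that]])
  have "H_free h Q x - z *\<^sub>C x = y"
  proof (rule lat_eqI)
    fix n
    let ?b = "of_real (1 / h\<^sup>2) :: complex"
    have "lat_fun (H_free h Q x - z *\<^sub>C x) n
        = ?b *\<^sub>C (2 *\<^sub>C lat_fun x n - lat_fun x (n - 1) - lat_fun x (n + 1)) + Q (lat_fun x n) - z *\<^sub>C lat_fun x n"
      by (simp only: H_eq minus_lat.rep_eq plus_lat.rep_eq scaleC_lat.rep_eq lat_fun_lap lat_fun_pw[OF one_le linQ(1)] scaleC_one)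
    also have "\<dots> = (\<Sum>t\<in>I. ?b *\<^sub>C (2 *\<^sub>C p t (lat_fun (c t) n) - p t (lat_fun (c t) (n - 1)) - p t (lat_fun (c t) (n + 1)))
        + Q (p t (lat_fun (c t) n)) - z *\<^sub>C p t (lat_fun (c t) n))"
      by (simp only: xn sum.distrib sum_subtractf scaleC.diff_right scaleC.sum_right bounded_clinear_sum[OF linQ(1)])
    also have "\<dots> = (\<Sum>t\<in>I. p t (lat_fun y n))"
    proof (rule sum.cong[OF refl])
      fix t assume t: "t \<in> I"
      let ?a = "p t (lat_fun (c t) n)"
      have b1: "?b * of_real (h\<^sup>2) = 1" using h by (simp flip: of_real_mult)
      have "?b *\<^sub>C (2 *\<^sub>C ?a - p t (lat_fun (c t) (n - 1)) - p t (lat_fun (c t) (n + 1))) + Q ?a - z *\<^sub>C ?a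
          = ?b *\<^sub>C ((2 * W t) *\<^sub>C ?a - p t (lat_fun (c t) (n - 1)) - p t (lat_fun (c t) (n + 1)))"
      proof -
        have "Q ?a = of_real (\<mu> t) *\<^sub>C ?a" by (simp only: Q(2)[OF t] scaleC_of_real)
        moreover have "?b *\<^sub>C ((2 * W t) *\<^sub>C ?a) = ?b *\<^sub>C 2 *\<^sub>C ?a - (z - of_real (\<mu> t)) *\<^sub>C ?a"
        proof -
          have "?b * (2 * W t) = ?b * 2 - ?b * of_real (h\<^sup>2) * (z - of_real (\<mu> t))"
            by (simp only: W right_diff_distrib mult.assoc)
          then have "?b * (2 * W t) = ?b * 2 - (z - of_real (\<mu> t))" by (simp only: b1 mult_1)
          then show ?thesis by (simp only: scaleC_scaleC scaleC.diff_left)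
        qed
        ultimately show ?thesis by (simp only: scaleC.diff_right scaleC.diff_left) simp
      qed
      also have "\<dots> = ?b *\<^sub>C p t ((2 * W t) *\<^sub>C lat_fun (c t) n - lat_fun (c t) (n - 1) - lat_fun (c t) (n + 1))"
        by (simp only: bounded_clinear_diff[OF p(1)[OF t]] bounded_clinear_scaleC[OF p(1)[OF t]])
      also have "\<dots> = p t (lat_fun y n)"
        by (simp only: cn[OF t] bounded_clinear_scaleC[OF p(1)[OF t]] scaleC_scaleC b1 scaleC_one)
      finally show "?b *\<^sub>C (2 *\<^sub>C ?a - p t (lat_fun (c t) (n - 1)) - p t (lat_fun (c t) (n + 1))) + Q ?a - z *\<^sub>C ?a
          = p t (lat_fun y n)" .
    qed
    also have "\<dots> = lat_fun y n" by (rule sum_p)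
    finally show "lat_fun (H_free h Q x - z *\<^sub>C x) n = lat_fun y n" .
  qed
  moreover have "Im z \<noteq> 0" using e by (simp add: z_def)
  ultimately have inv: "inv (\<lambda>x. H_free h Q x - z *\<^sub>C x) y = x" by (intro inv_f_eq inj_H)
  have "pw (weight \<nu>) K x = (\<Sum>t\<in>I. kop (kern (green h (r t))) (X t) s)"
  proof (rule lat_eqI)
    fix n
    have chan: "weight \<nu> n *\<^sub>C lat_fun (c t) n = K' (red (row (kern (green h (r t))) n) s)" if t: "t \<in> I" for t
    proof -
      let ?g = "green h (r t)"
      have gs: "(\<lambda>j. cmod (?g j)) summable_on UNIV" by (rule green_summable[OF r(1)[OF t]])
      have dk: "dom (cmod (of_real (h\<^sup>2) * r t / (1 - (r t)\<^sup>2))) (kern ?g)"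
        by (rule dom_kern) (rule green_le[OF less_imp_le[OF r(1)[OF t]]])
      have bij: "bij_betw (\<lambda>m. n - m) UNIV UNIV" by (rule bij_betwI[of _ _ _ "\<lambda>m. n - m"]) auto
      have "((\<lambda>j. ?g j *\<^sub>C lat_fun y (n - j)) has_sum lat_fun (c t) n) UNIV"
        unfolding c_def by (rule conv_has_sum[OF gs])
      then have "((\<lambda>m. ?g (n - m) *\<^sub>C lat_fun y (n - (n - m))) has_sum lat_fun (c t) n) UNIV"
        by (simp only: has_sum_reindex_bij_betw[OF bij, of "\<lambda>j. ?g j *\<^sub>C lat_fun y (n - j)"])
      then have "((\<lambda>m. weight \<nu> n *\<^sub>C ?g (n - m) *\<^sub>C lat_fun y m) has_sum weight \<nu> n *\<^sub>C lat_fun (c t) n) UNIV"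
        using has_sum_bounded_linear[OF scaleC.bounded_linear_right] by fastforce
      moreover have "((\<lambda>m. K' (cnj (lat_fun (row (kern ?g) n) m) *\<^sub>C lat_fun s m)) has_sum K' (red (row (kern ?g) n) s)) UNIV"
        by (rule has_sum_bounded_linear[OF bounded_clinear_linear[OF K'(2)] red_has_sum])
      moreover have "K' (cnj (lat_fun (row (kern ?g) n) m) *\<^sub>C lat_fun s m) = weight \<nu> n *\<^sub>C ?g (n - m) *\<^sub>C lat_fun y m" for m
        by (simp add: lat_fun_row[OF dk] y_def lat_fun_pw[OF wt(1) K'(2)] bounded_clinear_scaleC[OF K'(2)]
            kern_def weight_psi scaleC_scaleC mult_ac)
      ultimately show ?thesis using has_sum_unique by (simp only:) blast
    qed
    have "lat_fun (pw (weight \<nu>) K x) n = K (\<Sum>t\<in>I. p t (weight \<nu> n *\<^sub>C lat_fun (c t) n))"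
      unfolding lat_fun_pw[OF wt(1) K'(1)] xn bounded_clinear_scaleC[OF K'(1), symmetric] scaleC.sum_right
      by (intro arg_cong[where f = K] sum.cong refl) (simp add: bounded_clinear_scaleC[OF p(1)])
    also have "\<dots> = (\<Sum>t\<in>I. K (p t (K' (red (row (kern (green h (r t))) n) s))))"
      unfolding bounded_clinear_sum[OF K'(1)] by (intro sum.cong refl) (simp only: chan)
    also have "\<dots> = lat_fun (\<Sum>t\<in>I. kop (kern (green h (r t))) (X t) s) n"
      unfolding lat_fun_sum
    proof (rule sum.cong[OF refl])
      fix t assume t: "t \<in> I"
      have dk: "dom (cmod (of_real (h\<^sup>2) * r t / (1 - (r t)\<^sup>2))) (kern (green h (r t)))"
        by (rule dom_kern) (rule green_le[OF less_imp_le[OF r(1)[OF t]]])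
      show "K (p t (K' (red (row (kern (green h (r t))) n) s))) = lat_fun (kop (kern (green h (r t))) (X t) s) n"
        unfolding lat_fun_kop[OF dk X(3)[OF t]] by (simp add: X_def)
    qed
    finally show "lat_fun (pw (weight \<nu>) K x) n = lat_fun (\<Sum>t\<in>I. kop (kern (green h (r t))) (X t) s) n" .
  qed
  then show "sandwiched_resolvent (H_free h Q) M (Complex lam e) u = T (\<lambda>t. kern (green h (r t))) u"
    by (simp add: sandwiched_resolvent_def adj_cadj[OF adj_M] M'_def y_def[symmetric] s_def[symmetric]
        z_def[symmetric] inv M_eq T_def)
qed

section \<open>The limit on the real axis\<close>

definition a0 :: "real \<Rightarrow> nat \<Rightarrow> int \<Rightarrow> int \<Rightarrow> complex" where
  "a0 lam t = kern (green h (root0 (w0 lam t)))"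

lemma dom_mono: "dom C a \<Longrightarrow> C \<le> C' \<Longrightarrow> dom C' a"
  unfolding dom_def by (meson abs_ge_zero mult_right_mono order_trans)

lemma dom_a0:
  assumes "\<And>t. t \<in> I \<Longrightarrow> \<bar>w0 lam t\<bar> \<noteq> 1"
  obtains C where "\<forall>t\<in>I. dom C (a0 lam t)"
proof -
  let ?b = "\<lambda>t. cmod (of_real (h\<^sup>2) * root0 (w0 lam t) / (1 - (root0 (w0 lam t))\<^sup>2))"
  have "dom (\<Sum>t\<in>I. ?b t) (a0 lam t)" if t: "t \<in> I" for t
  proof (rule dom_mono)
    show "dom (?b t) (a0 lam t)"
      unfolding a0_def by (rule dom_kern) (rule green_le[OF root0_facts(1)[OF assms[OF t]]])
    show "?b t \<le> (\<Sum>t\<in>I. ?b t)" by (rule member_le_sum[OF t _ I]) simp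
  qed
  then show ?thesis by (intro that ballI)
qed

text \<open>By \<open>root_distance\<close> the roots converge to \<open>root0\<close>, and the
  prefactors converge since \<open>(root0 w)\<^sup>2 \<noteq> 1\<close>. Then
  \<open>green_difference\<close> bounds the kernel of the difference by a vanishing multiple of the
  weight, and \<open>hs_bound_T\<close> carries this over to the Hilbert-Schmidt norm.\<close>

lemma boundary_resolvent_eq:
  assumes w: "\<And>t. t \<in> I \<Longrightarrow> \<bar>w0 lam t\<bar> \<noteq> 1"
  shows "schatten_tendsto 2 (\<lambda>\<epsilon>. sandwiched_resolvent (H_free h Q) M (Complex lam \<epsilon>)) (T (a0 lam)) (at_right 0)"
    and "boundary_resolvent (H_free h Q) M lam = T (a0 lam)"
proof -
  define W where "W e t = of_real (w0 lam t) - \<i> * of_real (h\<^sup>2 * e / 2)" for e t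
  have "\<exists>r. cmod r < 1 \<and> r\<^sup>2 - 2 * W e t * r + 1 = 0" if "e > 0" for e t
  proof -
    have "Im (W e t) \<noteq> 0" using that h by (simp add: W_def)
    then obtain r where "cmod r < 1" "r\<^sup>2 - 2 * W e t * r + 1 = 0" by (rule small_root_exists)
    then show ?thesis by blast
  qed
  then obtain r where r: "\<And>e t. e > 0 \<Longrightarrow> cmod (r e t) < 1 \<and> (r e t)\<^sup>2 - 2 * W e t * r e t + 1 = 0"
    by metis
  define r0 where "r0 t = root0 (w0 lam t)" for t
  let ?b = "\<lambda>r. of_real (h\<^sup>2) * r / (1 - r\<^sup>2) :: complex"
  have lim: "((\<lambda>e. r e t) \<longlongrightarrow> r0 t) (at_right 0)" if t: "t \<in> I" for t
  proof -
    obtain \<delta> where \<delta>: "0 < \<delta>" "\<forall>e r. e > 0 \<longrightarrow> cmod r < 1 \<longrightarrow>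
        r\<^sup>2 - 2 * (of_real (w0 lam t) - \<i> * of_real e) * r + 1 = 0 \<longrightarrow> cmod (r - root0 (w0 lam t)) \<le> e / \<delta>"
      by (rule root_distance[OF w[OF t]])
    have ev: "\<forall>\<^sub>F e in at_right 0. norm (r e t - r0 t) \<le> h\<^sup>2 * e / 2 / \<delta>"
      unfolding eventually_at_right_field
    proof (intro exI[of _ 1] conjI allI impI)
      fix e :: real assume e: "0 < e"
      have "0 < h\<^sup>2 * e / 2" using e h by simp
      then show "norm (r e t - r0 t) \<le> h\<^sup>2 * e / 2 / \<delta>"
        using \<delta>(2) r[OF e, of t] unfolding r0_def W_def by blast
    qed simp
    have "((\<lambda>e. h\<^sup>2 * e / 2 / \<delta>) \<longlongrightarrow> h\<^sup>2 * 0 / 2 / \<delta>) (at_right 0)" by (intro tendsto_intros) (use \<delta>(1) in auto)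
    then have "((\<lambda>e. h\<^sup>2 * e / 2 / \<delta>) \<longlongrightarrow> 0) (at_right 0)" by simp
    from Lim_null_comparison[OF ev this] show ?thesis by (rule LIM_zero_cancel)
  qed
  define \<eta> where "\<eta> e t = cmod (?b (r e t) - ?b (r0 t)) + cmod (?b (r0 t)) * cmod (r e t - r0 t)" for e t
  have \<eta>0: "0 \<le> \<eta> e t" for e t by (simp add: \<eta>_def)
  have \<eta>lim: "((\<lambda>e. \<eta> e t) \<longlongrightarrow> 0) (at_right 0)" if t: "t \<in> I" for t
  proof -
    have nz: "1 - (r0 t)\<^sup>2 \<noteq> 0" using root0_facts(2)[OF w[OF t]] by (simp add: r0_def)
    have "((\<lambda>e. \<eta> e t) \<longlongrightarrow> cmod (?b (r0 t) - ?b (r0 t)) + cmod (?b (r0 t)) * cmod (r0 t - r0 t)) (at_right 0)"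
      unfolding \<eta>_def by (intro tendsto_intros lim[OF t] nz)
    then show ?thesis by simp
  qed
  define E where "E e = (\<Sum>t\<in>I. \<eta> e t)" for e
  have Elim: "((\<lambda>e. sqrt (cT * (E e)\<^sup>2)) \<longlongrightarrow> 0) (at_right 0)"
  proof -
    have "((\<lambda>e. sqrt (cT * (E e)\<^sup>2)) \<longlongrightarrow> sqrt (cT * (\<Sum>t\<in>I. 0)\<^sup>2)) (at_right 0)"
      unfolding E_def by (intro tendsto_intros \<eta>lim)
    then show ?thesis by simp
  qed
  let ?S = "\<lambda>e. sandwiched_resolvent (H_free h Q) M (Complex lam e)"
  have S: "?S e = T (\<lambda>t. kern (green h (r e t)))" if "e > 0" for e
    using r[OF that] by (intro sandwiched_resolvent_eq[OF that]) (simp_all add: W_def)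
  obtain C0 where C0: "\<forall>t\<in>I. dom C0 (a0 lam t)" using w by (rule dom_a0)
  have hs0: "hs_bound (T (a0 lam)) (cT * C0\<^sup>2)" by (rule hs_bound_T) (use C0 in blast)
  have hsS: "hs_bound (?S e) (cT * (\<Sum>t\<in>I. cmod (?b (r e t)))\<^sup>2)" if e: "e > 0" for e
    unfolding S[OF e]
  proof (rule hs_bound_T)
    fix t assume t: "t \<in> I"
    have "dom (cmod (?b (r e t))) (kern (green h (r e t)))"
      by (rule dom_kern) (rule green_le[OF less_imp_le[OF conjunct1[OF r[OF e]]]])
    then show "dom (\<Sum>t\<in>I. cmod (?b (r e t))) (kern (green h (r e t)))"
      by (rule dom_mono) (rule member_le_sum[OF t _ I], simp)
  qed
  have diff: "hs_bound (\<lambda>u. ?S e u - T (a0 lam) u) (cT * (E e)\<^sup>2)" if e: "e > 0" for e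
  proof -
    have dS: "dom (\<Sum>t\<in>I. cmod (?b (r e t))) (kern (green h (r e t)))" if t: "t \<in> I" for t
    proof (rule dom_mono)
      show "dom (cmod (?b (r e t))) (kern (green h (r e t)))"
        by (rule dom_kern) (rule green_le[OF less_imp_le[OF conjunct1[OF r[OF e]]]])
      show "cmod (?b (r e t)) \<le> (\<Sum>t\<in>I. cmod (?b (r e t)))" by (rule member_le_sum[OF t _ I]) simp
    qed
    have d0: "dom C0 (a0 lam t)" if "t \<in> I" for t using C0 that by blast
    have dm: "dom (cmod (-1) * C0) (\<lambda>n m. - 1 * a0 lam t n m)" if "t \<in> I" for t by (rule dom_scale[OF d0[OF that]])
    have eq: "(\<lambda>u. ?S e u - T (a0 lam) u) = T (\<lambda>t. kern (\<lambda>j. green h (r e t) j - green h (r0 t) j))"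
    proof
      fix u
      have 1: "T (\<lambda>t n m. kern (green h (r e t)) n m + - 1 * a0 lam t n m) u
          = T (\<lambda>t. kern (green h (r e t))) u + T (\<lambda>t n m. - 1 * a0 lam t n m) u"
        by (rule T_add[OF dS dm])
      have 2: "T (\<lambda>t n m. - 1 * a0 lam t n m) u = - 1 *\<^sub>C T (a0 lam) u" by (rule T_scaleC[OF d0])
      have "T (\<lambda>t n m. kern (green h (r e t)) n m + - 1 * a0 lam t n m) u = ?S e u - T (a0 lam) u"
        unfolding 1 2 S[OF e] by (simp add: scaleC.minus_left scaleC_one)
      moreover have "kern (green h (r e t)) n m + - 1 * a0 lam t n m = kern (\<lambda>j. green h (r e t) j - green h (r0 t) j) n m" for t n m
        by (simp add: kern_def a0_def r0_def algebra_simps)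
      ultimately show "?S e u - T (a0 lam) u = T (\<lambda>t. kern (\<lambda>j. green h (r e t) j - green h (r0 t) j)) u"
        by (simp only:)
    qed
    show ?thesis
      unfolding eq
    proof (rule hs_bound_T)
      fix t assume t: "t \<in> I"
      have "dom (\<eta> e t) (kern (\<lambda>j. green h (r e t) j - green h (r0 t) j))"
        unfolding \<eta>_def r0_def
        by (rule dom_kern, rule green_difference[OF less_imp_le[OF conjunct1[OF r[OF e]]] root0_facts(1)[OF w[OF t]]])
      then show "dom (E e) (kern (\<lambda>j. green h (r e t) j - green h (r0 t) j))"
        unfolding E_def by (rule dom_mono) (rule member_le_sum[OF t _ I], rule \<eta>0)
    qed
  qed
  have pos: "\<forall>\<^sub>F e in at_right (0::real). e > 0" by (simp add: eventually_at_right_less)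
  have ev1: "\<forall>\<^sub>F e in at_right 0. ?S e \<in> schatten 2"
    using pos by eventually_elim (rule hs_bound_schatten(1)[OF hsS])
  have ev2: "\<forall>\<^sub>F e in at_right 0. norm (schatten_norm 2 (\<lambda>u. ?S e u - T (a0 lam) u)) \<le> sqrt (cT * (E e)\<^sup>2)"
    using pos
  proof eventually_elim
    case (elim e)
    show ?case using hs_bound_schatten(2,3)[OF diff[OF elim]] by simp
  qed
  show st: "schatten_tendsto 2 ?S (T (a0 lam)) (at_right 0)"
    unfolding schatten_tendsto_def
    using hs_bound_schatten(1)[OF hs0] ev1 Lim_null_comparison[OF ev2 Elim] by blast
  show "boundary_resolvent (H_free h Q) M lam = T (a0 lam)"
    unfolding boundary_resolvent_def
  proof (rule the_equality)
    show "schatten_tendsto 2 ?S (T (a0 lam)) (at_right 0)" by (rule st)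
    fix T' assume "schatten_tendsto 2 ?S T' (at_right 0)"
    then show "T' = T (a0 lam)" by (rule schatten_tendsto_unique[OF _ st]) simp
  qed
qed

end

section \<open>The estimate near a non-degenerate threshold\<close>

context lattice_model
begin

definition vec :: "(int \<Rightarrow> real) \<Rightarrow> complex lat" where
  "vec g = Abs_lat (\<lambda>n. of_real (psi \<nu> n * g n))"

lemma
  assumes g: "\<And>n. \<bar>g n\<bar> \<le> C * (1 + \<bar>of_int n\<bar>)"
  shows lat_fun_vec: "lat_fun (vec g) n = of_real (psi \<nu> n * g n)"
    and norm_vec: "(norm (vec g))\<^sup>2 \<le> C\<^sup>2 * U"
proof -
  have le: "(norm (complex_of_real (psi \<nu> n * g n)))\<^sup>2 \<le> C\<^sup>2 * (growth \<nu> n)\<^sup>2" for n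
  proof -
    have "\<bar>psi \<nu> n * g n\<bar> = psi \<nu> n * \<bar>g n\<bar>" using psi_pos[of \<nu> n] by (simp add: abs_mult)
    also have "\<dots> \<le> psi \<nu> n * (C * (1 + \<bar>of_int n\<bar>))"
      by (rule mult_left_mono[OF g less_imp_le[OF psi_pos]])
    also have "\<dots> = C * growth \<nu> n" by (simp add: growth_def)
    finally have "\<bar>psi \<nu> n * g n\<bar>\<^sup>2 \<le> (C * growth \<nu> n)\<^sup>2" by (rule power_mono) simp
    then show ?thesis by (simp only: norm_of_real power_mult_distrib)
  qed
  have sm: "(\<lambda>n. C\<^sup>2 * (growth \<nu> n)\<^sup>2) summable_on UNIV" by (intro summable_on_cmult_right u_summable)
  have sf: "(\<lambda>n. (norm (complex_of_real (psi \<nu> n * g n)))\<^sup>2) summable_on UNIV"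
    by (rule summable_on_comparison_test[OF sm le]) simp
  show 1: "lat_fun (vec g) n = of_real (psi \<nu> n * g n)" for n
    unfolding vec_def by (simp only: lat_fun_Abs[OF sf])
  have "(norm (vec g))\<^sup>2 \<le> (\<Sum>\<^sub>\<infinity>n. C\<^sup>2 * (growth \<nu> n)\<^sup>2)"
    unfolding norm_lat_sq 1 by (rule infsum_mono[OF sf sm le])
  also have "\<dots> = C\<^sup>2 * U" by (simp only: infsum_cmult_right' U_def)
  finally show "(norm (vec g))\<^sup>2 \<le> C\<^sup>2 * U" .
qed

lemma bounded_le_growth: "\<bar>g n\<bar> \<le> 1 \<Longrightarrow> \<bar>g n\<bar> \<le> 1 * (1 + \<bar>real_of_int n\<bar>)" for g :: "int \<Rightarrow> real"
  by (erule order_trans) simp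

lemma vec_diff:
  assumes g: "\<And>n. \<bar>g n\<bar> \<le> 1" "\<And>n. \<bar>g' n\<bar> \<le> 1"
  shows "vec g - vec g' = vec (\<lambda>n. g n - g' n)"
proof -
  have d: "\<bar>g n - g' n\<bar> \<le> 2 * (1 + \<bar>of_int n\<bar>)" for n
  proof -
    have "\<bar>g n - g' n\<bar> \<le> 2" using g(1)[of n] g(2)[of n] by linarith
    then show ?thesis by (rule order_trans) simp
  qed
  have b: "\<bar>g n\<bar> \<le> 1 * (1 + \<bar>of_int n\<bar>)" "\<bar>g' n\<bar> \<le> 1 * (1 + \<bar>of_int n\<bar>)" for n
    by (rule bounded_le_growth, rule g)+
  show ?thesis
    by (rule lat_eqI) (simp add: minus_lat.rep_eq lat_fun_vec[OF b(1)] lat_fun_vec[OF b(2)]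
        lat_fun_vec[OF d] right_diff_distrib)
qed

text \<open>The column built from a lattice vector \<open>v\<close>, with adjoint \<open>Lr\<close>.
  For \<open>v = v0 1\<close> the product of \<open>Lr\<close> and \<open>Lc\<close> on the small
  space is the lower effective operator up to a scalar, and \<open>LL\<close> is the matching
  operator on the lattice side.\<close>

definition Lc :: "nat \<Rightarrow> complex lat \<Rightarrow> 'g \<Rightarrow> 'g lat" where
  "Lc t v g = rV (v \<otimes>\<^sub>l K (p t g))"

definition Lr :: "nat \<Rightarrow> complex lat \<Rightarrow> 'g lat \<Rightarrow> 'g" where
  "Lr t v u = p t (K' (red v (rV u)))"

definition LL :: "nat \<Rightarrow> complex lat \<Rightarrow> 'g lat \<Rightarrow> 'g lat" where
  "LL t v u = Lc t v (Lr t v u)"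

definition cL :: real where "cL = kV\<^sup>2 * cK"

lemma Lc:
  assumes t: "t \<in> I"
  shows "adj (Lc t v) (Lr t v)" "hs_bound (Lc t v) (cL * (norm v)\<^sup>2)" "bounded_clinear (Lr t v)"
proof -
  have "adj (\<lambda>g. K (p t g)) (\<lambda>x. p t (K' x))" by (rule adj_compose[OF K(2) p(2)[OF t]])
  from adj_compose[OF rV(3) adj_compose[OF adj_tensor_red this]]
  show adj: "adj (Lc t v) (Lr t v)" unfolding Lc_def[abs_def] Lr_def[abs_def] .
  have np: "norm (p t x) \<le> 1 * norm x" for x using norm_p[OF t, of x] by simp
  have "hs_bound (\<lambda>g. K (p t g)) (1\<^sup>2 * cK)" by (rule hs_bound_right[OF K p(2,1)[OF t] np])
  moreover have "norm (v \<otimes>\<^sub>l x) \<le> norm v * norm x" for x :: 'g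
    using norm_tensor_le[of v x] by (simp add: mult.commute)
  ultimately have "hs_bound (\<lambda>g. v \<otimes>\<^sub>l K (p t g)) ((norm v)\<^sup>2 * (1\<^sup>2 * cK))"
    by (rule hs_bound_left[OF _ bounded_clinear_tensor])
  from hs_bound_left[OF this rV(2,5)]
  have "hs_bound (Lc t v) (kV\<^sup>2 * ((norm v)\<^sup>2 * (1\<^sup>2 * cK)))" unfolding Lc_def[abs_def] .
  moreover have "kV\<^sup>2 * ((norm v)\<^sup>2 * (1\<^sup>2 * cK)) = cL * (norm v)\<^sup>2" by (simp add: cL_def mult_ac)
  ultimately show hs: "hs_bound (Lc t v) (cL * (norm v)\<^sup>2)" by (simp only:)
  show "bounded_clinear (Lr t v)" by (rule adj_bounded[OF hs_boundD(1)[OF hs] adj])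
qed

lemma Lr_add: "t \<in> I \<Longrightarrow> Lr t (v + v') u = Lr t v u + Lr t v' u"
  by (simp add: Lr_def red_add bounded_clinear_add[OF K'(2)] bounded_clinear_add[OF p(1)])

lemma inner_LL: "t \<in> I \<Longrightarrow> inner u (LL t v u) = (norm (Lr t v u))\<^sup>2"
  by (simp add: LL_def adjD[OF adj_sym[OF Lc(1)], symmetric] cinner_self flip: Re_cinner)

lemma hs_LL:
  assumes t: "t \<in> I"
  shows "\<exists>c. hs_bound (LL t v) c"
proof -
  have "hs_bound (\<lambda>u. Lc t v (Lr t v u)) ((sqrt (cL * (norm v)\<^sup>2))\<^sup>2 * (cL * (norm v)\<^sup>2))"
    by (rule hs_bound_left[OF hs_bound_adj[OF Lc(2,1)[OF t]] hs_boundD(1)[OF Lc(2)[OF t]] hs_bound_norm[OF Lc(2)[OF t]]])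
  then show ?thesis unfolding LL_def[abs_def] by blast
qed

text \<open>The Boolean index separates cosine (\<open>True\<close>) from sine
  (\<open>False\<close>). The same shape serves the imaginary part and the remainder at a threshold,
  so both inherit positivity and the trace bound.\<close>

definition F :: "(nat \<Rightarrow> bool \<Rightarrow> real) \<Rightarrow> (nat \<Rightarrow> bool \<Rightarrow> complex lat) \<Rightarrow> 'g lat \<Rightarrow> 'g lat" where
  "F c v u = (\<Sum>t\<in>I. \<Sum>i\<in>UNIV. c t i *\<^sub>R LL t (v t i) u)"

lemma inner_F: "inner u (F c v u) = (\<Sum>t\<in>I. \<Sum>i\<in>UNIV. c t i * (norm (Lr t (v t i) u))\<^sup>2)"
  unfolding F_def inner_sum_right by (intro sum.cong refl) (simp add: inner_LL)

lemma csa_F: "csa (F c v)"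
proof -
  have "\<forall>t\<in>I. \<exists>cc. \<forall>i. hs_bound (LL t (v t i)) (cc i)"
    by (intro ballI choice allI hs_LL)
  then have "\<exists>cc. \<forall>t\<in>I. \<forall>i. hs_bound (LL t (v t i)) (cc t i)" by (rule bchoice)
  then obtain cc where cc: "\<And>t i. t \<in> I \<Longrightarrow> hs_bound (LL t (v t i)) (cc t i)" by blast
  have hs: "hs_bound (\<lambda>u. \<Sum>t\<in>I. \<Sum>i\<in>UNIV. c t i *\<^sub>R LL t (v t i) u)
    (real (card I) * (\<Sum>t\<in>I. real (card (UNIV :: bool set)) * (\<Sum>i\<in>UNIV. (c t i)\<^sup>2 * cc t i)))"
    by (rule hs_bound_sum[OF I], rule hs_bound_sum[OF finite], rule hs_bound_scaleR, rule cc)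
  have sym: "cinner (LL t w x) y = cinner x (LL t w y)" if "t \<in> I" for t w x y
    unfolding LL_def by (simp add: adjD[OF Lc(1)[OF that]] adjD[OF adj_sym[OF Lc(1)[OF that]]])
  have "adj (F c v) (F c v)"
    unfolding adj_def F_def
    by (simp add: cinner.sum_left cinner.sum_right cinner.scaleR_left cinner.scaleR_right sym)
  with hs show ?thesis unfolding F_def[abs_def] by (rule csa_hs)
qed

lemma F_nonneg: "(\<And>t i. t \<in> I \<Longrightarrow> 0 \<le> c t i) \<Longrightarrow> 0 \<le> inner u (F c v u)"
  unfolding inner_F by (intro sum_nonneg mult_nonneg_nonneg) auto

lemma F_trace:
  assumes c: "\<And>t i. t \<in> I \<Longrightarrow> 0 \<le> c t i" and A: "finite A" "onset A"
  shows "(\<Sum>e\<in>A. inner e (F c v e)) \<le> (\<Sum>t\<in>I. \<Sum>i\<in>UNIV. c t i * (cL * (norm (v t i))\<^sup>2))"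
proof -
  have "(\<Sum>e\<in>A. inner e (F c v e)) = (\<Sum>t\<in>I. \<Sum>i\<in>UNIV. c t i * (\<Sum>e\<in>A. (norm (Lr t (v t i) e))\<^sup>2))"
    unfolding inner_F sum_distrib_left
    by (subst sum.swap, intro sum.cong refl, subst sum.swap, rule refl)
  also have "\<dots> \<le> (\<Sum>t\<in>I. \<Sum>i\<in>UNIV. c t i * (cL * (norm (v t i))\<^sup>2))"
    by (intro sum_mono mult_left_mono hs_boundD(2)[OF hs_bound_adj[OF Lc(2,1)] A] c)
  finally show ?thesis .
qed

text \<open>The amplitude \<open>h\<^sup>2 / (2 * sin \<theta>)\<close> of the imaginary part when
  \<open>w0 lam t = cos \<theta>\<close>; outside the band the Green function is real.\<close>

definition kap :: "real \<Rightarrow> nat \<Rightarrow> real" where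
  "kap lam t = (if \<bar>w0 lam t\<bar> < 1 then h\<^sup>2 / (2 * sqrt (1 - (w0 lam t)\<^sup>2)) else 0)"

definition cs :: "real \<Rightarrow> nat \<Rightarrow> bool \<Rightarrow> complex lat" where
  "cs lam t i = vec (\<lambda>n. if i then cos (of_int n * arccos (w0 lam t)) else sin (of_int n * arccos (w0 lam t)))"

lemma kap_nonneg: "0 \<le> kap lam t"
proof -
  have "\<bar>w0 lam t\<bar> < 1 \<Longrightarrow> (w0 lam t)\<^sup>2 \<le> 1" by (simp add: abs_square_le_1)
  then show ?thesis by (simp add: kap_def)
qed

lemma cs_bound: "\<bar>if i then cos x else sin x\<bar> \<le> (1::real)"
  by simp

lemma cs_le: "\<bar>if i then cos (of_int n * \<theta>) else sin (of_int n * \<theta>)\<bar> \<le> 1 * (1 + \<bar>real_of_int n\<bar>)"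
  by (rule order_trans[OF cs_bound]) simp

lemma lat_fun_cs: "lat_fun (cs lam t i) n =
    of_real (psi \<nu> n * (if i then cos (of_int n * arccos (w0 lam t)) else sin (of_int n * arccos (w0 lam t))))"
  unfolding cs_def by (rule lat_fun_vec[OF cs_le])

lemma norm_cs: "(norm (cs lam t i))\<^sup>2 \<le> U"
  unfolding cs_def using norm_vec[OF cs_le] by (simp only: one_power2 mult_1)

lemma a0_sym: "a0 lam t n m = a0 lam t m n"
proof -
  have "nat \<bar>n - m\<bar> = nat \<bar>m - n\<bar>" by simp
  then show ?thesis by (simp add: a0_def kern_def green_def mult.commute)
qed

text \<open>The addition formula \<open>cos (\<theta> (n - m)) = cos \<theta> n cos \<theta> m + sin \<theta> n sin \<theta> m\<close> makes the imaginary part of each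
  open channel an operator built from two vectors.\<close>

lemma im_part_eq:
  assumes w: "\<And>t. t \<in> I \<Longrightarrow> \<bar>w0 lam t\<bar> \<noteq> 1"
  shows "im_part (T (a0 lam)) = F (\<lambda>t i. kap lam t) (cs lam)"
proof
  fix u
  obtain C where C: "\<forall>t\<in>I. dom C (a0 lam t)" using w by (rule dom_a0)
  let ?r = "\<lambda>v n m. lat_fun v n * cnj (lat_fun v m)"
  let ?k = "\<lambda>t. complex_of_real (kap lam t)"
  have dr: "dom 1 (?r (cs lam t i))" for t i
    unfolding dom_def
  proof (intro allI)
    fix n m
    have b: "cmod (lat_fun (cs lam t i) n) \<le> growth \<nu> n" for n
    proof -
      have "cmod (lat_fun (cs lam t i) n) \<le> psi \<nu> n * 1"
        unfolding lat_fun_cs norm_of_real abs_mult abs_of_pos[OF psi_pos]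
        by (rule mult_left_mono[OF cs_bound less_imp_le[OF psi_pos]])
      also have "\<dots> \<le> growth \<nu> n"
        unfolding growth_def by (rule mult_left_mono[OF _ less_imp_le[OF psi_pos]]) simp
      finally show ?thesis .
    qed
    have "cmod (?r (cs lam t i) n m) \<le> growth \<nu> n * growth \<nu> m"
      unfolding norm_mult complex_mod_cnj
      by (intro mult_mono b less_imp_le[OF growth_pos] norm_ge_zero)
    then show "cmod (?r (cs lam t i) n m) \<le> 1 * \<bar>growth \<nu> n\<bar> * \<bar>growth \<nu> m\<bar>"
      using growth_pos[of \<nu>] by (simp add: less_imp_le)
  qed
  have im: "of_real (Im (a0 lam t n m)) = ?k t * ?r (cs lam t True) n m + ?k t * ?r (cs lam t False) n m"
    if t: "t \<in> I" for t n m
  proof -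
    define \<theta> where "\<theta> = arccos (w0 lam t)"
    have "Im (green h (root0 (w0 lam t)) (n - m)) = kap lam t * cos (of_int (n - m) * \<theta>)"
    proof (cases "\<bar>w0 lam t\<bar> < 1")
      case True
      then show ?thesis using green_boundary_inside(1)[OF True, of h "n - m"] by (simp add: kap_def \<theta>_def)
    next
      case False
      then have "\<bar>w0 lam t\<bar> > 1" using w[OF t] by simp
      then show ?thesis using False by (simp add: green_boundary_outside(1) kap_def)
    qed
    then have "Im (a0 lam t n m) = psi \<nu> n * psi \<nu> m * (kap lam t * cos (of_int n * \<theta> - of_int m * \<theta>))"
      by (simp add: a0_def kern_def left_diff_distrib)
    then have "complex_of_real (Im (a0 lam t n m))
        = of_real (psi \<nu> n * psi \<nu> m * (kap lam t * (cos (of_int n * \<theta>) * cos (of_int m * \<theta>) + sin (of_int n * \<theta>) * sin (of_int m * \<theta>))))"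
      by (simp only: cos_diff)
    also have "\<dots> = ?k t * ?r (cs lam t True) n m + ?k t * ?r (cs lam t False) n m"
      by (simp add: lat_fun_cs \<theta>_def algebra_simps)
    finally show ?thesis .
  qed
  have chan: "kop (\<lambda>n m. of_real (Im (a0 lam t n m))) (X t) s
      = of_real (kap lam t) *\<^sub>C (cs lam t True \<otimes>\<^sub>l X t (red (cs lam t True) s))
        + of_real (kap lam t) *\<^sub>C (cs lam t False \<otimes>\<^sub>l X t (red (cs lam t False) s))" if t: "t \<in> I" for t s
  proof -
    have "kop (\<lambda>n m. of_real (Im (a0 lam t n m))) (X t) s
        = kop (\<lambda>n m. ?k t * ?r (cs lam t True) n m + ?k t * ?r (cs lam t False) n m) (X t) s"
      by (simp only: im[OF t])
    also have "\<dots> = kop (\<lambda>n m. ?k t * ?r (cs lam t True) n m) (X t) s + kop (\<lambda>n m. ?k t * ?r (cs lam t False) n m) (X t) s"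
      by (rule kop_add[OF dom_scale[OF dr] dom_scale[OF dr] X(3)[OF t]])
    also have "\<dots> = of_real (kap lam t) *\<^sub>C (cs lam t True \<otimes>\<^sub>l X t (red (cs lam t True) s))
        + of_real (kap lam t) *\<^sub>C (cs lam t False \<otimes>\<^sub>l X t (red (cs lam t False) s))"
      by (simp only: kop_scaleC[OF dr X(3)[OF t]] kop_rank_one[OF dr X(3)[OF t]])
    finally show ?thesis .
  qed
  have LLX: "LL t v u = rV (v \<otimes>\<^sub>l X t (red v (rV u)))" if "t \<in> I" for t v
    by (simp add: LL_def Lc_def Lr_def X_def p(3)[OF that])
  have "im_part (T (a0 lam)) u = (\<Sum>t\<in>I. rV (kop (\<lambda>n m. of_real (Im (a0 lam t n m))) (X t) (rV u)))"
  proof -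
    have "im_part (T (a0 lam)) = T (\<lambda>t n m. of_real (Im (a0 lam t n m)))"
      by (rule im_part_T[OF _ a0_sym]) (use C in blast)
    then show ?thesis by (simp only: T_def bounded_clinear_sum[OF rV(2)])
  qed
  also have "\<dots> = (\<Sum>t\<in>I. kap lam t *\<^sub>R LL t (cs lam t True) u + kap lam t *\<^sub>R LL t (cs lam t False) u)"
    by (intro sum.cong refl)
       (simp only: chan bounded_clinear_add[OF rV(2)] bounded_clinear_scaleR[OF rV(2)] LLX scaleC_of_real)
  also have "\<dots> = F (\<lambda>t i. kap lam t) (cs lam) u"
    unfolding F_def by (simp add: UNIV_bool add.commute)
  finally show "im_part (T (a0 lam)) u = F (\<lambda>t i. kap lam t) (cs lam) u" .
qed

text \<open>Open channels contribute at most \<open>h\<^sup>2 / 2\<close> times the growth factor,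
  even at the threshold. Only the channels with \<open>\<bar>w0 lam t\<bar> > 1\<close> need a
  distance to their thresholds, which is the hypothesis on \<open>C\<close>.\<close>

lemma re_part_hs:
  assumes w: "\<And>t. t \<in> I \<Longrightarrow> \<bar>w0 lam t\<bar> \<noteq> 1"
    and C: "\<And>t. t \<in> I \<Longrightarrow> \<bar>w0 lam t\<bar> > 1 \<Longrightarrow> h\<^sup>2 / (2 * sqrt ((w0 lam t)\<^sup>2 - 1)) \<le> C" "h\<^sup>2 / 2 \<le> C"
  shows "hs_bound (re_part (T (a0 lam))) (cT * C\<^sup>2)" "csa (re_part (T (a0 lam)))"
proof -
  obtain C' where C': "\<forall>t\<in>I. dom C' (a0 lam t)" using w by (rule dom_a0)
  have eq: "re_part (T (a0 lam)) = T (\<lambda>t n m. of_real (Re (a0 lam t n m)))"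
    by (rule re_part_T[OF _ a0_sym]) (use C' in blast)
  have d: "dom C (\<lambda>n m. of_real (Re (a0 lam t n m)))" if t: "t \<in> I" for t
  proof -
    have "dom C (kern (\<lambda>j. of_real (Re (green h (root0 (w0 lam t)) j))))"
    proof (rule dom_kern)
      fix j
      have "\<bar>Re (green h (root0 (w0 lam t)) j)\<bar> \<le> C * (1 + \<bar>of_int j\<bar>)"
      proof (cases "\<bar>w0 lam t\<bar> < 1")
        case True
        have "\<bar>Re (green h (root0 (w0 lam t)) j)\<bar> \<le> h\<^sup>2 / 2 * \<bar>of_int j\<bar>" by (rule green_boundary_inside(2)[OF True])
        also have "\<dots> \<le> C * (1 + \<bar>of_int j\<bar>)" using C(2) by (intro mult_mono) (auto intro: order_trans[OF _ C(2)])
        finally show ?thesis .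
      next
        case False
        then have o: "\<bar>w0 lam t\<bar> > 1" using w[OF t] by simp
        have "\<bar>Re (green h (root0 (w0 lam t)) j)\<bar> \<le> C * 1"
          using green_boundary_outside(2)[OF o, of h j] C(1)[OF t o] by linarith
        also have "\<dots> \<le> C * (1 + \<bar>of_int j\<bar>)"
          by (rule mult_left_mono) (auto intro: order_trans[OF _ C(2)])
        finally show ?thesis .
      qed
      then show "cmod (of_real (Re (green h (root0 (w0 lam t)) j))) \<le> C * (1 + \<bar>of_int j\<bar>)" by simp
    qed
    moreover have "kern (\<lambda>j. of_real (Re (green h (root0 (w0 lam t)) j))) = (\<lambda>n m. of_real (Re (a0 lam t n m)))"
      by (intro ext) (simp add: kern_def a0_def)
    ultimately show ?thesis by simp
  qed
  show hs: "hs_bound (re_part (T (a0 lam))) (cT * C\<^sup>2)" unfolding eq by (rule hs_bound_T[OF d])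
  have e1: "T (\<lambda>t n m. cnj (complex_of_real (Re (a0 lam t m n)))) = T (\<lambda>t n m. of_real (Re (a0 lam t n m)))"
    by (intro arg_cong[where f = T] ext) (simp add: a0_sym[of lam _ _ _])
  have "adj (T (\<lambda>t n m. of_real (Re (a0 lam t n m)))) (T (\<lambda>t n m. cnj (complex_of_real (Re (a0 lam t m n)))))"
    by (rule adj_T) (rule d)
  then have "adj (re_part (T (a0 lam))) (re_part (T (a0 lam)))" unfolding eq e1 .
  then show "csa (re_part (T (a0 lam)))" by (rule csa_hs[OF hs])
qed

text \<open>Here \<open>d\<close> is the chord from \<open>cis \<theta>\<close> to
  \<open>sg\<close>, and powers of unimodular numbers separate at most linearly. The two claims are
  the real and imaginary parts of that estimate, \<open>sg\<close> being real.\<close>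

lemma unimodular_power_distance:
  fixes sg \<theta> :: real and n :: int
  assumes sg: "sg = 1 \<or> sg = (-1::real)"
  defines "d \<equiv> sqrt (2 - 2 * sg * cos \<theta>)"
  shows "\<bar>cos (of_int n * \<theta>) - sg ^ nat \<bar>n\<bar>\<bar> \<le> d * (1 + \<bar>of_int n\<bar>)"
    and "\<bar>sin (of_int n * \<theta>)\<bar> \<le> d * (1 + \<bar>of_int n\<bar>)"
proof -
  let ?k = "nat \<bar>n\<bar>"
  have sg2: "sg\<^sup>2 = 1" using sg by auto
  have "(cmod (cis \<theta> - of_real sg))\<^sup>2 = (cos \<theta>)\<^sup>2 + (sin \<theta>)\<^sup>2 + sg\<^sup>2 - 2 * sg * cos \<theta>"
    by (simp add: cmod_power2 power2_diff)
  also have "\<dots> = 2 - 2 * sg * cos \<theta>" unfolding sg2 by simp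
  finally have d: "cmod (cis \<theta> - of_real sg) = d"
    unfolding d_def by (metis norm_ge_zero real_sqrt_unique)
  have "cmod (cis \<theta> ^ ?k - of_real sg ^ ?k) \<le> real ?k * cmod (cis \<theta> - of_real sg)"
    by (rule norm_power_diff) (use sg in auto)
  also have "\<dots> \<le> d * (1 + \<bar>of_int n\<bar>)"
  proof -
    have "0 \<le> d" using d by (metis norm_ge_zero)
    from mult_left_mono[OF _ this, of "real ?k" "1 + \<bar>of_int n\<bar>"] show ?thesis
      unfolding d by (simp add: mult.commute)
  qed
  finally have le: "cmod (cis \<theta> ^ ?k - of_real sg ^ ?k) \<le> d * (1 + \<bar>of_int n\<bar>)" .
  have "real ?k = \<bar>of_int n\<bar>" by simp
  then have c: "cis \<theta> ^ ?k = cis (\<bar>of_int n\<bar> * \<theta>)" by (simp only: Complex.DeMoivre)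
  have r: "Re (cis \<theta> ^ ?k - of_real sg ^ ?k) = cos (\<bar>of_int n\<bar> * \<theta>) - sg ^ ?k"
    "Im (cis \<theta> ^ ?k - of_real sg ^ ?k) = sin (\<bar>of_int n\<bar> * \<theta>)"
    unfolding c by (simp_all flip: of_real_power)
  have "cos (\<bar>of_int n\<bar> * \<theta>) = cos (of_int n * \<theta>)" "\<bar>sin (\<bar>of_int n\<bar> * \<theta>)\<bar> = \<bar>sin (of_int n * \<theta>)\<bar>"
    by (cases "n \<ge> 0"; simp add: abs_if)+
  then show "\<bar>cos (of_int n * \<theta>) - sg ^ nat \<bar>n\<bar>\<bar> \<le> d * (1 + \<bar>of_int n\<bar>)"
    "\<bar>sin (of_int n * \<theta>)\<bar> \<le> d * (1 + \<bar>of_int n\<bar>)"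
    using abs_Re_le_cmod[of "cis \<theta> ^ ?k - of_real sg ^ ?k"] abs_Im_le_cmod[of "cis \<theta> ^ ?k - of_real sg ^ ?k"] le
    unfolding r by linarith+
qed

text \<open>The sign \<open>-1\<close> belongs to the upper thresholds and produces \<open>J \<psi>\<close>.\<close>

definition v0 :: "real \<Rightarrow> complex lat" where
  "v0 sg = vec (\<lambda>n. sg ^ nat \<bar>n\<bar>)"

lemma norm_sq_perturb:
  fixes a b :: "'x::real_normed_vector"
  assumes "\<eta> > 0"
  shows "(norm (a + b))\<^sup>2 \<le> (1 + \<eta>) * (norm a)\<^sup>2 + (1 + 1 / \<eta>) * (norm b)\<^sup>2"
proof -
  have "(norm (a + b))\<^sup>2 \<le> (norm a + norm b)\<^sup>2" by (intro power_mono norm_triangle_ineq) simp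
  also have "\<dots> = (norm a)\<^sup>2 + (norm b)\<^sup>2 + 2 * norm a * norm b" by (rule power2_sum)
  also have "2 * norm a * norm b \<le> \<eta> * (norm a)\<^sup>2 + 1 / \<eta> * (norm b)\<^sup>2"
  proof -
    have "0 \<le> (sqrt \<eta> * norm a - norm b / sqrt \<eta>)\<^sup>2" by simp
    also have "\<dots> = \<eta> * (norm a)\<^sup>2 + 1 / \<eta> * (norm b)\<^sup>2 - 2 * norm a * norm b"
      using assms by (simp add: power2_diff power_mult_distrib power_divide)
    finally show ?thesis by simp
  qed
  finally show ?thesis by (simp add: algebra_simps)
qed

text \<open>The perturbed vectors at the channel \<open>s\<close> differ from the threshold vector by \<open>O(\<delta>)\<close> while \<open>\<kappa> \<delta>\<^sup>2\<close> stays bounded.\<close>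

lemma threshold_forms:
  assumes s: "s \<in> I" and sg: "sg = 1 \<or> sg = (-1::real)" and \<eta>: "0 < \<eta>"
    and ws: "\<bar>w0 lam s\<bar> < 1" "0 \<le> sg * w0 lam s"
    and w: "\<And>t. t \<in> I \<Longrightarrow> \<bar>w0 lam t\<bar> \<noteq> 1"
    and Kb: "\<And>t. t \<in> I \<Longrightarrow> t \<noteq> s \<Longrightarrow> kap lam t \<le> Kb" "0 \<le> Kb"
  defines "B \<equiv> im_part (T (a0 lam))"
  obtains D where "csa D" "\<forall>x. 0 \<le> inner x (D x)"
    "\<forall>A. finite A \<longrightarrow> onset A \<longrightarrow> (\<Sum>e\<in>A. inner e (D e)) \<le> (1 + 1 / \<eta>) * cL * U * real (card I) * (2 * h\<^sup>2 + 2 * Kb)"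
    "\<forall>x. inner x (B x) \<le> (1 + \<eta>) * (kap lam s * (norm (Lr s (v0 sg) x))\<^sup>2) + inner x (D x)"
    "\<forall>x. kap lam s * (norm (Lr s (v0 sg) x))\<^sup>2 \<le> (1 + \<eta>) * inner x (B x) + inner x (D x)"
proof -
  define q where "q = 1 + 1 / \<eta>"
  have q: "1 \<le> q" using \<eta> by (simp add: q_def)
  define \<theta> where "\<theta> = arccos (w0 lam s)"
  define d where "d = sqrt (2 - 2 * sg * cos \<theta>)"
  \<comment> \<open>In the channel \<open>s\<close> the cosine vector is replaced by its difference
    from the threshold vector, while the sine vector is small by itself; vectors of the other
    channels go to the remainder unchanged.\<close>
  define v where "v t i = (if t = s \<and> i then cs lam s True - v0 sg else cs lam t i)" for t i
  \<comment> \<open>The factor \<open>q\<close> is the price of Young's inequality for the cosine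
    term; since \<open>1 \<le> q\<close>, it also covers the terms that were not split.\<close>
  define c where "c t i = q * kap lam t" for t and i :: bool
  have cp: "0 \<le> c t i" for t i using q kap_nonneg[of lam t] by (simp add: c_def)
  have cL: "0 \<le> cL" using hs_boundD(3)[OF K(1)] by (simp add: cL_def)
  have Beq: "B = F (\<lambda>t i. kap lam t) (cs lam)" unfolding B_def by (rule im_part_eq[OF w])
  have cw: "cos \<theta> = w0 lam s" unfolding \<theta>_def by (rule root0_inside(2)[OF ws(1)])
  have sg1: "\<bar>sg ^ k\<bar> \<le> 1" for k using sg by (auto simp: power_abs)
  \<comment> \<open>With \<open>a = 1 - sg * w0 lam s\<close> the squared chord is
    \<open>2 * a\<close>, while \<open>1 - (w0 lam s)\<^sup>2 = a * (2 - a)\<close> is at least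
    \<open>a\<^sup>2\<close> because \<open>a \<le> 1\<close>; this is where the sign condition on
    \<open>w0\<close> enters.\<close>
  have kd: "kap lam s * d\<^sup>2 \<le> h\<^sup>2"
  proof -
    define a where "a = 1 - sg * w0 lam s"
    have sw: "\<bar>sg * w0 lam s\<bar> < 1" using sg ws(1) by auto
    have a: "0 < a" "a \<le> 1" using sw ws(2) by (simp_all add: a_def)
    have d2: "d\<^sup>2 = 2 * a"
      unfolding d_def cw a_def using sw by (subst real_sqrt_pow2) auto
    have "(sg * w0 lam s)\<^sup>2 = (w0 lam s)\<^sup>2" using sg by (auto simp: power_mult_distrib)
    then have "1 - (w0 lam s)\<^sup>2 = a * (2 - a)" by (simp add: a_def power2_eq_square algebra_simps)
    also have "\<dots> \<ge> a * a" using a by (intro mult_left_mono) auto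
    finally have "sqrt (a\<^sup>2) \<le> sqrt (1 - (w0 lam s)\<^sup>2)" by (intro real_sqrt_le_mono) (simp add: power2_eq_square)
    then have sq: "a \<le> sqrt (1 - (w0 lam s)\<^sup>2)" using a by simp
    have sp: "0 < sqrt (1 - (w0 lam s)\<^sup>2)" using sq a(1) by (rule order.strict_trans2[rotated])
    have "kap lam s * d\<^sup>2 = h\<^sup>2 * (a / sqrt (1 - (w0 lam s)\<^sup>2))" using ws(1) by (simp add: kap_def d2)
    also have "\<dots> \<le> h\<^sup>2 * 1"
      by (intro mult_left_mono) (simp_all add: divide_le_eq_1_pos[OF sp] sq)
    finally show ?thesis by simp
  qed
  have nv: "kap lam t * (norm (v t i))\<^sup>2 \<le> U * (h\<^sup>2 + Kb)" if t: "t \<in> I" for t i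
  proof (cases "t = s")
    case True
    have "(norm (v s i))\<^sup>2 \<le> d\<^sup>2 * U"
    proof (cases i)
      case True
      have "v s i = vec (\<lambda>n. cos (of_int n * \<theta>) - sg ^ nat \<bar>n\<bar>)"
        using True vec_diff[of "\<lambda>n. cos (of_int n * \<theta>)" "\<lambda>n. sg ^ nat \<bar>n\<bar>"] sg1
        by (simp add: v_def cs_def v0_def \<theta>_def)
      then show ?thesis
        using norm_vec[of "\<lambda>n. cos (of_int n * \<theta>) - sg ^ nat \<bar>n\<bar>" d] unimodular_power_distance(1)[OF sg]
        by (simp add: d_def)
    next
      case False
      have "v s i = vec (\<lambda>n. sin (of_int n * \<theta>))" using False by (simp add: v_def cs_def \<theta>_def)
      then show ?thesis
        using norm_vec[of "\<lambda>n. sin (of_int n * \<theta>)" d] unimodular_power_distance(2)[OF sg]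
        by (simp add: d_def)
    qed
    then have "kap lam s * (norm (v s i))\<^sup>2 \<le> kap lam s * (d\<^sup>2 * U)" by (rule mult_left_mono[OF _ kap_nonneg])
    also have "\<dots> = U * (kap lam s * d\<^sup>2)" by simp
    also have "\<dots> \<le> U * (h\<^sup>2 + Kb)" using kd Kb(2) U_nonneg by (intro mult_left_mono) auto
    finally show ?thesis using True by simp
  next
    case False
    then have "kap lam t * (norm (v t i))\<^sup>2 \<le> Kb * U"
      unfolding v_def using norm_cs[of lam t i] kap_nonneg[of lam t] Kb t by (intro mult_mono) auto
    also have "\<dots> \<le> U * (h\<^sup>2 + Kb)" using U_nonneg by (simp add: algebra_simps)
    finally show ?thesis .
  qed
  have tr: "(\<Sum>e\<in>A. inner e (F c v e)) \<le> (1 + 1 / \<eta>) * cL * U * real (card I) * (2 * h\<^sup>2 + 2 * Kb)"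
    if A: "finite A" "onset A" for A
  proof -
    have "(\<Sum>e\<in>A. inner e (F c v e)) \<le> (\<Sum>t\<in>I. \<Sum>i\<in>UNIV. c t i * (cL * (norm (v t i))\<^sup>2))"
      by (rule F_trace[OF cp A])
    also have "\<dots> \<le> (\<Sum>t\<in>I. \<Sum>i\<in>(UNIV::bool set). q * cL * (U * (h\<^sup>2 + Kb)))"
    proof (intro sum_mono)
      fix t i assume "t \<in> I"
      from mult_left_mono[OF nv[OF this, of i], of "q * cL"] q cL
      show "c t i * (cL * (norm (v t i))\<^sup>2) \<le> q * cL * (U * (h\<^sup>2 + Kb))" by (simp add: c_def mult_ac)
    qed
    also have "\<dots> = (1 + 1 / \<eta>) * cL * U * real (card I) * (2 * h\<^sup>2 + 2 * Kb)"
      by (simp add: q_def algebra_simps)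
    finally show ?thesis .
  qed
  let ?n = "\<lambda>t w x. (norm (Lr t w x))\<^sup>2"
  have split: "Lr s (cs lam s True) x = Lr s (v0 sg) x + Lr s (v s True) x" for x
    unfolding v_def by (simp flip: Lr_add[OF s])
  have qk: "kap lam t \<le> q * kap lam t" for t using q kap_nonneg[of lam t] by (simp add: mult_le_cancel_right1)
  have up: "inner x (B x) \<le> (1 + \<eta>) * (kap lam s * ?n s (v0 sg) x) + inner x (F c v x)" for x
  proof -
    have "(\<Sum>i\<in>UNIV. kap lam t * ?n t (cs lam t i) x) \<le>
        (if t = s then (1 + \<eta>) * (kap lam s * ?n s (v0 sg) x) else 0) + (\<Sum>i\<in>UNIV. c t i * ?n t (v t i) x)" if t: "t \<in> I" for t
    proof (cases "t = s")
      case True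
      have "kap lam s * ?n s (cs lam s True) x \<le> kap lam s * ((1 + \<eta>) * ?n s (v0 sg) x + q * ?n s (v s True) x)"
        unfolding split q_def by (intro mult_left_mono norm_sq_perturb \<eta> kap_nonneg)
      moreover have "kap lam s * ?n s (cs lam s False) x \<le> q * kap lam s * ?n s (v s False) x"
        unfolding v_def using qk[of s] by (simp add: mult_right_mono)
      ultimately show ?thesis using True by (simp add: UNIV_bool c_def algebra_simps)
    next
      case False
      have "kap lam t * ?n t (cs lam t i) x \<le> c t i * ?n t (v t i) x" for i
        using False qk[of t] by (simp add: v_def c_def mult_right_mono)
      then show ?thesis using False by (auto intro: sum_mono)
    qed
    then have "inner x (B x) \<le> (\<Sum>t\<in>I. (if t = s then (1 + \<eta>) * (kap lam s * ?n s (v0 sg) x) else 0)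
        + (\<Sum>i\<in>UNIV. c t i * ?n t (v t i) x))"
      unfolding Beq inner_F by (rule sum_mono)
    then show ?thesis using s I by (simp add: sum.distrib inner_F)
  qed
  have low: "kap lam s * ?n s (v0 sg) x \<le> (1 + \<eta>) * inner x (B x) + inner x (F c v x)" for x
  proof -
    have "Lr s (v0 sg) x = Lr s (cs lam s True) x + - Lr s (v s True) x" using split[of x] by simp
    then have "kap lam s * ?n s (v0 sg) x \<le> kap lam s * ((1 + \<eta>) * ?n s (cs lam s True) x + q * ?n s (v s True) x)"
      unfolding q_def using norm_sq_perturb[OF \<eta>, of "Lr s (cs lam s True) x" "- Lr s (v s True) x"]
      by (intro mult_left_mono kap_nonneg) simp
    also have "\<dots> = (1 + \<eta>) * (kap lam s * ?n s (cs lam s True) x) + c s True * ?n s (v s True) x"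
      by (simp add: c_def algebra_simps)
    also have "\<dots> \<le> (1 + \<eta>) * inner x (B x) + inner x (F c v x)"
    proof (intro add_mono mult_left_mono)
      have one: "f s True \<le> (\<Sum>t\<in>I. \<Sum>i\<in>UNIV. f t i)" if "\<And>t i. 0 \<le> f t i" for f :: "nat \<Rightarrow> bool \<Rightarrow> real"
      proof -
        have "f s True \<le> (\<Sum>i\<in>UNIV. f s i)" by (rule member_le_sum) (auto intro: that)
        also have "\<dots> \<le> (\<Sum>t\<in>I. \<Sum>i\<in>UNIV. f t i)"
          by (rule member_le_sum[OF s _ I]) (auto intro: sum_nonneg that)
        finally show ?thesis .
      qed
      show "kap lam s * ?n s (cs lam s True) x \<le> inner x (B x)"
        unfolding Beq inner_F by (rule one) (simp add: kap_nonneg)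
      show "c s True * ?n s (v s True) x \<le> inner x (F c v x)"
        unfolding inner_F by (rule one) (simp add: cp)
    qed (use \<eta> in simp)
    finally show ?thesis .
  qed
  show ?thesis
    by (rule that[OF csa_F, of c v]) (use F_nonneg[OF cp] tr up low in auto)
qed

end

section \<open>The spectral shift function and the effective operators\<close>

lemma counting_zero: "counting \<sigma> 1 (\<lambda>x :: 'a::chilbert_space. 0) = 0"
proof -
  have "csa (\<lambda>x :: 'a. 0)"
    by (rule csa_hs[OF hs_bound_0]) (simp add: adj_def cinner.zero_left cinner.zero_right)
  moreover have "le_off (\<lambda>x :: 'a. 0) 1 {}" by (simp add: le_off_def)
  ultimately have "counting 1 1 (\<lambda>x :: 'a. 0) \<le> card ({} :: 'a set)" by (rule counting_le[OF _ zero_less_one])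
  then show ?thesis by (simp add: counting_scaleR[of \<sigma>])
qed

lemma csa_combination:
  fixes A B :: "'a::chilbert_space \<Rightarrow> 'a"
  assumes "hs_bound A a" "hs_bound B b" "adj A A" "adj B B"
  shows "csa (\<lambda>x. r *\<^sub>R A x + t *\<^sub>R B x)"
proof -
  have "hs_bound (\<lambda>x. r *\<^sub>R A x - (- t) *\<^sub>R B x) (2 * (r\<^sup>2 * a + (- t)\<^sup>2 * b))"
    by (rule hs_bound_diff[OF hs_bound_scaleR[OF assms(1)] hs_bound_scaleR[OF assms(2)]])
  then have "hs_bound (\<lambda>x. r *\<^sub>R A x + t *\<^sub>R B x) (2 * (r\<^sup>2 * a + (- t)\<^sup>2 * b))" by simp
  then show ?thesis
    by (rule csa_hs) (simp add: adj_def cinner_add_left cinner_add_right cinner.scaleR_left cinner.scaleR_right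
        adjD[OF assms(3)] adjD[OF assms(4)])
qed

context lattice_model
begin

section \<open>Reduction of the spectral shift function to an average\<close>

definition avg :: "real \<Rightarrow> real \<Rightarrow> real" where
  "avg \<tau> lam = (LINT t|lborel. real (counting 1 1 (\<lambda>x. \<tau> *\<^sub>R re_part (T (a0 lam)) x + t *\<^sub>R im_part (T (a0 lam)) x)) / (1 + t\<^sup>2))"

text \<open>Pulling \<open>- \<sigma>\<close> out of \<open>counting\<close> puts it on both parts.
  For \<open>\<sigma> = 1\<close> the reflection of \<open>t\<close> preserves the Cauchy kernel and
  restores the positive sign of \<open>B\<close>, so both perturbations differ only in the sign of
  \<open>A\<close>.\<close>

lemma pushnitski_eq:
  assumes w: "\<And>t. t \<in> I \<Longrightarrow> \<bar>w0 lam t\<bar> \<noteq> 1" and \<sigma>: "\<sigma> = 1 \<or> \<sigma> = -1"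
  shows "pushnitski_formula \<sigma> (H_free h Q) M lam = \<sigma> * (1 / pi) * avg (- \<sigma>) lam"
proof -
  define A B where "A = re_part (T (a0 lam))" and "B = im_part (T (a0 lam))"
  define N where "N t = real (counting 1 1 (\<lambda>x. (- \<sigma>) *\<^sub>R A x + t *\<^sub>R B x))" for t
  have c: "real (counting (- \<sigma>) 1 (\<lambda>x. A x + t *\<^sub>R B x)) = N (- \<sigma> * t)" for t
    unfolding N_def by (subst counting_scaleR) (simp add: scaleR_add_right)
  have "(LINT t|lborel. N (- \<sigma> * t) / (1 + t\<^sup>2)) = (LINT t|lborel. N t / (1 + t\<^sup>2))"
    using \<sigma>
  proof
    assume "\<sigma> = 1"
    then show ?thesis
      using lborel_integral_real_affine[of "-1" "\<lambda>t. N t / (1 + t\<^sup>2)" 0] by simp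
  qed simp
  moreover have br: "boundary_resolvent (H_free h Q) M lam = T (a0 lam)"
    by (rule boundary_resolvent_eq(2)) (rule w)
  ultimately show ?thesis
    unfolding pushnitski_formula_def br avg_def A_def[symmetric] B_def[symmetric] c
    by (simp only: N_def)
qed

text \<open>The description in \<open>ssf\<close> ranges over both signs; this settles the one case
  in which both are possible, as equality of the two perturbed operators forces
  \<open>M = 0\<close>.\<close>

lemma pushnitski_zero:
  assumes w: "\<And>t. t \<in> I \<Longrightarrow> \<bar>w0 lam t\<bar> \<noteq> 1" and M0: "\<And>f. M f = 0"
  shows "pushnitski_formula \<sigma> (H_free h Q) M lam = 0"
proof -
  have S: "sandwiched_resolvent (H_free h Q) M z = (\<lambda>u. 0)" for z
    by (simp add: sandwiched_resolvent_def M0 fun_eq_iff)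
  have sn: "schatten_norm 2 (\<lambda>u :: 'g lat. 0 :: 'g lat) = 0"
    using hs_bound_schatten(2,3)[OF hs_bound_0[where 'a = "'g lat" and 'b = "'g lat"]] by simp
  have "schatten_tendsto 2 (\<lambda>\<epsilon>. sandwiched_resolvent (H_free h Q) M (Complex lam \<epsilon>)) (\<lambda>u. 0) (at_right 0)"
    unfolding schatten_tendsto_def S
    using hs_bound_schatten(1)[OF hs_bound_0[where 'a = "'g lat" and 'b = "'g lat"]] by (simp add: sn)
  from schatten_tendsto_unique[OF boundary_resolvent_eq(1)[OF w] this]
  have T0: "T (a0 lam) = (\<lambda>u. 0)" by simp
  have br: "boundary_resolvent (H_free h Q) M lam = T (a0 lam)"
    by (rule boundary_resolvent_eq(2)) (rule w)
  have "boundary_resolvent (H_free h Q) M lam = (\<lambda>u. 0)" unfolding br by (rule T0)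
  moreover have "cadj (\<lambda>u :: 'g lat. 0 :: 'g lat) = (\<lambda>u. 0)"
    by (rule adj_cadj) (simp add: adj_def cinner.zero_left cinner.zero_right)
  then have "re_part (\<lambda>u :: 'g lat. 0) = (\<lambda>u. 0)" "im_part (\<lambda>u :: 'g lat. 0) = (\<lambda>u. 0)"
    by (simp_all add: re_part_def im_part_def fun_eq_iff scaleC.zero_right)
  ultimately show ?thesis by (simp add: pushnitski_formula_def counting_zero)
qed

lemma V_op_eq: "V_op \<nu> K V f = M' (M f)"
  by (simp add: V_op_def adj_cadj[OF K(2)] mult_op_tensor[OF wt(1) K'(1)] mult_op_tensor[OF wt(1) K'(2)]
      M'_def M_eq rV(4))

lemma ssf_eq:
  assumes w: "\<And>t. t \<in> I \<Longrightarrow> \<bar>w0 lam t\<bar> \<noteq> 1" and \<sigma>: "\<sigma> = 1 \<or> \<sigma> = -1"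
  shows "- \<sigma> * ssf (H_pert \<sigma> h \<nu> Q K V) (H_free h Q) (factor_op \<nu> K V) lam = - (1 / pi) * avg (- \<sigma>) lam"
proof -
  have H1: "H_pert \<sigma> h \<nu> Q K V = (\<lambda>f. H_free h Q f + \<sigma> *\<^sub>R cadj M (M f))"
    by (simp add: fun_eq_iff H_pert_def V_op_eq adj_cadj[OF adj_M])
  have "ssf (H_pert \<sigma> h \<nu> Q K V) (H_free h Q) M lam = pushnitski_formula \<sigma> (H_free h Q) M lam"
    unfolding ssf_def
  proof (rule the_equality)
    show "\<exists>\<sigma>'\<in>{1, -1}. H_pert \<sigma> h \<nu> Q K V = (\<lambda>f. H_free h Q f + \<sigma>' *\<^sub>R cadj M (M f)) \<and>
        pushnitski_formula \<sigma> (H_free h Q) M lam = pushnitski_formula \<sigma>' (H_free h Q) M lam"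
      using H1 \<sigma> by (intro bexI[of _ \<sigma>]) auto
    fix x assume "\<exists>\<sigma>'\<in>{1, -1}. H_pert \<sigma> h \<nu> Q K V = (\<lambda>f. H_free h Q f + \<sigma>' *\<^sub>R cadj M (M f)) \<and>
        x = pushnitski_formula \<sigma>' (H_free h Q) M lam"
    then obtain \<sigma>' where \<sigma>': "\<sigma>' = 1 \<or> \<sigma>' = -1" "x = pushnitski_formula \<sigma>' (H_free h Q) M lam"
      "H_pert \<sigma> h \<nu> Q K V = (\<lambda>f. H_free h Q f + \<sigma>' *\<^sub>R cadj M (M f))" by blast
    show "x = pushnitski_formula \<sigma> (H_free h Q) M lam"
    proof (cases "\<sigma>' = \<sigma>")
      case False
      have "M f = 0" for f
      proof -
        have "\<sigma> *\<^sub>R M' (M f) = \<sigma>' *\<^sub>R M' (M f)"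
          using fun_cong[OF \<sigma>'(3), of f] unfolding H1 by (simp add: adj_cadj[OF adj_M])
        then have "M' (M f) = 0" using False by simp
        then have "cinner (M f) (M f) = 0" by (simp add: adjD[OF adj_M] cinner.zero_right)
        then show ?thesis by (simp add: cinner_self)
      qed
      then show ?thesis unfolding \<sigma>'(2) using pushnitski_zero[OF w] by simp
    qed (simp add: \<sigma>')
  qed
  then have "- \<sigma> * ssf (H_pert \<sigma> h \<nu> Q K V) (H_free h Q) (factor_op \<nu> K V) lam
      = - (\<sigma> * \<sigma>) * (1 / pi) * avg (- \<sigma>) lam"
    unfolding M_def[symmetric] by (simp add: pushnitski_eq[OF w \<sigma>])
  also have "\<sigma> * \<sigma> = 1" using \<sigma> by auto
  finally show ?thesis by simp
qed

text \<open>Common form of \<open>omega_lower\<close> (\<open>sg = 1\<close>) and of the negative of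
  \<open>omega_upper\<close> (\<open>sg = -1\<close>), with V multiplied by \<open>r\<close> and
  \<open>\<kappa>\<close> equal to \<open>h / 2\<close> over the root of the distance to the
  threshold.\<close>

definition eff :: "nat \<Rightarrow> real \<Rightarrow> real \<Rightarrow> real \<Rightarrow> 'g \<Rightarrow> 'g" where
  "eff s sg \<kappa> r x = r *\<^sub>R \<kappa> *\<^sub>R Lr s (v0 sg) (Lc s (v0 sg) x)"

text \<open>The value \<open>\<epsilon> / 16\<close> is spent twice: on Young's inequality in
  \<open>threshold_forms\<close> and on replacing \<open>kap\<close> by its leading term
  \<open>\<kappa>\<close>. The product \<open>(1 + \<epsilon> / 16)\<^sup>2\<close> stays below the
  factor \<open>1 + \<epsilon> / 4\<close> required by \<open>cauchy_average\<close>.\<close>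

lemma avg_estimate:
  assumes s: "s \<in> I" and sg: "sg = 1 \<or> sg = (-1::real)" and \<epsilon>: "0 < \<epsilon>" "\<epsilon> < 1" and \<tau>: "\<bar>\<tau>\<bar> = 1"
    and ws: "\<bar>w0 lam s\<bar> < 1" "0 \<le> sg * w0 lam s"
    and w: "\<And>t. t \<in> I \<Longrightarrow> t \<noteq> s \<Longrightarrow> \<bar>w0 lam t\<bar> \<noteq> 1 \<and> h\<^sup>2 / (2 * sqrt \<bar>1 - (w0 lam t)\<^sup>2\<bar>) \<le> Kb" "0 \<le> Kb"
    and \<kappa>: "0 \<le> \<kappa>" "\<kappa> \<le> kap lam s" "kap lam s \<le> (1 + \<epsilon> / 16) * \<kappa>"
  defines "E \<equiv> 64 * (cT * (h\<^sup>2 / 2 + Kb)\<^sup>2) / \<epsilon>\<^sup>2 * (LINT t|lborel. 1 / (1 + t\<^sup>2))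
      + 4 / \<epsilon> * ((1 + 1 / (\<epsilon> / 16)) * cL * U * real (card I) * (2 * h\<^sup>2 + 2 * Kb))"
  shows "avg \<tau> lam \<le> tr_arctan (eff s sg \<kappa> (1 / (1 - \<epsilon>))) + E"
    and "tr_arctan (eff s sg \<kappa> (1 / (1 + \<epsilon>))) \<le> avg \<tau> lam + E"
proof -
  let ?\<eta> = "\<epsilon> / 16"
  have w': "\<bar>w0 lam t\<bar> \<noteq> 1" if "t \<in> I" for t using w(1)[OF that] ws(1) by (cases "t = s") auto
  define A B where "A = re_part (T (a0 lam))" and "B = im_part (T (a0 lam))"
  have kb: "kap lam t \<le> Kb" if "t \<in> I" "t \<noteq> s" for t
  proof (cases "\<bar>w0 lam t\<bar> < 1")
    case True
    then have "0 \<le> 1 - (w0 lam t)\<^sup>2" by (simp add: abs_square_le_1)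
    then show ?thesis using w(1)[OF that] True by (simp add: kap_def)
  qed (simp add: kap_def w(2))
  have \<eta>: "0 < ?\<eta>" using \<epsilon> by simp
  obtain D where D: "csa D" "\<forall>x. 0 \<le> inner x (D x)"
    "\<forall>A. finite A \<longrightarrow> onset A \<longrightarrow> (\<Sum>e\<in>A. inner e (D e)) \<le> (1 + 1 / ?\<eta>) * cL * U * real (card I) * (2 * h\<^sup>2 + 2 * Kb)"
    "\<forall>x. inner x (im_part (T (a0 lam)) x) \<le> (1 + ?\<eta>) * (kap lam s * (norm (Lr s (v0 sg) x))\<^sup>2) + inner x (D x)"
    "\<forall>x. kap lam s * (norm (Lr s (v0 sg) x))\<^sup>2 \<le> (1 + ?\<eta>) * inner x (im_part (T (a0 lam)) x) + inner x (D x)"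
    by (rule threshold_forms[OF s sg \<eta> ws w' kb w(2)])
  have C: "h\<^sup>2 / (2 * sqrt ((w0 lam t)\<^sup>2 - 1)) \<le> h\<^sup>2 / 2 + Kb" if t: "t \<in> I" "\<bar>w0 lam t\<bar> > 1" for t
  proof -
    have "t \<noteq> s" using t ws(1) by auto
    moreover have "1\<^sup>2 < \<bar>w0 lam t\<bar>\<^sup>2" using t(2) by (intro power_strict_mono) auto
    then have "\<bar>1 - (w0 lam t)\<^sup>2\<bar> = (w0 lam t)\<^sup>2 - 1" by simp
    ultimately have "h\<^sup>2 / (2 * sqrt ((w0 lam t)\<^sup>2 - 1)) \<le> Kb" using w(1)[OF t(1)] by simp
    then show ?thesis by (rule order_trans) simp
  qed
  have C2: "h\<^sup>2 / 2 \<le> h\<^sup>2 / 2 + Kb" using w(2) by simp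
  note A = re_part_hs[OF w' C C2, folded A_def]
  have BF: "B = F (\<lambda>t i. kap lam t) (cs lam)" unfolding B_def by (rule im_part_eq[OF w'])
  obtain C' where C': "\<forall>t\<in>I. dom C' (a0 lam t)" using w' by (rule dom_a0)
  have hsB: "hs_bound B (cT * C'\<^sup>2)"
  proof -
    have "B = T (\<lambda>t n m. of_real (Im (a0 lam t n m)))"
      unfolding B_def by (rule im_part_T[OF _ a0_sym]) (use C' in blast)
    moreover have "dom C' (\<lambda>n m. of_real (Im (a0 lam t n m)))" if t: "t \<in> I" for t
      unfolding dom_def
    proof (intro allI)
      fix n m
      have "cmod (a0 lam t n m) \<le> C' * \<bar>growth \<nu> n\<bar> * \<bar>growth \<nu> m\<bar>" using C' t by (simp add: dom_def)
      then show "cmod (of_real (Im (a0 lam t n m))) \<le> C' * \<bar>growth \<nu> n\<bar> * \<bar>growth \<nu> m\<bar>"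
        unfolding norm_of_real using abs_Im_le_cmod[of "a0 lam t n m"] by linarith
    qed
    ultimately show ?thesis using hs_bound_T by simp
  qed
  have csaB: "csa B" unfolding BF by (rule csa_F)
  have adj: "adj A A" "adj B B" using csaD(4)[OF A(2)] csaD(4)[OF csaB] by (simp_all add: adj_def)
  have B0: "0 \<le> inner x (B x)" for x unfolding BF by (rule F_nonneg) (rule kap_nonneg)
  let ?r = "sqrt \<kappa>"
  let ?L = "\<lambda>g. ?r *\<^sub>R Lc s (v0 sg) g" and ?L' = "\<lambda>u. ?r *\<^sub>R Lr s (v0 sg) u"
  have nL: "(norm (?L' x))\<^sup>2 = \<kappa> * (norm (Lr s (v0 sg) x))\<^sup>2" for x
    using \<kappa>(1) by (simp add: power_mult_distrib)
  interpret ca: cauchy_average A B D ?L ?L' \<tau> \<epsilon> "cT * (h\<^sup>2 / 2 + Kb)\<^sup>2"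
    "\<Sum>t\<in>I. \<Sum>i\<in>UNIV. kap lam t * (cL * (norm (cs lam t i))\<^sup>2)"
    "(1 + 1 / ?\<eta>) * cL * U * real (card I) * (2 * h\<^sup>2 + 2 * Kb)" "?r\<^sup>2 * (cL * (norm (v0 sg))\<^sup>2)"
  proof
    show "csa (\<lambda>x. \<tau> *\<^sub>R A x + t *\<^sub>R B x)" for t by (rule csa_combination[OF A(1) hsB adj])
    show "csa A" by (rule A(2))
    show "hs_bound A (cT * (h\<^sup>2 / 2 + Kb)\<^sup>2)" by (rule A(1))
    show "\<bar>\<tau>\<bar> = 1" by (rule \<tau>)
    show "0 < \<epsilon>" "\<epsilon> < 1" by fact+
    show "csa B" by (rule csaB)
    show "0 \<le> inner x (B x)" for x by (rule B0)
    show "(\<Sum>e\<in>A. inner e (B e)) \<le> (\<Sum>t\<in>I. \<Sum>i\<in>UNIV. kap lam t * (cL * (norm (cs lam t i))\<^sup>2))"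
      if "finite A" "onset A" for A
      unfolding BF by (rule F_trace[OF kap_nonneg that])
    show "csa D" by (rule D(1))
    show "0 \<le> inner x (D x)" for x using D(2) by blast
    show "(\<Sum>e\<in>A. inner e (D e)) \<le> (1 + 1 / ?\<eta>) * cL * U * real (card I) * (2 * h\<^sup>2 + 2 * Kb)"
      if "finite A" "onset A" for A using D(3) that by blast
    show "adj ?L ?L'" using Lc(1)[OF s] by (simp add: adj_def cinner.scaleR_left cinner.scaleR_right)
    show "hs_bound ?L (?r\<^sup>2 * (cL * (norm (v0 sg))\<^sup>2))" by (rule hs_bound_scaleR[OF Lc(2)[OF s]])
    show "bounded_clinear ?L'" by (rule bounded_clinear_scaleR_left[OF Lc(3)[OF s]])
    fix x
    define n where "n = (norm (Lr s (v0 sg) x))\<^sup>2"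
    have n0: "0 \<le> n" by (simp add: n_def)
    have "(1 + ?\<eta>) * kap lam s \<le> (1 + ?\<eta>) * ((1 + ?\<eta>) * \<kappa>)" using \<kappa>(3) \<eta> by (intro mult_left_mono) auto
    also have "\<dots> = ((1 + ?\<eta>) * (1 + ?\<eta>)) * \<kappa>" by simp
    also have "\<dots> \<le> (1 + \<epsilon> / 4) * \<kappa>"
    proof (rule mult_right_mono[OF _ \<kappa>(1)])
      have "?\<eta> * ?\<eta> \<le> ?\<eta> * 1" using \<epsilon> by (intro mult_left_mono) auto
      moreover have "(1 + a) * (1 + a) = 1 + 2 * a + a * a" for a :: real by (simp add: algebra_simps)
      note this[of ?\<eta>]
      ultimately show "(1 + ?\<eta>) * (1 + ?\<eta>) \<le> 1 + \<epsilon> / 4" using \<epsilon> by linarith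
    qed
    finally have "((1 + ?\<eta>) * kap lam s) * n \<le> ((1 + \<epsilon> / 4) * \<kappa>) * n" by (rule mult_right_mono[OF _ n0])
    then show "inner x (B x) \<le> (1 + \<epsilon> / 4) * (norm (?L' x))\<^sup>2 + inner x (D x)"
      using D(4)[rule_format, of x] unfolding nL B_def n_def[symmetric] by (simp add: mult.assoc)
    have "\<kappa> * n \<le> kap lam s * n" by (rule mult_right_mono[OF \<kappa>(2) n0])
    moreover have "(1 + ?\<eta>) * inner x (B x) \<le> (1 + \<epsilon> / 4) * inner x (B x)"
      using \<epsilon> B0 by (intro mult_right_mono) auto
    ultimately show "(norm (?L' x))\<^sup>2 \<le> (1 + \<epsilon> / 4) * inner x (B x) + inner x (D x)"
      using D(5)[rule_format, of x] unfolding nL B_def[symmetric] n_def[symmetric] by linarith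
  qed
  have G: "ca.G r = eff s sg \<kappa> r" for r
    using \<kappa>(1) by (simp add: fun_eq_iff ca.G_def eff_def bounded_clinear_scaleR[OF Lc(3)[OF s]])
  have N: "(LINT t|lborel. ca.N t / (1 + t\<^sup>2)) = avg \<tau> lam"
    by (simp only: ca.N_def avg_def A_def[symmetric] B_def[symmetric])
  have E: "ca.err = E" by (simp only: ca.err_def E_def)
  show "avg \<tau> lam \<le> tr_arctan (eff s sg \<kappa> (1 / (1 - \<epsilon>))) + E"
    using ca.integral_N_upper unfolding N G E .
  show "tr_arctan (eff s sg \<kappa> (1 / (1 + \<epsilon>))) \<le> avg \<tau> lam + E"
    using ca.integral_N_lower unfolding N G E .
qed

text \<open>With \<open>z\<close> the distance to the threshold,
  \<open>1 - (w0 lam s)\<^sup>2\<close> equals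
  \<open>h\<^sup>2 * z * (1 - h\<^sup>2 * z / 4)\<close>. Hence \<open>kap\<close> is
  \<open>h / 2 / sqrt z\<close> divided by a quantity tending to 1 from below, which supplies both
  comparisons with \<open>\<kappa>\<close>.\<close>

lemma threshold_asymptotics:
  assumes s: "s \<in> I" and sg: "sg = 1 \<or> sg = (-1::real)" and \<epsilon>: "0 < \<epsilon>" "\<epsilon> < 1" and \<tau>: "\<bar>\<tau>\<bar> = 1"
    and z: "\<forall>\<^sub>F lam in L. 0 < z lam \<and> sg * w0 lam s = 1 - h\<^sup>2 * z lam / 2" "(z \<longlongrightarrow> 0) L"
    and wl: "\<And>t. t \<in> I \<Longrightarrow> t \<noteq> s \<Longrightarrow> ((\<lambda>lam. w0 lam t) \<longlongrightarrow> wl t) L \<and> \<bar>wl t\<bar> \<noteq> 1"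
  obtains E where "\<forall>\<^sub>F lam in L. (\<forall>t\<in>I. \<bar>w0 lam t\<bar> \<noteq> 1) \<and>
    avg \<tau> lam \<le> tr_arctan (eff s sg (h / 2 / sqrt (z lam)) (1 / (1 - \<epsilon>))) + E \<and>
    tr_arctan (eff s sg (h / 2 / sqrt (z lam)) (1 / (1 + \<epsilon>))) \<le> avg \<tau> lam + E"
proof -
  \<comment> \<open>The summand 1 leaves room above the limiting value, so the bound holds
    eventually; \<open>Kb\<close> adds the channels to dominate each of them.\<close>
  define k where "k t = h\<^sup>2 / (2 * sqrt \<bar>1 - (wl t)\<^sup>2\<bar>) + 1" for t
  define Kb where "Kb = (\<Sum>t\<in>I. k t)"
  have k0: "0 \<le> k t" for t by (simp add: k_def)
  have Kb0: "0 \<le> Kb" unfolding Kb_def by (rule sum_nonneg) (rule k0)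
  have others: "\<forall>\<^sub>F lam in L. \<forall>t\<in>I - {s}. \<bar>w0 lam t\<bar> \<noteq> 1 \<and> h\<^sup>2 / (2 * sqrt \<bar>1 - (w0 lam t)\<^sup>2\<bar>) \<le> Kb"
  proof (rule eventually_ball_finite)
    show "finite (I - {s})" using I by simp
    show "\<forall>t\<in>I - {s}. \<forall>\<^sub>F lam in L. \<bar>w0 lam t\<bar> \<noteq> 1 \<and> h\<^sup>2 / (2 * sqrt \<bar>1 - (w0 lam t)\<^sup>2\<bar>) \<le> Kb"
    proof
      fix t assume t: "t \<in> I - {s}"
      then have lim: "((\<lambda>lam. w0 lam t) \<longlongrightarrow> wl t) L" and ne: "\<bar>wl t\<bar> \<noteq> 1" using wl by auto
      have nz: "1 - (wl t)\<^sup>2 \<noteq> 0" using ne by (simp add: abs_square_eq_1)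
      have "((\<lambda>lam. 1 - (w0 lam t)\<^sup>2) \<longlongrightarrow> 1 - (wl t)\<^sup>2) L" by (intro tendsto_intros lim)
      then have ev1: "\<forall>\<^sub>F lam in L. 1 - (w0 lam t)\<^sup>2 \<noteq> 0" using nz by (rule tendsto_imp_eventually_ne)
      have "((\<lambda>lam. h\<^sup>2 / (2 * sqrt \<bar>1 - (w0 lam t)\<^sup>2\<bar>)) \<longlongrightarrow> h\<^sup>2 / (2 * sqrt \<bar>1 - (wl t)\<^sup>2\<bar>)) L"
        by (intro tendsto_intros lim) (use nz in simp)
      then have ev2: "\<forall>\<^sub>F lam in L. h\<^sup>2 / (2 * sqrt \<bar>1 - (w0 lam t)\<^sup>2\<bar>) < k t"
        by (rule order_tendstoD(2)) (simp add: k_def)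
      have "k t \<le> Kb" unfolding Kb_def by (rule member_le_sum) (use t k0 I in auto)
      show "\<forall>\<^sub>F lam in L. \<bar>w0 lam t\<bar> \<noteq> 1 \<and> h\<^sup>2 / (2 * sqrt \<bar>1 - (w0 lam t)\<^sup>2\<bar>) \<le> Kb"
        using ev1 ev2
      proof eventually_elim
        case (elim lam)
        then show ?case using \<open>k t \<le> Kb\<close> by (auto simp: abs_square_eq_1)
      qed
    qed
  qed
  have "((\<lambda>lam. h\<^sup>2 * z lam / 2) \<longlongrightarrow> h\<^sup>2 * 0 / 2) L" by (intro tendsto_intros z(2)) simp
  then have ev_small: "\<forall>\<^sub>F lam in L. h\<^sup>2 * z lam / 2 < 1" by (rule order_tendstoD(2)) simp
  have "((\<lambda>lam. sqrt (1 - h\<^sup>2 * z lam / 4)) \<longlongrightarrow> sqrt (1 - h\<^sup>2 * 0 / 4)) L" by (intro tendsto_intros z(2)) simp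
  then have ev_close: "\<forall>\<^sub>F lam in L. 1 / (1 + \<epsilon> / 16) < sqrt (1 - h\<^sup>2 * z lam / 4)"
    by (rule order_tendstoD(1)) (use \<epsilon> in simp)
  define E where "E = 64 * (cT * (h\<^sup>2 / 2 + Kb)\<^sup>2) / \<epsilon>\<^sup>2 * (LINT t|lborel. 1 / (1 + t\<^sup>2))
      + 4 / \<epsilon> * ((1 + 1 / (\<epsilon> / 16)) * cL * U * real (card I) * (2 * h\<^sup>2 + 2 * Kb))"
  show ?thesis
  proof (rule that[of E])
    show "\<forall>\<^sub>F lam in L. (\<forall>t\<in>I. \<bar>w0 lam t\<bar> \<noteq> 1) \<and>
      avg \<tau> lam \<le> tr_arctan (eff s sg (h / 2 / sqrt (z lam)) (1 / (1 - \<epsilon>))) + E \<and>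
      tr_arctan (eff s sg (h / 2 / sqrt (z lam)) (1 / (1 + \<epsilon>))) \<le> avg \<tau> lam + E"
      using z(1) others ev_small ev_close
    proof eventually_elim
      case (elim lam)
      define y where "y = h\<^sup>2 * z lam"
      have zp: "0 < z lam" and y: "0 < y" "y < 2" "sg * w0 lam s = 1 - y / 2"
        using elim(1,3) h by (auto simp: y_def)
      define q where "q = sqrt (1 - y / 4)"
      have q: "0 < q" "q \<le> 1" "1 / (1 + \<epsilon> / 16) < q" using y elim(4) by (simp_all add: q_def y_def)
      have aw: "\<bar>w0 lam s\<bar> = \<bar>sg * w0 lam s\<bar>" using sg by auto
      have ws: "\<bar>w0 lam s\<bar> < 1" "0 \<le> sg * w0 lam s" using y unfolding aw y(3) by auto
      have w2: "(w0 lam s)\<^sup>2 = (1 - y / 2)\<^sup>2" using sg unfolding y(3)[symmetric] by (auto simp: power_mult_distrib)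
      have "1 - (w0 lam s)\<^sup>2 = y * (1 - y / 4)" unfolding w2 by (simp add: power2_eq_square algebra_simps)
      then have "sqrt (1 - (w0 lam s)\<^sup>2) = h * sqrt (z lam) * q"
        using h by (simp add: q_def y_def real_sqrt_mult)
      then have kap: "kap lam s = (h / 2 / sqrt (z lam)) / q"
        using ws(1) h zp q(1) by (simp add: kap_def power2_eq_square field_simps)
      have k0: "0 \<le> h / 2 / sqrt (z lam)" using h zp by simp
      have k1: "h / 2 / sqrt (z lam) \<le> kap lam s"
        unfolding kap using mult_left_mono[OF q(2) k0] q(1) by (simp only: le_divide_eq if_True mult_1_right)
      have "1 / q \<le> 1 + \<epsilon> / 16" using q \<epsilon> by (simp add: field_simps)
      from mult_left_mono[OF this k0]
      have k2: "kap lam s \<le> (1 + \<epsilon> / 16) * (h / 2 / sqrt (z lam))" unfolding kap by (simp add: mult.commute)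
      have w: "\<bar>w0 lam t\<bar> \<noteq> 1 \<and> h\<^sup>2 / (2 * sqrt \<bar>1 - (w0 lam t)\<^sup>2\<bar>) \<le> Kb" if "t \<in> I" "t \<noteq> s" for t
        using elim(2) that by blast
      note est = avg_estimate[OF s sg \<epsilon> \<tau> ws w Kb0 k0 k1 k2, folded E_def]
      have "\<forall>t\<in>I. \<bar>w0 lam t\<bar> \<noteq> 1" using w ws(1) by force
      then show ?case using est by blast
    qed
  qed
qed

section \<open>Identification of the effective operators\<close>

lemma tensor_pw:
  assumes w: "\<And>n. cmod (w n) \<le> 1" and Y: "bounded_clinear Y"
  shows "pw w Y (\<phi> \<otimes>\<^sub>l g) = mult_op w \<phi> \<otimes>\<^sub>l Y (g :: 'g)"
  by (rule lat_eqI)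
     (simp add: lat_fun_pw[OF w Y] lat_fun_tensor lat_fun_mult_op[OF w] bounded_clinear_scaleC[OF Y] scaleC_scaleC)

lemma mult_op_1: "mult_op (\<lambda>_. 1) = (\<lambda>\<phi>. \<phi>)"
  by (intro ext lat_eqI) (simp add: lat_fun_mult_op)

lemma sg_power_le: "sg = 1 \<or> sg = (-1::real) \<Longrightarrow> \<bar>sg ^ k\<bar> \<le> 1"
  by (auto simp: power_abs)

lemma lat_fun_v0:
  assumes "sg = 1 \<or> sg = (-1::real)"
  shows "lat_fun (v0 sg) n = of_real (psi \<nu> n * sg ^ nat \<bar>n\<bar>)"
proof -
  have "\<bar>sg ^ nat \<bar>n\<bar>\<bar> \<le> 1 * (1 + \<bar>of_int n\<bar>)" for n :: int
    by (rule order_trans[OF sg_power_le[OF assms]]) simp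
  then show ?thesis unfolding v0_def by (rule lat_fun_vec)
qed

lemma weight_vector: "Abs_lat (weight \<nu>) = v0 1"
  by (simp add: v0_def vec_def weight_psi[abs_def])

lemma alternating: "(-1 :: complex) powi n = of_real ((-1) ^ nat \<bar>n\<bar>)"
  by (cases "n \<ge> 0") (simp_all add: power_int_def)

lemma mult_J: "mult_op (\<lambda>n. (-1) powi n) (v0 1) = v0 (-1)"
proof (rule lat_eqI)
  fix n
  have "cmod ((-1) powi n) \<le> 1" for n by (simp only: alternating norm_of_real) (simp add: power_abs)
  from lat_fun_mult_op[of "\<lambda>n. (-1) powi n", OF this]
  show "lat_fun (mult_op (\<lambda>n. (-1) powi n) (v0 1)) n = lat_fun (v0 (-1)) n"
    by (simp add: lat_fun_v0 alternating)
qed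

lemma P_op_eq:
  assumes s: "s \<in> I" and es: "eigen_proj Q \<mu> s = p s"
  shows "P_op \<nu> Q \<mu> s = (\<lambda>f. p s (red (v0 1) f))" "cadj (\<lambda>f. p s (red (v0 1) f)) = (\<lambda>g. v0 1 \<otimes>\<^sub>l p s g)"
proof -
  show "P_op \<nu> Q \<mu> s = (\<lambda>f. p s (red (v0 1) f))"
    unfolding P_op_def es weight_vector by (rule tensor_op_functional[OF p(1)[OF s]])
  show "cadj (\<lambda>f. p s (red (v0 1) f)) = (\<lambda>g. v0 1 \<otimes>\<^sub>l p s g)"
    by (rule adj_cadj[OF adj_compose[OF p(2)[OF s] adj_sym[OF adj_tensor_red]]])
qed

lemma V_bold_scaled: "V_bold K (\<lambda>x. r *\<^sub>R V x) f = r *\<^sub>R pw (\<lambda>_. 1) K' (V (pw (\<lambda>_. 1) K f))"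
  by (simp add: V_bold_def adj_cadj[OF K(2)] id_tensor[OF K'(1)] id_tensor[OF K'(2)]
      bounded_clinear_scaleR[OF bounded_clinear_pw[OF one_le K'(2)]])

lemma gram_eq: "p s (red v (pw (\<lambda>_. 1) K' (V (pw (\<lambda>_. 1) K (v \<otimes>\<^sub>l p s g))))) = Lr s v (Lc s v g)"
  by (simp add: tensor_pw[OF one_le K'(1)] red_pw[OF one_le K'(2)] mult_op_1 Lr_def Lc_def rV(4))

lemma omega_lower_eq:
  assumes s: "s \<in> I" and es: "eigen_proj Q \<mu> s = p s"
  shows "omega_lower h \<nu> Q \<mu> s K (\<lambda>x. r *\<^sub>R V x) lam = eff s 1 (h / 2 / sqrt \<bar>lam - \<mu> s\<bar>) r"
  by (simp add: fun_eq_iff omega_lower_def P_op_eq[OF s es] V_bold_scaled eff_def gram_eq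
      bounded_clinear_scaleR[OF bounded_clinear_red] bounded_clinear_scaleR[OF p(1)[OF s]] mult.commute)

text \<open>The unitary sign operator is self-adjoint and moves from the potential onto the weight
  vector, which becomes \<open>v0 (-1)\<close>. The minus sign on the left undoes the one in
  \<open>omega_upper\<close>.\<close>

lemma omega_upper_eq:
  assumes s: "s \<in> I" and es: "eigen_proj Q \<mu> s = p s"
  shows "(\<lambda>x. - omega_upper h \<nu> Q \<mu> s K (\<lambda>x. r *\<^sub>R V x) lam x)
    = eff s (-1) (h / 2 / sqrt \<bar>4 / h\<^sup>2 + \<mu> s - lam\<bar>) r"
proof -
  let ?J = "\<lambda>n. (-1 :: complex) powi n"
  have J: "cmod (?J n) \<le> 1" for n by (simp only: alternating norm_of_real) (simp add: power_abs)
  have cnjJ: "cnj (?J n) = ?J n" for n by (simp add: alternating)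
  have Jid: "J_op \<otimes>\<^sub>o id = pw ?J (id :: 'g \<Rightarrow> 'g)"
    unfolding J_op_def by (rule mult_op_tensor[of ?J id, OF J]) (use bounded_clinear_id in \<open>simp add: id_def\<close>)
  have lin: "bounded_clinear (id :: 'g \<Rightarrow> 'g)" using bounded_clinear_id by (simp add: id_def)
  have "adj (pw ?J (id :: 'g \<Rightarrow> 'g)) (pw ?J id)"
    using adj_pw[of ?J id id, OF J lin] unfolding cnjJ by (simp add: adj_def)
  then have cJ: "cadj (pw ?J (id :: 'g \<Rightarrow> 'g)) = pw ?J id" by (rule adj_cadj)
  have Jt: "pw ?J id (v0 1 \<otimes>\<^sub>l g) = v0 (-1) \<otimes>\<^sub>l (g :: 'g)" for g
    using tensor_pw[of ?J id "v0 1" g, OF J lin] by (simp add: mult_J)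
  have Jr: "red (v0 1) (pw ?J id f) = red (v0 (-1)) (f :: 'g lat)" for f
    using red_pw[of ?J id "v0 1" f, OF J lin] by (simp add: cnjJ mult_J)
  show ?thesis
    by (simp add: fun_eq_iff omega_upper_def P_op_eq[OF s es] V_bold_J_def Jid cJ Jt V_bold_scaled eff_def
        bounded_clinear_scaleR[OF bounded_clinear_pw[of ?J id, OF J lin]] Jr gram_eq
        bounded_clinear_scaleR[OF bounded_clinear_red] bounded_clinear_scaleR[OF p(1)[OF s]] mult.commute)
qed

lemma sim_at_threshold:
  assumes s: "s \<in> I" and sg: "sg = 1 \<or> sg = (-1::real)" and \<sigma>: "\<sigma> = 1 \<or> \<sigma> = (-1::real)"
    and z: "\<forall>\<^sub>F lam in L. 0 < z lam \<and> sg * w0 lam s = 1 - h\<^sup>2 * z lam / 2" "(z \<longlongrightarrow> 0) L"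
    and wl: "\<And>t. t \<in> I \<Longrightarrow> t \<noteq> s \<Longrightarrow> ((\<lambda>lam. w0 lam t) \<longlongrightarrow> wl t) L \<and> \<bar>wl t\<bar> \<noteq> 1"
    and om: "\<And>r lam. om (\<lambda>x. r *\<^sub>R V x) lam = eff s sg (h / 2 / sqrt (z lam)) r"
  shows "sim_along (\<lambda>W lam. - \<sigma> * ssf (H_pert \<sigma> h \<nu> Q K W) (H_free h Q) (factor_op \<nu> K W) lam)
    (\<lambda>W lam. - (1 / pi) * tr_arctan (om W lam)) V L"
  unfolding sim_along_def
proof
  fix \<epsilon> :: real assume "\<epsilon> \<in> {0<..<1}"
  then have \<epsilon>: "0 < \<epsilon>" "\<epsilon> < 1" by auto
  have \<tau>: "\<bar>- \<sigma>\<bar> = 1" using \<sigma> by auto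
  obtain E where E: "\<forall>\<^sub>F lam in L. (\<forall>t\<in>I. \<bar>w0 lam t\<bar> \<noteq> 1) \<and>
    avg (- \<sigma>) lam \<le> tr_arctan (eff s sg (h / 2 / sqrt (z lam)) (1 / (1 - \<epsilon>))) + E \<and>
    tr_arctan (eff s sg (h / 2 / sqrt (z lam)) (1 / (1 + \<epsilon>))) \<le> avg (- \<sigma>) lam + E"
    by (rule threshold_asymptotics[OF s sg \<epsilon> \<tau> z wl])
  show "\<exists>R1\<in>O[L](\<lambda>_. 1). \<exists>R2\<in>O[L](\<lambda>_. 1). \<forall>\<^sub>F lam in L.
      - (1 / pi) * tr_arctan (om (\<lambda>x. (1 / (1 - \<epsilon>)) *\<^sub>R V x) lam) + R1 lam
        \<le> - \<sigma> * ssf (H_pert \<sigma> h \<nu> Q K V) (H_free h Q) (factor_op \<nu> K V) lam \<and>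
      - \<sigma> * ssf (H_pert \<sigma> h \<nu> Q K V) (H_free h Q) (factor_op \<nu> K V) lam
        \<le> - (1 / pi) * tr_arctan (om (\<lambda>x. (1 / (1 + \<epsilon>)) *\<^sub>R V x) lam) + R2 lam"
  \<comment> \<open>Constants serve as bounded remainders. The factor \<open>- (1 / pi)\<close>
    swaps the estimates: the upper bound for the average, with \<open>1 / (1 - \<epsilon>)\<close>,
    becomes the lower bound here.\<close>
  proof (rule bexI[where x = "\<lambda>_. - (1 / pi) * E"], rule bexI[where x = "\<lambda>_. 1 / pi * E"])
    show "\<forall>\<^sub>F lam in L.
      - (1 / pi) * tr_arctan (om (\<lambda>x. (1 / (1 - \<epsilon>)) *\<^sub>R V x) lam) + - (1 / pi) * E
        \<le> - \<sigma> * ssf (H_pert \<sigma> h \<nu> Q K V) (H_free h Q) (factor_op \<nu> K V) lam \<and>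
      - \<sigma> * ssf (H_pert \<sigma> h \<nu> Q K V) (H_free h Q) (factor_op \<nu> K V) lam
        \<le> - (1 / pi) * tr_arctan (om (\<lambda>x. (1 / (1 + \<epsilon>)) *\<^sub>R V x) lam) + 1 / pi * E"
      using E
    proof eventually_elim
      case (elim lam)
      have ssf: "- \<sigma> * ssf (H_pert \<sigma> h \<nu> Q K V) (H_free h Q) (factor_op \<nu> K V) lam = - (1 / pi) * avg (- \<sigma>) lam"
        by (rule ssf_eq[OF _ \<sigma>]) (use elim in blast)
      have p: "0 \<le> 1 / pi" by simp
      have up: "1 / pi * avg (- \<sigma>) lam \<le> 1 / pi * (tr_arctan (eff s sg (h / 2 / sqrt (z lam)) (1 / (1 - \<epsilon>))) + E)"
        and low: "1 / pi * tr_arctan (eff s sg (h / 2 / sqrt (z lam)) (1 / (1 + \<epsilon>))) \<le> 1 / pi * (avg (- \<sigma>) lam + E)"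
        by (rule mult_left_mono[OF _ p], use elim in blast)+
      show ?case unfolding ssf om using up low by (simp only: distrib_left mult_minus_left) linarith
    qed
  qed simp_all
qed

end

text \<open>The definite description in \<open>orth_proj\<close> is evaluated by the components of
  the given orthogonal decomposition. Symmetry and idempotence follow from the characterization by
  orthogonality, and linearity from symmetry.\<close>

lemma eigen_proj_decomp:
  fixes Q :: "'g::chilbert_space \<Rightarrow> 'g"
  assumes "eigen_decomp Q d \<mu>"
  shows "\<And>t. t \<in> index_set Q d \<Longrightarrow> adj (eigen_proj Q \<mu> t) (eigen_proj Q \<mu> t)"
    and "\<And>t. t \<in> index_set Q d \<Longrightarrow> bounded_clinear (eigen_proj Q \<mu> t)"
    and "\<And>t x. t \<in> index_set Q d \<Longrightarrow> eigen_proj Q \<mu> t (eigen_proj Q \<mu> t x) = eigen_proj Q \<mu> t x"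
    and "\<And>x. (\<Sum>t\<in>index_set Q d. eigen_proj Q \<mu> t x) = x"
    and "\<And>t x. t \<in> index_set Q d \<Longrightarrow> Q (eigen_proj Q \<mu> t x) = \<mu> t *\<^sub>R eigen_proj Q \<mu> t x"
proof -
  let ?I = "index_set Q d" and ?p = "eigen_proj Q \<mu>"
  have "(\<forall>t\<in>?I. adj (?p t) (?p t)) \<and> (\<forall>t\<in>?I. bounded_clinear (?p t)) \<and> (\<forall>t\<in>?I. \<forall>x. ?p t (?p t x) = ?p t x) \<and>
      (\<forall>x. (\<Sum>t\<in>?I. ?p t x) = x) \<and> (\<forall>t\<in>?I. \<forall>x. Q (?p t x) = \<mu> t *\<^sub>R ?p t x)"
  proof (cases "Q = (\<lambda>_. 0)")
    case True
    have "\<mu> 0 = 0" using assms True by (simp add: eigen_decomp_def)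
    then show ?thesis
      using True bounded_clinear_id by (simp add: index_set_def eigen_proj_def adj_def id_def)
  next
    case False
    have I: "?I = {1..d}" and p: "?p t = orth_proj (eigenspace Q (\<mu> t))" for t
      using False by (simp_all add: index_set_def eigen_proj_def)
    have orth: "cinner x y = 0" if "s \<in> {1..d}" "t \<in> {1..d}" "s \<noteq> t" "x \<in> eigenspace Q (\<mu> s)" "y \<in> eigenspace Q (\<mu> t)" for s t x y
      using assms False that unfolding eigen_decomp_def by simp
    have ex: "\<exists>y. (\<forall>s\<in>{1..d}. y s \<in> eigenspace Q (\<mu> s)) \<and> x = (\<Sum>s\<in>{1..d}. y s)" for x
      using assms False unfolding eigen_decomp_def by simp
    have linQ: "bounded_clinear Q" using assms by (simp add: eigen_decomp_def self_adjoint_def)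
    \<comment> \<open>For any decomposition of \<open>x\<close> into eigenvectors the component
      \<open>y t\<close> has the defining property of the projection: the other components are
      orthogonal to the eigenspace, and two candidates differ by a vector of the eigenspace
      orthogonal to itself.\<close>
    have proj: "?p t x \<in> eigenspace Q (\<mu> t) \<and> (\<forall>z\<in>eigenspace Q (\<mu> t). cinner z (x - ?p t x) = 0)
        \<and> ?p t x = y t"
      if t: "t \<in> {1..d}" and y: "\<forall>s\<in>{1..d}. y s \<in> eigenspace Q (\<mu> s)" "x = (\<Sum>s\<in>{1..d}. y s)" for t x y
    proof -
      have yt: "cinner z (x - y t) = 0" if z: "z \<in> eigenspace Q (\<mu> t)" for z
      proof -
        have "x - y t = (\<Sum>s\<in>{1..d} - {t}. y s)" unfolding y(2) using t by (subst sum.remove[of _ t]) auto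
        moreover have "cinner z (y s) = 0" if "s \<in> {1..d} - {t}" for s
          by (rule orth[OF t _ _ z]) (use that y(1) in auto)
        ultimately show ?thesis by (simp add: cinner.sum_right)
      qed
      have "?p t x = y t"
        unfolding p orth_proj_def
      proof (rule the_equality)
        show "y t \<in> eigenspace Q (\<mu> t) \<and> (\<forall>z\<in>eigenspace Q (\<mu> t). cinner z (x - y t) = 0)" using y(1) t yt by blast
        fix q assume q: "q \<in> eigenspace Q (\<mu> t) \<and> (\<forall>z\<in>eigenspace Q (\<mu> t). cinner z (x - q) = 0)"
        have e: "q - y t \<in> eigenspace Q (\<mu> t)"
          using q y(1) t by (simp add: eigenspace_def bounded_clinear_diff[OF linQ] scaleR_diff_right)
        then have "cinner (q - y t) (x - y t) - cinner (q - y t) (x - q) = 0" using yt[OF e] q by simp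
        then have "cinner (q - y t) (q - y t) = 0" by (simp flip: cinner.diff_right)
        then show "q = y t" by (simp add: cinner_self)
      qed
      then show ?thesis using y(1) t yt by simp
    qed
    have char: "?p t x \<in> eigenspace Q (\<mu> t)" "z \<in> eigenspace Q (\<mu> t) \<Longrightarrow> cinner z (x - ?p t x) = 0"
      if t: "t \<in> {1..d}" for t x z
    proof -
      obtain y where y: "\<forall>s\<in>{1..d}. y s \<in> eigenspace Q (\<mu> s)" "x = (\<Sum>s\<in>{1..d}. y s)" using ex by blast
      show "?p t x \<in> eigenspace Q (\<mu> t)" "z \<in> eigenspace Q (\<mu> t) \<Longrightarrow> cinner z (x - ?p t x) = 0"
        using proj[OF t y] by auto
    qed
    have adj: "cinner (?p t x) y = cinner x (?p t y)" if t: "t \<in> {1..d}" for t x y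
    proof -
      have "cinner (?p t x) y = cinner (?p t x) (?p t y)"
        using char(2)[OF t char(1)[OF t, of x], of y] by (simp add: cinner.diff_right)
      moreover have "cinner (?p t y) x = cinner (?p t y) (?p t x)"
        using char(2)[OF t char(1)[OF t, of y], of x] by (simp add: cinner.diff_right)
      ultimately show ?thesis by (metis cinner_commute)
    qed
    have idem: "?p t (?p t x) = ?p t x" if t: "t \<in> {1..d}" for t x
    proof -
      let ?d = "?p t x - ?p t (?p t x)"
      have "?d \<in> eigenspace Q (\<mu> t)"
        using char(1)[OF t, of x] char(1)[OF t, of "?p t x"]
        by (simp add: eigenspace_def bounded_clinear_diff[OF linQ] scaleR_diff_right)
      then have "cinner ?d ?d = 0" by (rule char(2)[OF t])
      then show ?thesis by (simp add: cinner_self)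
    qed
    have lin: "bounded_clinear (?p t)" if t: "t \<in> {1..d}" for t
    proof (rule bounded_clinearI[where K = 1])
      show "?p t (x + y) = ?p t x + ?p t y" for x y
        by (rule cinner_eqI) (simp add: adj[OF t, symmetric] cinner_add_right)
      show "?p t (c *\<^sub>C x) = c *\<^sub>C ?p t x" for c x
        by (rule cinner_eqI) (simp add: adj[OF t, symmetric] cinner_scaleC_right)
      fix x
      have "(norm (?p t x))\<^sup>2 = cmod (cinner x (?p t x))"
        using adj[OF t, of x "?p t x"] idem[OF t, of x] by (metis cinner_self norm_of_real abs_of_nonneg zero_le_power2)
      also have "\<dots> \<le> norm x * norm (?p t x)" by (rule cmod_cinner_le)
      finally have "norm (?p t x) * norm (?p t x) \<le> norm x * norm (?p t x)" by (simp add: power2_eq_square)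
      then show "norm (?p t x) \<le> norm x * 1" by (cases "?p t x = 0") simp_all
    qed
    have sum: "(\<Sum>t\<in>{1..d}. ?p t x) = x" for x
    proof -
      obtain y where y: "\<forall>s\<in>{1..d}. y s \<in> eigenspace Q (\<mu> s)" "x = (\<Sum>s\<in>{1..d}. y s)" using ex by blast
      have "(\<Sum>t\<in>{1..d}. ?p t x) = (\<Sum>t\<in>{1..d}. y t)" by (intro sum.cong refl) (use proj[OF _ y] in blast)
      then show ?thesis by (simp only: y(2)[symmetric])
    qed
    have eig: "Q (?p t x) = \<mu> t *\<^sub>R ?p t x" if "t \<in> {1..d}" for t x
      using char(1)[OF that, of x] by (simp add: eigenspace_def)
    show ?thesis unfolding I using adj lin idem sum eig by (simp add: adj_def)
  qed
  then show "\<And>t. t \<in> ?I \<Longrightarrow> adj (?p t) (?p t)" "\<And>t. t \<in> ?I \<Longrightarrow> bounded_clinear (?p t)"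
    "\<And>t x. t \<in> ?I \<Longrightarrow> ?p t (?p t x) = ?p t x" "\<And>x. (\<Sum>t\<in>?I. ?p t x) = x"
    "\<And>t x. t \<in> ?I \<Longrightarrow> Q (?p t x) = \<mu> t *\<^sub>R ?p t x" by blast+
qed

theorem theorem5p7:
  fixes h \<nu>\<^sub>0 :: real
    and Q K :: "'g::chilbert_space \<Rightarrow> 'g"
    and d :: nat and \<mu> :: "nat \<Rightarrow> real"
    and \<V> :: "'g lat \<Rightarrow> 'g lat"
  assumes "h > 0"
    and "separable_space (euclidean :: 'g topology)"
    and "eigen_decomp Q d \<mu>"
    and "\<nu>\<^sub>0 > 3"
    and "nonneg_op \<V>"
    and "K \<in> schatten 2"
  shows "\<forall>s\<in>index_set Q d. \<forall>\<sigma>\<in>{1, -1}.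
    (nondegenerate_lower h Q d \<mu> s \<longrightarrow>
       sim_along
         (\<lambda>W lam. - \<sigma> * ssf (H_pert \<sigma> h \<nu>\<^sub>0 Q K W) (H_free h Q) (factor_op \<nu>\<^sub>0 K W) lam)
         (\<lambda>W lam. - (1 / pi) * tr_arctan (omega_lower h \<nu>\<^sub>0 Q \<mu> s K W lam))
         \<V> (at_right (\<mu> s))) \<and>
    (nondegenerate_upper h Q d \<mu> s \<longrightarrow>
       sim_along
         (\<lambda>W lam. - \<sigma> * ssf (H_pert \<sigma> h \<nu>\<^sub>0 Q K W) (H_free h Q) (factor_op \<nu>\<^sub>0 K W) lam)
         (\<lambda>W lam. - (1 / pi) * tr_arctan (\<lambda>x. - omega_upper h \<nu>\<^sub>0 Q \<mu> s K W lam x))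
         \<V> (at_left (4 / h\<^sup>2 + \<mu> s)))"
proof (intro ballI conjI impI)
  fix s and \<sigma> :: real
  assume s: "s \<in> index_set Q d" and "\<sigma> \<in> {1, -1}"
  then have \<sigma>: "\<sigma> = 1 \<or> \<sigma> = -1" by simp
  note K = schatten_hs_bound[OF assms(6)]
  obtain K' where K': "adj K K'" by (rule adj_exists[OF hs_boundD(1)[OF K]])
  have Q: "self_adjoint Q" using assms(3) unfolding eigen_decomp_def by blast
  have fin: "finite (index_set Q d)" by (simp add: index_set_def)
  note ep = eigen_proj_decomp[OF assms(3)]
  have distinct: "\<mu> t \<noteq> \<mu> s" if "t \<in> index_set Q d" "t \<noteq> s" for t
  proof (cases "Q = (\<lambda>_. 0)")
    case False
    have inj: "inj_on \<mu> {1..d}" using assms(3) unfolding eigen_decomp_def if_not_P[OF False] by blast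
    have "t \<in> {1..d}" "s \<in> {1..d}" using that(1) s unfolding index_set_def if_not_P[OF False] by blast+
    then show ?thesis using inj_on_eq_iff[OF inj] that(2) by blast
  qed (use that s in \<open>simp add: index_set_def\<close>)
  have Q0: "t = s" if "Q = (\<lambda>_. 0)" "t \<in> index_set Q d" for t
    using that s by (simp add: index_set_def)
  interpret lattice_model h \<nu>\<^sub>0 "(schatten_norm 2 K)\<^sup>2" Q K K' \<V> "index_set Q d" \<mu> "eigen_proj Q \<mu>"
    by unfold_locales (use assms ep Q K K' fin in auto)
  have lim: "((\<lambda>lam. w0 lam t) \<longlongrightarrow> 1 - h\<^sup>2 * (x - \<mu> t) / 2) (at x within S)" for t x S
    unfolding w0_def by (intro tendsto_intros) simp
  have h2: "h\<^sup>2 * (4 / h\<^sup>2) = 4" using assms(1) by simp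
  {
    assume nd: "nondegenerate_lower h Q d \<mu> s"
    show "sim_along
         (\<lambda>W lam. - \<sigma> * ssf (H_pert \<sigma> h \<nu>\<^sub>0 Q K W) (H_free h Q) (factor_op \<nu>\<^sub>0 K W) lam)
         (\<lambda>W lam. - (1 / pi) * tr_arctan (omega_lower h \<nu>\<^sub>0 Q \<mu> s K W lam))
         \<V> (at_right (\<mu> s))"
    proof (rule sim_at_threshold[where sg = 1 and z = "\<lambda>lam. \<bar>lam - \<mu> s\<bar>"
          and wl = "\<lambda>t. 1 - h\<^sup>2 * (\<mu> s - \<mu> t) / 2", OF s _ \<sigma>])
      show "\<forall>\<^sub>F lam in at_right (\<mu> s). 0 < \<bar>lam - \<mu> s\<bar> \<and> 1 * w0 lam s = 1 - h\<^sup>2 * \<bar>lam - \<mu> s\<bar> / 2"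
        using eventually_at_right_less[of "\<mu> s"] by eventually_elim (simp add: w0_def)
      have "((\<lambda>lam. \<bar>lam - \<mu> s\<bar>) \<longlongrightarrow> \<bar>\<mu> s - \<mu> s\<bar>) (at_right (\<mu> s))" by (intro tendsto_intros)
      then show "((\<lambda>lam. \<bar>lam - \<mu> s\<bar>) \<longlongrightarrow> 0) (at_right (\<mu> s))" by simp
      fix t assume t: "t \<in> index_set Q d" "t \<noteq> s"
      have "\<mu> s \<noteq> 4 / h\<^sup>2 + \<mu> t" using nd t Q0 by (auto simp: nondegenerate_lower_def)
      then have "\<mu> s - \<mu> t \<noteq> 4 / h\<^sup>2" by simp
      then have "h\<^sup>2 * (\<mu> s - \<mu> t) \<noteq> h\<^sup>2 * (4 / h\<^sup>2)" using assms(1) by (simp only: mult_cancel_left) simp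
      moreover have "h\<^sup>2 * (\<mu> s - \<mu> t) \<noteq> 0" using distinct[OF t] assms(1) by simp
      \<comment> \<open>The modulus of \<open>1 - x / 2\<close> equals 1 only for
        \<open>x = 0\<close>, a coincidence of two eigenvalues, and for \<open>x = 4\<close>, the
        degenerate case.\<close>
      ultimately have "\<bar>1 - h\<^sup>2 * (\<mu> s - \<mu> t) / 2\<bar> \<noteq> 1" unfolding h2 by (simp add: abs_if)
      then show "((\<lambda>lam. w0 lam t) \<longlongrightarrow> 1 - h\<^sup>2 * (\<mu> s - \<mu> t) / 2) (at_right (\<mu> s)) \<and> \<bar>1 - h\<^sup>2 * (\<mu> s - \<mu> t) / 2\<bar> \<noteq> 1"
        using lim by blast
    qed (simp, rule omega_lower_eq[OF s refl])
  }
  {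
    assume nd: "nondegenerate_upper h Q d \<mu> s"
    let ?e = "4 / h\<^sup>2 + \<mu> s"
    show "sim_along
         (\<lambda>W lam. - \<sigma> * ssf (H_pert \<sigma> h \<nu>\<^sub>0 Q K W) (H_free h Q) (factor_op \<nu>\<^sub>0 K W) lam)
         (\<lambda>W lam. - (1 / pi) * tr_arctan (\<lambda>x. - omega_upper h \<nu>\<^sub>0 Q \<mu> s K W lam x))
         \<V> (at_left ?e)"
    proof (rule sim_at_threshold[where sg = "-1" and z = "\<lambda>lam. \<bar>?e - lam\<bar>"
          and wl = "\<lambda>t. 1 - h\<^sup>2 * (?e - \<mu> t) / 2", OF s _ \<sigma>])
      have "\<forall>\<^sub>F lam in at_left ?e. lam < ?e" by (simp add: eventually_at_filter)
      \<comment> \<open>Near the upper threshold \<open>w0 lam s\<close> tends to -1, hence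
        \<open>sg = -1\<close>; approaching from below keeps the channel \<open>s\<close>
        open.\<close>
      then show "\<forall>\<^sub>F lam in at_left ?e. 0 < \<bar>?e - lam\<bar> \<and> - 1 * w0 lam s = 1 - h\<^sup>2 * \<bar>?e - lam\<bar> / 2"
      proof eventually_elim
        case (elim lam)
        then have "\<bar>?e - lam\<bar> = 4 / h\<^sup>2 + (\<mu> s - lam)" by simp
        then have "h\<^sup>2 * \<bar>?e - lam\<bar> = 4 + h\<^sup>2 * (\<mu> s - lam)" by (simp only: distrib_left h2)
        moreover have "h\<^sup>2 * (lam - \<mu> s) = - (h\<^sup>2 * (\<mu> s - lam))" by (simp add: algebra_simps)
        moreover have "x = 4 + y \<Longrightarrow> z = - y \<Longrightarrow> - 1 * (1 - z / 2) = 1 - x / 2" for x y z :: real by (simp add: field_simps)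
        ultimately have "- 1 * w0 lam s = 1 - h\<^sup>2 * \<bar>?e - lam\<bar> / 2" unfolding w0_def by blast
        then show ?case using elim by simp
      qed
      have "((\<lambda>lam. \<bar>?e - lam\<bar>) \<longlongrightarrow> \<bar>?e - ?e\<bar>) (at_left ?e)" by (intro tendsto_intros)
      then show "((\<lambda>lam. \<bar>?e - lam\<bar>) \<longlongrightarrow> 0) (at_left ?e)" by simp
      fix t assume t: "t \<in> index_set Q d" "t \<noteq> s"
      have "?e \<noteq> \<mu> t" using nd t Q0 by (auto simp: nondegenerate_upper_def)
      then have "h\<^sup>2 * (?e - \<mu> t) \<noteq> 0" using assms(1) by simp
      moreover have "?e - \<mu> t \<noteq> 4 / h\<^sup>2" using distinct[OF t] by simp
      then have "h\<^sup>2 * (?e - \<mu> t) \<noteq> h\<^sup>2 * (4 / h\<^sup>2)" using assms(1) by (simp only: mult_cancel_left) simp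
      ultimately have "\<bar>1 - h\<^sup>2 * (?e - \<mu> t) / 2\<bar> \<noteq> 1" unfolding h2 by (simp add: abs_if)
      then show "((\<lambda>lam. w0 lam t) \<longlongrightarrow> 1 - h\<^sup>2 * (?e - \<mu> t) / 2) (at_left ?e) \<and> \<bar>1 - h\<^sup>2 * (?e - \<mu> t) / 2\<bar> \<noteq> 1"
        using lim by blast
    qed (simp, rule omega_upper_eq[OF s refl])
  }
qed

end
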